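(* Assume $0<a<b<\infty$. For all $g\in\mathcal N$: (i) $I_{[0,1]^d}(g)=\infty$ if and only if $g\in\mathcal N\setminus\mathcal N^*$ (i.e. there exists $x\ne0$ with $g(x)=b\|x\|$) and $\nu(\{b\})=0$. (ii) $I_{[0,1]^d}(g)=0$ if and only if $g\le\mu$, where $\mu$ is the time constant.
   Context: Let $d\ge2$ be an integer and $\mathbb E^d$ the set of non-oriented nearest-neighbour edges of $\mathbb Z^d$. Let $\nu$ be a probability distribution on $[0,\infty)$, and let $a$ and $b$ be the infimum and supremum of its support. Let $(\tau_e)_{e\in\mathbb E^d}$ be i.i.d. random variables with distribution $\nu$. Write $\|x\|=\sum_{i=1}^d|x_i|$ on $\mathbb R^d$. For $z,z'\in\mathbb R^d$, let $\tau(z,z')=\tau_{(v,v')}\|z-z'\|$ if there exist adjacent vertices $v,v'\in\mathbb Z^d$ such that $z,z'$ belong to the segment $[v,v']$, and $\tau(z,z')=b\|z-z'\|$ otherwise. For a finite sequence $\pi=(x_0,\dots,x_r)$ of points of $\mathbb R^d$, let $\tau(\pi)=\sum_{i=0}^{r-1}\tau(x_i,x_{i+1})$. For $x,y\in\mathbb R^d$, $\mathbf T(x,y)$ is the infimum of $\tau(\pi)$ over all finite sequences $\pi$ of points of $\mathbb R^d$ with endpoints $x,y$. For a compact convex set $X\subset\mathbb R^d$ with nonempty interior and $x,y\in X$, $\mathbf T_X(x,y)$ is the same infimum restricted to finite sequences of points of $X$, and $\widetilde{\mathbf T}_{n,X}(x,y)=\frac1n\mathbf T_{nX}(nx,ny)$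 for $n\ge1$. The time constant $\mu$ is the norm on $\mathbb R^d$ such that almost surely, for all $x\in\mathbb Z^d$, $\frac1n\mathbf T(0,nx)\to\mu(x)$ as $n\to\infty$. $\mathcal N$ is the set of norms $g$ on $\mathbb R^d$ such that $a\|\cdot\|\le g\le b\|\cdot\|$, and $\mathcal N^*$ is the subset of those $g$ with $g(x)<b\|x\|$ for all $x\ne0$. For $g\in\mathcal N$ and $\varepsilon>0$, let $$\mathrm{LD}_{n,[0,1]^d}(g,\varepsilon)=\left\{\max_{x,y\in[0,1]^d}\left|g(x-y)-\widetilde{\mathbf T}_{n,[0,1]^d}(x,y)\right|\le\varepsilon\right\}.$$ $I_{[0,1]^d}(g)\in[0,\infty]$ denotes the common value of $\lim_{\varepsilon\to0}\liminf_{n\to\infty}-\frac1{n^d}\log\mathbb P(\mathrm{LD}_{n,[0,1]^d}(g,\varepsilon))$ and $\lim_{\varepsilon\to0}\limsup_{n\to\infty}-\frac1{n^d}\log\mathbb P(\mathrm{LD}_{n,[0,1]^d}(g,\varepsilon))$ (these two monotone limits coincide for $g\in\mathcal N$). *)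

theory Defs
  imports "HOL-Probability.Probability"
begin

definition l1norm :: "real ^ 'n \<Rightarrow> real" where
  "l1norm x = (\<Sum>i\<in>UNIV. \<bar>x $ i\<bar>)"

definition Zd :: "(real ^ 'n) set" where
  "Zd = {v. \<forall>i. v $ i \<in> \<int>}"

(* A non-oriented edge is the two-element set of its endpoints. *)
definition edges :: "(real ^ 'n) set set" where
  "edges = {{v, v'} | v v'. v \<in> Zd \<and> v' \<in> Zd \<and> l1norm (v - v') = 1}"

definition top_support :: "real measure \<Rightarrow> real set" where
  "top_support \<nu> = {x. \<forall>U. open U \<and> x \<in> U \<longrightarrow> emeasure \<nu> (U \<inter> space \<nu>) > 0}"

(* The convex hull of an edge {v, v'} is the segment [v, v'].  Distinct points z, z' lie on at most
   one common edge; if z = z' the edge chosen by SOME is irrelevant because the length is 0.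
   Here t is a realisation of the edge weights. *)
definition step_time ::
  "real \<Rightarrow> ((real ^ 'n) set \<Rightarrow> real) \<Rightarrow> real ^ 'n \<Rightarrow> real ^ 'n \<Rightarrow> real" where
  "step_time b t z z' =
     (if \<exists>e\<in>edges. z \<in> convex hull e \<and> z' \<in> convex hull e
      then t (SOME e. e \<in> edges \<and> z \<in> convex hull e \<and> z' \<in> convex hull e) * l1norm (z - z')
      else b * l1norm (z - z'))"

definition path_time ::
  "real \<Rightarrow> ((real ^ 'n) set \<Rightarrow> real) \<Rightarrow> (real ^ 'n) list \<Rightarrow> real" where
  "path_time b t p = (\<Sum>i<length p - 1. step_time b t (p ! i) (p ! Suc i))"

definition passage_time ::
  "real \<Rightarrow> ((real ^ 'n) set \<Rightarrow> real) \<Rightarrow> (real ^ 'n) set \<Rightarrow> real ^ 'n \<Rightarrow> real ^ 'n \<Rightarrow> real" where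
  "passage_time b t X x y =
     Inf {path_time b t p | p. p \<noteq> [] \<and> hd p = x \<and> last p = y \<and> set p \<subseteq> X}"

definition rescaled_time ::
  "real \<Rightarrow> ((real ^ 'n) set \<Rightarrow> real) \<Rightarrow> nat \<Rightarrow> (real ^ 'n) set \<Rightarrow> real ^ 'n \<Rightarrow> real ^ 'n \<Rightarrow> real" where
  "rescaled_time b t n X x y =
     passage_time b t ((\<lambda>z. real n *\<^sub>R z) ` X) (real n *\<^sub>R x) (real n *\<^sub>R y) / real n"

definition is_norm :: "(real ^ 'n \<Rightarrow> real) \<Rightarrow> bool" where
  "is_norm g \<longleftrightarrow>
     (\<forall>x. 0 \<le> g x) \<and> (\<forall>x. g x = 0 \<longleftrightarrow> x = 0) \<and>
     (\<forall>c x. g (c *\<^sub>R x) = \<bar>c\<bar> * g x) \<and>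
     (\<forall>x y. g (x + y) \<le> g x + g y)"

definition norms :: "real \<Rightarrow> real \<Rightarrow> (real ^ 'n \<Rightarrow> real) set" where
  "norms a b = {g. is_norm g \<and> (\<forall>x. a * l1norm x \<le> g x \<and> g x \<le> b * l1norm x)}"

definition norms_star :: "real \<Rightarrow> real \<Rightarrow> (real ^ 'n \<Rightarrow> real) set" where
  "norms_star a b = {g \<in> norms a b. \<forall>x. x \<noteq> 0 \<longrightarrow> g x < b * l1norm x}"

definition is_time_constant ::
  "'w measure \<Rightarrow> ((real ^ 'n) set \<Rightarrow> 'w \<Rightarrow> real) \<Rightarrow> real \<Rightarrow> (real ^ 'n \<Rightarrow> real) \<Rightarrow> bool" where
  "is_time_constant M \<tau> b \<mu> \<longleftrightarrow>
     is_norm \<mu> \<and>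
     (AE \<omega> in M. \<forall>x\<in>Zd.
        (\<lambda>n. passage_time b (\<lambda>e. \<tau> e \<omega>) UNIV 0 (real n *\<^sub>R x) / real n) \<longlonglongrightarrow> \<mu> x)"

definition unit_cube :: "(real ^ 'n) set" where
  "unit_cube = {x. \<forall>i. 0 \<le> x $ i \<and> x $ i \<le> 1}"

(* For g in norms a b with 0 \<le> b and nonnegative weights, the supremum is over a bounded set of
   reals and is attained, so it is the maximum. *)
definition LD ::
  "'w measure \<Rightarrow> ((real ^ 'n) set \<Rightarrow> 'w \<Rightarrow> real) \<Rightarrow> real \<Rightarrow> nat \<Rightarrow> (real ^ 'n \<Rightarrow> real) \<Rightarrow> real
    \<Rightarrow> 'w set" where
  "LD M \<tau> b n g \<epsilon> =
     {\<omega> \<in> space M.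
        (SUP (x, y)\<in>unit_cube \<times> unit_cube.
           \<bar>g (x - y) - rescaled_time b (\<lambda>e. \<tau> e \<omega>) n unit_cube x y\<bar>) \<le> \<epsilon>}"

(* The real logarithm of the library satisfies ln 0 = 0; here -log 0 must be infinite. *)
definition neg_log :: "real \<Rightarrow> ereal" where
  "neg_log p = (if p = 0 then \<infinity> else ereal (- ln p))"

definition LD_cost ::
  "'w measure \<Rightarrow> ((real ^ 'n) set \<Rightarrow> 'w \<Rightarrow> real) \<Rightarrow> real \<Rightarrow> (real ^ 'n \<Rightarrow> real) \<Rightarrow> real \<Rightarrow> nat
    \<Rightarrow> ereal" where
  "LD_cost M \<tau> b g \<epsilon> n =
     ereal (1 / real n ^ CARD('n)) * neg_log (measure M (LD M \<tau> b n g \<epsilon>))"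

(* The rate I(g) on the unit cube is the common value of rate_lower and rate_upper. *)
definition rate_lower ::
  "'w measure \<Rightarrow> ((real ^ 'n) set \<Rightarrow> 'w \<Rightarrow> real) \<Rightarrow> real \<Rightarrow> (real ^ 'n \<Rightarrow> real) \<Rightarrow> ereal" where
  "rate_lower M \<tau> b g = Lim (at_right 0) (\<lambda>\<epsilon>. liminf (LD_cost M \<tau> b g \<epsilon>))"

definition rate_upper ::
  "'w measure \<Rightarrow> ((real ^ 'n) set \<Rightarrow> 'w \<Rightarrow> real) \<Rightarrow> real \<Rightarrow> (real ^ 'n \<Rightarrow> real) \<Rightarrow> ereal" where
  "rate_upper M \<tau> b g = Lim (at_right 0) (\<lambda>\<epsilon>. limsup (LD_cost M \<tau> b g \<epsilon>))"

end

theory Submission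
  imports Defs
begin

text \<open>The probability of the event \<open>LD n g \<epsilon>\<close> is bounded from above by union bounds over blocks. If
  \<open>g\<close> equals \<open>b \<parallel>\<cdot>\<parallel>\<close> in some direction, then it does so in a coordinate direction, and nearly every edge in
  that direction is nearly equal to \<open>b\<close>. If \<open>g z > \<mu> z\<close> for an integer vector \<open>z\<close>, then on the
  event a positive fraction of the passage times over vectors \<open>m z\<close> exceeds \<open>m \<mu> z\<close> by a
  multiple of \<open>m\<close>. For fixed large \<open>m\<close> each of these is unlikely, and since \<open>a > 0\<close> confines
  geodesics, they depend on disjoint boxes up to finitely many colours.

  For the lower bounds, few edges are modified. A finite family of disjoint segments is chosen such
  that a metric bounded by \<open>b \<parallel>\<cdot>\<parallel>\<close> and by \<open>g\<close> on each of the segments is at most \<open>g + \<epsilon>\<close>. Along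
  each segment the edges of a lattice path get weights whose average is prescribed by \<open>g\<close>, and the edges
  around it large weights, so that the paths cannot be used partially to travel faster than
  \<open>g\<close>. If \<open>g \<le> \<mu>\<close> the remaining edges are left typical, at cost \<open>o (n ^ d)\<close>; in general they are given
  weights at least \<open>\<beta>\<close>, where \<open>g \<le> \<beta> \<parallel>\<cdot>\<parallel>\<close>, at cost \<open>O (n ^ d)\<close> independently of \<open>\<epsilon>\<close>.\<close>

section \<open>Passage times and deterministic properties\<close>

text \<open>The difficulty of the modifications is that inserted fast edges may create shortcuts,
  all the more since steps off the edges allow a path to enter and leave a highway anywhere. The
  lower bound is therefore proved for the slightly smaller norm (1 - \<kappa>) \<open>g\<close>. Its
  potentials have Lipschitz constant (1 - \<kappa>) \<beta>, which lies below the large highway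
  value \<beta> - \<theta> by at least \<theta>. This gap turns errors that are bounded, or small
  against \<open>n\<close>, into admissible Lipschitz terms as soon as the highways are far apart at
  scale \<open>n\<close>, and the price \<kappa> is absorbed in \<epsilon>. Dimension at least 2
  enters twice: lines have empty interior, so that segments can be put in general position, and a
  number of edges linear in \<open>n\<close> is negligible. If \<nu> has no atom at
  \<open>b\<close>, a level \<beta> below \<open>b\<close> is required; compactness of the unit
  sphere provides it for \<open>g\<close> in \<open>norms_star\<close>. Lower estimates are given
  for \<open>rate_lower\<close> and upper estimates for \<open>rate_upper\<close>, and the
  inequality between the two transfers both equivalences to either of them.\<close>

lemma l1norm_nonneg [simp]: "0 \<le> l1norm x"
  by (simp add: l1norm_def sum_nonneg)

lemma l1norm_zero [simp]: "l1norm 0 = 0"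
  by (simp add: l1norm_def)

lemma l1norm_eq_0 [simp]: "l1norm x = 0 \<longleftrightarrow> x = 0"
  by (simp add: l1norm_def vec_eq_iff sum_nonneg_eq_0_iff)

lemma l1norm_triangle: "l1norm (x + y) \<le> l1norm x + l1norm y"
  unfolding l1norm_def sum.distrib[symmetric] by (rule sum_mono) simp

lemma l1norm_scale [simp]: "l1norm (c *\<^sub>R x) = \<bar>c\<bar> * l1norm x"
  by (simp add: l1norm_def abs_mult sum_distrib_left)

lemma l1norm_uminus [simp]: "l1norm (- x) = l1norm x"
  by (simp add: l1norm_def)

lemma l1norm_minus_commute: "l1norm (x - y) = l1norm (y - x)"
  using l1norm_uminus[of "x - y"] by simp

lemma l1norm_triangle_diff: "l1norm (x - z) \<le> l1norm (x - y) + l1norm (y - z)"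
  using l1norm_triangle[of "x - y" "y - z"] by simp

lemma l1norm_axis [simp]: "l1norm (axis i c :: real ^ 'n) = \<bar>c\<bar>"
proof -
  have "l1norm (axis i c :: real ^ 'n) = (\<Sum>j\<in>UNIV. if i = j then \<bar>c\<bar> else 0)"
    unfolding l1norm_def axis_def by (intro sum.cong) auto
  then show ?thesis by simp
qed

lemma component_le_l1norm: "\<bar>x $ i\<bar> \<le> l1norm x"
  unfolding l1norm_def by (rule member_le_sum) auto

lemma norm_le_l1norm: "norm x \<le> l1norm x"
  unfolding l1norm_def by (rule norm_le_l1_cart)

lemma l1norm_le_norm: "l1norm (x :: real ^ 'n) \<le> CARD('n) * norm x"
  unfolding l1norm_def using sum_bounded_above[of UNIV "\<lambda>i. \<bar>x $ i\<bar>" "norm x"]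
  by (simp add: component_le_norm_cart)

lemma l1norm_bound:
  fixes x :: "real ^ 'n" and c :: real
  shows "(\<And>i. \<bar>x $ i\<bar> \<le> c) \<Longrightarrow> l1norm x \<le> CARD('n) * c"
  unfolding l1norm_def using sum_bounded_above[of UNIV "\<lambda>i. \<bar>x $ i\<bar>" c] by simp

lemma continuous_on_l1norm [continuous_intros]:
  "continuous_on S f \<Longrightarrow> continuous_on S (\<lambda>x. l1norm (f x))"
  unfolding l1norm_def by (intro continuous_intros)

section \<open>Lattice points, edges and segments\<close>

lemma Zd_add [intro]: "v \<in> Zd \<Longrightarrow> w \<in> Zd \<Longrightarrow> v + w \<in> Zd"
  and Zd_diff [intro]: "v \<in> Zd \<Longrightarrow> w \<in> Zd \<Longrightarrow> v - w \<in> Zd"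
  and Zd_uminus [intro]: "v \<in> Zd \<Longrightarrow> - v \<in> Zd"
  and Zd_zero [intro, simp]: "0 \<in> Zd"
  and Zd_axis [intro, simp]: "axis i 1 \<in> Zd"
  and Zd_scale [intro]: "c \<in> \<int> \<Longrightarrow> v \<in> Zd \<Longrightarrow> c *\<^sub>R v \<in> Zd"
  by (auto simp: Zd_def axis_def)

lemma edge_axis [intro, simp]: "(v :: real ^ 'n) \<in> Zd \<Longrightarrow> {v, v + axis i 1} \<in> edges"
proof -
  assume "v \<in> Zd"
  moreover have "l1norm (v - (v + axis i 1)) = 1"
    using l1norm_minus_commute[of v "v + axis i 1"] by simp
  moreover have "v + axis i 1 \<in> Zd" using \<open>v \<in> Zd\<close> by auto
  ultimately show ?thesis unfolding edges_def by blast
qed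

text \<open>One nonzero integer coordinate already uses up the whole norm 1, so all the others
  vanish.\<close>

lemma unit_Zd_cases:
  assumes "w \<in> Zd" "l1norm (w :: real ^ 'n) = 1"
  obtains i where "w = axis i 1 \<or> w = - axis i 1"
proof -
  from assms have "w \<noteq> 0" by auto
  then obtain i where i: "w $ i \<noteq> 0" by (auto simp: vec_eq_iff)
  have Z: "w $ i \<in> \<int>" using assms by (simp add: Zd_def)
  have ge: "1 \<le> \<bar>w $ i\<bar>" using Ints_nonzero_abs_ge1[OF Z i] .
  have split: "1 = \<bar>w $ i\<bar> + (\<Sum>j\<in>UNIV - {i}. \<bar>w $ j\<bar>)"
    using assms(2) unfolding l1norm_def by (subst (asm) sum.remove[of _ i]) auto
  have "0 \<le> (\<Sum>j\<in>UNIV - {i}. \<bar>w $ j\<bar>)" by (rule sum_nonneg) simp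
  then have s0: "(\<Sum>j\<in>UNIV - {i}. \<bar>w $ j\<bar>) = 0" and one: "\<bar>w $ i\<bar> = 1"
    using split ge by linarith+
  from s0 have "\<forall>j\<in>UNIV - {i}. \<bar>w $ j\<bar> = 0" by (subst (asm) sum_nonneg_eq_0_iff) auto
  then have "w = axis i (w $ i)" by (auto simp: vec_eq_iff axis_def)
  moreover have "w $ i = 1 \<or> w $ i = -1" using one by linarith
  moreover have "axis i (-1) = - axis i (1::real)" by (auto simp: vec_eq_iff axis_def)
  ultimately show ?thesis using that by metis
qed

lemma edge_cases:
  assumes "e \<in> edges"
  obtains v i where "v \<in> Zd" "e = {v, v + axis i 1}"
proof -
  from assms obtain v v' where v: "v \<in> Zd" "v' \<in> Zd" "l1norm (v - v') = 1" "e = {v, v'}"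
    by (auto simp: edges_def)
  from v obtain i where "v - v' = axis i 1 \<or> v - v' = - axis i 1"
    using unit_Zd_cases[of "v - v'"] by auto
  then show ?thesis
  proof
    assume "v - v' = axis i 1"
    then have "v = v' + axis i 1" by (simp add: algebra_simps)
    then show ?thesis using that[of v' i] v by auto
  next
    assume "v - v' = - axis i 1"
    then have "v' = v + axis i 1" by (simp add: algebra_simps)
    then show ?thesis using that[of v i] v by auto
  qed
qed

lemma hull_pair: "z \<in> convex hull {v, w} \<longleftrightarrow> (\<exists>s. 0 \<le> s \<and> s \<le> 1 \<and> z = v + s *\<^sub>R (w - v))"
  for v w z :: "'a :: real_vector"
  unfolding segment_convex_hull[symmetric] closed_segment_def by (auto simp: algebra_simps)

lemma axis_scale: "s *\<^sub>R axis i (1::real) = axis i s"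
  by (auto simp: vec_eq_iff axis_def)

lemma hull_edge: "(z :: real ^ 'n) \<in> convex hull {v, v + axis i 1} \<longleftrightarrow> (\<exists>s. 0 \<le> s \<and> s \<le> 1 \<and> z = v + axis i s)"
  unfolding hull_pair add_diff_cancel_left' axis_scale ..

text \<open>Two distinct common points determine the axis; the base vertices then differ along it by
  an integer of absolute value below 1. So the edge selected by SOME in \<open>step_time\<close> is
  the only candidate whenever the step has positive length.\<close>

lemma edge_unique:
  fixes z z' :: "real ^ 'n"
  assumes e: "e \<in> edges" "e' \<in> edges" and ne: "z \<noteq> z'"
    and h: "z \<in> convex hull e" "z' \<in> convex hull e" "z \<in> convex hull e'" "z' \<in> convex hull e'"
  shows "e = e'"
proof -
  obtain v i where v: "v \<in> Zd" "e = {v, v + axis i 1}" using e(1) by (rule edge_cases)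
  obtain w j where w: "w \<in> Zd" "e' = {w, w + axis j 1}" using e(2) by (rule edge_cases)
  from h v w obtain s r s' r' where s: "0 \<le> s" "s \<le> 1" "z = v + axis i s"
    and r: "0 \<le> r" "r \<le> 1" "z' = v + axis i r"
    and s': "0 \<le> s'" "s' \<le> 1" "z = w + axis j s'"
    and r': "0 \<le> r'" "r' \<le> 1" "z' = w + axis j r'"
    by (auto simp: hull_edge)
  have D: "axis i (s - r) = axis j (s' - r')"
  proof -
    have "axis i (s - r) = z - z'" using s r by (auto simp: vec_eq_iff axis_def)
    also have "\<dots> = axis j (s' - r')" using s' r' by (auto simp: vec_eq_iff axis_def)
    finally show ?thesis .
  qed
  have sr: "s \<noteq> r" using ne s r by auto
  then have ij: "i = j" and d: "s - r = s' - r'" using D by (auto simp: axis_eq_axis)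
  have vw: "v - w = axis i (s' - s)"
  proof -
    have "v + axis i s = w + axis i s'" using s s' ij by simp
    then have "v - w = axis i s' - axis i s" by (simp add: algebra_simps)
    then show ?thesis by (simp add: vec_eq_iff axis_def)
  qed
  have "(v - w) $ i \<in> \<int>" using v w Zd_diff[of v w] by (auto simp: Zd_def)
  then have "s' - s \<in> \<int>" unfolding vw by (simp add: axis_def)
  then obtain k :: int where k: "s' - s = of_int k" by (elim Ints_cases)
  have "s' - s < 1" "s' - s > -1"
    using s r s' r' d sr by linarith+
  then have "k = 0" using k by linarith
  then have "v = w" using vw k by (simp add: axis_def vec_eq_iff)
  then show ?thesis using v w ij by simp
qed

text \<open>An edge may touch a box in a single point, but two distinct points of it in a box with
  integer corners force both endpoints inside. Hence a path in such a box reads only weights of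
  edges of the box, which is the source of independence between disjoint boxes.\<close>

lemma edge_in_box:
  fixes z z' :: "real ^ 'n"
  assumes lu: "l \<in> Zd" "u \<in> Zd" and e: "e \<in> edges" and ne: "z \<noteq> z'"
    and h: "z \<in> convex hull e" "z' \<in> convex hull e" and box: "z \<in> cbox l u" "z' \<in> cbox l u"
  shows "e \<subseteq> cbox l u"
proof -
  obtain v i where v: "v \<in> Zd" "e = {v, v + axis i 1}" using e by (rule edge_cases)
  from h v obtain s r where s: "0 \<le> s" "s \<le> 1" "z = v + axis i s"
    and r: "0 \<le> r" "r \<le> 1" "z' = v + axis i r" by (auto simp: hull_edge)
  have "s \<noteq> r" using ne s r by auto
  have *: "l $ j \<le> v $ j \<and> v $ j + (if j = i then 1 else 0) \<le> u $ j" for j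
  proof -
    have Z: "l $ j \<in> \<int>" "u $ j \<in> \<int>" "v $ j \<in> \<int>" using lu v by (auto simp: Zd_def)
    then obtain a b c where abc: "l $ j = of_int a" "u $ j = of_int b" "v $ j = of_int c"
      by (elim Ints_cases) auto
    have "l $ j \<le> z $ j" "z $ j \<le> u $ j" "l $ j \<le> z' $ j" "z' $ j \<le> u $ j"
      using box by (auto simp: mem_box_cart)
    then show ?thesis
    proof (cases "j = i")
      case True
      then have "l $ j \<le> v $ j + s" "v $ j + s \<le> u $ j" "l $ j \<le> v $ j + r" "v $ j + r \<le> u $ j"
        using s r box by (auto simp: mem_box_cart axis_def dest!: spec[of _ i])
      \<comment> \<open>Two different parameters in the unit interval make one of the inequalities
        strict on either side; integrality then gives the bounds for both endpoints.\<close>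
      then have "real_of_int a < of_int c + 1" "real_of_int c < of_int b"
        using s(1,2) r(1,2) \<open>s \<noteq> r\<close> abc by linarith+
      then have "a \<le> c" "c + 1 \<le> b" by linarith+
      then show ?thesis using True abc by simp
    next
      case False
      then show ?thesis using s box by (auto simp: mem_box_cart axis_def dest!: spec[of _ j])
    qed
  qed
  have "l $ j \<le> v $ j \<and> v $ j \<le> u $ j \<and> l $ j \<le> (v + axis i 1) $ j \<and> (v + axis i 1) $ j \<le> u $ j" for j
    using *[of j] by (auto simp: axis_def split: if_splits)
  then show ?thesis using v by (auto simp: mem_box_cart)
qed

section \<open>Travel times of steps and of paths\<close>

lemma step_time_edge:
  assumes "e \<in> edges" "z \<in> convex hull e" "z' \<in> convex hull e"
  shows "step_time b t z z' = t e * l1norm (z - z')"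
proof (cases "z = z'")
  case True then show ?thesis by (simp add: step_time_def)
next
  case False
  have "(SOME e. e \<in> edges \<and> z \<in> convex hull e \<and> z' \<in> convex hull e) = e"
    by (rule some_equality) (use assms edge_unique[OF _ _ False] in auto)
  then show ?thesis using assms by (auto simp: step_time_def)
qed

lemma step_time_nonedge:
  assumes "\<not> (\<exists>e\<in>edges. z \<in> convex hull e \<and> z' \<in> convex hull e)"
  shows "step_time b t z z' = b * l1norm (z - z')"
  unfolding step_time_def by (simp only: assms if_False)

text \<open>The alternative depends on the two points only and not on \<open>b\<close> or
  \<open>t\<close>, so that two environments can be compared within one case.\<close>

lemma step_time_cases:
  obtains (edge) e where "e \<in> edges" "z \<in> convex hull e" "z' \<in> convex hull e"
      "\<And>b t. step_time b t z z' = t e * l1norm (z - z')"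
  | (off) "\<And>b t. step_time b t z z' = b * l1norm (z - z')"
  using step_time_edge step_time_nonedge by metis

lemma step_time_mono:
  assumes "\<And>e. e \<in> edges \<Longrightarrow> t e \<le> t' e"
  shows "step_time b t z z' \<le> step_time b t' z z'"
  by (cases rule: step_time_cases[of z z']) (auto intro!: mult_right_mono assms)

lemma step_time_ge:
  assumes "\<And>e. e \<in> edges \<Longrightarrow> a \<le> t e" "a \<le> b"
  shows "a * l1norm (z - z') \<le> step_time b t z z'"
  by (cases rule: step_time_cases[of z z']) (auto intro!: mult_right_mono assms)

lemma step_time_le:
  assumes "\<And>e. e \<in> edges \<Longrightarrow> t e \<le> b"
  shows "step_time b t z z' \<le> b * l1norm (z - z')"
  by (cases rule: step_time_cases[of z z']) (auto intro!: mult_right_mono assms)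

lemma step_time_box_cong:
  assumes "l \<in> Zd" "u \<in> Zd" "z \<in> cbox l u" "z' \<in> cbox l u"
    and "\<And>e. e \<in> edges \<Longrightarrow> e \<subseteq> cbox l u \<Longrightarrow> t e = t' e"
  shows "step_time b t z z' = step_time b t' z z'"
proof (cases "z = z'")
  case True then show ?thesis by (simp add: step_time_def)
next
  case False
  show ?thesis
    by (cases rule: step_time_cases[of z z'])
      (use assms edge_in_box[OF assms(1,2) _ False _ _ assms(3,4)] in auto)
qed

lemma step_time_translate:
  assumes "v \<in> Zd"
  shows "step_time b t (v + z) (v + z') = step_time b (\<lambda>e. t ((+) v ` e)) z z'"
proof -
  have tr: "(+) w ` e \<in> edges" if "e \<in> edges" "w \<in> Zd" for e :: "(real ^ 'a) set" and w
  proof -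
    from that(1) obtain u i where "u \<in> Zd" "e = {u, u + axis i 1}" by (rule edge_cases)
    then have "(+) w ` e = {w + u, w + u + axis i 1}" by (auto simp: algebra_simps)
    then show ?thesis using \<open>u \<in> Zd\<close> that(2) by auto
  qed
  show ?thesis
  proof (cases "\<exists>e\<in>edges. z \<in> convex hull e \<and> z' \<in> convex hull e")
    case True
    then obtain e where e: "e \<in> edges" "z \<in> convex hull e" "z' \<in> convex hull e" by auto
    have "v + z \<in> convex hull ((+) v ` e)" "v + z' \<in> convex hull ((+) v ` e)"
      using e by (auto simp: convex_hull_translation)
    then show ?thesis
      using step_time_edge[OF e] step_time_edge[OF tr[OF e(1) assms]] by auto
  next
    case False
    have "\<not> (\<exists>e\<in>edges. v + z \<in> convex hull e \<and> v + z' \<in> convex hull e)"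
    proof
      assume "\<exists>e\<in>edges. v + z \<in> convex hull e \<and> v + z' \<in> convex hull e"
      then obtain e where e: "e \<in> edges" "v + z \<in> convex hull e" "v + z' \<in> convex hull e" by auto
      have "z \<in> (+) (- v) ` (convex hull e)" by (rule image_eqI[OF _ e(2)]) simp
      moreover have "z' \<in> (+) (- v) ` (convex hull e)" by (rule image_eqI[OF _ e(3)]) simp
      ultimately have "z \<in> convex hull ((+) (- v) ` e)" "z' \<in> convex hull ((+) (- v) ` e)"
        by (simp_all only: convex_hull_translation)
      then show False using False tr[OF e(1), of "- v"] assms by auto
    qed
    then show ?thesis using False by (simp add: step_time_nonedge)
  qed
qed

lemma path_time_single [simp]: "path_time b t [x] = 0"
  by (simp add: path_time_def)

lemma path_time_Cons [simp]: "path_time b t (x # y # p) = step_time b t x y + path_time b t (y # p)"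
  unfolding path_time_def by (simp add: sum.lessThan_Suc_shift del: sum.lessThan_Suc)

lemma path_time_append:
  "p \<noteq> [] \<Longrightarrow> q \<noteq> [] \<Longrightarrow> last p = hd q \<Longrightarrow>
     path_time b t (p @ tl q) = path_time b t p + path_time b t q"
proof (induction p rule: induct_list012)
  case (2 x) then show ?case by (cases q) auto
next
  case (3 x y zs) then show ?case by (auto split: if_splits)
qed simp

text \<open>Weak duality: a function whose increments are bounded by step times telescopes along a
  path. The lower bounds on passage times in modified environments rest on this.\<close>

lemma path_potential:
  assumes "\<And>z z'. z \<in> X \<Longrightarrow> z' \<in> X \<Longrightarrow> f z' - f z \<le> step_time b t z z'"
  shows "p \<noteq> [] \<Longrightarrow> set p \<subseteq> X \<Longrightarrow> f (last p) - f (hd p) \<le> path_time b t p"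
proof (induction p rule: induct_list012)
  case (3 x y zs)
  then show ?case using assms[of x y] by auto
qed auto

lemma path_time_mono:
  assumes "\<And>z z'. z \<in> X \<Longrightarrow> z' \<in> X \<Longrightarrow> step_time b t z z' \<le> step_time b t' z z'"
  shows "set p \<subseteq> X \<Longrightarrow> path_time b t p \<le> path_time b t' p"
proof (induction p rule: induct_list012)
  case (3 x y zs)
  then show ?case using assms[of x y] by auto
qed (auto simp: path_time_def)

lemma path_time_nonneg:
  assumes "\<And>e. e \<in> edges \<Longrightarrow> 0 \<le> t e" "0 \<le> b"
  shows "0 \<le> path_time b t p"
  unfolding path_time_def using step_time_ge[of 0 t b] assms by (intro sum_nonneg) auto

text \<open>A path that visits \<open>w\<close> pays at least \<open>a\<close> per unit of distance
  to get there; for positive \<open>a\<close> this confines cheap paths.\<close>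

lemma path_time_ge_visit:
  assumes "\<And>e. e \<in> edges \<Longrightarrow> a \<le> t e" "a \<le> b" "0 \<le> a"
  shows "w \<in> set p \<Longrightarrow> a * l1norm (w - hd p) \<le> path_time b t p"
proof (induction p rule: induct_list012)
  case (3 x y zs)
  have nn: "0 \<le> path_time b t (y # zs)" "0 \<le> step_time b t x y"
    using path_time_nonneg[of t b] step_time_ge[of 0 t b] assms by fastforce+
  show ?case
  proof (cases "w = x")
    case False
    then have "a * l1norm (w - y) \<le> path_time b t (y # zs)" using 3 by auto
    moreover have "a * l1norm (x - y) \<le> step_time b t x y" using step_time_ge assms by blast
    moreover have "a * l1norm (w - x) \<le> a * (l1norm (w - y) + l1norm (x - y))"
      using l1norm_triangle_diff[of w x y] assms(3)
      by (intro mult_left_mono) (auto simp: l1norm_minus_commute)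
    ultimately show ?thesis by (simp add: algebra_simps)
  qed (use nn in simp)
qed auto

section \<open>Passage times\<close>

definition paths :: "(real ^ 'n) set \<Rightarrow> real ^ 'n \<Rightarrow> real ^ 'n \<Rightarrow> (real ^ 'n) list set" where
  "paths X x y = {p. p \<noteq> [] \<and> hd p = x \<and> last p = y \<and> set p \<subseteq> X}"

lemma passage_time_eq: "passage_time b t X x y = (INF p\<in>paths X x y. path_time b t p)"
  unfolding passage_time_def paths_def by (rule arg_cong[where f=Inf]) auto

text \<open>The direct step is always admissible. It keeps the set of paths nonempty, so that
  \<open>Inf\<close> has its meaning, and yields the a priori upper bound by a single step.\<close>

lemma direct_path: "x \<in> X \<Longrightarrow> y \<in> X \<Longrightarrow> [x, y] \<in> paths X x y"
  by (auto simp: paths_def)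

lemma passage_le_path:
  assumes "\<And>e. e \<in> edges \<Longrightarrow> 0 \<le> t e" "0 \<le> b" "p \<in> paths X x y"
  shows "passage_time b t X x y \<le> path_time b t p"
  unfolding passage_time_eq
  by (rule cINF_lower[OF _ assms(3)]) (auto intro!: bdd_belowI[of _ 0] path_time_nonneg assms)

lemma passage_ge:
  assumes "x \<in> X" "y \<in> X" "\<And>p. p \<in> paths X x y \<Longrightarrow> c \<le> path_time b t p"
  shows "c \<le> passage_time b t X x y"
  unfolding passage_time_eq using direct_path[OF assms(1,2)] by (intro cINF_greatest) (auto intro: assms(3))

lemma passage_le_step:
  assumes "\<And>e. e \<in> edges \<Longrightarrow> 0 \<le> t e" "0 \<le> b" "x \<in> X" "y \<in> X"
  shows "passage_time b t X x y \<le> step_time b t x y"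
  using passage_le_path[where t=t and b=b, OF assms(1,2) direct_path[OF assms(3,4)]] by simp

lemma passage_le:
  assumes "\<And>e. e \<in> edges \<Longrightarrow> 0 \<le> t e \<and> t e \<le> b" "0 \<le> b" "x \<in> X" "y \<in> X"
  shows "passage_time b t X x y \<le> b * l1norm (x - y)"
  using passage_le_step[of t b x X y] step_time_le[of t b x y] assms by force

lemma passage_refl:
  assumes "\<And>e. e \<in> edges \<Longrightarrow> 0 \<le> t e" "0 \<le> b" "x \<in> X"
  shows "passage_time b t X x x = 0"
proof (rule antisym)
  show "passage_time b t X x x \<le> 0"
  proof -
    have "step_time b t x x = 0" by (simp add: step_time_def)
    then show ?thesis using passage_le_step[where t=t and b=b, OF assms assms(3)] by simp
  qed
  show "0 \<le> passage_time b t X x x" using assms by (intro passage_ge path_time_nonneg) auto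
qed

lemma passage_potential:
  assumes "\<And>z z'. z \<in> X \<Longrightarrow> z' \<in> X \<Longrightarrow> f z' - f z \<le> step_time b t z z'" "x \<in> X" "y \<in> X"
  shows "f y - f x \<le> passage_time b t X x y"
proof (rule passage_ge[OF assms(2,3)])
  fix p assume "p \<in> paths X x y"
  then show "f y - f x \<le> path_time b t p"
    using path_potential[of X f b t p] assms(1) by (auto simp: paths_def)
qed

text \<open>Concatenation of paths, with one infimum taken at a time: over \<open>q\<close> for
  fixed \<open>p\<close>, then over \<open>p\<close>.\<close>

lemma passage_triangle:
  assumes t: "\<And>e. e \<in> edges \<Longrightarrow> 0 \<le> t e" "0 \<le> b" and X: "x \<in> X" "y \<in> X" "z \<in> X"
  shows "passage_time b t X x z \<le> passage_time b t X x y + passage_time b t X y z"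
proof -
  have "passage_time b t X x z - path_time b t p \<le> passage_time b t X y z" if p: "p \<in> paths X x y" for p
  proof (rule passage_ge[OF X(2,3)])
    fix q assume q: "q \<in> paths X y z"
    have "p @ tl q \<in> paths X x z"
      using p q by (cases q; cases "tl q = []") (auto simp: paths_def)
    then have "passage_time b t X x z \<le> path_time b t (p @ tl q)"
      using passage_le_path[of t b "p @ tl q" X x z] t by blast
    also have "\<dots> = path_time b t p + path_time b t q"
      using p q by (intro path_time_append) (auto simp: paths_def)
    finally show "passage_time b t X x z - path_time b t p \<le> path_time b t q" by simp
  qed
  then have "passage_time b t X x z - passage_time b t X y z \<le> passage_time b t X x y"
    using X by (intro passage_ge) (auto simp: algebra_simps)
  then show ?thesis by simp
qed

lemma passage_mono_weights:
  assumes "\<And>e. e \<in> edges \<Longrightarrow> 0 \<le> t e" "0 \<le> b" "x \<in> X" "y \<in> X"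
    and "\<And>z z'. z \<in> X \<Longrightarrow> z' \<in> X \<Longrightarrow> step_time b t z z' \<le> step_time b t' z z'"
  shows "passage_time b t X x y \<le> passage_time b t' X x y"
proof (rule passage_ge[OF assms(3,4)])
  fix p assume p: "p \<in> paths X x y"
  have "passage_time b t X x y \<le> path_time b t p" by (rule passage_le_path[where t=t, OF assms(1,2) p])
  also have "\<dots> \<le> path_time b t' p"
    using p by (intro path_time_mono[of X] assms(5)) (auto simp: paths_def)
  finally show "passage_time b t X x y \<le> path_time b t' p" .
qed

lemma passage_mono_set:
  assumes "\<And>e. e \<in> edges \<Longrightarrow> 0 \<le> t e" "0 \<le> b" "x \<in> X" "y \<in> X" "X \<subseteq> X'"
  shows "passage_time b t X' x y \<le> passage_time b t X x y"
proof (rule passage_ge[OF assms(3,4)])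
  fix p assume "p \<in> paths X x y"
  then show "passage_time b t X' x y \<le> path_time b t p"
    using assms(5) by (intro passage_le_path[where t=t, OF assms(1,2)]) (auto simp: paths_def)
qed

lemma path_time_box_cong:
  assumes "l \<in> Zd" "u \<in> Zd" "\<And>e. e \<in> edges \<Longrightarrow> e \<subseteq> cbox l u \<Longrightarrow> t e = t' e" "set p \<subseteq> cbox l u"
  shows "path_time b t p = path_time b t' p"
proof -
  have st: "step_time b t z z' = step_time b t' z z'" if "z \<in> cbox l u" "z' \<in> cbox l u" for z z'
    by (rule step_time_box_cong[OF assms(1,2) that assms(3)])
  show ?thesis
    by (rule antisym; rule path_time_mono[of "cbox l u", OF _ assms(4)]) (simp_all add: st)
qed

lemma passage_box_cong:
  assumes "l \<in> Zd" "u \<in> Zd" "\<And>e. e \<in> edges \<Longrightarrow> e \<subseteq> cbox l u \<Longrightarrow> t e = t' e"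
  shows "passage_time b t (cbox l u) x y = passage_time b t' (cbox l u) x y"
  unfolding passage_time_eq
  by (rule INF_cong[OF refl]) (auto simp: paths_def intro!: path_time_box_cong[OF assms])

lemma path_time_translate:
  assumes "v \<in> Zd"
  shows "path_time b t (map ((+) v) p) = path_time b (\<lambda>e. t ((+) v ` e)) p"
proof (induction p rule: induct_list012)
  case (3 x y zs)
  then show ?case by (simp add: step_time_translate[OF assms])
qed (simp_all add: path_time_def)

lemma passage_translate:
  assumes "v \<in> Zd"
  shows "passage_time b t ((+) v ` X) (v + x) (v + y) = passage_time b (\<lambda>e. t ((+) v ` e)) X x y"
proof -
  have *: "map ((+) v) ` paths X x y = paths ((+) v ` X) (v + x) (v + y)"
  proof (intro equalityI subsetI)
    fix q assume q: "q \<in> paths ((+) v ` X) (v + x) (v + y)"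
    then have "q = map ((+) v) (map ((+) (- v)) q)" by (simp add: comp_def)
    moreover have "map ((+) (- v)) q \<in> paths X x y"
      using q by (auto simp: paths_def hd_map last_map)
    ultimately show "q \<in> map ((+) v) ` paths X x y" by (rule image_eqI)
  qed (auto simp: paths_def hd_map last_map subset_iff)
  show ?thesis
    unfolding passage_time_eq *[symmetric] image_image path_time_translate[OF assms] ..
qed

text \<open>A path that leaves \<open>X\<close> visits a point \<open>w\<close> for which
  \<open>a * l1norm (w - x)\<close> exceeds \<open>b * l1norm (x - y)\<close>, hence costs more than
  the direct step. So for positive \<open>a\<close> a passage time in the full space is one in a box
  of comparable size.\<close>

lemma passage_UNIV_eq:
  assumes t: "\<And>e. e \<in> edges \<Longrightarrow> a \<le> t e \<and> t e \<le> b" "0 \<le> a" "a \<le> b"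
    and X: "\<And>w. a * l1norm (w - x) \<le> b * l1norm (x - y) \<Longrightarrow> w \<in> X" and y: "y \<in> X"
  shows "passage_time b t UNIV x y = passage_time b t X x y"
proof (rule antisym)
  have b: "0 \<le> b" and t0: "\<And>e. e \<in> edges \<Longrightarrow> 0 \<le> t e" using t by (auto intro: order_trans)
  have x: "x \<in> X" by (rule X) (use b in simp)
  show "passage_time b t UNIV x y \<le> passage_time b t X x y"
    by (rule passage_mono_set) (use t0 b x y in auto)
  show "passage_time b t X x y \<le> passage_time b t UNIV x y"
  proof (rule passage_ge)
    fix p assume p: "p \<in> paths UNIV x y"
    show "passage_time b t X x y \<le> path_time b t p"
    proof (cases "set p \<subseteq> X")
      case True
      then show ?thesis using p by (intro passage_le_path) (use t0 b in \<open>auto simp: paths_def\<close>)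
    next
      case False
      then obtain w where w: "w \<in> set p" "w \<notin> X" by auto
      have "passage_time b t X x y \<le> b * l1norm (x - y)"
        by (rule passage_le) (use t0 t b x y in auto)
      also have "\<dots> \<le> a * l1norm (w - x)" using X[of w] w by linarith
      also have "\<dots> \<le> path_time b t p"
        using path_time_ge_visit[of a t b w p] t w p by (auto simp: paths_def)
      finally show ?thesis .
    qed
  qed auto
qed

section \<open>Lattice counting and measurability\<close>

lemma normsD:
  assumes "g \<in> norms a b"
  shows "0 \<le> g x" "g 0 = 0" "g (c *\<^sub>R x) = \<bar>c\<bar> * g x" "g (x + y) \<le> g x + g y"
    "a * l1norm x \<le> g x" "g x \<le> b * l1norm x" "g (- x) = g x"
proof -
  have n: "is_norm g" and ab: "\<And>x. a * l1norm x \<le> g x \<and> g x \<le> b * l1norm x"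
    using assms by (auto simp: norms_def)
  have s: "\<And>c x. g (c *\<^sub>R x) = \<bar>c\<bar> * g x" using n by (auto simp: is_norm_def)
  show "0 \<le> g x" "g 0 = 0" "g (c *\<^sub>R x) = \<bar>c\<bar> * g x" "g (x + y) \<le> g x + g y"
    "a * l1norm x \<le> g x" "g x \<le> b * l1norm x"
    using n ab by (auto simp: is_norm_def)
  show "g (- x) = g x" using s[of "-1" x] by simp
qed

lemma norms_diff:
  assumes "g \<in> norms a b"
  shows "g (x - z) \<le> g (x - y) + g (y - z)" "\<bar>g x - g y\<bar> \<le> g (x - y)"
    "g (x - y) = g (y - x)"
proof -
  note N = normsD[OF assms]
  show "g (x - z) \<le> g (x - y) + g (y - z)" using N(4)[of "x - y" "y - z"] by simp
  show sym: "g (x - y) = g (y - x)" for x y using N(7)[of "x - y"] by simp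
  show "\<bar>g x - g y\<bar> \<le> g (x - y)"
    using N(4)[of "x - y" y] N(4)[of "y - x" x] sym[of x y] by simp
qed

text \<open>Written as a \<open>cbox\<close> with integer corners, so that the locality lemmas for
  boxes apply to the cube.\<close>

definition ncube :: "nat \<Rightarrow> (real ^ 'n) set" where
  "ncube n = cbox 0 (\<chi> i. real n)"

lemma mem_ncube: "x \<in> ncube n \<longleftrightarrow> (\<forall>i. 0 \<le> x $ i \<and> x $ i \<le> real n)"
  by (auto simp: ncube_def mem_box_cart)

lemma Zd_const [simp]: "(\<chi> i. real n) \<in> Zd" "(\<chi> i. real_of_int k) \<in> Zd"
  by (auto simp: Zd_def)

lemma scaled_unit_cube:
  assumes "n > 0" shows "(\<lambda>z. real n *\<^sub>R z) ` unit_cube = ncube n"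
proof (intro equalityI subsetI)
  fix x :: "real ^ 'n" assume "x \<in> ncube n"
  then have "(1 / real n) *\<^sub>R x \<in> unit_cube" "x = real n *\<^sub>R ((1 / real n) *\<^sub>R x)"
    using assms by (auto simp: mem_ncube unit_cube_def field_simps)
  then show "x \<in> (\<lambda>z. real n *\<^sub>R z) ` unit_cube" by blast
qed (auto simp: mem_ncube unit_cube_def mult_left_le)

lemma rescaled_time_ncube:
  "n > 0 \<Longrightarrow> rescaled_time b t n unit_cube x y
     = passage_time b t (ncube n) (real n *\<^sub>R x) (real n *\<^sub>R y) / real n"
  by (simp add: rescaled_time_def scaled_unit_cube)

lemma scale_in_ncube: "x \<in> unit_cube \<Longrightarrow> real n *\<^sub>R x \<in> ncube n"
  by (auto simp: mem_ncube unit_cube_def mult_left_le)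

lemma card_lattice_box:
  fixes A :: "'n::finite \<Rightarrow> int set"
  assumes "\<And>i. finite (A i)"
  shows "finite {v :: real ^ 'n. \<forall>i. v $ i \<in> real_of_int ` A i}"
    and "card {v :: real ^ 'n. \<forall>i. v $ i \<in> real_of_int ` A i} = (\<Prod>i\<in>UNIV. card (A i))"
proof -
  let ?f = "\<lambda>f :: 'n \<Rightarrow> int. (\<chi> i. real_of_int (f i)) :: real ^ 'n"
  have eq: "{v :: real ^ 'n. \<forall>i. v $ i \<in> real_of_int ` A i} = ?f ` (PiE UNIV A)"
  proof (intro equalityI subsetI)
    fix v :: "real ^ 'n" assume "v \<in> {v. \<forall>i. v $ i \<in> real_of_int ` A i}"
    then have "\<forall>i. \<exists>k. k \<in> A i \<and> v $ i = real_of_int k" by auto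
    then obtain f where "\<forall>i. f i \<in> A i \<and> v $ i = real_of_int (f i)" by metis
    then show "v \<in> ?f ` (PiE UNIV A)" by (intro image_eqI[of _ _ f]) (auto simp: vec_eq_iff)
  qed (auto simp: PiE_def Pi_def)
  have inj: "inj_on ?f (PiE UNIV A)" by (auto simp: inj_on_def vec_eq_iff fun_eq_iff)
  show "finite {v :: real ^ 'n. \<forall>i. v $ i \<in> real_of_int ` A i}"
    unfolding eq by (intro finite_imageI finite_PiE) (auto simp: assms)
  show "card {v :: real ^ 'n. \<forall>i. v $ i \<in> real_of_int ` A i} = (\<Prod>i\<in>UNIV. card (A i))"
    unfolding eq card_image[OF inj] by (simp add: card_PiE)
qed

text \<open>The centre may be any real point: in each coordinate an interval of length
  \<open>2 * r\<close> holds at most \<open>2 * r + 1\<close> integers.\<close>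

lemma lattice_ball_card:
  fixes c :: "real ^ 'n"
  assumes "0 \<le> r"
  shows "finite {v \<in> Zd. \<forall>i. \<bar>v $ i - c $ i\<bar> \<le> r}"
    and "real (card {v \<in> Zd. \<forall>i. \<bar>v $ i - c $ i\<bar> \<le> r}) \<le> (2 * r + 1) ^ CARD('n)"
proof -
  let ?A = "\<lambda>i. {\<lceil>c $ i - r\<rceil>..\<lfloor>c $ i + r\<rfloor>}"
  have sub: "{v \<in> Zd. \<forall>i. \<bar>v $ i - c $ i\<bar> \<le> r} \<subseteq> {v. \<forall>i. v $ i \<in> real_of_int ` ?A i}"
  proof
    fix v assume "v \<in> {v \<in> Zd. \<forall>i. \<bar>v $ i - c $ i\<bar> \<le> r}"
    then have Z: "\<And>i. v $ i \<in> \<int>" and d: "\<And>i. \<bar>v $ i - c $ i\<bar> \<le> r" by (auto simp: Zd_def)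
    have "v $ i \<in> real_of_int ` ?A i" for i
    proof -
      obtain k where k: "v $ i = of_int k" using Z[of i] by (elim Ints_cases)
      have "c $ i - r \<le> of_int k" "of_int k \<le> c $ i + r" using d[of i] k by linarith+
      then have "k \<in> ?A i" by (auto simp: ceiling_le_iff le_floor_iff)
      then show ?thesis using k by auto
    qed
    then show "v \<in> {v. \<forall>i. v $ i \<in> real_of_int ` ?A i}" by auto
  qed
  have fin: "finite {v :: real ^ 'n. \<forall>i. v $ i \<in> real_of_int ` ?A i}"
    by (rule card_lattice_box) auto
  show "finite {v \<in> Zd. \<forall>i. \<bar>v $ i - c $ i\<bar> \<le> r}" by (rule finite_subset[OF sub fin])
  have "card {v \<in> Zd. \<forall>i. \<bar>v $ i - c $ i\<bar> \<le> r} \<le> (\<Prod>i\<in>UNIV. card (?A i))"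
    using card_mono[OF fin sub] card_lattice_box(2)[of ?A] by auto
  also have "real \<dots> \<le> (\<Prod>i\<in>(UNIV :: 'n set). 2 * r + 1)"
  proof (unfold of_nat_prod, intro prod_mono conjI)
    fix i
    have "real (nat (\<lfloor>c $ i + r\<rfloor> + 1 - \<lceil>c $ i - r\<rceil>)) \<le> 2 * r + 1"
      using assms by linarith
    then show "real (card (?A i)) \<le> 2 * r + 1" by simp
  qed auto
  finally show "real (card {v \<in> Zd. \<forall>i. \<bar>v $ i - c $ i\<bar> \<le> r}) \<le> (2 * r + 1) ^ CARD('n)"
    by (simp add: prod_constant)
qed

text \<open>A vertex lies on two edges per direction; the Boolean \<open>s\<close> tells whether it
  is the lower or the upper end.\<close>

lemma card_edges_touching:
  fixes V :: "(real ^ 'n) set"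
  assumes "finite V" "V \<subseteq> Zd"
  shows "finite {e \<in> edges. e \<inter> V \<noteq> {}}"
    and "card {e \<in> edges. e \<inter> V \<noteq> {}} \<le> 2 * CARD('n) * card V"
proof -
  let ?f = "\<lambda>(v, i, s). if s then {v, v + axis i 1} else {v - axis i 1, (v :: real ^ 'n)}"
  have sub: "{e \<in> edges. e \<inter> V \<noteq> {}} \<subseteq> ?f ` (V \<times> UNIV \<times> (UNIV :: bool set))"
  proof
    fix e assume "e \<in> {e \<in> edges. e \<inter> V \<noteq> {}}"
    then have e: "e \<in> edges" "e \<inter> V \<noteq> {}" by auto
    from e(1) obtain v i where v: "v \<in> Zd" "e = {v, v + axis i 1}" by (rule edge_cases)
    then have "v \<in> V \<or> v + axis i 1 \<in> V" using e by auto
    then show "e \<in> ?f ` (V \<times> UNIV \<times> (UNIV :: bool set))"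
    proof
      assume "v \<in> V" then show ?thesis using v by (intro image_eqI[of _ _ "(v, i, True)"]) auto
    next
      assume "v + axis i 1 \<in> V"
      then show ?thesis using v by (intro image_eqI[of _ _ "(v + axis i 1, i, False)"]) auto
    qed
  qed
  have fin: "finite (V \<times> (UNIV :: 'n set) \<times> (UNIV :: bool set))" using assms by simp
  show "finite {e \<in> edges. e \<inter> V \<noteq> {}}" by (rule finite_surj[OF fin sub])
  have "card {e \<in> edges. e \<inter> V \<noteq> {}} \<le> card (V \<times> (UNIV :: 'n set) \<times> (UNIV :: bool set))"
    by (rule surj_card_le[OF fin sub])
  then show "card {e \<in> edges. e \<inter> V \<noteq> {}} \<le> 2 * CARD('n) * card V"
    by (simp add: card_cartesian_product algebra_simps)
qed

lemma edge_subset_Zd: "e \<in> edges \<Longrightarrow> e \<subseteq> Zd"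
  by (auto simp: edges_def)

lemma edge_nonempty: "e \<in> edges \<Longrightarrow> e \<noteq> {}"
  by (auto simp: edges_def)

lemma finite_box_edges:
  fixes l u :: "real ^ 'n"
  shows "finite {e \<in> edges. e \<subseteq> cbox l u}"
proof -
  obtain r where r: "cbox l u \<subseteq> ball 0 r" using bounded_subset_ballD[OF bounded_cbox] by blast
  let ?V = "{v :: real ^ 'n \<in> Zd. \<forall>i. \<bar>v $ i - 0 $ i\<bar> \<le> \<bar>r\<bar>}"
  have "e \<inter> ?V \<noteq> {}" if e: "e \<in> edges" "e \<subseteq> cbox l u" for e
  proof -
    obtain v where v: "v \<in> e" using edge_nonempty[OF e(1)] by auto
    have "norm v \<le> \<bar>r\<bar>" using v e r by fastforce
    then have "\<bar>v $ i\<bar> \<le> \<bar>r\<bar>" for i using component_le_norm_cart[of v i] by linarith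
    then show ?thesis using v edge_subset_Zd[OF e(1)] by auto
  qed
  then show ?thesis
    by (intro finite_subset[OF _ card_edges_touching(1)[OF lattice_ball_card(1)[of "\<bar>r\<bar>" 0]]]) auto
qed

lemma card_ncube_edges:
  "real (card {e :: (real ^ 'n) set \<in> edges. e \<subseteq> ncube n}) \<le> 2 * CARD('n) * (real n + 1) ^ CARD('n)"
proof -
  let ?V = "{v :: real ^ 'n \<in> Zd. \<forall>i. \<bar>v $ i - (\<chi> i. real n / 2) $ i\<bar> \<le> real n / 2}"
  have fV: "finite ?V" by (rule lattice_ball_card) simp
  have "e \<inter> ?V \<noteq> {}" if e: "e \<in> edges" "e \<subseteq> ncube n" for e :: "(real ^ 'n) set"
  proof -
    obtain v where v: "v \<in> e" using edge_nonempty[OF e(1)] by auto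
    have "\<bar>v $ i - real n / 2\<bar> \<le> real n / 2" for i
    proof -
      have "0 \<le> v $ i" "v $ i \<le> real n" using v e by (auto simp: mem_ncube subset_iff)
      then show ?thesis by linarith
    qed
    then show ?thesis using v edge_subset_Zd[OF e(1)] by auto
  qed
  then have "card {e :: (real ^ 'n) set \<in> edges. e \<subseteq> ncube n} \<le> card {e \<in> edges. e \<inter> ?V \<noteq> {}}"
    by (intro card_mono card_edges_touching(1) fV) auto
  also have "\<dots> \<le> 2 * CARD('n) * card ?V" by (intro card_edges_touching(2) fV) auto
  also have "real \<dots> \<le> 2 * CARD('n) * (2 * (real n / 2) + 1) ^ CARD('n)"
    using lattice_ball_card(2)[of "real n / 2" "\<chi> i. real n / 2"]
    by (simp add: mult_left_mono)
  finally show ?thesis by simp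
qed

section \<open>Countability and measurability\<close>

lemma countable_Zd: "countable (Zd :: (real ^ 'n) set)"
proof -
  let ?f = "\<lambda>f :: 'n \<Rightarrow> int. (\<chi> i. real_of_int (f i)) :: real ^ 'n"
  have "v \<in> range ?f" if "v \<in> Zd" for v
  proof -
    from that have "\<forall>i. \<exists>k. v $ i = real_of_int k" by (auto simp: Zd_def Ints_def)
    then obtain f where "\<forall>i. v $ i = real_of_int (f i)" by metis
    then show ?thesis by (intro image_eqI[of _ _ f]) (auto simp: vec_eq_iff)
  qed
  then have "Zd \<subseteq> range ?f" by blast
  then show ?thesis by (rule countable_subset) simp
qed

lemma countable_edges: "countable (edges :: (real ^ 'n) set set)"
proof -
  have "edges \<subseteq> (\<lambda>(v, w). {v, w}) ` (Zd \<times> (Zd :: (real ^ 'n) set))"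
    by (auto simp: edges_def)
  then show ?thesis by (rule countable_subset) (intro countable_image countable_SIGMA countable_Zd)
qed

text \<open>Weights are read as a sequence through the enumeration \<open>to_nat_on edges\<close>:
  the product topology on \<open>nat \<Rightarrow> real\<close> is second countable, as the covering
  argument for measurability requires.\<close>

lemma path_time_continuous:
  "continuous_on UNIV (\<lambda>s :: nat \<Rightarrow> real. path_time b (\<lambda>e. s (to_nat_on edges e)) p)"
proof (induction p rule: induct_list012)
  case (3 x y zs)
  have "continuous_on UNIV (\<lambda>s :: nat \<Rightarrow> real. step_time b (\<lambda>e. s (to_nat_on edges e)) x y)"
    by (cases rule: step_time_cases[of x y]) (auto intro!: continuous_intros)
  then show ?case using 3 by (auto intro!: continuous_intros)
qed (auto simp: path_time_def)

lemma path_time_edges_cong: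
  assumes "\<And>e. e \<in> edges \<Longrightarrow> t e = t' e"
  shows "path_time b t p = path_time b t' p"
  unfolding path_time_def
proof (rule sum.cong)
  fix i
  show "step_time b t (p ! i) (p ! Suc i) = step_time b t' (p ! i) (p ! Suc i)"
    by (cases rule: step_time_cases[of "p ! i" "p ! Suc i"]) (auto simp: assms)
qed simp

text \<open>The infimum runs over uncountably many paths. Its strict sublevel sets correspond to
  unions of the sets \<open>U p\<close> of weight sequences, which are open because a path time is
  continuous in the weights; by the Lindelof property countably many paths suffice for a given
  level.\<close>

lemma passage_measurable:
  assumes m: "\<And>e. e \<in> edges \<Longrightarrow> \<tau> e \<in> borel_measurable N"
    and nn: "\<And>e \<omega>. e \<in> edges \<Longrightarrow> \<omega> \<in> space N \<Longrightarrow> 0 \<le> \<tau> e \<omega>" and b: "0 \<le> b"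
    and X: "x \<in> X" "y \<in> (X :: (real ^ 'n) set)"
  shows "(\<lambda>\<omega>. passage_time b (\<lambda>e. \<tau> e \<omega>) X x y) \<in> borel_measurable N"
proof (rule borel_measurableI_less)
  fix c :: real
  define U where "U p = {s :: nat \<Rightarrow> real. path_time b (\<lambda>e. s (to_nat_on edges e)) (p :: (real ^ 'n) list) < c}" for p
  have op: "open (U p)" for p
    unfolding U_def by (rule open_Collect_less[OF path_time_continuous]) simp
  obtain F where F: "F \<subseteq> U ` paths X x y" "countable F" "\<Union>F = \<Union>(U ` paths X x y)"
    using Lindelof[of "U ` paths X x y"] op by (metis (no_types, lifting) imageE)
  have in_U: "(\<lambda>k. \<tau> (from_nat_into edges k) \<omega>) \<in> U p \<longleftrightarrow> path_time b (\<lambda>e. \<tau> e \<omega>) p < c" for \<omega> p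
    unfolding U_def mem_Collect_eq
    by (subst path_time_edges_cong[of _ "\<lambda>e. \<tau> e \<omega>"])
      (simp_all add: from_nat_into_to_nat_on[OF countable_edges])
  have "{\<omega> \<in> space N. passage_time b (\<lambda>e. \<tau> e \<omega>) X x y < c}
      = {\<omega> \<in> space N. \<exists>p\<in>paths X x y. path_time b (\<lambda>e. \<tau> e \<omega>) p < c}"
  proof (rule Collect_cong, rule conj_cong[OF refl])
    fix \<omega> assume w: "\<omega> \<in> space N"
    have "bdd_below (path_time b (\<lambda>e. \<tau> e \<omega>) ` paths X x y)"
      using w nn b by (auto intro!: bdd_belowI[of _ 0] path_time_nonneg)
    then show "passage_time b (\<lambda>e. \<tau> e \<omega>) X x y < c \<longleftrightarrow> (\<exists>p\<in>paths X x y. path_time b (\<lambda>e. \<tau> e \<omega>) p < c)"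
      unfolding passage_time_eq using direct_path[OF X] by (subst cINF_less_iff) auto
  qed
  also have "\<dots> = {\<omega> \<in> space N. (\<lambda>k. \<tau> (from_nat_into edges k) \<omega>) \<in> \<Union>F}"
    unfolding F(3) by (auto simp: in_U)
  also have "\<dots> = (\<Union>V\<in>F. {\<omega> \<in> space N. (\<lambda>k. \<tau> (from_nat_into edges k) \<omega>) \<in> V})" by auto
  also have "\<dots> \<in> sets N"
  proof (rule sets.countable_UN''[OF F(2)])
    fix V assume "V \<in> F"
    then obtain p where p: "V = U p" using F(1) by auto
    have pm: "(\<lambda>\<omega>. path_time b (\<lambda>e. \<tau> e \<omega>) q) \<in> borel_measurable N" for q
      unfolding path_time_def
    proof (rule borel_measurable_sum)
      fix i
      show "(\<lambda>\<omega>. step_time b (\<lambda>e. \<tau> e \<omega>) (q ! i) (q ! Suc i)) \<in> borel_measurable N"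
        by (cases rule: step_time_cases[of "q ! i" "q ! Suc i"]) (auto intro!: borel_measurable_times m)
    qed
    show "{\<omega> \<in> space N. (\<lambda>k. \<tau> (from_nat_into edges k) \<omega>) \<in> V} \<in> sets N"
      unfolding p in_U using pm by measurable
  qed
  finally show "{\<omega> \<in> space N. passage_time b (\<lambda>e. \<tau> e \<omega>) X x y < c} \<in> sets N" .
qed

text \<open>\<open>B\<close> dominates \<open>b\<close> and all weights in the box. Weights are at
  most \<open>b\<close> only almost surely, whereas the description of \<open>LD\<close> needs a
  Lipschitz bound for every realisation.\<close>

lemma passage_box_lipschitz:
  fixes x y x' y' :: "real ^ 'n"
  assumes lu: "l \<in> Zd" "u \<in> Zd" and nn: "\<And>e. e \<in> edges \<Longrightarrow> 0 \<le> t e" and b: "0 \<le> b" "b \<le> B"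
    and tB: "\<And>e. e \<in> edges \<Longrightarrow> e \<subseteq> cbox l u \<Longrightarrow> t e \<le> B"
    and X: "x \<in> cbox l u" "y \<in> cbox l u" "x' \<in> cbox l u" "y' \<in> cbox l u"
  shows "\<bar>passage_time b t (cbox l u) x y - passage_time b t (cbox l u) x' y'\<bar>
           \<le> B * (l1norm (x - x') + l1norm (y - y'))"
proof -
  let ?T = "passage_time b t (cbox l u)"
  have st: "?T z z' \<le> B * l1norm (z - z')" if z: "z \<in> cbox l u" "z' \<in> cbox l u" for z z'
  proof (cases "z = z'")
    case True then show ?thesis using passage_refl[of t b z "cbox l u"] nn b z by simp
  next
    case False
    have "?T z z' \<le> step_time b t z z'" using passage_le_step[of t b] nn b z by blast
    also have "\<dots> \<le> B * l1norm (z - z')"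
      by (cases rule: step_time_cases[of z z'])
        (use b tB edge_in_box[OF lu _ False _ _ z] in \<open>auto intro!: mult_right_mono\<close>)
    finally show ?thesis .
  qed
  have tri: "?T p r \<le> ?T p q + ?T q r" if "p \<in> cbox l u" "q \<in> cbox l u" "r \<in> cbox l u" for p q r
    using passage_triangle[of t b] nn b that by blast
  have "?T x y \<le> ?T x x' + (?T x' y' + ?T y' y)"
    using tri[of x x' y] tri[of x' y' y] X by linarith
  moreover have "?T x' y' \<le> ?T x' x + (?T x y + ?T y y')"
    using tri[of x' x y'] tri[of x y y'] X by linarith
  ultimately show ?thesis
    using st[of x x'] st[of x' x] st[of y y'] st[of y' y] X
    by (simp add: l1norm_minus_commute[of x' x] l1norm_minus_commute[of y' y] algebra_simps abs_le_iff)
qed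

section \<open>The event \<open>LD\<close>\<close>

lemma unit_cube_cbox: "(unit_cube :: (real ^ 'n) set) = cbox 0 (\<chi> i. 1)"
  by (auto simp: unit_cube_def mem_box_cart)

lemma zero_in_unit_cube [simp]: "0 \<in> unit_cube"
  by (simp add: unit_cube_def)

lemma LD_gap_lipschitz:
  fixes g :: "real ^ 'n \<Rightarrow> real"
  assumes g: "g \<in> norms a b" and nn: "\<And>e. e \<in> edges \<Longrightarrow> 0 \<le> t e" and b: "0 \<le> b" and n: "n > 0"
  obtains L where "L \<ge> 0" "\<And>x y x' y'. x \<in> unit_cube \<Longrightarrow> y \<in> unit_cube \<Longrightarrow> x' \<in> unit_cube \<Longrightarrow> y' \<in> unit_cube \<Longrightarrow>
     \<bar>\<bar>g (x - y) - rescaled_time b t n unit_cube x y\<bar>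
       - \<bar>g (x' - y') - rescaled_time b t n unit_cube x' y'\<bar>\<bar> \<le> L * (l1norm (x - x') + l1norm (y - y'))"
proof -
  let ?E = "{e :: (real ^ 'n) set \<in> edges. e \<subseteq> ncube n}"
  have fE: "finite ?E" unfolding ncube_def by (rule finite_box_edges)
  \<comment> \<open>The sum over the finitely many edges of the cube is a crude bound for each
    single weight, depending on the realisation.\<close>
  define B where "B = b + (\<Sum>e\<in>?E. t e)"
  have B: "b \<le> B" unfolding B_def using nn by (auto intro!: sum_nonneg)
  have tB: "t e \<le> B" if "e \<in> edges" "e \<subseteq> ncube n" for e
  proof -
    have "t e \<le> (\<Sum>e\<in>?E. t e)" using that fE nn by (intro member_le_sum) auto
    then show ?thesis using b by (simp add: B_def)
  qed
  show ?thesis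
  proof (rule that[of "b + B"])
    fix x y x' y' :: "real ^ 'n"
    assume X: "x \<in> unit_cube" "y \<in> unit_cube" "x' \<in> unit_cube" "y' \<in> unit_cube"
    let ?R = "rescaled_time b t n unit_cube"
    let ?s = "l1norm (x - x') + l1norm (y - y')"
    have "\<bar>g (x - y) - g (x' - y')\<bar> \<le> g ((x - y) - (x' - y'))" by (rule norms_diff(2)[OF g])
    also have "\<dots> \<le> b * l1norm ((x - y) - (x' - y'))" by (rule normsD[OF g])
    also have "\<dots> \<le> b * ?s"
      using l1norm_triangle[of "x - x'" "y' - y"] b
      by (intro mult_left_mono) (auto simp: algebra_simps l1norm_minus_commute[of y' y])
    finally have 1: "\<bar>g (x - y) - g (x' - y')\<bar> \<le> b * ?s" .
    have "\<bar>passage_time b t (ncube n) (real n *\<^sub>R x) (real n *\<^sub>R y)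
        - passage_time b t (ncube n) (real n *\<^sub>R x') (real n *\<^sub>R y')\<bar>
        \<le> B * (l1norm (real n *\<^sub>R x - real n *\<^sub>R x') + l1norm (real n *\<^sub>R y - real n *\<^sub>R y'))"
      unfolding ncube_def
      by (rule passage_box_lipschitz)
        (use nn b B tB X scale_in_ncube in \<open>auto simp: ncube_def[symmetric]\<close>)
    also have "\<dots> = real n * (B * ?s)"
      unfolding scaleR_diff_right[symmetric] l1norm_scale by (simp add: algebra_simps)
    finally have *: "\<bar>passage_time b t (ncube n) (real n *\<^sub>R x) (real n *\<^sub>R y)
        - passage_time b t (ncube n) (real n *\<^sub>R x') (real n *\<^sub>R y')\<bar> \<le> real n * (B * ?s)" .
    have 2: "\<bar>?R x y - ?R x' y'\<bar> \<le> B * ?s"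
    proof -
      have "?R x y - ?R x' y' = (passage_time b t (ncube n) (real n *\<^sub>R x) (real n *\<^sub>R y)
        - passage_time b t (ncube n) (real n *\<^sub>R x') (real n *\<^sub>R y')) / real n"
        unfolding rescaled_time_ncube[OF n] by (rule diff_divide_distrib[symmetric])
      then have "\<bar>?R x y - ?R x' y'\<bar> \<le> (real n * (B * ?s)) / real n"
        using * by (simp only: abs_divide abs_of_nat) (rule divide_right_mono, auto)
      then show ?thesis using n by simp
    qed
    show "\<bar>\<bar>g (x - y) - ?R x y\<bar> - \<bar>g (x' - y') - ?R x' y'\<bar>\<bar> \<le> (b + B) * ?s"
      using 1 2 unfolding distrib_right by linarith
  qed (use b B in auto)
qed

lemma l1norm_unit_cube:
  assumes "x \<in> unit_cube" "y \<in> unit_cube" shows "l1norm (x - y :: real ^ 'n) \<le> CARD('n)"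
proof -
  have "\<bar>(x - y) $ i\<bar> \<le> 1" for i
  proof -
    have "0 \<le> x $ i" "x $ i \<le> 1" "0 \<le> y $ i" "y $ i \<le> 1" using assms by (auto simp: unit_cube_def)
    then show ?thesis by simp
  qed
  then show ?thesis using l1norm_bound[of "x - y" 1] by simp
qed

text \<open>A real supremum can be bounded pointwise only if the set is bounded above; the Lipschitz
  estimate, compared with the pair (0, 0), provides this.\<close>

lemma LD_iff:
  fixes g :: "real ^ 'n \<Rightarrow> real"
  assumes g: "g \<in> norms a b" and nn: "\<And>e. e \<in> edges \<Longrightarrow> 0 \<le> \<tau> e \<omega>" and b: "0 \<le> b" and n: "n > 0"
    and w: "\<omega> \<in> space M"
  shows "\<omega> \<in> LD M \<tau> b n g \<epsilon> \<longleftrightarrow> (\<forall>x\<in>unit_cube. \<forall>y\<in>unit_cube.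
      \<bar>g (x - y) - rescaled_time b (\<lambda>e. \<tau> e \<omega>) n unit_cube x y\<bar> \<le> \<epsilon>)"
proof -
  let ?h = "\<lambda>(x, y). \<bar>g (x - y) - rescaled_time b (\<lambda>e. \<tau> e \<omega>) n unit_cube x y\<bar>"
  obtain L where L: "L \<ge> 0" "\<And>x y x' y'. x \<in> unit_cube \<Longrightarrow> y \<in> unit_cube \<Longrightarrow> x' \<in> unit_cube \<Longrightarrow> y' \<in> unit_cube \<Longrightarrow>
     \<bar>\<bar>g (x - y) - rescaled_time b (\<lambda>e. \<tau> e \<omega>) n unit_cube x y\<bar>
       - \<bar>g (x' - y') - rescaled_time b (\<lambda>e. \<tau> e \<omega>) n unit_cube x' y'\<bar>\<bar> \<le> L * (l1norm (x - x') + l1norm (y - y'))"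
    using LD_gap_lipschitz[of g a b "\<lambda>e. \<tau> e \<omega>" n, OF g nn b n] by blast
  have "bdd_above (?h ` (unit_cube \<times> unit_cube))"
  proof (rule bdd_aboveI2)
    fix q :: "(real ^ 'n) \<times> (real ^ 'n)" assume "q \<in> unit_cube \<times> unit_cube"
    then obtain x y where q: "q = (x, y)" and x: "x \<in> unit_cube" and y: "y \<in> unit_cube" by auto
    have "?h (x, y) \<le> ?h (0, 0) + L * (l1norm (x - 0) + l1norm (y - 0))"
      using L(2)[OF x y zero_in_unit_cube zero_in_unit_cube] by auto
    also have "\<dots> \<le> ?h (0, 0) + L * (CARD('n) + CARD('n))"
    proof -
      have "l1norm (x - 0) + l1norm (y - 0) \<le> real (CARD('n) + CARD('n))"
        using l1norm_unit_cube[OF x zero_in_unit_cube] l1norm_unit_cube[OF y zero_in_unit_cube] by linarith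
      from mult_left_mono[OF this L(1)] show ?thesis by simp
    qed
    finally show "?h q \<le> ?h (0, 0) + L * (CARD('n) + CARD('n))" unfolding q .
  qed
  then have "(SUP q\<in>unit_cube \<times> unit_cube. ?h q) \<le> \<epsilon> \<longleftrightarrow> (\<forall>q\<in>unit_cube \<times> unit_cube. ?h q \<le> \<epsilon>)"
  proof (rule cSUP_le_iff[rotated])
    have "(0, 0) \<in> unit_cube \<times> (unit_cube :: (real ^ 'n) set)" by simp
    then show "unit_cube \<times> (unit_cube :: (real ^ 'n) set) \<noteq> {}" by blast
  qed
  then show ?thesis using w by (auto simp: LD_def)
qed

lemma LD_measurable:
  fixes g :: "real ^ 'n \<Rightarrow> real"
  assumes g: "g \<in> norms a b" and m: "\<And>e. e \<in> edges \<Longrightarrow> \<tau> e \<in> borel_measurable M"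
    and nn: "\<And>e \<omega>. e \<in> edges \<Longrightarrow> \<omega> \<in> space M \<Longrightarrow> 0 \<le> \<tau> e \<omega>" and b: "0 \<le> b" and n: "n > 0"
  shows "LD M \<tau> b n g \<epsilon> \<in> sets M"
proof -
  \<comment> \<open>Density is arranged inside the open set \<open>S\<close>, whose closure is the
    product of the closed cubes; continuity extends the inequality from a countable dense part of
    \<open>S\<close> to the whole product.\<close>
  define S where "S = box (0 :: real ^ 'n) (\<chi> i. 1) \<times> box (0 :: real ^ 'n) (\<chi> i. 1)"
  have opS: "open S" unfolding S_def by (intro open_Times open_box)
  have "box (0 :: real ^ 'n) (\<chi> i. 1) \<noteq> {}" by (auto simp: interval_ne_empty_cart)
  then have clS: "closure S = unit_cube \<times> unit_cube"
    by (simp add: S_def closure_Times closure_box unit_cube_cbox)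
  obtain D :: "((real ^ 'n) \<times> (real ^ 'n)) set" where D: "countable D" "\<And>U. open U \<Longrightarrow> U \<noteq> {} \<Longrightarrow> \<exists>d\<in>D. d \<in> U"
    by (erule countable_dense_setE)
  have dense: "S \<subseteq> closure (D \<inter> S)"
  proof
    fix p assume "p \<in> S"
    show "p \<in> closure (D \<inter> S)"
      unfolding closure_iff_nhds_not_empty
    proof (intro allI impI)
      fix A V assume "V \<subseteq> A" "open V" "p \<in> V"
      then have "open (V \<inter> S)" "V \<inter> S \<noteq> {}" using opS \<open>p \<in> S\<close> by auto
      then obtain d where "d \<in> D" "d \<in> V \<inter> S" using D(2) by blast
      then show "D \<inter> S \<inter> A \<noteq> {}" using \<open>V \<subseteq> A\<close> by auto
    qed
  qed
  have clD: "closure (D \<inter> S) = unit_cube \<times> unit_cube"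
    using closure_mono[OF dense] closure_mono[of "D \<inter> S" S] clS by auto
  let ?h = "\<lambda>\<omega> (x, y). \<bar>g (x - y) - rescaled_time b (\<lambda>e. \<tau> e \<omega>) n unit_cube x y\<bar>"
  have DS: "D \<inter> S \<subseteq> unit_cube \<times> unit_cube" unfolding clD[symmetric] by (rule closure_subset)
  have "LD M \<tau> b n g \<epsilon> = {\<omega> \<in> space M. \<forall>q\<in>D \<inter> S. ?h \<omega> q \<le> \<epsilon>}"
  proof (rule set_eqI)
    fix \<omega>
    show "\<omega> \<in> LD M \<tau> b n g \<epsilon> \<longleftrightarrow> \<omega> \<in> {\<omega> \<in> space M. \<forall>q\<in>D \<inter> S. ?h \<omega> q \<le> \<epsilon>}"
    proof (cases "\<omega> \<in> space M")
      case True
      obtain L where L: "L \<ge> 0" "\<And>x y x' y'. x \<in> unit_cube \<Longrightarrow> y \<in> unit_cube \<Longrightarrow> x' \<in> unit_cube \<Longrightarrow> y' \<in> unit_cube \<Longrightarrow>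
         \<bar>\<bar>g (x - y) - rescaled_time b (\<lambda>e. \<tau> e \<omega>) n unit_cube x y\<bar>
       - \<bar>g (x' - y') - rescaled_time b (\<lambda>e. \<tau> e \<omega>) n unit_cube x' y'\<bar>\<bar> \<le> L * (l1norm (x - x') + l1norm (y - y'))"
        using LD_gap_lipschitz[of g a b "\<lambda>e. \<tau> e \<omega>" n, OF g nn[OF _ True] b n] by blast
      have "continuous_on (unit_cube \<times> unit_cube) (?h \<omega>)"
      proof (rule lipschitz_on_continuous_on[of "L * (CARD('n) + CARD('n))"], rule lipschitz_onI)
        fix p q assume pq: "p \<in> (unit_cube :: (real ^ 'n) set) \<times> (unit_cube :: (real ^ 'n) set)" "q \<in> (unit_cube :: (real ^ 'n) set) \<times> (unit_cube :: (real ^ 'n) set)"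
        obtain x y x' y' where xy: "p = (x, y)" "q = (x', y')" by (metis surj_pair)
        have "dist (?h \<omega> p) (?h \<omega> q) \<le> L * (l1norm (x - x') + l1norm (y - y'))"
          using L(2)[of x y x' y'] pq xy by (auto simp: dist_real_def)
        also have "\<dots> \<le> L * (CARD('n) * dist p q + CARD('n) * dist p q)"
        proof (intro mult_left_mono add_mono L(1))
          have "l1norm (x - x') \<le> CARD('n) * dist x x'" using l1norm_le_norm[of "x - x'"] by (simp add: dist_norm)
          also have "\<dots> \<le> CARD('n) * dist p q" using dist_fst_le[of p q] xy by (intro mult_left_mono) auto
          finally show "l1norm (x - x') \<le> CARD('n) * dist p q" .
          have "l1norm (y - y') \<le> CARD('n) * dist y y'" using l1norm_le_norm[of "y - y'"] by (simp add: dist_norm)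
          also have "\<dots> \<le> CARD('n) * dist p q" using dist_snd_le[of p q] xy by (intro mult_left_mono) auto
          finally show "l1norm (y - y') \<le> CARD('n) * dist p q" .
        qed
        finally show "dist (?h \<omega> p) (?h \<omega> q) \<le> L * (CARD('n) + CARD('n)) * dist p q"
          by (simp add: algebra_simps)
      qed (use L in auto)
      then have cont: "continuous_on (closure (D \<inter> S)) (?h \<omega>)" unfolding clD .
      have "(\<forall>q\<in>unit_cube \<times> unit_cube. ?h \<omega> q \<le> \<epsilon>) \<longleftrightarrow> (\<forall>q\<in>D \<inter> S. ?h \<omega> q \<le> \<epsilon>)"
      proof
        assume *: "\<forall>q\<in>D \<inter> S. ?h \<omega> q \<le> \<epsilon>"
        show "\<forall>q\<in>unit_cube \<times> unit_cube. ?h \<omega> q \<le> \<epsilon>"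
          using continuous_le_on_closure[OF cont] * unfolding clD by blast
      qed (use DS in blast)
      then show ?thesis using LD_iff[OF g, of \<tau> \<omega> n M \<epsilon>] nn True b n by auto
    qed (auto simp: LD_def)
  qed
  also have "\<dots> \<in> sets M"
  proof (rule sets.sets_Collect_countable_All')
    show "countable (D \<inter> S)" using D by auto
    fix q assume "q \<in> D \<inter> S"
    then obtain x y where q: "q = (x, y)" "x \<in> unit_cube" "y \<in> unit_cube" using DS by auto
    have "(\<lambda>\<omega>. passage_time b (\<lambda>e. \<tau> e \<omega>) (ncube n) (real n *\<^sub>R x) (real n *\<^sub>R y)) \<in> borel_measurable M"
      by (rule passage_measurable) (use m nn b q scale_in_ncube in auto)
    then show "{\<omega> \<in> space M. ?h \<omega> q \<le> \<epsilon>} \<in> sets M"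
      unfolding q(1) prod.case rescaled_time_ncube[OF n] by measurable
  qed
  finally show ?thesis .
qed

section \<open>The probabilistic setting\<close>

text \<open>Independence survives an injective relabelling; with translations of edges as labels
  this makes shifted environments comparable.\<close>

lemma (in prob_space) indep_vars_reindex_inj:
  assumes ind: "indep_vars (\<lambda>_. N) X I" and inj: "inj_on \<sigma> J" and sub: "\<sigma> ` J \<subseteq> I"
  shows "indep_vars (\<lambda>_. N) (\<lambda>j. X (\<sigma> j)) J"
  unfolding indep_vars_def2 indep_sets_def
proof (intro conjI allI impI ballI)
  let ?F = "\<lambda>i. {X i -` A \<inter> space M |A. A \<in> sets N}"
  have ev: "\<And>i. i \<in> I \<Longrightarrow> ?F i \<subseteq> events"
    and pr: "\<And>K A. K \<subseteq> I \<Longrightarrow> K \<noteq> {} \<Longrightarrow> finite K \<Longrightarrow> A \<in> Pi K ?F \<Longrightarrow>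
        prob (\<Inter>j\<in>K. A j) = (\<Prod>j\<in>K. prob (A j))"
    and rv: "\<And>i. i \<in> I \<Longrightarrow> random_variable N (X i)"
    using ind unfolding indep_vars_def2 indep_sets_def by auto
  show "random_variable N (X (\<sigma> j))" if "j \<in> J" for j using rv that sub by auto
  show "?F (\<sigma> j) \<subseteq> events" if "j \<in> J" for j using ev that sub by blast
  fix K A assume K: "K \<subseteq> J" "K \<noteq> {}" "finite K" "A \<in> Pi K (\<lambda>j. ?F (\<sigma> j))"
  have injK: "inj_on \<sigma> K" using inj K(1) by (rule inj_on_subset)
  define A' where "A' e = A (inv_into K \<sigma> e)" for e
  have A': "A' (\<sigma> j) = A j" if "j \<in> K" for j using injK that by (simp add: A'_def)
  have mem: "A' e \<in> ?F e" if e: "e \<in> \<sigma> ` K" for e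
  proof -
    obtain j where j: "j \<in> K" "e = \<sigma> j" using e by auto
    have "A j \<in> ?F (\<sigma> j)" using K(4) j(1) by (rule Pi_mem)
    then show ?thesis unfolding j(2) A'[OF j(1)] .
  qed
  have "prob (\<Inter>e\<in>\<sigma> ` K. A' e) = (\<Prod>e\<in>\<sigma> ` K. prob (A' e))"
  proof (rule pr)
    show "\<sigma> ` K \<subseteq> I" using K(1) sub by blast
    show "A' \<in> Pi (\<sigma> ` K) ?F" by (rule Pi_I) (rule mem)
  qed (use K in auto)
  then show "prob (\<Inter>j\<in>K. A j) = (\<Prod>j\<in>K. prob (A j))"
    by (simp add: prod.reindex[OF injK] A' cong: INF_cong)
qed

text \<open>The values increase as the argument decreases to 0, so the one-sided limit exists in the
  extended reals and is the supremum.\<close>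

lemma Lim_at_right_antimono:
  fixes f :: "real \<Rightarrow> ereal"
  assumes "\<And>x y. 0 < x \<Longrightarrow> x \<le> y \<Longrightarrow> f y \<le> f x"
  shows "Lim (at_right 0) f = (SUP \<epsilon>\<in>{0<..}. f \<epsilon>)"
proof (rule tendsto_Lim)
  show "(f \<longlongrightarrow> (SUP \<epsilon>\<in>{0<..}. f \<epsilon>)) (at_right 0)"
  proof (rule order_tendstoI)
    fix y assume "y < (SUP \<epsilon>\<in>{0<..}. f \<epsilon>)"
    then obtain e where e: "0 < e" "y < f e" by (auto simp: less_SUP_iff)
    have "\<forall>\<^sub>F x in at_right 0. x \<in> {0<..<e}" using e(1) by (rule eventually_at_right_real)
    then show "\<forall>\<^sub>F x in at_right 0. y < f x"
    proof (rule eventually_mono)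
      fix x assume "x \<in> {0<..<e}"
      then show "y < f x" using assms[of x e] e by auto
    qed
  next
    fix y assume y: "(SUP \<epsilon>\<in>{0<..}. f \<epsilon>) < y"
    have "\<forall>\<^sub>F x in at_right 0. x \<in> {0<..<1::real}" by (rule eventually_at_right_real) simp
    then show "\<forall>\<^sub>F x in at_right 0. f x < y"
    proof (rule eventually_mono)
      fix x :: real assume "x \<in> {0<..<1}"
      then have "f x \<le> (SUP \<epsilon>\<in>{0<..}. f \<epsilon>)" by (intro SUP_upper) auto
      then show "f x < y" using y by simp
    qed
  qed
qed simp

definition corner :: "nat \<Rightarrow> real ^ 'n" where
  "corner r = (\<chi> i. real r)"

lemma corner_nth [simp]: "corner r $ i = real r"
  by (simp add: corner_def)

lemma corner_Zd [simp]: "corner r \<in> Zd"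
  by (simp add: corner_def)

locale fpp = prob_space M for M :: "'w measure" +
  fixes \<nu> :: "real measure" and \<tau> :: "(real ^ 'n) set \<Rightarrow> 'w \<Rightarrow> real" and a b :: real
  assumes nu_prob: "prob_space \<nu>"
    and nu_sets: "sets \<nu> = sets (restrict_space borel {0..})"
    and a_def: "ereal a = (INF x\<in>top_support \<nu>. ereal x)"
    and b_def: "ereal b = (SUP x\<in>top_support \<nu>. ereal x)"
    and ab: "0 < a" "a < b"
    and indep: "indep_vars (\<lambda>_. \<nu>) \<tau> edges"
    and ident: "\<And>e. e \<in> edges \<Longrightarrow> distr M \<nu> (\<tau> e) = \<nu>"
begin

lemma b_pos: "0 < b" using ab by simp

lemma space_nu: "space \<nu> = {0..}"
  using sets_eq_imp_space_eq[OF nu_sets] by (simp add: space_restrict_space)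

text \<open>The sigma-algebra of \<nu> is the trace of the Borel sets on the half-line, hence the
  recurring intersections with \<open>{0..}\<close>.\<close>

lemma nu_sets_Int: "A \<in> sets borel \<Longrightarrow> A \<inter> {0..} \<in> sets \<nu>"
  unfolding nu_sets by (auto simp: sets_restrict_space)

lemma tau_meas: "e \<in> edges \<Longrightarrow> \<tau> e \<in> measurable M \<nu>"
  using indep unfolding indep_vars_def2 by auto

lemma nu_to_borel: "f \<in> measurable N \<nu> \<Longrightarrow> f \<in> borel_measurable N"
proof -
  assume "f \<in> measurable N \<nu>"
  then have "f \<in> measurable N (restrict_space borel {0..})"
    by (simp cong: measurable_cong_sets add: measurable_cong_sets[OF refl nu_sets])
  then show ?thesis by (simp add: measurable_restrict_space2_iff)
qed

lemma tau_borel: "e \<in> edges \<Longrightarrow> \<tau> e \<in> borel_measurable M"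
  by (intro nu_to_borel tau_meas)

lemma tau_nonneg: "e \<in> edges \<Longrightarrow> \<omega> \<in> space M \<Longrightarrow> 0 \<le> \<tau> e \<omega>"
  using measurable_space[OF tau_meas, of e \<omega>] by (simp add: space_nu)

lemma prob_tau:
  assumes "e \<in> edges" "A \<in> sets borel"
  shows "prob {\<omega> \<in> space M. \<tau> e \<omega> \<in> A} = measure \<nu> (A \<inter> {0..})"
proof -
  have "measure \<nu> (A \<inter> {0..}) = measure (distr M \<nu> (\<tau> e)) (A \<inter> {0..})" using ident assms by simp
  also have "\<dots> = prob (\<tau> e -` (A \<inter> {0..}) \<inter> space M)"
    by (rule measure_distr) (use assms tau_meas nu_sets_Int in auto)
  also have "\<tau> e -` (A \<inter> {0..}) \<inter> space M = {\<omega> \<in> space M. \<tau> e \<omega> \<in> A}"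
    using tau_nonneg[OF assms(1)] by auto
  finally show ?thesis ..
qed

lemma support_bounds: "x \<in> top_support \<nu> \<Longrightarrow> a \<le> x \<and> x \<le> b"
  using INF_lower[of x "top_support \<nu>" ereal] SUP_upper[of x "top_support \<nu>" ereal]
  unfolding a_def[symmetric] b_def[symmetric] by simp

lemma support_nbhd:
  assumes "x \<in> top_support \<nu>" "open U" "x \<in> U"
  shows "0 < measure \<nu> (U \<inter> {0..})"
proof -
  interpret N: prob_space \<nu> by (rule nu_prob)
  have "emeasure \<nu> (U \<inter> space \<nu>) > 0" using assms by (auto simp: top_support_def)
  then show ?thesis by (simp add: space_nu N.emeasure_eq_measure)
qed

text \<open>Support points approach their infimum and therefore enter every neighbourhood of
  \<open>a\<close>; likewise for \<open>b\<close>. So weights near \<open>a\<close> and weights near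
  \<open>b\<close> have positive probability, which is what the modifications use.\<close>

lemma a_in_support: "a \<in> top_support \<nu>"
  unfolding top_support_def mem_Collect_eq
proof (intro allI impI)
  fix U :: "real set" assume U: "open U \<and> a \<in> U"
  then obtain e where e: "e > 0" "ball a e \<subseteq> U" by (meson openE)
  have "(INF x\<in>top_support \<nu>. ereal x) < ereal (a + e)" unfolding a_def[symmetric] using e by simp
  then obtain x where x: "x \<in> top_support \<nu>" "x < a + e" by (auto simp: INF_less_iff)
  then have "x \<in> U" using support_bounds[of x] e by (auto simp: dist_real_def subset_iff)
  then show "0 < emeasure \<nu> (U \<inter> space \<nu>)" using x U by (auto simp: top_support_def)
qed

lemma b_in_support: "b \<in> top_support \<nu>"
  unfolding top_support_def mem_Collect_eq
proof (intro allI impI)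
  fix U :: "real set" assume U: "open U \<and> b \<in> U"
  then obtain e where e: "e > 0" "ball b e \<subseteq> U" by (meson openE)
  have "ereal (b - e) < (SUP x\<in>top_support \<nu>. ereal x)" unfolding b_def[symmetric] using e by simp
  then obtain x where x: "x \<in> top_support \<nu>" "b - e < x" by (auto simp: less_SUP_iff)
  then have "x \<in> U" using support_bounds[of x] e by (auto simp: dist_real_def subset_iff)
  then show "0 < emeasure \<nu> (U \<inter> space \<nu>)" using x U by (auto simp: top_support_def)
qed

text \<open>Each point off the support has a null open neighbourhood, and by the Lindelof property
  countably many of these cover \<open>S\<close>.\<close>

lemma null_outside_support:
  assumes "S \<inter> top_support \<nu> = {}" "S \<in> sets borel"
  shows "measure \<nu> (S \<inter> {0..}) = 0"
proof -
  interpret N: prob_space \<nu> by (rule nu_prob)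
  let ?F = "{U :: real set. open U \<and> emeasure \<nu> (U \<inter> space \<nu>) = 0}"
  obtain F where F: "F \<subseteq> ?F" "countable F" "\<Union>F = \<Union>?F"
    using Lindelof[of ?F] by auto
  have "S \<subseteq> \<Union>?F"
  proof
    fix x assume "x \<in> S"
    then have "x \<notin> top_support \<nu>" using assms by auto
    then obtain U where "open U" "x \<in> U" "emeasure \<nu> (U \<inter> space \<nu>) = 0"
      by (auto simp: top_support_def zero_less_iff_neq_zero)
    then show "x \<in> \<Union>?F" by blast
  qed
  then have sub: "S \<inter> {0..} \<subseteq> (\<Union>U\<in>F. U \<inter> {0..})" unfolding F(3)[symmetric] by auto
  have "(\<Union>U\<in>F. U \<inter> {0..}) \<in> null_sets \<nu>"
  proof (rule null_sets_UN'[OF F(2)])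
    fix U assume "U \<in> F"
    then have "open U" "emeasure \<nu> (U \<inter> {0..}) = 0" using F(1) by (auto simp: space_nu)
    then show "U \<inter> {0..} \<in> null_sets \<nu>" by (intro null_setsI nu_sets_Int) auto
  qed
  then have "S \<inter> {0..} \<in> null_sets \<nu>"
    by (rule null_sets_subset[OF _ _ sub]) (rule nu_sets_Int[OF assms(2)])
  then show ?thesis by (simp add: measure_eq_0_null_sets)
qed

lemma AE_bounds: "AE \<omega> in M. \<forall>e\<in>edges. a \<le> \<tau> e \<omega> \<and> \<tau> e \<omega> \<le> b"
proof (rule AE_ball_countable'[OF _ countable_edges])
  fix e :: "(real ^ 'n) set" assume e: "e \<in> edges"
  have "measure \<nu> (- {a..b} \<inter> {0..}) = 0"
    by (rule null_outside_support) (use support_bounds in auto)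
  then have "prob {\<omega> \<in> space M. \<tau> e \<omega> \<in> - {a..b}} = 0" by (subst prob_tau[OF e]) auto
  moreover have "{\<omega> \<in> space M. \<tau> e \<omega> \<in> - {a..b}} \<in> events" using tau_borel[OF e] by measurable
  ultimately have "AE \<omega> in M. \<omega> \<notin> {\<omega> \<in> space M. \<tau> e \<omega> \<in> - {a..b}}"
    by (simp add: prob_eq_0)
  then show "AE \<omega> in M. a \<le> \<tau> e \<omega> \<and> \<tau> e \<omega> \<le> b" using AE_space by eventually_elim auto
qed

text \<open>The joint law of the weights, read through any injection \<sigma> of \<open>E\<close>
  into the edges, is the same product measure; for a translation \<sigma> this is
  stationarity.\<close>

lemma distr_edges:
  assumes "inj_on \<sigma> E" "\<sigma> ` E \<subseteq> edges"
  shows "distr M (PiM E (\<lambda>_. \<nu>)) (\<lambda>\<omega>. \<lambda>e\<in>E. \<tau> (\<sigma> e) \<omega>) = PiM E (\<lambda>_. \<nu>)"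
proof (cases "E = {}")
  case True
  interpret N: prob_space \<nu> by (rule nu_prob)
  interpret P: product_prob_space "\<lambda>_. \<nu>" E by unfold_locales
  show ?thesis
  proof (rule measure_eqI)
    fix A assume A: "A \<in> sets (distr M (PiM E (\<lambda>_. \<nu>)) (\<lambda>\<omega>. \<lambda>e\<in>E. \<tau> (\<sigma> e) \<omega>))"
    then have "A \<in> sets (PiM E (\<lambda>_. \<nu>))" by simp
    \<comment> \<open>The product over the empty index set is a one-point space, so it is enough to
      compare total masses.\<close>
    have A2: "A = {} \<or> A = {\<lambda>x. undefined}"
      using sets.sets_into_space[OF \<open>A \<in> sets (PiM E (\<lambda>_. \<nu>))\<close>] True by (auto simp: space_PiM)
    have m: "(\<lambda>\<omega>. \<lambda>e\<in>E. \<tau> (\<sigma> e) \<omega>) \<in> measurable M (PiM E (\<lambda>_. \<nu>))"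
      using True by (auto intro!: measurable_restrict)
    show "emeasure (distr M (PiM E (\<lambda>_. \<nu>)) (\<lambda>\<omega>. \<lambda>e\<in>E. \<tau> (\<sigma> e) \<omega>)) A = emeasure (PiM E (\<lambda>_. \<nu>)) A"
    proof (cases "A = {}")
      case False
      then have "A = space (PiM E (\<lambda>_. \<nu>))" using A2 True by (auto simp: space_PiM)
      moreover have "emeasure (PiM E (\<lambda>_. \<nu>)) (space (PiM E (\<lambda>_. \<nu>))) = 1" by (rule P.emeasure_space_1)
      moreover have "emeasure (distr M (PiM E (\<lambda>_. \<nu>)) (\<lambda>\<omega>. \<lambda>e\<in>E. \<tau> (\<sigma> e) \<omega>)) (space (PiM E (\<lambda>_. \<nu>))) = 1"
        using prob_space.emeasure_space_1[OF prob_space_distr[OF m]] by simp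
      ultimately show ?thesis by simp
    qed simp
  qed simp
next
  case False
  have iv: "indep_vars (\<lambda>_. \<nu>) (\<lambda>e. \<tau> (\<sigma> e)) E"
    by (rule indep_vars_reindex_inj[OF indep assms])
  have "distr M (PiM E (\<lambda>_. \<nu>)) (\<lambda>\<omega>. \<lambda>e\<in>E. \<tau> (\<sigma> e) \<omega>) = PiM E (\<lambda>e. distr M \<nu> (\<tau> (\<sigma> e)))"
    using indep_vars_iff_distr_eq_PiM'[OF False, where M' = "\<lambda>_. \<nu>" and X = "\<lambda>e. \<tau> (\<sigma> e)"] iv tau_meas assms(2) by blast
  also have "\<dots> = PiM E (\<lambda>_. \<nu>)" by (rule PiM_cong) (use assms(2) ident in auto)
  finally show ?thesis .
qed

lemma restrict_measurable:
  "\<sigma> ` E \<subseteq> edges \<Longrightarrow> (\<lambda>\<omega>. \<lambda>e\<in>E. \<tau> (\<sigma> e) \<omega>) \<in> measurable M (PiM E (\<lambda>_. \<nu>))"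
  using tau_meas by (intro measurable_restrict) auto

lemma prob_blocks:
  assumes V: "finite V" "V \<noteq> {}" and K: "\<And>v. v \<in> V \<Longrightarrow> K v \<subseteq> edges" "disjoint_family_on K V"
    and B: "\<And>v. v \<in> V \<Longrightarrow> B v \<in> sets (PiM (K v) (\<lambda>_. \<nu>))"
  shows "prob {\<omega> \<in> space M. \<forall>v\<in>V. (\<lambda>e\<in>K v. \<tau> e \<omega>) \<in> B v}
       = (\<Prod>v\<in>V. prob {\<omega> \<in> space M. (\<lambda>e\<in>K v. \<tau> e \<omega>) \<in> B v})"
proof -
  have "indep_vars (\<lambda>j. PiM (K j) (\<lambda>_. \<nu>)) (\<lambda>j \<omega>. restrict (\<lambda>e. \<tau> e \<omega>) (K j)) V"
    by (rule indep_vars_restrict[OF indep K])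
  from indep_varsD_finite[OF this V(2,1) B]
  have "prob (\<Inter>v\<in>V. (\<lambda>\<omega>. \<lambda>e\<in>K v. \<tau> e \<omega>) -` B v \<inter> space M)
      = (\<Prod>v\<in>V. prob ((\<lambda>\<omega>. \<lambda>e\<in>K v. \<tau> e \<omega>) -` B v \<inter> space M))" .
  moreover have "(\<Inter>v\<in>V. (\<lambda>\<omega>. \<lambda>e\<in>K v. \<tau> e \<omega>) -` B v \<inter> space M)
      = {\<omega> \<in> space M. \<forall>v\<in>V. (\<lambda>e\<in>K v. \<tau> e \<omega>) \<in> B v}" using V(2) by auto
  moreover have "(\<lambda>\<omega>. \<lambda>e\<in>K v. \<tau> e \<omega>) -` B v \<inter> space M = {\<omega> \<in> space M. (\<lambda>e\<in>K v. \<tau> e \<omega>) \<in> B v}" for v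
    by auto
  ultimately show ?thesis by simp
qed

text \<open>The set \<open>E\<close> is one block, indexed by \<open>None\<close>, and each edge of
  \<open>H\<close> is a block \<open>Some e\<close> of its own. Disjointness of the blocks
  factorises an arbitrary event on \<open>E\<close> from prescribed ranges on
  \<open>H\<close>.\<close>

lemma prob_block_edges:
  assumes H: "finite H" "H \<subseteq> edges" and E: "E \<subseteq> edges" "E \<inter> H = {}"
    and G: "G \<in> sets (PiM E (\<lambda>_. \<nu>))" and W: "\<And>e. e \<in> H \<Longrightarrow> W e \<in> sets borel"
  shows "prob {\<omega> \<in> space M. (\<lambda>e\<in>E. \<tau> e \<omega>) \<in> G \<and> (\<forall>e\<in>H. \<tau> e \<omega> \<in> W e)}
       = prob {\<omega> \<in> space M. (\<lambda>e\<in>E. \<tau> e \<omega>) \<in> G} * (\<Prod>e\<in>H. measure \<nu> (W e \<inter> {0..}))"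
proof -
  define V where "V = insert None (Some ` H)"
  define K where "K v = (case v of None \<Rightarrow> E | Some e \<Rightarrow> {e})" for v
  define B where "B v = (case v of None \<Rightarrow> G | Some e \<Rightarrow> {f \<in> space (PiM {e} (\<lambda>_. \<nu>)). f e \<in> W e})" for v
  have Bs: "B v \<in> sets (PiM (K v) (\<lambda>_. \<nu>))" if "v \<in> V" for v
  proof (cases v)
    case None then show ?thesis using G by (simp add: B_def K_def)
  next
    case (Some e)
    then have "e \<in> H" using that by (auto simp: V_def)
    have "(\<lambda>f. f e) \<in> borel_measurable (PiM {e} (\<lambda>_. \<nu>))"
      by (rule nu_to_borel) simp
    then have "{f \<in> space (PiM {e} (\<lambda>_. \<nu>)). f e \<in> W e} \<in> sets (PiM {e} (\<lambda>_. \<nu>))"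
      using W[OF \<open>e \<in> H\<close>] by measurable
    then show ?thesis using Some by (simp add: B_def K_def)
  qed
  have mem: "(\<lambda>e'\<in>K (Some e). \<tau> e' \<omega>) \<in> B (Some e) \<longleftrightarrow> \<tau> e \<omega> \<in> W e" if "e \<in> H" "\<omega> \<in> space M" for e \<omega>
    using that H tau_nonneg[of e \<omega>] by (auto simp: K_def B_def space_PiM space_nu PiE_def)
  have "prob {\<omega> \<in> space M. \<forall>v\<in>V. (\<lambda>e\<in>K v. \<tau> e \<omega>) \<in> B v}
       = (\<Prod>v\<in>V. prob {\<omega> \<in> space M. (\<lambda>e\<in>K v. \<tau> e \<omega>) \<in> B v})"
  proof (rule prob_blocks)
    show "disjoint_family_on K V" using E by (auto simp: disjoint_family_on_def V_def K_def)
  qed (use H E Bs in \<open>auto simp: V_def K_def\<close>)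
  also have "{\<omega> \<in> space M. \<forall>v\<in>V. (\<lambda>e\<in>K v. \<tau> e \<omega>) \<in> B v}
      = {\<omega> \<in> space M. (\<lambda>e\<in>E. \<tau> e \<omega>) \<in> G \<and> (\<forall>e\<in>H. \<tau> e \<omega> \<in> W e)}"
    using mem by (auto simp: V_def) (auto simp: K_def B_def)
  also have "(\<Prod>v\<in>V. prob {\<omega> \<in> space M. (\<lambda>e\<in>K v. \<tau> e \<omega>) \<in> B v})
      = prob {\<omega> \<in> space M. (\<lambda>e\<in>E. \<tau> e \<omega>) \<in> G} * (\<Prod>e\<in>H. prob {\<omega> \<in> space M. \<tau> e \<omega> \<in> W e})"
  proof -
    have "(\<Prod>v\<in>Some ` H. prob {\<omega> \<in> space M. (\<lambda>e\<in>K v. \<tau> e \<omega>) \<in> B v})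
        = (\<Prod>e\<in>H. prob {\<omega> \<in> space M. \<tau> e \<omega> \<in> W e})"
      by (subst prod.reindex) (auto intro!: prod.cong arg_cong[where f = prob] simp: mem)
    then show ?thesis using H unfolding V_def
      by (subst prod.insert) (auto simp: K_def B_def)
  qed
  also have "(\<Prod>e\<in>H. prob {\<omega> \<in> space M. \<tau> e \<omega> \<in> W e}) = (\<Prod>e\<in>H. measure \<nu> (W e \<inter> {0..}))"
    using H W by (intro prod.cong prob_tau) auto
  finally show ?thesis .
qed

section \<open>Passage times in boxes as functions of the weights in the box\<close>

definition box_edges :: "real ^ 'n \<Rightarrow> real ^ 'n \<Rightarrow> (real ^ 'n) set set" where
  "box_edges l u = {e \<in> edges. e \<subseteq> cbox l u}"

text \<open>The passage time factored through the coordinates of the box. Edges outside get the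
  dummy value 0, which by locality never enters.\<close>

definition box_time :: "real ^ 'n \<Rightarrow> real ^ 'n \<Rightarrow> real ^ 'n \<Rightarrow> real ^ 'n \<Rightarrow> ((real ^ 'n) set \<Rightarrow> real) \<Rightarrow> real" where
  "box_time l u x y f = passage_time b (\<lambda>e. if e \<in> box_edges l u then f e else 0) (cbox l u) x y"

lemma box_time_measurable:
  assumes "x \<in> cbox l u" "y \<in> cbox l u"
  shows "box_time l u x y \<in> borel_measurable (PiM (box_edges l u) (\<lambda>_. \<nu>))"
  unfolding box_time_def[abs_def]
proof (rule passage_measurable)
  fix e :: "(real ^ 'n) set"
  show "(\<lambda>f. if e \<in> box_edges l u then f e else 0) \<in> borel_measurable (PiM (box_edges l u) (\<lambda>_. \<nu>))"
    by (cases "e \<in> box_edges l u") (auto intro!: nu_to_borel)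
  fix f assume "f \<in> space (PiM (box_edges l u) (\<lambda>_. \<nu>))"
  then show "0 \<le> (if e \<in> box_edges l u then f e else 0)"
    by (auto simp: space_PiM space_nu PiE_def Pi_def)
qed (use assms b_pos in auto)

lemma box_time_eq:
  assumes "l \<in> Zd" "u \<in> Zd"
  shows "passage_time b t (cbox l u) x y = box_time l u x y (restrict t (box_edges l u))"
  unfolding box_time_def
  by (rule passage_box_cong[OF assms]) (auto simp: box_edges_def)

lemma box_time_restrict:
  assumes "l \<in> Zd" "u \<in> Zd"
  shows "passage_time b (\<lambda>e. \<tau> e \<omega>) (cbox l u) x y = box_time l u x y (\<lambda>e\<in>box_edges l u. \<tau> e \<omega>)"
  by (rule box_time_eq[OF assms])

lemma box_passage_measurable:
  assumes "x \<in> X" "y \<in> X"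
  shows "(\<lambda>\<omega>. passage_time b (\<lambda>e. \<tau> e \<omega>) X x y) \<in> borel_measurable M"
  by (rule passage_measurable) (use assms tau_borel tau_nonneg b_pos in auto)

text \<open>Both probabilities are the measure of the same set \<open>?B\<close> under the same
  product measure: the edges of \<open>cbox l u\<close> are read once through the translation by
  \<open>v\<close> and once through the identity.\<close>

lemma prob_translate:
  assumes lu: "l \<in> Zd" "u \<in> Zd" and xy: "x \<in> cbox l u" "y \<in> cbox l u" and v: "v \<in> Zd"
    and S: "S \<in> sets borel"
  shows "prob {\<omega> \<in> space M. passage_time b (\<lambda>e. \<tau> e \<omega>) (cbox (v + l) (v + u)) (v + x) (v + y) \<in> S}
       = prob {\<omega> \<in> space M. passage_time b (\<lambda>e. \<tau> e \<omega>) (cbox l u) x y \<in> S}"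
proof -
  let ?E = "box_edges l u"
  let ?B = "{f \<in> space (PiM ?E (\<lambda>_. \<nu>)). box_time l u x y f \<in> S}"
  have B: "?B \<in> sets (PiM ?E (\<lambda>_. \<nu>))"
    using box_time_measurable[OF xy] S by measurable
  have gen: "prob {\<omega> \<in> space M. box_time l u x y (\<lambda>e\<in>?E. \<tau> (\<sigma> e) \<omega>) \<in> S} = measure (PiM ?E (\<lambda>_. \<nu>)) ?B"
    if s: "inj_on \<sigma> ?E" "\<sigma> ` ?E \<subseteq> edges" for \<sigma>
  proof -
    have "measure (PiM ?E (\<lambda>_. \<nu>)) ?B = measure (distr M (PiM ?E (\<lambda>_. \<nu>)) (\<lambda>\<omega>. \<lambda>e\<in>?E. \<tau> (\<sigma> e) \<omega>)) ?B"
      unfolding distr_edges[OF s] ..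
    also have "\<dots> = prob ((\<lambda>\<omega>. \<lambda>e\<in>?E. \<tau> (\<sigma> e) \<omega>) -` ?B \<inter> space M)"
      by (rule measure_distr[OF restrict_measurable[OF s(2)] B])
    also have "(\<lambda>\<omega>. \<lambda>e\<in>?E. \<tau> (\<sigma> e) \<omega>) -` ?B \<inter> space M
        = {\<omega> \<in> space M. box_time l u x y (\<lambda>e\<in>?E. \<tau> (\<sigma> e) \<omega>) \<in> S}"
      using measurable_space[OF restrict_measurable[OF s(2)]] by auto
    finally show ?thesis ..
  qed
  have tr: "(+) v ` e \<in> edges" if "e \<in> edges" for e :: "(real ^ 'n) set"
  proof -
    from that obtain u i where "u \<in> Zd" "e = {u, u + axis i 1}" by (rule edge_cases)
    then have "(+) v ` e = {v + u, v + u + axis i 1}" by (auto simp: algebra_simps)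
    then show ?thesis using \<open>u \<in> Zd\<close> v by auto
  qed
  have "passage_time b (\<lambda>e. \<tau> e \<omega>) (cbox (v + l) (v + u)) (v + x) (v + y)
      = box_time l u x y (\<lambda>e\<in>?E. \<tau> ((+) v ` e) \<omega>)" for \<omega>
    unfolding cbox_translation passage_translate[OF v] by (rule box_time_eq[OF lu])
  then have "prob {\<omega> \<in> space M. passage_time b (\<lambda>e. \<tau> e \<omega>) (cbox (v + l) (v + u)) (v + x) (v + y) \<in> S}
      = measure (PiM ?E (\<lambda>_. \<nu>)) ?B"
    using gen[of "(`) ((+) v)"] tr by (auto simp: box_edges_def inj_on_def inj_image_eq_iff image_subset_iff)
  moreover have "prob {\<omega> \<in> space M. passage_time b (\<lambda>e. \<tau> e \<omega>) (cbox l u) x y \<in> S}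
      = measure (PiM ?E (\<lambda>_. \<nu>)) ?B"
    unfolding box_time_restrict[OF lu] using gen[of "\<lambda>e. e"] by (auto simp: box_edges_def)
  ultimately show ?thesis by simp
qed

text \<open>Half-width per unit of \<open>m\<close>: a path from 0 that costs at most
  \<open>b * l1norm (real m *\<^sub>R z)\<close> stays in the cube of half-width
  \<open>reach z * m\<close>. Rounding up gives the cube integer corners.\<close>

definition reach :: "real ^ 'n \<Rightarrow> nat" where
  "reach z = nat \<lceil>b / a * l1norm z\<rceil>"

lemma reach: "b * l1norm z \<le> a * real (reach z)"
proof -
  have "b / a * l1norm z \<le> real (reach z)" unfolding reach_def by (rule real_nat_ceiling_ge)
  then show ?thesis using ab by (simp add: field_simps)
qed

lemma mem_cbox_corner: "w \<in> cbox (- corner r) (corner r) \<longleftrightarrow> (\<forall>i. \<bar>w $ i\<bar> \<le> real r)"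
  by (auto simp: mem_box_cart abs_le_iff) (metis minus_le_iff)+

lemma reach_box:
  assumes "a * l1norm w \<le> b * l1norm (real m *\<^sub>R z)"
  shows "w \<in> cbox (- corner (reach z * m)) (corner (reach z * m))"
proof -
  have "a * l1norm w \<le> a * real (reach z) * real m"
    using assms mult_right_mono[OF reach[of z], of "real m"] by (simp add: mult_ac)
  then have "l1norm w \<le> real (reach z * m)" using ab by simp
  then show ?thesis unfolding mem_cbox_corner using component_le_l1norm order_trans by blast
qed

text \<open>Dominated convergence of indicators turns almost sure convergence into convergence in
  probability, and confinement replaces the full space by a box, so that the events depend on
  finitely many edges.\<close>

lemma time_constant_prob:
  assumes tc: "is_time_constant M \<tau> b \<mu>" and z: "z \<in> Zd" and d: "\<delta> > 0"
  shows "(\<lambda>m. prob {\<omega> \<in> space M. \<delta> * real m < \<bar>passage_time b (\<lambda>e. \<tau> e \<omega>)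
      (cbox (- corner (reach z * m)) (corner (reach z * m))) 0 (real m *\<^sub>R z) - real m * \<mu> z\<bar>}) \<longlonglongrightarrow> 0"
proof -
  let ?T = "\<lambda>m \<omega>. passage_time b (\<lambda>e. \<tau> e \<omega>)
      (cbox (- corner (reach z * m)) (corner (reach z * m))) 0 (real m *\<^sub>R z)"
  let ?A = "\<lambda>m. {\<omega> \<in> space M. \<delta> * real m < \<bar>?T m \<omega> - real m * \<mu> z\<bar>}"
  have zin: "real m *\<^sub>R z \<in> cbox (- corner (reach z * m)) (corner (reach z * m))" for m
    by (rule reach_box) (use ab in \<open>auto intro!: mult_right_mono\<close>)
  have oin: "0 \<in> cbox (- corner (reach z * m)) (corner (reach z * m))" for m
    by (rule reach_box) (use b_pos in auto)
  have Am: "?A m \<in> events" for m using box_passage_measurable[OF oin zin] by measurable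
  have "(\<lambda>m. integral\<^sup>L M (indicator (?A m) :: 'w \<Rightarrow> real)) \<longlonglongrightarrow> integral\<^sup>L M (\<lambda>_. 0 :: real)"
  proof (rule integral_dominated_convergence[where w = "\<lambda>_. 1"])
    show "indicator (?A m) \<in> borel_measurable M" for m using Am by simp
    show "AE \<omega> in M. (\<lambda>m. indicator (?A m) \<omega> :: real) \<longlonglongrightarrow> 0"
      using AE_bounds tc[unfolded is_time_constant_def, THEN conjunct2]
    proof eventually_elim
      fix \<omega> assume bd: "\<forall>e\<in>edges. a \<le> \<tau> e \<omega> \<and> \<tau> e \<omega> \<le> b"
        and lim: "\<forall>x\<in>Zd. (\<lambda>n. passage_time b (\<lambda>e. \<tau> e \<omega>) UNIV 0 (real n *\<^sub>R x) / real n) \<longlonglongrightarrow> \<mu> x"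
      have eq: "passage_time b (\<lambda>e. \<tau> e \<omega>) UNIV 0 (real m *\<^sub>R z) = ?T m \<omega>" for m
        by (rule passage_UNIV_eq[of a]) (use bd ab reach_box zin in auto)
      have "(\<lambda>m. ?T m \<omega> / real m) \<longlonglongrightarrow> \<mu> z" using lim z eq by auto
      then have "\<forall>\<^sub>F m in sequentially. dist (?T m \<omega> / real m) (\<mu> z) < \<delta>" using d by (rule tendstoD)
      then have "\<forall>\<^sub>F m in sequentially. indicator (?A m) \<omega> = (0 :: real)"
        using eventually_gt_at_top[of 0]
      proof eventually_elim
        case (elim m)
        have "\<bar>?T m \<omega> - real m * \<mu> z\<bar> = real m * \<bar>?T m \<omega> / real m - \<mu> z\<bar>"
          using elim(2) by (simp add: abs_mult[symmetric, of "real m", simplified] algebra_simps)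
        also have "\<dots> \<le> real m * \<delta>" using elim by (intro mult_left_mono) (auto simp: dist_real_def)
        finally show ?case by (auto simp: indicator_def mult.commute)
      qed
      then show "(\<lambda>m. indicator (?A m) \<omega> :: real) \<longlonglongrightarrow> 0" by (rule tendsto_eventually)
    qed
    show "AE \<omega> in M. norm (indicator (?A m) \<omega> :: real) \<le> 1" for m by (auto simp: indicator_def)
  qed auto
  moreover have "integral\<^sup>L M (indicator (?A m) :: 'w \<Rightarrow> real) = prob (?A m)" for m
    using Am by simp
  ultimately show ?thesis by simp
qed

section \<open>Costs and rates\<close>

lemma LD_events: "g \<in> norms a b \<Longrightarrow> n > 0 \<Longrightarrow> LD M \<tau> b n g \<epsilon> \<in> events"
  by (rule LD_measurable) (use tau_borel tau_nonneg b_pos in auto)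

lemma neg_log_antimono: "0 \<le> p \<Longrightarrow> p \<le> q \<Longrightarrow> neg_log q \<le> neg_log p"
  by (auto simp: neg_log_def)

lemma LD_mono:
  assumes g: "g \<in> norms a b" and n: "n > 0" and e: "\<epsilon> \<le> \<epsilon>'"
  shows "LD M \<tau> b n g \<epsilon> \<subseteq> LD M \<tau> b n g \<epsilon>'"
  by (auto simp: LD_def intro: order_trans[OF _ e])

lemma LD_cost_antimono:
  assumes g: "g \<in> norms a b" and n: "n > 0" and e: "\<epsilon> \<le> \<epsilon>'"
  shows "LD_cost M \<tau> b g \<epsilon>' n \<le> LD_cost M \<tau> b g \<epsilon> n"
  unfolding LD_cost_def
  by (intro ereal_mult_left_mono neg_log_antimono finite_measure_mono LD_mono LD_events) (use assms in auto)

text \<open>A smaller \<epsilon> shrinks the event and raises the cost, so both rates are suprema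
  over \<epsilon>: a lower bound needs a single \<epsilon>, an upper bound has to hold for
  all.\<close>

lemma rates_eq_SUP:
  assumes g: "g \<in> norms a b"
  shows "rate_lower M \<tau> b g = (SUP \<epsilon>\<in>{0<..}. liminf (LD_cost M \<tau> b g \<epsilon>))"
    and "rate_upper M \<tau> b g = (SUP \<epsilon>\<in>{0<..}. limsup (LD_cost M \<tau> b g \<epsilon>))"
proof -
  have ev: "\<forall>\<^sub>F n in sequentially. LD_cost M \<tau> b g y n \<le> LD_cost M \<tau> b g x n" if "x \<le> y" for x y
    using eventually_gt_at_top[of 0] by eventually_elim (use LD_cost_antimono g that in auto)
  show "rate_lower M \<tau> b g = (SUP \<epsilon>\<in>{0<..}. liminf (LD_cost M \<tau> b g \<epsilon>))"
    unfolding rate_lower_def by (rule Lim_at_right_antimono) (intro Liminf_mono ev)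
  show "rate_upper M \<tau> b g = (SUP \<epsilon>\<in>{0<..}. limsup (LD_cost M \<tau> b g \<epsilon>))"
    unfolding rate_upper_def by (rule Lim_at_right_antimono) (intro Limsup_mono ev)
qed

lemma rates_le: "g \<in> norms a b \<Longrightarrow> rate_lower M \<tau> b g \<le> rate_upper M \<tau> b g"
  unfolding rates_eq_SUP by (intro SUP_mono' Liminf_le_Limsup) simp

lemma LD_cost_nonneg: "0 \<le> LD_cost M \<tau> b g \<epsilon> n"
proof -
  have "0 \<le> neg_log (prob (LD M \<tau> b n g \<epsilon>))"
  proof -
    have "neg_log 1 = 0" by (simp add: neg_log_def)
    then show ?thesis using neg_log_antimono[of "prob (LD M \<tau> b n g \<epsilon>)" 1] by simp
  qed
  then show ?thesis unfolding LD_cost_def by (intro ereal_0_le_mult) auto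
qed

lemma rate_lower_nonneg: "g \<in> norms a b \<Longrightarrow> 0 \<le> rate_lower M \<tau> b g"
  unfolding rates_eq_SUP
  by (intro SUP_upper2[of 1] Liminf_bounded always_eventually) (auto simp: LD_cost_nonneg)

end

section \<open>The infinite case\<close>

text \<open>If \<open>k\<close> events occur, the pigeonhole principle puts \<open>k'\<close> of
  them into one colour class. There are at most \<open>2 ^ card V\<close> monochromatic sets of size
  \<open>k'\<close>, each with joint probability at most \<open>\<eta> ^ k'\<close>. Colours stand
  for classes on which the events are independent.\<close>

lemma (in prob_space) prob_many_bad:
  fixes E :: "'v \<Rightarrow> 'a set" and col :: "'v \<Rightarrow> 'c"
  assumes V: "finite V" and ev: "\<And>v. v \<in> V \<Longrightarrow> E v \<in> events" and \<eta>: "0 \<le> \<eta>"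
    and C: "finite C" "C \<noteq> {}" "col ` V \<subseteq> C"
    and mono: "\<And>S c. S \<subseteq> V \<Longrightarrow> S \<noteq> {} \<Longrightarrow> (\<And>v. v \<in> S \<Longrightarrow> col v = c) \<Longrightarrow>
        prob {\<omega> \<in> space M. \<forall>v\<in>S. \<omega> \<in> E v} \<le> \<eta> ^ card S"
    and k: "k' * card C \<le> k" "0 < k'"
  shows "prob {\<omega> \<in> space M. k \<le> card {v \<in> V. \<omega> \<in> E v}} \<le> 2 ^ card V * \<eta> ^ k'"
proof -
  define SS where "SS = {S. S \<subseteq> V \<and> card S = k' \<and> (\<exists>c. \<forall>v\<in>S. col v = c)}"
  have fSS: "finite SS" unfolding SS_def using V by auto
  have card: "card SS \<le> 2 ^ card V"
    using card_mono[of "Pow V" SS] V by (auto simp: SS_def card_Pow)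
  have evS: "{\<omega> \<in> space M. \<forall>v\<in>S. \<omega> \<in> E v} \<in> events" if "S \<in> SS" for S
  proof (rule sets.sets_Collect_finite_All)
    show "finite S" using that V finite_subset by (auto simp: SS_def)
    fix v assume "v \<in> S"
    then have "E v \<in> events" using that ev by (auto simp: SS_def)
    then have "{\<omega> \<in> space M. \<omega> \<in> E v} = E v" using sets.sets_into_space by blast
    then show "{\<omega> \<in> space M. \<omega> \<in> E v} \<in> events" using \<open>E v \<in> events\<close> by simp
  qed
  have "{\<omega> \<in> space M. k \<le> card {v \<in> V. \<omega> \<in> E v}} \<subseteq> (\<Union>S\<in>SS. {\<omega> \<in> space M. \<forall>v\<in>S. \<omega> \<in> E v})"
  proof
    fix \<omega> assume w: "\<omega> \<in> {\<omega> \<in> space M. k \<le> card {v \<in> V. \<omega> \<in> E v}}"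
    define B where "B = {v \<in> V. \<omega> \<in> E v}"
    have fB: "finite B" using V by (simp add: B_def)
    have "\<exists>c\<in>C. k' \<le> card {v \<in> B. col v = c}"
    proof (rule ccontr)
      assume "\<not> (\<exists>c\<in>C. k' \<le> card {v \<in> B. col v = c})"
      then have small: "\<And>c. c \<in> C \<Longrightarrow> card {v \<in> B. col v = c} < k'" by force
      have "B = (\<Union>c\<in>C. {v \<in> B. col v = c})" using C by (auto simp: B_def)
      then have "card B \<le> (\<Sum>c\<in>C. card {v \<in> B. col v = c})" using card_UN_le[OF C(1)] by metis
      also have "\<dots> < (\<Sum>c\<in>C. k')" by (rule sum_strict_mono) (use C small in auto)
      also have "\<dots> \<le> k" using k by (simp add: mult.commute)
      finally show False using w by (simp add: B_def)
    qed
    then obtain c where c: "c \<in> C" "k' \<le> card {v \<in> B. col v = c}" by auto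
    then obtain S where S: "S \<subseteq> {v \<in> B. col v = c}" "card S = k'"
      by (meson obtain_subset_with_card_n)
    then have "S \<subseteq> V" "\<forall>v\<in>S. col v = c" by (auto simp: B_def)
    then have "S \<in> SS" using S(2) by (auto simp: SS_def)
    moreover have "\<forall>v\<in>S. \<omega> \<in> E v" using S by (auto simp: B_def)
    ultimately show "\<omega> \<in> (\<Union>S\<in>SS. {\<omega> \<in> space M. \<forall>v\<in>S. \<omega> \<in> E v})" using w by auto
  qed
  then have "prob {\<omega> \<in> space M. k \<le> card {v \<in> V. \<omega> \<in> E v}}
      \<le> prob (\<Union>S\<in>SS. {\<omega> \<in> space M. \<forall>v\<in>S. \<omega> \<in> E v})"
    by (rule finite_measure_mono) (use fSS evS in auto)
  also have "\<dots> \<le> (\<Sum>S\<in>SS. prob {\<omega> \<in> space M. \<forall>v\<in>S. \<omega> \<in> E v})"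
    by (rule finite_measure_subadditive_finite) (use fSS evS in auto)
  also have "\<dots> \<le> (\<Sum>S\<in>SS. \<eta> ^ k')"
  proof (rule sum_mono)
    fix S assume S: "S \<in> SS"
    then obtain c where c: "\<And>v. v \<in> S \<Longrightarrow> col v = c" by (auto simp: SS_def)
    have "S \<noteq> {}" using S k by (auto simp: SS_def)
    then show "prob {\<omega> \<in> space M. \<forall>v\<in>S. \<omega> \<in> E v} \<le> \<eta> ^ k'"
      using mono[of S c] S c by (auto simp: SS_def)
  qed
  also have "\<dots> = real (card SS) * \<eta> ^ k'" by simp
  also have "\<dots> \<le> real (2 ^ card V) * \<eta> ^ k'"
    using card \<eta> by (intro mult_right_mono) (auto simp del: of_nat_power)
  finally show ?thesis by simp
qed

lemma passage_chain:
  assumes t: "\<And>e. e \<in> edges \<Longrightarrow> 0 \<le> t e" "0 \<le> b" and u: "\<And>j. j \<le> L \<Longrightarrow> u j \<in> X"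
  shows "passage_time b t X (u 0) (u L) \<le> (\<Sum>j<L. passage_time b t X (u j) (u (Suc j)))"
  using u
proof (induction L)
  case 0
  then show ?case using passage_refl[where t = t and b = b, OF t] by simp
next
  case (Suc L)
  have "passage_time b t X (u 0) (u (Suc L)) \<le> passage_time b t X (u 0) (u L) + passage_time b t X (u L) (u (Suc L))"
    by (rule passage_triangle) (use t Suc.prems in auto)
  then show ?case using Suc by fastforce
qed

lemma is_norm_sum_le:
  fixes \<mu> :: "real ^ 'n \<Rightarrow> real"
  assumes "is_norm \<mu>"
  shows "\<mu> x \<le> (\<Sum>i\<in>UNIV. \<bar>x $ i\<bar> * \<mu> (axis i 1))"
proof -
  have s: "\<mu> (\<Sum>i\<in>A. f i) \<le> (\<Sum>i\<in>A. \<mu> (f i))" if "finite A" for A and f :: "'n \<Rightarrow> real ^ 'n"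
    using that
  proof (induction A)
    case empty
    have "\<mu> 0 = 0" using assms unfolding is_norm_def by blast
    then show ?case by simp
  next
    case (insert i A)
    have "\<mu> (f i + sum f A) \<le> \<mu> (f i) + \<mu> (sum f A)" using assms by (auto simp: is_norm_def)
    then show ?case using insert by simp
  qed
  have "\<mu> x = \<mu> (\<Sum>i\<in>UNIV. (x $ i) *\<^sub>R axis i 1)"
    using basis_expansion[of x] by (simp add: scalar_mult_eq_scaleR)
  also have "\<dots> \<le> (\<Sum>i\<in>UNIV. \<mu> ((x $ i) *\<^sub>R axis i 1))" by (rule s) simp
  also have "\<dots> = (\<Sum>i\<in>UNIV. \<bar>x $ i\<bar> * \<mu> (axis i 1))" using assms by (simp add: is_norm_def)
  finally show ?thesis .
qed

context fpp begin

lemma LD_cost_ge: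
  assumes n: "n > 0" and p: "prob (LD M \<tau> b n g \<epsilon>) \<le> exp (- c * real n ^ CARD('n))"
  shows "ereal c \<le> LD_cost M \<tau> b g \<epsilon> n"
proof (cases "prob (LD M \<tau> b n g \<epsilon>) = 0")
  case True
  then show ?thesis using n by (simp add: LD_cost_def neg_log_def)
next
  case False
  then have "0 < prob (LD M \<tau> b n g \<epsilon>)" by (simp add: zero_less_measure_iff)
  then have "ln (prob (LD M \<tau> b n g \<epsilon>)) \<le> - c * real n ^ CARD('n)"
    using p by (metis exp_gt_zero ln_exp ln_le_cancel_iff)
  then have "c \<le> 1 / real n ^ CARD('n) * - ln (prob (LD M \<tau> b n g \<epsilon>))"
    using n by (simp add: field_simps)
  then show ?thesis using False by (simp add: LD_cost_def neg_log_def)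
qed

lemma LD_cost_le:
  assumes n: "n > 0" and p: "exp (- c * real n ^ CARD('n)) \<le> prob (LD M \<tau> b n g \<epsilon>)"
  shows "LD_cost M \<tau> b g \<epsilon> n \<le> ereal c"
proof -
  have pos: "0 < prob (LD M \<tau> b n g \<epsilon>)" using p exp_gt_zero less_le_trans by blast
  then have "- c * real n ^ CARD('n) \<le> ln (prob (LD M \<tau> b n g \<epsilon>))"
    using p by (metis exp_gt_zero ln_exp ln_le_cancel_iff)
  then have "1 / real n ^ CARD('n) * - ln (prob (LD M \<tau> b n g \<epsilon>)) \<le> c"
    using n by (simp add: field_simps)
  then show ?thesis using pos by (simp add: LD_cost_def neg_log_def)
qed

lemma prob_edges:
  assumes H: "finite H" "H \<subseteq> edges" and W: "\<And>e. e \<in> H \<Longrightarrow> W e \<in> sets borel"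
  shows "prob {\<omega> \<in> space M. \<forall>e\<in>H. \<tau> e \<omega> \<in> W e} = (\<Prod>e\<in>H. measure \<nu> (W e \<inter> {0..}))"
proof -
  have "(\<lambda>e\<in>{}. \<tau> e \<omega>) \<in> space (PiM {} (\<lambda>_. \<nu>))" for \<omega>
    by (simp add: space_PiM fun_eq_iff)
  then show ?thesis
    using prob_block_edges[OF H, of "{}" "space (PiM {} (\<lambda>_. \<nu>))" W] W by (simp add: prob_space)
qed

lemma LD_passage:
  fixes g :: "real ^ 'n \<Rightarrow> real"
  assumes g: "g \<in> norms a b" and n: "n > 0" and w: "\<omega> \<in> LD M \<tau> b n g \<epsilon>"
    and X: "x \<in> ncube n" "y \<in> ncube n"
  shows "\<bar>g (x - y) - passage_time b (\<lambda>e. \<tau> e \<omega>) (ncube n) x y\<bar> \<le> \<epsilon> * real n"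
proof -
  have sp: "\<omega> \<in> space M" using w by (simp add: LD_def)
  define x' y' where "x' = (1 / real n) *\<^sub>R x" and "y' = (1 / real n) *\<^sub>R y"
  have eq: "x = real n *\<^sub>R x'" "y = real n *\<^sub>R y'" using n by (auto simp: x'_def y'_def)
  have in': "x' \<in> unit_cube" "y' \<in> unit_cube"
    using X n by (auto simp: x'_def y'_def mem_ncube unit_cube_def field_simps)
  have "\<bar>g (x' - y') - rescaled_time b (\<lambda>e. \<tau> e \<omega>) n unit_cube x' y'\<bar> \<le> \<epsilon>"
    using LD_iff[OF g, of \<tau> \<omega> n M \<epsilon>] w sp n tau_nonneg b_pos in' by auto
  then have "real n * \<bar>g (x' - y') - passage_time b (\<lambda>e. \<tau> e \<omega>) (ncube n) x y / real n\<bar> \<le> real n * \<epsilon>"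
    using n by (intro mult_left_mono) (auto simp: rescaled_time_ncube eq)
  also have "real n * \<bar>g (x' - y') - passage_time b (\<lambda>e. \<tau> e \<omega>) (ncube n) x y / real n\<bar>
      = \<bar>real n * (g (x' - y') - passage_time b (\<lambda>e. \<tau> e \<omega>) (ncube n) x y / real n)\<bar>"
    by (simp add: abs_mult)
  also have "real n * (g (x' - y') - passage_time b (\<lambda>e. \<tau> e \<omega>) (ncube n) x y / real n)
      = g (x - y) - passage_time b (\<lambda>e. \<tau> e \<omega>) (ncube n) x y"
  proof -
    have "g (x - y) = real n * g (x' - y')"
      unfolding eq scaleR_diff_right[symmetric] using normsD(3)[OF g] by simp
    then show ?thesis using n by (simp add: algebra_simps)
  qed
  finally show ?thesis by (simp add: mult.commute)
qed

text \<open>In the decomposition of \<open>x\<close> along the axes each axis contributes at most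
  \<open>b\<close> times its coefficient, so equality for \<open>x\<close> forces equality on every
  axis with nonzero coefficient.\<close>

lemma extremal_axis:
  fixes g :: "real ^ 'n \<Rightarrow> real"
  assumes "g \<in> norms a b - norms_star a b"
  obtains i where "g (axis i 1) = b"
proof -
  have g: "g \<in> norms a b" using assms by simp
  obtain x where x: "x \<noteq> 0" "b * l1norm x \<le> g x" using assms by (force simp: norms_star_def not_less)
  obtain i where i: "x $ i \<noteq> 0" using x by (auto simp: vec_eq_iff)
  have le: "g (axis j 1) \<le> b" for j using normsD(6)[OF g, of "axis j 1"] by simp
  have "g (axis i 1) = b"
  proof (rule ccontr)
    assume "g (axis i 1) \<noteq> b"
    then have lt: "g (axis i 1) < b" using le[of i] by simp
    have "g x \<le> (\<Sum>j\<in>UNIV. \<bar>x $ j\<bar> * g (axis j 1))"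
      using g by (intro is_norm_sum_le) (simp add: norms_def)
    also have "\<dots> < (\<Sum>j\<in>UNIV. \<bar>x $ j\<bar> * b)"
    proof (rule sum_strict_mono_ex1)
      show "\<exists>j\<in>UNIV. \<bar>x $ j\<bar> * g (axis j 1) < \<bar>x $ j\<bar> * b"
        by (rule bexI[of _ i]) (use i lt in auto)
    qed (use le in \<open>auto intro!: mult_left_mono\<close>)
    also have "\<dots> = b * l1norm x" by (simp add: l1norm_def sum_distrib_right mult.commute sum_distrib_left)
    finally show False using x by simp
  qed
  then show ?thesis by (rule that)
qed

text \<open>Continuity from above: the intervals shrink to \<open>{b}\<close>, which has no
  mass.\<close>

lemma nu_near_b:
  assumes "measure \<nu> {b} = 0" "0 < q"
  obtains \<epsilon> where "0 < \<epsilon>" "measure \<nu> ({b - 2 * \<epsilon>..b} \<inter> {0..}) \<le> q"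
proof -
  interpret N: prob_space \<nu> by (rule nu_prob)
  let ?A = "\<lambda>n :: nat. {b - 2 * (1 / real (Suc n))..b} \<inter> {0..}"
  have "(\<lambda>n. measure \<nu> (?A n)) \<longlonglongrightarrow> measure \<nu> (\<Inter>n. ?A n)"
  proof (rule N.finite_Lim_measure_decseq)
    show "range ?A \<subseteq> sets \<nu>"
    proof
      fix X assume "X \<in> range ?A"
      then obtain n where "X = ?A n" by (rule rangeE)
      then show "X \<in> sets \<nu>" by (simp only:) (rule nu_sets_Int, simp)
    qed
    show "decseq ?A"
    proof (rule decseq_SucI, rule Int_mono[OF _ subset_refl])
      fix n
      have "1 / real (Suc (Suc n)) \<le> 1 / real (Suc n)" by (intro divide_left_mono) auto
      then show "{b - 2 * (1 / real (Suc (Suc n)))..b} \<subseteq> {b - 2 * (1 / real (Suc n))..b}" by auto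
    qed
  qed
  moreover have "(\<Inter>n. ?A n) = {b}"
  proof (intro equalityI subsetI)
    fix x assume x: "x \<in> (\<Inter>n. ?A n)"
    have "b \<le> x"
    proof (rule ccontr)
      assume "\<not> b \<le> x"
      then have "0 < (b - x) / 2" by simp
      then obtain n where n: "1 / real (Suc n) < (b - x) / 2" using nat_approx_posE by blast
      define r where "r = 1 / real (Suc n)"
      have "x \<in> ?A n" using x by blast
      then have "b - 2 * r \<le> x" unfolding r_def by simp
      moreover have "r < (b - x) / 2" unfolding r_def by (rule n)
      ultimately show False by (simp add: field_simps)
    qed
    then show "x \<in> {b}" using x by auto
  qed (use b_pos in auto)
  ultimately have "(\<lambda>n. measure \<nu> (?A n)) \<longlonglongrightarrow> 0" using assms by simp
  then have "\<forall>\<^sub>F n in sequentially. measure \<nu> (?A n) < q" using assms(2) by (rule order_tendstoD)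
  then obtain n where "measure \<nu> (?A n) < q" by (auto simp: eventually_sequentially)
  then show ?thesis using that[of "1 / real (Suc n)"] by simp
qed

text \<open>On \<open>LD\<close> each line of \<open>n\<close> edges across the cube in direction
  \<open>i\<close> takes time at least \<open>(b - \<epsilon>) * n\<close>; as almost surely no
  weight exceeds \<open>b\<close>, at least half of its edges have weight at least
  \<open>b - 2 * \<epsilon>\<close>. Such edges have probability at most \<open>q\<^sup>2\<close>,
  and a union bound over sets of half of all these edges makes the cost at least
  \<open>K\<close>.\<close>

lemma rate_infinite:
  fixes g :: "real ^ 'n \<Rightarrow> real"
  assumes gn: "g \<in> norms a b - norms_star a b" and nub: "measure \<nu> {b} = 0"
  shows "rate_lower M \<tau> b g = \<infinity>"
proof -
  have g: "g \<in> norms a b" using gn by simp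
  obtain i where i: "g (axis i 1) = b" using gn by (rule extremal_axis)
  have main: "\<exists>\<epsilon>>0. ereal K \<le> liminf (LD_cost M \<tau> b g \<epsilon>)" if K: "K > 0" for K :: real
  proof -
    \<comment> \<open>So \<open>2 * q\<close> is \<open>exp (- K)\<close>: a factor 2 per edge pays
      for the number of subsets, and the square of \<open>q\<close> makes up for only half of the
      edges being used.\<close>
    define q where "q = exp (- K) / 2"
    have q: "0 < q" "q < 1" using K by (auto simp: q_def) (smt (verit) exp_less_one_iff)
    obtain \<epsilon> where \<epsilon>: "0 < \<epsilon>" "measure \<nu> ({b - 2 * \<epsilon>..b} \<inter> {0..}) \<le> q\<^sup>2"
      using nu_near_b[OF nub, of "q\<^sup>2"] q by auto
    define \<eta> where "\<eta> = measure \<nu> ({b - 2 * \<epsilon>..b} \<inter> {0..})"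
    have "ereal K \<le> LD_cost M \<tau> b g \<epsilon> n" if n: "n > 0" for n
    proof (rule LD_cost_ge[OF n])
      \<comment> \<open>\<open>W\<close> consists of the lattice points of the face where coordinate
        \<open>i\<close> vanishes; the edges on the line through \<open>w\<close> start at heights 0
        to \<open>n - 1\<close>.\<close>
      define A :: "'n \<Rightarrow> int set" where "A j = (if j = i then {0} else {0..int n})" for j
      define W where "W = {v :: real ^ 'n. \<forall>j. v $ j \<in> real_of_int ` A j}"
      define ed where "ed = (\<lambda>(w, j). {w + axis i (real j), w + axis i (real j) + axis i 1 :: real ^ 'n})"
      define V where "V = ed ` (W \<times> {..<n})"
      have fW: "finite W" and cW: "card W = (\<Prod>j\<in>UNIV. card (A j))"
        unfolding W_def by (rule card_lattice_box; simp add: A_def)+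
      have WZ: "w \<in> Zd" "w $ i = 0" "\<And>j. 0 \<le> w $ j \<and> w $ j \<le> real n" if "w \<in> W" for w
      proof -
        have "w $ j \<in> real_of_int ` A j" for j using that by (auto simp: W_def)
        then have *: "\<exists>k. w $ j = of_int k \<and> k \<in> A j" for j by auto
        have "w $ j \<in> \<int>" for j using *[of j] by (elim exE conjE) simp
        then show "w \<in> Zd" by (simp add: Zd_def)
        show "w $ i = 0" using *[of i] by (auto simp: A_def)
        show "0 \<le> w $ j \<and> w $ j \<le> real n" for j using *[of j] by (auto simp: A_def split: if_splits)
      qed
      have axZ: "axis i (real j) \<in> Zd" for j by (auto simp: Zd_def axis_def)
      have edE: "ed (w, j) \<in> edges" if "w \<in> W" for w j
        using WZ(1)[OF that] axZ by (auto simp: ed_def intro!: edge_axis)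
      have inj: "inj_on ed (W \<times> {..<n})"
      proof (rule inj_onI, clarify)
        fix w j w' j' assume w: "w \<in> W" "w' \<in> W" and eq: "ed (w, j) = ed (w', j')"
        have "w + axis i (real j) = w' + axis i (real j') \<or>
              (w + axis i (real j) = w' + axis i (real j') + axis i 1 \<and> w' + axis i (real j') = w + axis i (real j) + axis i 1)"
          using eq by (auto simp: ed_def doubleton_eq_iff)
        then have eq2: "w + axis i (real j) = w' + axis i (real j')"
        proof
          assume h: "w + axis i (real j) = w' + axis i (real j') + axis i 1 \<and> w' + axis i (real j') = w + axis i (real j) + axis i 1"
          then have "(w + axis i (real j)) $ i = (w' + axis i (real j') + axis i 1) $ i"
            "(w' + axis i (real j')) $ i = (w + axis i (real j) + axis i 1) $ i" by metis+
          then show ?thesis by (simp add: axis_def)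
        qed
        have "(w + axis i (real j)) $ i = (w' + axis i (real j')) $ i" using eq2 by simp
        then have "j = j'" using WZ(2)[OF w(1)] WZ(2)[OF w(2)] by (simp add: axis_def)
        then show "w = w' \<and> j = j'" using eq2 by simp
      qed
      have cV: "card V = card W * n" unfolding V_def card_image[OF inj] by (simp add: card_cartesian_product)
      have fV: "finite V" unfolding V_def using fW by simp
      have "real n ^ CARD('n) \<le> real (card V)"
      proof -
        have "n ^ (CARD('n) - 1) \<le> (\<Prod>j\<in>UNIV - {i}. card (A j))"
        proof -
          have "(\<Prod>j\<in>UNIV - {i}. n) \<le> (\<Prod>j\<in>UNIV - {i}. card (A j))"
            by (rule prod_mono) (auto simp: A_def)
          then show ?thesis by (simp add: card_Diff_singleton)
        qed
        also have "\<dots> = card W" unfolding cW by (subst (2) prod.remove[of _ i]) (auto simp: A_def)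
        finally have "n ^ (CARD('n) - 1) * n \<le> card W * n" by simp
        moreover have "n ^ (CARD('n) - 1) * n = n ^ CARD('n)"
          by (metis One_nat_def Suc_pred mult.commute power_Suc zero_less_card_finite)
        ultimately show ?thesis unfolding cV by (metis of_nat_le_iff of_nat_power)
      qed
      define E where "E e = {\<omega> \<in> space M. \<tau> e \<omega> \<in> {b - 2 * \<epsilon>..b}}" for e
      have evE: "E e \<in> events" if "e \<in> edges" for e unfolding E_def using tau_borel[OF that] by measurable
      have VE: "V \<subseteq> edges" unfolding V_def using edE by auto
      \<comment> \<open>Half of the number of edges, rounded up, so that \<open>2 * ?k\<close> is at
        least \<open>card V\<close>.\<close>
      let ?k = "(card V + 1) div 2"
      have "AE \<omega> in M. \<omega> \<in> LD M \<tau> b n g \<epsilon> \<longrightarrow> \<omega> \<in> {\<omega> \<in> space M. ?k \<le> card {e \<in> V. \<omega> \<in> E e}}"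
        using AE_bounds AE_space
      proof eventually_elim
        fix \<omega> assume bd: "\<forall>e\<in>edges. a \<le> \<tau> e \<omega> \<and> \<tau> e \<omega> \<le> b" and sp: "\<omega> \<in> space M"
        show "\<omega> \<in> LD M \<tau> b n g \<epsilon> \<longrightarrow> \<omega> \<in> {\<omega> \<in> space M. ?k \<le> card {e \<in> V. \<omega> \<in> E e}}"
        proof
          assume L: "\<omega> \<in> LD M \<tau> b n g \<epsilon>"
          have line: "real n / 2 \<le> real (card {j \<in> {..<n}. \<omega> \<in> E (ed (w, j))})" if w: "w \<in> W" for w
          proof -
            let ?T = "passage_time b (\<lambda>e. \<tau> e \<omega>) (ncube n)"
            let ?u = "\<lambda>j :: nat. w + axis i (real j)"
            have uin: "?u j \<in> ncube n" if "j \<le> n" for j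
              using WZ(2,3)[OF w] that by (auto simp: mem_ncube axis_def)
            have "\<bar>g (?u 0 - ?u n) - ?T (?u 0) (?u n)\<bar> \<le> \<epsilon> * real n"
              by (rule LD_passage[OF g n L uin uin]) auto
            moreover have "g (?u 0 - ?u n) = real n * b"
            proof -
              have "?u 0 - ?u n = (- real n) *\<^sub>R axis i 1" by (auto simp: vec_eq_iff axis_def)
              then show ?thesis using normsD(3)[OF g, of "- real n" "axis i 1"] i by simp
            qed
            ultimately have "real n * b - \<epsilon> * real n \<le> ?T (?u 0) (?u n)" by linarith
            also have "\<dots> \<le> (\<Sum>j<n. ?T (?u j) (?u (Suc j)))"
              by (rule passage_chain) (use uin bd ab in \<open>auto intro: order_trans[of 0 a]\<close>)
            also have "\<dots> \<le> (\<Sum>j<n. if \<omega> \<in> E (ed (w, j)) then b else b - 2 * \<epsilon>)"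
            proof (rule sum_mono)
              fix j assume j: "j \<in> {..<n}"
              have us: "?u (Suc j) = ?u j + axis i 1" by (auto simp: vec_eq_iff axis_def)
              have ee: "ed (w, j) \<in> edges" by (rule edE[OF w])
              have "?T (?u j) (?u (Suc j)) \<le> step_time b (\<lambda>e. \<tau> e \<omega>) (?u j) (?u (Suc j))"
                by (rule passage_le_step[OF _ _ uin uin]) (use j tau_nonneg sp b_pos in auto)
              also have "\<dots> = \<tau> (ed (w, j)) \<omega> * l1norm (?u j - ?u (Suc j))"
                unfolding us by (rule step_time_edge[OF ee]) (auto simp: ed_def intro!: hull_inc)
              also have "\<dots> = \<tau> (ed (w, j)) \<omega>" unfolding us by simp
              also have "\<dots> \<le> (if \<omega> \<in> E (ed (w, j)) then b else b - 2 * \<epsilon>)"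
                using bd ee sp by (auto simp: E_def)
              finally show "?T (?u j) (?u (Suc j)) \<le> (if \<omega> \<in> E (ed (w, j)) then b else b - 2 * \<epsilon>)" .
            qed
            also have "\<dots> = (\<Sum>j<n. (b - 2 * \<epsilon>) + (if \<omega> \<in> E (ed (w, j)) then 2 * \<epsilon> else 0))"
              by (intro sum.cong) auto
            also have "\<dots> = real n * (b - 2 * \<epsilon>) + real (card {j \<in> {..<n}. \<omega> \<in> E (ed (w, j))}) * (2 * \<epsilon>)"
              by (simp add: sum.distrib sum.If_cases Int_def)
            finally have "real n * \<epsilon> \<le> real (card {j \<in> {..<n}. \<omega> \<in> E (ed (w, j))}) * (2 * \<epsilon>)"
              by (simp add: algebra_simps)
            then show ?thesis using \<epsilon>(1) by (simp add: field_simps)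
          qed
          have "real (card V) / 2 = (\<Sum>w\<in>W. real n / 2)" by (simp add: cV)
          also have "\<dots> \<le> (\<Sum>w\<in>W. real (card {j \<in> {..<n}. \<omega> \<in> E (ed (w, j))}))"
            by (rule sum_mono) (rule line)
          also have "\<dots> = real (card (SIGMA w:W. {j \<in> {..<n}. \<omega> \<in> E (ed (w, j))}))"
            using fW by (simp add: card_SigmaI)
          also have "\<dots> = real (card (ed ` (SIGMA w:W. {j \<in> {..<n}. \<omega> \<in> E (ed (w, j))})))"
            by (subst card_image) (auto intro: inj_on_subset[OF inj])
          also have "\<dots> \<le> real (card {e \<in> V. \<omega> \<in> E e})"
            by (intro of_nat_mono card_mono) (use fV in \<open>auto simp: V_def\<close>)
          finally show "\<omega> \<in> {\<omega> \<in> space M. ?k \<le> card {e \<in> V. \<omega> \<in> E e}}" using sp by simp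
        qed
      qed
      moreover have "{\<omega> \<in> space M. ?k \<le> card {e \<in> V. \<omega> \<in> E e}} \<in> events"
      proof -
        have "(\<lambda>\<omega>. \<Sum>e\<in>V. indicator (E e) \<omega> :: real) \<in> borel_measurable M"
          using VE evE by (intro borel_measurable_sum borel_measurable_indicator) auto
        then have "{\<omega> \<in> space M. real ?k \<le> (\<Sum>e\<in>V. indicator (E e) \<omega>)} \<in> events" by measurable
        moreover have "(\<Sum>e\<in>V. indicator (E e) \<omega>) = real (card {e \<in> V. \<omega> \<in> E e})" for \<omega>
          using fV by (simp add: indicator_def sum.If_cases Int_def)
        ultimately show ?thesis by (simp only: of_nat_le_iff)
      qed
      ultimately have "prob (LD M \<tau> b n g \<epsilon>) \<le> prob {\<omega> \<in> space M. ?k \<le> card {e \<in> V. \<omega> \<in> E e}}"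
        by (rule finite_measure_mono_AE)
      also have "\<dots> \<le> 2 ^ card V * \<eta> ^ ?k"
      proof (rule prob_many_bad[where C = "{()}" and col = "\<lambda>_. ()"])
        fix S assume S: "S \<subseteq> V"
        have "prob {\<omega> \<in> space M. \<forall>e\<in>S. \<tau> e \<omega> \<in> {b - 2 * \<epsilon>..b}} = (\<Prod>e\<in>S. measure \<nu> ({b - 2 * \<epsilon>..b} \<inter> {0..}))"
          by (rule prob_edges) (use S fV VE finite_subset in auto)
        moreover have "{\<omega> \<in> space M. \<forall>e\<in>S. \<omega> \<in> E e} = {\<omega> \<in> space M. \<forall>e\<in>S. \<tau> e \<omega> \<in> {b - 2 * \<epsilon>..b}}"
          by (auto simp: E_def)
        ultimately show "prob {\<omega> \<in> space M. \<forall>e\<in>S. \<omega> \<in> E e} \<le> \<eta> ^ card S" by (simp add: \<eta>_def)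
      next
        have "0 < card V" using \<open>real n ^ CARD('n) \<le> real (card V)\<close> n
          by (metis not_gr_zero of_nat_0 of_nat_0_less_iff linorder_not_less zero_less_power)
        then show "0 < ?k" by simp
      qed (use fV VE evE in \<open>auto simp: \<eta>_def\<close>)
      also have "\<dots> \<le> 2 ^ card V * (q\<^sup>2) ^ ?k"
        by (intro mult_left_mono power_mono) (use \<epsilon> in \<open>auto simp: \<eta>_def\<close>)
      also have "\<dots> \<le> 2 ^ card V * q ^ card V"
        unfolding power_mult[symmetric] using q by (intro mult_left_mono power_decreasing) auto
      also have "\<dots> = exp (- K) ^ card V" by (simp add: q_def power_mult_distrib[symmetric])
      also have "\<dots> = exp (- K * real (card V))" by (simp add: exp_of_nat_mult[symmetric] mult.commute)
      also have "\<dots> \<le> exp (- K * real n ^ CARD('n))"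
        using \<open>real n ^ CARD('n) \<le> real (card V)\<close> K by simp
      finally show "prob (LD M \<tau> b n g \<epsilon>) \<le> exp (- K * real n ^ CARD('n))" .
    qed
    then have "ereal K \<le> liminf (LD_cost M \<tau> b g \<epsilon>)"
      by (intro Liminf_bounded) (auto simp: eventually_sequentially intro!: exI[of _ 1])
    then show ?thesis using \<epsilon> by auto
  qed
  show ?thesis
  proof (rule ereal_top)
    fix B :: real
    obtain \<epsilon> where "\<epsilon> > 0" "ereal (max B 1) \<le> liminf (LD_cost M \<tau> b g \<epsilon>)"
    proof -
      have "0 < max B 1" by simp
      from main[OF this] show ?thesis using that by blast
    qed
    then have "ereal (max B 1) \<le> rate_lower M \<tau> b g"
      unfolding rates_eq_SUP(1)[OF g] by (intro SUP_upper2[of \<epsilon>]) auto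
    then show "ereal B \<le> rate_lower M \<tau> b g" by (rule order_trans[rotated]) simp
  qed
qed

end

section \<open>Upper bound on the probability when the norm exceeds the time constant\<close>

lemma is_norm_le_l1norm:
  fixes \<mu> :: "real ^ 'n \<Rightarrow> real"
  assumes "is_norm \<mu>"
  obtains C where "0 \<le> C" "\<And>x. \<mu> x \<le> C * l1norm x"
proof
  let ?C = "\<Sum>i\<in>UNIV. \<mu> (axis i 1)"
  have nn: "0 \<le> \<mu> x" for x using assms by (auto simp: is_norm_def)
  show "0 \<le> ?C" by (intro sum_nonneg nn)
  fix x
  have "\<mu> x \<le> (\<Sum>i\<in>UNIV. \<bar>x $ i\<bar> * \<mu> (axis i 1))" by (rule is_norm_sum_le[OF assms])
  also have "\<dots> \<le> (\<Sum>i\<in>UNIV. l1norm x * \<mu> (axis i 1))"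
    by (intro sum_mono mult_right_mono component_le_l1norm nn)
  finally show "\<mu> x \<le> ?C * l1norm x" by (simp add: sum_distrib_left mult.commute)
qed

definition vfloor :: "real ^ 'n \<Rightarrow> real ^ 'n" where
  "vfloor x = (\<chi> i. real_of_int \<lfloor>x $ i\<rfloor>)"

lemma vfloor_Zd [simp]: "vfloor x \<in> Zd"
  by (simp add: vfloor_def Zd_def)

lemma l1norm_vfloor: "l1norm (x - vfloor x :: real ^ 'n) \<le> CARD('n)"
proof -
  have "\<bar>(x - vfloor x) $ i\<bar> \<le> 1" for i
    unfolding vfloor_def by (simp add: abs_le_iff) linarith
  then show ?thesis using l1norm_bound[of "x - vfloor x" 1] by simp
qed

text \<open>Scaling by \<open>N\<close> enlarges the gap between the norms linearly, while rounding
  to a lattice point changes each of them by a bounded amount.\<close>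

lemma norms_separate_Zd:
  fixes g \<mu> :: "real ^ 'n \<Rightarrow> real"
  assumes g: "is_norm g" and \<mu>: "is_norm \<mu>" and x: "\<mu> x < g x"
  obtains z where "z \<in> Zd" "\<mu> z < g z"
proof -
  obtain B where B: "0 \<le> B" "\<And>x. g x \<le> B * l1norm x" using is_norm_le_l1norm[OF g] by metis
  obtain C where C: "0 \<le> C" "\<And>x. \<mu> x \<le> C * l1norm x" using is_norm_le_l1norm[OF \<mu>] by metis
  obtain N :: nat where N: "(B + C) * CARD('n) < real N * (g x - \<mu> x)"
    using reals_Archimedean3[of "g x - \<mu> x"] x by auto
  define z where "z = vfloor (real N *\<^sub>R x)"
  have tri: "f (u + v) \<le> f u + f v" "f (c *\<^sub>R u) = \<bar>c\<bar> * f u" if "is_norm f" for f :: "real ^ 'n \<Rightarrow> real" and c u v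
    using that by (auto simp: is_norm_def)
  have d: "l1norm (real N *\<^sub>R x - z) \<le> CARD('n)" unfolding z_def by (rule l1norm_vfloor)
  have "real N * g x = g (real N *\<^sub>R x)" by (simp add: tri(2)[OF g])
  also have "\<dots> \<le> g z + g (real N *\<^sub>R x - z)" using tri(1)[OF g, of z "real N *\<^sub>R x - z"] by simp
  also have "g (real N *\<^sub>R x - z) \<le> B * CARD('n)"
    using B(2)[of "real N *\<^sub>R x - z"] mult_left_mono[OF d B(1)] by linarith
  finally have 1: "real N * g x \<le> g z + B * CARD('n)" by simp
  have "\<mu> z \<le> \<mu> (real N *\<^sub>R x) + \<mu> (z - real N *\<^sub>R x)"
    using tri(1)[OF \<mu>, of "real N *\<^sub>R x" "z - real N *\<^sub>R x"] by simp
  also have "\<mu> (real N *\<^sub>R x) = real N * \<mu> x" by (simp add: tri(2)[OF \<mu>])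
  also have "\<mu> (z - real N *\<^sub>R x) \<le> C * CARD('n)"
    using C(2)[of "z - real N *\<^sub>R x"] mult_left_mono[OF d C(1)] by (simp add: l1norm_minus_commute)
  finally have 2: "\<mu> z \<le> real N * \<mu> x + C * CARD('n)" by simp
  have "real N * \<mu> x + C * CARD('n) < real N * g x - B * CARD('n)"
    using N by (simp add: algebra_simps)
  then have "\<mu> z < g z" using 1 2 by linarith
  then show ?thesis by (rule that[rotated]) (simp add: z_def)
qed

lemma card_Zd_interval:
  assumes "p \<le> q + 1"
  shows "finite {w :: real ^ 'n \<in> Zd. \<forall>i. real_of_int p \<le> w $ i \<and> w $ i \<le> real_of_int q}"
    and "card {w :: real ^ 'n \<in> Zd. \<forall>i. real_of_int p \<le> w $ i \<and> w $ i \<le> real_of_int q} = nat (q + 1 - p) ^ CARD('n)"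
proof -
  have "{w :: real ^ 'n \<in> Zd. \<forall>i. real_of_int p \<le> w $ i \<and> w $ i \<le> real_of_int q}
      = {w. \<forall>i. w $ i \<in> real_of_int ` {p..q}}"
  proof (rule set_eqI)
    fix w :: "real ^ 'n"
    have "(w $ i \<in> \<int> \<and> real_of_int p \<le> w $ i \<and> w $ i \<le> real_of_int q) \<longleftrightarrow> w $ i \<in> real_of_int ` {p..q}" for i
      by (auto elim!: Ints_cases)
    then show "w \<in> {w \<in> Zd. \<forall>i. real_of_int p \<le> w $ i \<and> w $ i \<le> real_of_int q}
        \<longleftrightarrow> w \<in> {w. \<forall>i. w $ i \<in> real_of_int ` {p..q}}" by (auto simp: Zd_def)
  qed
  then show "finite {w :: real ^ 'n \<in> Zd. \<forall>i. real_of_int p \<le> w $ i \<and> w $ i \<le> real_of_int q}"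
    "card {w :: real ^ 'n \<in> Zd. \<forall>i. real_of_int p \<le> w $ i \<and> w $ i \<le> real_of_int q} = nat (q + 1 - p) ^ CARD('n)"
    using card_lattice_box[where A = "\<lambda>_ :: 'n. {p..q}"] by (simp_all add: prod_constant algebra_simps)
qed

lemma Zd_neq_component: "w \<noteq> w' \<Longrightarrow> \<exists>i. w $ i \<noteq> w' $ i"
  by (auto simp: vec_eq_iff)

lemma half_le_nat_floor: "2 \<le> x \<Longrightarrow> x / 2 \<le> real (nat \<lfloor>x\<rfloor>)" for x :: real
  by linarith

context fpp begin

section \<open>Slow blocks and their independence\<close>

lemma prob_card_measurable:
  assumes "finite V" "\<And>v. v \<in> V \<Longrightarrow> E v \<in> events"
  shows "{\<omega> \<in> space M. k \<le> card {v \<in> V. \<omega> \<in> E v}} \<in> events"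
proof -
  have "(\<lambda>\<omega>. \<Sum>v\<in>V. indicator (E v) \<omega> :: real) \<in> borel_measurable M"
    using assms by (intro borel_measurable_sum borel_measurable_indicator) auto
  then have "{\<omega> \<in> space M. real k \<le> (\<Sum>v\<in>V. indicator (E v) \<omega>)} \<in> events" by measurable
  moreover have "(\<Sum>v\<in>V. indicator (E v) \<omega>) = real (card {v \<in> V. \<omega> \<in> E v})" for \<omega>
    using assms(1) by (simp add: indicator_def sum.If_cases Int_def)
  ultimately show ?thesis by (simp only: of_nat_le_iff)
qed

abbreviation nbox :: "nat \<Rightarrow> nat \<Rightarrow> real ^ 'n \<Rightarrow> (real ^ 'n) set" where
  "nbox r m v \<equiv> cbox (v - corner (r * m)) (v + corner (r * m))"

lemma mem_nbox: "w \<in> nbox r m v \<longleftrightarrow> (\<forall>i. \<bar>w $ i - v $ i\<bar> \<le> real (r * m))"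
proof -
  have "v $ i - real (r * m) \<le> w $ i \<and> w $ i \<le> v $ i + real (r * m) \<longleftrightarrow> \<bar>w $ i - v $ i\<bar> \<le> real (r * m)" for i
    by linarith
  then show ?thesis by (simp add: mem_box_cart)
qed

text \<open>The passage time is taken in the box of half-width \<open>reach z * m\<close> around
  \<open>v\<close>, so that the edges of this box determine the event. In use \<open>c\<close> lies
  slightly above \<mu> \<open>z\<close>.\<close>

definition slow :: "(real ^ 'n) \<Rightarrow> real \<Rightarrow> nat \<Rightarrow> real ^ 'n \<Rightarrow> 'w set" where
  "slow z c m v = {\<omega> \<in> space M. real m * c <
      passage_time b (\<lambda>e. \<tau> e \<omega>) (nbox (reach z) m v) v (v + real m *\<^sub>R z)}"

lemma nbox_mem: "v \<in> nbox r m v" "v + real m *\<^sub>R z \<in> nbox (reach z) m v"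
proof -
  show "v \<in> nbox r m v" unfolding mem_nbox by simp
  have "real m *\<^sub>R z \<in> cbox (- corner (reach z * m)) (corner (reach z * m))"
    by (rule reach_box) (use ab in \<open>auto intro!: mult_right_mono\<close>)
  then show "v + real m *\<^sub>R z \<in> nbox (reach z) m v"
    unfolding mem_cbox_corner mem_nbox by simp
qed

lemma slow_events: "slow z c m v \<in> events"
  unfolding slow_def using box_passage_measurable[OF nbox_mem] by measurable

lemma nbox_Zd: "v \<in> Zd \<Longrightarrow> v - corner r \<in> Zd" "v \<in> Zd \<Longrightarrow> v + corner r \<in> Zd"
  by auto

lemma slow_block:
  assumes "v \<in> Zd"
  shows "\<exists>B. B \<in> sets (PiM (box_edges (v - corner (reach z * m)) (v + corner (reach z * m))) (\<lambda>_. \<nu>)) \<and>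
    slow z c m v = {\<omega> \<in> space M. (\<lambda>e\<in>box_edges (v - corner (reach z * m)) (v + corner (reach z * m)). \<tau> e \<omega>) \<in> B}"
proof -
  let ?l = "v - corner (reach z * m)" and ?u = "v + corner (reach z * m)"
  let ?E = "box_edges ?l ?u"
  let ?B = "{f \<in> space (PiM ?E (\<lambda>_. \<nu>)). real m * c < box_time ?l ?u v (v + real m *\<^sub>R z) f}"
  have B: "?B \<in> sets (PiM ?E (\<lambda>_. \<nu>))"
    using box_time_measurable[OF nbox_mem] by measurable
  have E: "(\<lambda>e. e) ` ?E \<subseteq> edges" by (auto simp: box_edges_def)
  have "slow z c m v = {\<omega> \<in> space M. (\<lambda>e\<in>?E. \<tau> e \<omega>) \<in> ?B}"
    unfolding slow_def using measurable_space[OF restrict_measurable[OF E]] assms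
    by (auto simp: box_time_restrict nbox_Zd simp del: of_nat_mult)
  then show ?thesis using B by (intro exI[of _ ?B] conjI)
qed

lemma prob_slow:
  assumes "v \<in> Zd" "z \<in> Zd"
  shows "prob (slow z c m v) = prob (slow z c m 0)"
proof -
  have "prob {\<omega> \<in> space M. passage_time b (\<lambda>e. \<tau> e \<omega>) (cbox (v + - corner (reach z * m)) (v + corner (reach z * m))) (v + 0) (v + real m *\<^sub>R z) \<in> {real m * c<..}}
    = prob {\<omega> \<in> space M. passage_time b (\<lambda>e. \<tau> e \<omega>) (cbox (- corner (reach z * m)) (corner (reach z * m))) 0 (real m *\<^sub>R z) \<in> {real m * c<..}}"
    by (rule prob_translate) (use assms nbox_mem[of 0] in \<open>auto simp del: of_nat_mult\<close>)
  then show ?thesis by (simp add: slow_def)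
qed

lemma slow_independent:
  assumes S: "finite S" "S \<noteq> {}" "S \<subseteq> Zd" and z: "z \<in> Zd"
    and sep: "\<And>v w. v \<in> S \<Longrightarrow> w \<in> S \<Longrightarrow> v \<noteq> w \<Longrightarrow> nbox (reach z) m v \<inter> nbox (reach z) m w = {}"
  shows "prob {\<omega> \<in> space M. \<forall>v\<in>S. \<omega> \<in> slow z c m v} = prob (slow z c m 0) ^ card S"
proof -
  let ?K = "\<lambda>v. box_edges (v - corner (reach z * m)) (v + corner (reach z * m))"
  have "\<forall>v\<in>S. \<exists>B. B \<in> sets (PiM (?K v) (\<lambda>_. \<nu>)) \<and> slow z c m v = {\<omega> \<in> space M. (\<lambda>e\<in>?K v. \<tau> e \<omega>) \<in> B}"
    using slow_block S(3) by auto
  from bchoice[OF this] obtain B where "\<forall>v\<in>S. B v \<in> sets (PiM (?K v) (\<lambda>_. \<nu>)) \<and>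
      slow z c m v = {\<omega> \<in> space M. (\<lambda>e\<in>?K v. \<tau> e \<omega>) \<in> B v}"
    by (elim exE)
  then have B: "B v \<in> sets (PiM (?K v) (\<lambda>_. \<nu>))"
      "slow z c m v = {\<omega> \<in> space M. (\<lambda>e\<in>?K v. \<tau> e \<omega>) \<in> B v}" if "v \<in> S" for v
    using that by (auto dest: bspec)
  have "prob {\<omega> \<in> space M. \<forall>v\<in>S. (\<lambda>e\<in>?K v. \<tau> e \<omega>) \<in> B v}
      = (\<Prod>v\<in>S. prob {\<omega> \<in> space M. (\<lambda>e\<in>?K v. \<tau> e \<omega>) \<in> B v})"
  proof (rule prob_blocks[OF S(1,2)])
    show "disjoint_family_on ?K S"
      unfolding disjoint_family_on_def
    proof (intro ballI impI)
      fix v w assume vw: "v \<in> S" "w \<in> S" "v \<noteq> w"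
      show "?K v \<inter> ?K w = {}"
      proof (rule equals0I)
        fix e assume "e \<in> ?K v \<inter> ?K w"
        then have e: "e \<in> edges" "e \<subseteq> nbox (reach z) m v" "e \<subseteq> nbox (reach z) m w"
          by (simp_all only: box_edges_def Int_iff mem_Collect_eq)
        then obtain x where "x \<in> e" using edge_nonempty[of e] by blast
        then have "x \<in> nbox (reach z) m v \<inter> nbox (reach z) m w"
          using e by (simp only: Int_iff subset_iff)
        then show False unfolding sep[OF vw] by simp
      qed
    qed
    show "?K v \<subseteq> edges" for v by (simp only: box_edges_def) blast
    show "B v \<in> sets (PiM (?K v) (\<lambda>_. \<nu>))" if "v \<in> S" for v by (rule B(1)[OF that])
  qed
  also have "{\<omega> \<in> space M. \<forall>v\<in>S. (\<lambda>e\<in>?K v. \<tau> e \<omega>) \<in> B v} = {\<omega> \<in> space M. \<forall>v\<in>S. \<omega> \<in> slow z c m v}"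
  proof (intro Collect_cong conj_cong ball_cong refl)
    fix \<omega> v assume "\<omega> \<in> space M" "v \<in> S"
    then show "(\<lambda>e\<in>?K v. \<tau> e \<omega>) \<in> B v \<longleftrightarrow> \<omega> \<in> slow z c m v"
      unfolding B(2)[OF \<open>v \<in> S\<close>] mem_Collect_eq by (simp only: simp_thms)
  qed
  also have "(\<Prod>v\<in>S. prob {\<omega> \<in> space M. (\<lambda>e\<in>?K v. \<tau> e \<omega>) \<in> B v}) = (\<Prod>v\<in>S. prob (slow z c m 0))"
  proof (rule prod.cong[OF refl])
    fix v assume v: "v \<in> S"
    then show "prob {\<omega> \<in> space M. (\<lambda>e\<in>?K v. \<tau> e \<omega>) \<in> B v} = prob (slow z c m 0)"
      unfolding B(2)[OF v, symmetric] using prob_slow[OF _ z] S(3) by blast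
  qed
  finally show ?thesis by simp
qed

text \<open>Points are coloured by the residues of their coordinates modulo
  \<open>2 * reach z + 1\<close>. After scaling by \<open>m\<close>, two different points of one
  colour differ in some coordinate by more than twice the half-width of the boxes, so the boxes are
  disjoint and the slow events independent.\<close>

lemma many_slow:
  fixes z :: "real ^ 'n"
  assumes z: "z \<in> Zd" and m: "m > 0" and \<eta>: "prob (slow z c m 0) \<le> \<eta>"
    and k: "k' * (2 * reach z + 1) ^ CARD('n) \<le> k" "0 < k'"
    and V: "finite V" "V \<subseteq> Zd"
  shows "prob {\<omega> \<in> space M. k \<le> card {w \<in> V. \<omega> \<in> slow z c m (real m *\<^sub>R w)}} \<le> 2 ^ card V * \<eta> ^ k'"
proof -
  define Q where "Q = 2 * int (reach z) + 1"
  define col where "col w = (\<lambda>i. \<lfloor>w $ i\<rfloor> mod Q)" for w :: "real ^ 'n"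
  let ?C = "PiE UNIV (\<lambda>_ :: 'n. {0..<Q})"
  have Q: "Q > 0" by (simp add: Q_def)
  have cC: "card ?C = (2 * reach z + 1) ^ CARD('n)"
    by (simp add: card_PiE prod_constant Q_def nat_add_distrib nat_mult_distrib)
  have sc: "real m *\<^sub>R w \<in> Zd" if "w \<in> Zd" for w :: "real ^ 'n" using that by auto
  show ?thesis
  proof (rule prob_many_bad[where C = ?C and col = col])
    fix S c' assume S: "S \<subseteq> V" "S \<noteq> {}" "\<And>v. v \<in> S \<Longrightarrow> col v = c'"
    let ?S = "(\<lambda>w. real m *\<^sub>R w) ` S"
    have inj: "inj_on (\<lambda>w :: real ^ 'n. real m *\<^sub>R w) S" using m by (auto simp: inj_on_def)
    have "prob {\<omega> \<in> space M. \<forall>v\<in>?S. \<omega> \<in> slow z c m v} = prob (slow z c m 0) ^ card ?S"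
    proof (rule slow_independent)
      fix v w assume "v \<in> ?S" "w \<in> ?S" "v \<noteq> w"
      then obtain v' w' where vw: "v' \<in> S" "w' \<in> S" "v' \<noteq> w'" "v = real m *\<^sub>R v'" "w = real m *\<^sub>R w'" by auto
      then obtain i where i: "v' $ i \<noteq> w' $ i" using Zd_neq_component by blast
      have "v' $ i \<in> \<int>" "w' $ i \<in> \<int>" using vw S V by (auto simp: Zd_def)
      then obtain p q where pq: "v' $ i = of_int p" "w' $ i = of_int q" by (elim Ints_cases) auto
      have "col v' i = col w' i" using S(3) vw by simp
      then have "p mod Q = q mod Q" using pq by (simp add: col_def)
      then have "Q dvd p - q" by (simp add: mod_eq_dvd_iff)
      then have "Q \<le> \<bar>p - q\<bar>" using i pq Q by (simp add: zdvd_imp_le)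
      then have "2 * real (reach z) + 1 \<le> \<bar>v' $ i - w' $ i\<bar>" unfolding pq Q_def by linarith
      then have "(2 * real (reach z) + 1) * real m \<le> \<bar>v' $ i - w' $ i\<bar> * real m" by (rule mult_right_mono) simp
      also have "\<dots> = \<bar>v $ i - w $ i\<bar>"
        unfolding vw by (simp add: abs_mult[symmetric] algebra_simps) (simp add: right_diff_distrib[symmetric] abs_mult)
      finally have far: "2 * real (reach z * m) < \<bar>v $ i - w $ i\<bar>" using m by (simp add: algebra_simps)
      show "nbox (reach z) m v \<inter> nbox (reach z) m w = {}"
      proof (rule ccontr)
        assume "nbox (reach z) m v \<inter> nbox (reach z) m w \<noteq> {}"
        then obtain u where "u \<in> nbox (reach z) m v" "u \<in> nbox (reach z) m w" by blast
        then have "\<bar>u $ i - v $ i\<bar> \<le> real (reach z * m)" "\<bar>u $ i - w $ i\<bar> \<le> real (reach z * m)"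
          unfolding mem_nbox by blast+
        then show False using far by linarith
      qed
    next
      show "finite ?S" using finite_subset[OF S(1) V(1)] by simp
    qed (use S V z sc in auto)
    also have "card ?S = card S" by (rule card_image[OF inj])
    also have "prob (slow z c m 0) ^ card S \<le> \<eta> ^ card S" using \<eta> by (intro power_mono) auto
    finally show "prob {\<omega> \<in> space M. \<forall>v\<in>S. \<omega> \<in> slow z c m (real m *\<^sub>R v)} \<le> \<eta> ^ card S" by simp
  next
    show "0 \<le> \<eta>" using \<eta> measure_nonneg order_trans by blast
    show "col ` V \<subseteq> ?C" using Q by (auto simp: col_def)
    show "?C \<noteq> {}" using cC by (metis card.empty add_gr_0 less_one not_less_zero power_eq_0_iff)
    show "finite ?C" by (intro finite_PiE) auto
    show "k' * card ?C \<le> k" unfolding cC by (rule k)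
  qed (use V k slow_events in auto)
qed

text \<open>Consider lines of \<open>J\<close> consecutive steps \<open>real m *\<^sub>R z\<close>.
  On \<open>LD\<close> such a line takes at least \<open>J * m * g z\<close> up to a small error,
  whereas a step that is not slow takes at most \<open>m * c\<close> with \<open>c\<close> below
  \<open>g z\<close>. So a fixed fraction of the steps of every line is slow, and counting pairs of
  a line and a position yields a fixed fraction of slow lattice points.\<close>

lemma rate_pos:
  fixes g :: "real ^ 'n \<Rightarrow> real"
  assumes g: "g \<in> norms a b" and tc: "is_time_constant M \<tau> b \<mu>" and x: "\<mu> x < g x"
  shows "0 < rate_lower M \<tau> b g"
proof -
  have \<mu>: "is_norm \<mu>" using tc by (simp add: is_time_constant_def)
  have gn: "is_norm g" using g by (simp add: norms_def)
  obtain z where z: "z \<in> Zd" "\<mu> z < g z" using norms_separate_Zd[OF gn \<mu> x] by auto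
  define Z where "Z = l1norm z"
  have "0 \<le> \<mu> 0" using \<mu> unfolding is_norm_def by blast
  then have "z \<noteq> 0" using z(2) normsD(2)[OF g] by auto
  then have Z: "0 < Z" unfolding Z_def by (metis l1norm_eq_0 l1norm_nonneg order_le_less)
  \<comment> \<open>The gap between the norms at \<open>z\<close> is cut into four parts: one goes
    into the threshold \<open>c\<close>, one is consumed by the error of \<open>LD\<close>, and two
    remain as the gain behind \<open>c0\<close>.\<close>
  define \<delta> where "\<delta> = (g z - \<mu> z) / 4"
  have \<delta>: "0 < \<delta>" "g z = \<mu> z + 4 * \<delta>" using z by (auto simp: \<delta>_def field_simps)
  define c where "c = \<mu> z + \<delta>"
  \<comment> \<open>The number \<open>J\<close> of steps will be at least
    \<open>n / (16 * m * Z)\<close>, which bounds the error \<open>\<epsilon> * n\<close> by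
    \<open>\<delta> * m * J\<close>.\<close>
  define \<epsilon> where "\<epsilon> = \<delta> / (16 * Z)"
  have \<epsilon>: "0 < \<epsilon>" using \<delta> Z by (simp add: \<epsilon>_def)
  define r where "r = reach z"
  define Q where "Q = (2 * r + 1) ^ CARD('n)"
  have Q: "0 < Q" by (simp add: Q_def)
  \<comment> \<open>A slow step is charged at most \<open>m * (b * Z)\<close> above
    \<open>m * c\<close>, while the average excess per step is at least
    \<open>2 * \<delta> * m\<close>; the quotient is the guaranteed fraction of slow steps.\<close>
  define c0 where "c0 = 2 * \<delta> / (b * Z)"
  have c0: "0 < c0" using \<delta> b_pos Z by (simp add: c0_def)
  \<comment> \<open>The start points \<open>Vi\<close> amount to at least one part in
    \<open>8 ^ CARD('n)\<close> of all points \<open>Va\<close>.\<close>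
  define c1 where "c1 = c0 / 8 ^ CARD('n)"
  have c1: "0 < c1" using c0 by (simp add: c1_def)
  \<comment> \<open>\<open>Q\<close> is the number of colours, and the factor 2 absorbs the rounding
    of \<open>k'\<close>.\<close>
  define c2 where "c2 = c1 / (2 * real Q)"
  have c2: "0 < c2" using c1 Q by (simp add: c2_def)
  \<comment> \<open>With this value \<open>\<eta> ^ k'\<close> cancels the
    \<open>2 ^ card Va\<close> of the union bound and leaves \<open>exp (- card Va)\<close>.\<close>
  define \<eta> where "\<eta> = exp (- (1 + ln 2) / c2)"
  have \<eta>: "0 < \<eta>" by (simp add: \<eta>_def)
  have "(\<lambda>m. prob {\<omega> \<in> space M. \<delta> * real m < \<bar>passage_time b (\<lambda>e. \<tau> e \<omega>)
      (cbox (- corner (reach z * m)) (corner (reach z * m))) 0 (real m *\<^sub>R z) - real m * \<mu> z\<bar>}) \<longlonglongrightarrow> 0"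
    by (rule time_constant_prob[OF tc z(1) \<delta>(1)])
  then have "\<forall>\<^sub>F m in sequentially. prob {\<omega> \<in> space M. \<delta> * real m < \<bar>passage_time b (\<lambda>e. \<tau> e \<omega>)
      (cbox (- corner (reach z * m)) (corner (reach z * m))) 0 (real m *\<^sub>R z) - real m * \<mu> z\<bar>} < \<eta>"
    using \<eta> by (rule order_tendstoD)
  from eventually_happens[OF eventually_conj[OF this eventually_gt_at_top[of 0]]]
  obtain m where m: "0 < m" and mp: "prob {\<omega> \<in> space M. \<delta> * real m < \<bar>passage_time b (\<lambda>e. \<tau> e \<omega>)
      (cbox (- corner (reach z * m)) (corner (reach z * m))) 0 (real m *\<^sub>R z) - real m * \<mu> z\<bar>} < \<eta>"
    by auto
  have oz: "(0 :: real ^ 'n) \<in> cbox (- corner (reach z * m)) (corner (reach z * m))"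
      "real m *\<^sub>R z \<in> cbox (- corner (reach z * m)) (corner (reach z * m))"
    using nbox_mem[of 0] by auto
  have "prob (slow z c m 0) \<le> prob {\<omega> \<in> space M. \<delta> * real m < \<bar>passage_time b (\<lambda>e. \<tau> e \<omega>)
      (cbox (- corner (reach z * m)) (corner (reach z * m))) 0 (real m *\<^sub>R z) - real m * \<mu> z\<bar>}"
  proof (rule finite_measure_mono)
    show "slow z c m 0 \<subseteq> {\<omega> \<in> space M. \<delta> * real m < \<bar>passage_time b (\<lambda>e. \<tau> e \<omega>)
      (cbox (- corner (reach z * m)) (corner (reach z * m))) 0 (real m *\<^sub>R z) - real m * \<mu> z\<bar>}"
      by (auto simp: slow_def c_def algebra_simps)
    show "{\<omega> \<in> space M. \<delta> * real m < \<bar>passage_time b (\<lambda>e. \<tau> e \<omega>)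
      (cbox (- corner (reach z * m)) (corner (reach z * m))) 0 (real m *\<^sub>R z) - real m * \<mu> z\<bar>} \<in> events"
      using box_passage_measurable[OF oz] by measurable
  qed
  then have ps: "prob (slow z c m 0) \<le> \<eta>" using mp by simp
  have step: "prob (LD M \<tau> b n g \<epsilon>) \<le> exp (- (1 / real m ^ CARD('n)) * real n ^ CARD('n))"
    if big: "16 * real m * Z \<le> real n" "8 * real (r * m) \<le> real n" "8 * real m \<le> real n"
      "2 * real Q / c1 \<le> (real n / real m) ^ CARD('n)" for n
  proof -
    have n: "n > 0" using big(3) m by (cases n) auto
    \<comment> \<open>A point \<open>w\<close> stands for \<open>real m *\<^sub>R w\<close>.
      \<open>Va\<close> covers the whole cube, \<open>Vi\<close> only the middle half in each
      coordinate: lines of length at most \<open>n / 8\<close> and boxes of half-width at most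
      \<open>n / 8\<close> around their points then stay in the cube.\<close>
    define Va where "Va = {w :: real ^ 'n \<in> Zd. \<forall>i. real_of_int 0 \<le> w $ i \<and> w $ i \<le> real_of_int (int (n div m))}"
    define p q where "p = \<lceil>real n / (4 * real m)\<rceil>" and "q = \<lfloor>3 * real n / (4 * real m)\<rfloor>"
    define Vi where "Vi = {w :: real ^ 'n \<in> Zd. \<forall>i. real_of_int p \<le> w $ i \<and> w $ i \<le> real_of_int q}"
    have nm: "8 \<le> real n / real m" using big(3) m by (simp add: field_simps)
    have fVa: "finite Va" and cVa: "card Va = (n div m + 1) ^ CARD('n)"
      unfolding Va_def using card_Zd_interval[of 0 "int (n div m)", where 'n = 'n]
      by (simp_all add: nat_add_distrib)
    have qp: "real_of_int (q + 1 - p) \<ge> real n / (4 * real m)"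
    proof -
      have "real n / (4 * real m) \<ge> 2" "3 * real n / (4 * real m) = 3 * (real n / (4 * real m))"
        using nm by (auto simp: field_simps)
      then show ?thesis unfolding p_def q_def by linarith
    qed
    then have "0 \<le> q + 1 - p" using n m
      by (metis divide_nonneg_nonneg of_int_0_le_iff of_nat_0_le_iff order_trans mult_nonneg_nonneg zero_le_numeral)
    then have pq: "p \<le> q + 1" by simp
    have fVi: "finite Vi" and cVi: "card Vi = nat (q + 1 - p) ^ CARD('n)"
      unfolding Vi_def by (rule card_Zd_interval[OF pq])+
    have "real (n div m) \<le> real n / real m" by (rule of_nat_div_le_of_nat)
    have Vale: "real (card Va) \<le> (2 * (real n / real m)) ^ CARD('n)"
    proof -
      have "real (card Va) = (real (n div m) + 1) ^ CARD('n)" unfolding cVa by (simp add: add.commute)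
      also have "\<dots> \<le> (2 * (real n / real m)) ^ CARD('n)"
        using \<open>real (n div m) \<le> real n / real m\<close> nm by (intro power_mono) auto
      finally show ?thesis .
    qed
    have Vage: "(real n / real m) ^ CARD('n) \<le> real (card Va)"
    proof -
      have "real n / real m \<le> real (n div m) + 1"
      proof -
        have "n < (n div m + 1) * m" using m
          by (metis Suc_eq_plus1 dividend_less_div_times mult.commute add.commute mult_Suc)
        then have "real n < real ((n div m + 1) * m)" by (rule of_nat_less_iff[THEN iffD2])
        then show ?thesis using m by (simp add: field_simps)
      qed
      then have "(real n / real m) ^ CARD('n) \<le> (real (n div m) + 1) ^ CARD('n)" by (intro power_mono) auto
      then show ?thesis unfolding cVa by (simp add: add.commute)
    qed
    have Vige: "real (card Va) \<le> 8 ^ CARD('n) * real (card Vi)"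
    proof -
      have "real (card Va) \<le> (8 * (real n / (4 * real m))) ^ CARD('n)" using Vale by (simp add: field_simps)
      also have "\<dots> \<le> (8 * real_of_int (q + 1 - p)) ^ CARD('n)" using qp by (intro power_mono mult_left_mono) auto
      also have "\<dots> = 8 ^ CARD('n) * real (card Vi)"
      proof -
        have "real_of_int (q + 1 - p) = real (nat (q + 1 - p))" using pq by simp
        then show ?thesis unfolding cVi by (simp only: power_mult_distrib of_nat_power)
      qed
      finally show ?thesis .
    qed
    define J where "J = nat \<lfloor>real n / (8 * real m * Z)\<rfloor>"
    have J1: "real J * (real m * Z) \<le> real n / 8"
    proof -
      have "0 \<le> real n / (8 * real m * Z)" using Z by simp
      then have "real J \<le> real n / (8 * real m * Z)" unfolding J_def by linarith
      then have "real J * (real m * Z) \<le> real n / (8 * real m * Z) * (real m * Z)"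
        using Z by (intro mult_right_mono) auto
      then show ?thesis using Z m by (simp add: field_simps)
    qed
    have J2: "real n / (16 * real m * Z) \<le> real J"
    proof -
      have "2 \<le> real n / (8 * real m * Z)" using big(1) Z m by (simp add: field_simps)
      moreover have "real n / (16 * real m * Z) = (real n / (8 * real m * Z)) / 2" by simp
      ultimately show ?thesis unfolding J_def by linarith
    qed
    let ?bad = "\<lambda>w. slow z c m (real m *\<^sub>R w)"
    define k' where "k' = nat \<lfloor>c1 * real (card Va) / real Q\<rfloor>"
    have k'1: "real k' * real Q \<le> c1 * real (card Va)"
    proof -
      have "0 \<le> c1 * real (card Va) / real Q" using c1 by simp
      then have "real k' \<le> c1 * real (card Va) / real Q" unfolding k'_def by linarith
      then show ?thesis using Q by (simp add: field_simps)
    qed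
    have k'2: "c2 * real (card Va) \<le> real k'"
    proof -
      have "2 * real Q / c1 \<le> real (card Va)" using big(4) Vage by linarith
      then have "2 \<le> c1 * real (card Va) / real Q" using c1 Q by (simp add: field_simps)
      moreover have "c2 * real (card Va) = (c1 * real (card Va) / real Q) / 2" by (simp add: c2_def)
      ultimately show ?thesis unfolding k'_def using half_le_nat_floor by metis
    qed
    have "card Va > 0" unfolding cVa by simp
    then have k'0: "0 < k'" using k'2 c2
      by (metis mult_pos_pos not_gr_zero of_nat_0 of_nat_0_less_iff order_less_le_trans less_irrefl)
    have "AE \<omega> in M. \<omega> \<in> LD M \<tau> b n g \<epsilon> \<longrightarrow> \<omega> \<in> {\<omega> \<in> space M. k' * Q \<le> card {w \<in> Va. \<omega> \<in> ?bad w}}"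
      using AE_bounds AE_space
    proof eventually_elim
      fix \<omega> assume bd: "\<forall>e\<in>edges. a \<le> \<tau> e \<omega> \<and> \<tau> e \<omega> \<le> b" and sp: "\<omega> \<in> space M"
      have t0: "0 \<le> \<tau> e \<omega>" if "e \<in> edges" for e using tau_nonneg[OF that sp] .
      show "\<omega> \<in> LD M \<tau> b n g \<epsilon> \<longrightarrow> \<omega> \<in> {\<omega> \<in> space M. k' * Q \<le> card {w \<in> Va. \<omega> \<in> ?bad w}}"
      proof
        assume L: "\<omega> \<in> LD M \<tau> b n g \<epsilon>"
        let ?T = "passage_time b (\<lambda>e. \<tau> e \<omega>) (ncube n)"
        define u where "u w j = w + real j *\<^sub>R z" for w :: "real ^ 'n" and j :: nat
        have uZ: "u w j \<in> Zd" if "w \<in> Zd" for w j using that z(1) by (auto simp: u_def intro!: Zd_add Zd_scale)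
        have ub: "real n / 8 \<le> real m * u w j $ i \<and> real m * u w j $ i \<le> real n - real n / 8"
          if w: "w \<in> Vi" and j: "j \<le> J" for w j i
        proof -
          have "real_of_int p \<le> w $ i" "w $ i \<le> real_of_int q" using w by (auto simp: Vi_def)
          then have "real n / (4 * real m) \<le> w $ i" "w $ i \<le> 3 * real n / (4 * real m)"
            unfolding p_def q_def by linarith+
          then have 1: "real n / 4 \<le> real m * w $ i" "real m * w $ i \<le> 3 * real n / 4"
            using m by (simp_all add: field_simps)
          have "\<bar>real m * (real j * z $ i)\<bar> = real m * (real j * \<bar>z $ i\<bar>)" by (simp add: abs_mult)
          also have "\<dots> \<le> real m * (real J * Z)"
            using j component_le_l1norm[of z i] by (intro mult_left_mono mult_mono) (auto simp: Z_def)
          also have "\<dots> \<le> real n / 8" using J1 by (simp add: mult_ac)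
          finally have 2: "\<bar>real m * (real j * z $ i)\<bar> \<le> real n / 8" .
          have "real m * u w j $ i = real m * w $ i + real m * (real j * z $ i)"
            by (simp add: u_def algebra_simps)
          then show ?thesis using 1 2 by linarith
        qed
        have uin: "real m *\<^sub>R u w j \<in> ncube n" if "w \<in> Vi" "j \<le> J" for w j
        proof -
          have "0 \<le> real m * u w j $ i \<and> real m * u w j $ i \<le> real n" for i
            using ub[OF that, of i] by linarith
          then show ?thesis by (simp add: mem_ncube)
        qed
        have boxin: "nbox r m (real m *\<^sub>R u w j) \<subseteq> ncube n" if "w \<in> Vi" "j \<le> J" for w j
        proof
          fix y assume "y \<in> nbox r m (real m *\<^sub>R u w j)"
          then have y: "\<bar>y $ i - real m * u w j $ i\<bar> \<le> real (r * m)" for i by (simp add: mem_nbox)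
          have "0 \<le> y $ i \<and> y $ i \<le> real n" for i
            using ub[OF that, of i] y[of i] big(2) by linarith
          then show "y \<in> ncube n" by (simp add: mem_ncube)
        qed
        have uVa: "u w j \<in> Va" if "w \<in> Vi" "j \<le> J" for w j
        proof -
          have Zd: "u w j \<in> Zd" using that(1) uZ by (simp add: Vi_def)
          have "0 \<le> u w j $ i \<and> u w j $ i \<le> real (n div m)" for i
          proof -
            have 1: "0 \<le> real m * u w j $ i" "real m * u w j $ i \<le> real n"
              using ub[OF that, of i] by linarith+
            have "u w j $ i \<in> \<int>" using Zd by (simp add: Zd_def)
            then obtain s where s: "u w j $ i = of_int s" by (elim Ints_cases)
            have "0 \<le> s" using 1 m unfolding s by (simp add: zero_le_mult_iff)
            moreover have "nat s * m \<le> n"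
            proof -
              have "real (nat s * m) \<le> real n" using 1 \<open>0 \<le> s\<close> unfolding s by (simp add: mult.commute)
              then show ?thesis by (simp only: of_nat_le_iff)
            qed
            then have "nat s \<le> n div m" using m by (simp add: less_eq_div_iff_mult_less_eq)
            then have "real (nat s) \<le> real (n div m)" by simp
            ultimately show ?thesis unfolding s by simp
          qed
          then show ?thesis using Zd by (simp add: Va_def)
        qed
        have line: "c0 * real J \<le> real (card {j \<in> {..<J}. \<omega> \<in> ?bad (u w j)})" if w: "w \<in> Vi" for w
        proof -
          define v where "v j = real m *\<^sub>R u w j" for j
          have vS: "v (Suc j) = v j + real m *\<^sub>R z" for j by (simp add: v_def u_def algebra_simps)
          have "\<bar>g (v 0 - v J) - ?T (v 0) (v J)\<bar> \<le> \<epsilon> * real n"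
            unfolding v_def by (rule LD_passage[OF g n L]) (use uin[OF w] in auto)
          moreover have "g (v 0 - v J) = real m * real J * g z"
          proof -
            have "v 0 - v J = (- (real m * real J)) *\<^sub>R z" by (simp add: v_def u_def algebra_simps)
            then show ?thesis using normsD(3)[OF g, of "- (real m * real J)" z] by simp
          qed
          ultimately have "real m * real J * g z - \<epsilon> * real n \<le> ?T (v 0) (v J)" by linarith
          also have "\<dots> \<le> (\<Sum>j<J. ?T (v j) (v (Suc j)))"
            by (rule passage_chain) (use uin[OF w] t0 b_pos in \<open>auto simp: v_def\<close>)
          also have "\<dots> \<le> (\<Sum>j<J. real m * c + (if \<omega> \<in> ?bad (u w j) then real m * (b * Z) else 0))"
          proof (rule sum_mono)
            fix j assume j: "j \<in> {..<J}"
            have vin: "v j \<in> ncube n" "v (Suc j) \<in> ncube n"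
              using uin[OF w, of j] uin[OF w, of "Suc j"] j by (auto simp: v_def)
            show "?T (v j) (v (Suc j)) \<le> real m * c + (if \<omega> \<in> ?bad (u w j) then real m * (b * Z) else 0)"
            proof (cases "\<omega> \<in> ?bad (u w j)")
              case True
              have "?T (v j) (v (Suc j)) \<le> b * l1norm (v j - v (Suc j))"
                by (rule passage_le) (use t0 bd b_pos vin in auto)
              also have "\<dots> = real m * (b * Z)" unfolding vS by (simp add: Z_def)
              also have "\<dots> \<le> real m * c + real m * (b * Z)"
                using \<delta> \<mu> by (simp add: c_def is_norm_def)
              finally show ?thesis using True by simp
            next
              case False
              have "?T (v j) (v j + real m *\<^sub>R z)
                  \<le> passage_time b (\<lambda>e. \<tau> e \<omega>) (nbox (reach z) m (v j)) (v j) (v j + real m *\<^sub>R z)"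
                by (rule passage_mono_set)
                  (use t0 b_pos nbox_mem boxin[OF w, of j] j in \<open>auto simp: r_def v_def\<close>)
              also have "\<dots> \<le> real m * c" using False sp by (simp add: slow_def v_def)
              finally show ?thesis using False by (simp add: vS)
            qed
          qed
          also have "\<dots> = real J * (real m * c) + real (card {j \<in> {..<J}. \<omega> \<in> ?bad (u w j)}) * (real m * (b * Z))"
            by (simp add: sum.distrib sum.If_cases Int_def)
          finally have A: "real m * real J * (g z - c) - \<epsilon> * real n
              \<le> real (card {j \<in> {..<J}. \<omega> \<in> ?bad (u w j)}) * (real m * (b * Z))"
            by (simp add: algebra_simps)
          have "\<epsilon> * real n \<le> real m * real J * \<delta>"
          proof -
            have "\<epsilon> * real n = real m * \<delta> * (real n / (16 * real m * Z))"
              using m Z by (simp add: \<epsilon>_def field_simps)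
            also have "\<dots> \<le> real m * \<delta> * real J" using J2 \<delta> by (intro mult_left_mono) auto
            finally show ?thesis by (simp add: mult_ac)
          qed
          moreover have "g z - c = 3 * \<delta>" using \<delta> by (simp add: c_def)
          ultimately have "real m * (2 * \<delta> * real J)
              \<le> real m * (real (card {j \<in> {..<J}. \<omega> \<in> ?bad (u w j)}) * (b * Z))"
            using A by (simp add: algebra_simps)
          then have "2 * \<delta> * real J \<le> real (card {j \<in> {..<J}. \<omega> \<in> ?bad (u w j)}) * (b * Z)" using m by simp
          then show ?thesis using b_pos Z by (simp add: c0_def field_simps)
        qed
        \<comment> \<open>Double counting: after the sums are exchanged, for fixed \<open>j\<close>
          the shift by \<open>real j *\<^sub>R z\<close> maps the slow start points injectively into
          \<open>?B\<close>.\<close>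
        let ?B = "{w \<in> Va. \<omega> \<in> ?bad w}"
        have "real J * (c0 * real (card Vi)) = (\<Sum>w\<in>Vi. c0 * real J)" by simp
        also have "\<dots> \<le> (\<Sum>w\<in>Vi. real (card {j \<in> {..<J}. \<omega> \<in> ?bad (u w j)}))"
          by (rule sum_mono) (rule line)
        also have "\<dots> = (\<Sum>w\<in>Vi. \<Sum>j<J. if \<omega> \<in> ?bad (u w j) then 1 else 0)"
          by (simp add: sum.If_cases Int_def)
        also have "\<dots> = (\<Sum>j<J. \<Sum>w\<in>Vi. if \<omega> \<in> ?bad (u w j) then 1 else 0)" by (rule sum.swap)
        also have "\<dots> = (\<Sum>j<J. real (card {w \<in> Vi. \<omega> \<in> ?bad (u w j)}))"
          using fVi by (simp add: sum.If_cases Int_def)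
        also have "\<dots> \<le> (\<Sum>j<J. real (card ?B))"
        proof (rule sum_mono)
          fix j assume j: "j \<in> {..<J}"
          have "card ((\<lambda>w. u w j) ` {w \<in> Vi. \<omega> \<in> ?bad (u w j)}) = card {w \<in> Vi. \<omega> \<in> ?bad (u w j)}"
            by (rule card_image) (auto simp: inj_on_def u_def)
          moreover have "card ((\<lambda>w. u w j) ` {w \<in> Vi. \<omega> \<in> ?bad (u w j)}) \<le> card ?B"
            by (rule card_mono) (use fVa uVa j in auto)
          ultimately show "real (card {w \<in> Vi. \<omega> \<in> ?bad (u w j)}) \<le> real (card ?B)" by simp
        qed
        also have "\<dots> = real J * real (card ?B)" by simp
        finally have "real J * (c0 * real (card Vi)) \<le> real J * real (card ?B)" .
        moreover have "0 < real J" using J2 n m Z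
          by (smt (verit) divide_pos_pos mult_pos_pos of_nat_0_less_iff)
        ultimately have "c0 * real (card Vi) \<le> real (card ?B)" by simp
        moreover have "c1 * real (card Va) \<le> c0 * real (card Vi)"
        proof -
          have "c1 * real (card Va) \<le> c1 * (8 ^ CARD('n) * real (card Vi))"
            using Vige c1 by (intro mult_left_mono) auto
          then show ?thesis by (simp add: c1_def)
        qed
        ultimately have "real (k' * Q) \<le> real (card ?B)" using k'1 by simp
        then show "\<omega> \<in> {\<omega> \<in> space M. k' * Q \<le> card {w \<in> Va. \<omega> \<in> ?bad w}}"
          using sp by (simp only: of_nat_le_iff mem_Collect_eq)
      qed
    qed
    moreover have "{\<omega> \<in> space M. k' * Q \<le> card {w \<in> Va. \<omega> \<in> ?bad w}} \<in> events"
      by (rule prob_card_measurable[OF fVa slow_events])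
    ultimately have "prob (LD M \<tau> b n g \<epsilon>) \<le> prob {\<omega> \<in> space M. k' * Q \<le> card {w \<in> Va. \<omega> \<in> ?bad w}}"
      by (rule finite_measure_mono_AE)
    also have "\<dots> \<le> 2 ^ card Va * \<eta> ^ k'"
      by (rule many_slow[OF z(1) m ps _ k'0 fVa]) (auto simp: Q_def r_def Va_def)
    also have "\<dots> \<le> exp (ln 2 * real (card Va)) * exp (- (1 + ln 2) * real (card Va))"
    proof -
      have "(2 :: real) ^ card Va = exp (ln 2 * real (card Va))"
        by (simp add: exp_of_nat_mult[symmetric] exp_of_nat2_mult)
      moreover have "\<eta> ^ k' \<le> exp (- (1 + ln 2) * real (card Va))"
      proof -
        have "\<eta> ^ k' = exp (real k' * (- (1 + ln 2) / c2))" unfolding \<eta>_def by (rule exp_of_nat_mult[symmetric])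
        also have "real k' * (- (1 + ln 2) / c2) \<le> (c2 * real (card Va)) * (- (1 + ln 2) / c2)"
        proof (rule mult_right_mono_neg[OF k'2])
          have "0 \<le> ln (2 :: real)" by simp
          then have "- (1 + ln 2) \<le> (0 :: real)" by linarith
          then show "- (1 + ln 2) / c2 \<le> 0" using c2 by (rule divide_nonpos_pos)
        qed
        also have "(c2 * real (card Va)) * (- (1 + ln 2) / c2) = - (1 + ln 2) * real (card Va)"
          using c2 by simp
        finally show ?thesis by simp
      qed
      ultimately show ?thesis by (simp add: mult_left_mono)
    qed
    also have "\<dots> = exp (- real (card Va))" by (simp add: exp_add[symmetric] algebra_simps)
    also have "\<dots> \<le> exp (- (1 / real m ^ CARD('n)) * real n ^ CARD('n))"
      using Vage by (simp add: power_divide)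
    finally show ?thesis .
  qed
  have ev: "\<forall>\<^sub>F n in sequentially. ereal (1 / real m ^ CARD('n)) \<le> LD_cost M \<tau> b g \<epsilon> n"
  proof -
    have 1: "\<forall>\<^sub>F n in sequentially. K \<le> real n" for K :: real
      using filterlim_real_sequentially by (simp add: filterlim_at_top)
    have 2: "\<forall>\<^sub>F n in sequentially. K \<le> (real n / real m) ^ CARD('n)" for K :: real
      using 1[of "real m * max K 1"]
    proof eventually_elim
      case (elim n)
      then have h: "max K 1 \<le> real n / real m"
        using m by (subst pos_le_divide_eq) (simp_all only: of_nat_0_less_iff mult.commute)
      then have "(real n / real m) ^ 1 \<le> (real n / real m) ^ CARD('n)"
        by (intro power_increasing) (auto simp: Suc_le_eq)
      then show ?case using h by simp
    qed
    show ?thesis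
      using 1[of "16 * real m * Z"] 1[of "8 * real (r * m)"] 1[of "8 * real m"] 2[of "2 * real Q / c1"]
    proof eventually_elim
      case (elim n)
      have "n > 0" using elim(3) m by (cases n) auto
      then show ?case by (rule LD_cost_ge) (rule step[OF elim])
    qed
  qed
  then have "ereal (1 / real m ^ CARD('n)) \<le> liminf (LD_cost M \<tau> b g \<epsilon>)" by (rule Liminf_bounded)
  then have "ereal (1 / real m ^ CARD('n)) \<le> rate_lower M \<tau> b g"
    unfolding rates_eq_SUP(1)[OF g] using \<epsilon> by (intro SUP_upper2[of \<epsilon>]) auto
  moreover have "0 < ereal (1 / real m ^ CARD('n))" using m by simp
  ultimately show ?thesis by (rule order.strict_trans2[rotated])
qed

end

section \<open>A skeleton of disjoint segments\<close>

text \<open>In dimension at least 2 a line has empty interior, so an open set stays nonempty when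
  finitely many lines are removed one by one.\<close>

lemma open_avoid_lines:
  fixes U :: "(real ^ 'n) set"
  assumes "CARD('n) \<ge> 2" "open U" "U \<noteq> {}" "finite D"
  shows "open (U - (\<Union>d\<in>D. span {d})) \<and> U - (\<Union>d\<in>D. span {d}) \<noteq> {}"
  using assms(4)
proof (induction D)
  case empty
  then show ?case using assms by simp
next
  case (insert d D)
  let ?W = "U - (\<Union>d\<in>D. span {d})"
  have eq: "U - (\<Union>d\<in>insert d D. span {d}) = ?W - span {d}" by auto
  have "dim (span {d}) \<le> 1" using dim_le_card'[of "{d}"] by simp
  then have "interior (span {d}) = {}"
    using assms(1) by (intro empty_interior_lowdim) simp
  then have "\<not> ?W \<subseteq> span {d}" using insert.IH interior_maximal[of ?W "span {d}"] by auto
  then show ?case unfolding eq using insert.IH by (auto intro!: open_Diff)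
qed

text \<open>Highways are periodic, so directions have to be lattice vectors; positive multiples of
  these are dense.\<close>

lemma rational_multiple_in_open:
  fixes U :: "(real ^ 'n) set"
  assumes "open U" "U \<noteq> {}"
  obtains z s where "z \<in> Zd" "0 < s" "s *\<^sub>R z \<in> U"
proof -
  obtain v where v: "v \<in> U" using assms by auto
  obtain \<rho> where \<rho>: "0 < \<rho>" "ball v \<rho> \<subseteq> U" using assms v by (meson openE)
  obtain N :: nat where N: "CARD('n) < real N * \<rho>" using reals_Archimedean3[OF \<rho>(1)] by blast
  have N0: "0 < N" using N by (cases N) auto
  define z where "z = vfloor (real N *\<^sub>R v)"
  have "norm (v - (1 / real N) *\<^sub>R z) = norm (real N *\<^sub>R v - z) / real N"
  proof -
    have "v - (1 / real N) *\<^sub>R z = (1 / real N) *\<^sub>R (real N *\<^sub>R v - z)"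
      using N0 by (simp add: scaleR_diff_right)
    then show ?thesis by simp
  qed
  also have "\<dots> \<le> CARD('n) / real N"
    using norm_le_l1norm[of "real N *\<^sub>R v - z"] l1norm_vfloor[of "real N *\<^sub>R v"]
    by (intro divide_right_mono) (auto simp: z_def)
  also have "\<dots> < \<rho>" using N N0 by (simp add: field_simps)
  finally have "(1 / real N) *\<^sub>R z \<in> U" using \<rho> by (auto simp: dist_norm)
  then show ?thesis using that[of z "1 / real N"] N0 by (simp add: z_def)
qed

definition open_cube :: "(real ^ 'n) set" where
  "open_cube = {x. \<forall>i. 0 < x $ i \<and> x $ i < 1}"

lemma open_open_cube: "open (open_cube :: (real ^ 'n) set)"
proof -
  have eq: "(open_cube :: (real ^ 'n) set) = box 0 (\<chi> i. (1 :: real))" by (auto simp: open_cube_def mem_box_cart)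
  show ?thesis unfolding eq by (rule open_box)
qed

lemma open_cube_subset: "x \<in> open_cube \<Longrightarrow> x \<in> unit_cube"
  by (auto simp: open_cube_def unit_cube_def less_imp_le)

lemma open_cube_convex:
  fixes x :: "real ^ 'n"
  assumes "x \<in> open_cube" "x + v \<in> open_cube" "0 \<le> r" "r \<le> 1"
  shows "x + r *\<^sub>R v \<in> open_cube"
proof -
  have "convex (open_cube :: (real ^ 'n) set)"
  proof -
    have eq: "(open_cube :: (real ^ 'n) set) = box 0 (\<chi> i. (1 :: real))" by (auto simp: open_cube_def mem_box_cart)
    show ?thesis unfolding eq by (rule convex_box)
  qed
  then have "(1 - r) *\<^sub>R x + r *\<^sub>R (x + v) \<in> open_cube"
    using assms by (intro convexD_alt) auto
  then show ?thesis by (simp add: algebra_simps)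
qed

text \<open>A contraction towards the centre of the cube.\<close>

lemma open_cube_approx:
  fixes x :: "real ^ 'n"
  assumes "x \<in> unit_cube" "0 < e"
  obtains x' where "x' \<in> open_cube" "l1norm (x - x') < e"
proof -
  define r where "r = min (1 / 2) (e / (2 * real CARD('n)))"
  have r: "0 < r" "r \<le> 1 / 2" "r \<le> e / (2 * real CARD('n))" using assms by (auto simp: r_def)
  define x' :: "real ^ 'n" where "x' = (\<chi> i. (1 - r) * x $ i + r * (1 / 2))"
  have c: "0 \<le> x $ i" "x $ i \<le> 1" for i using assms by (auto simp: unit_cube_def)
  have "x' \<in> open_cube"
  proof -
    have "0 < (1 - r) * x $ i + r * (1 / 2)" for i
    proof -
      have "0 \<le> (1 - r) * x $ i" using c[of i] r by (intro mult_nonneg_nonneg) auto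
      then show ?thesis using r by linarith
    qed
    moreover have "(1 - r) * x $ i + r * (1 / 2) < 1" for i
    proof -
      have "(1 - r) * x $ i \<le> 1 - r" using c[of i] r by (intro mult_left_le) auto
      then show ?thesis using r by linarith
    qed
    ultimately show ?thesis by (simp add: open_cube_def x'_def)
  qed
  moreover have "l1norm (x - x') \<le> CARD('n) * (r / 2)"
  proof (rule l1norm_bound[of "x - x'" "r / 2"])
    fix i
    have "(x - x') $ i = r * (x $ i - 1 / 2)" by (simp add: x'_def algebra_simps)
    then have "\<bar>(x - x') $ i\<bar> = r * \<bar>x $ i - 1 / 2\<bar>" using r by (simp add: abs_mult)
    also have "\<bar>x $ i - 1 / 2\<bar> \<le> 1 / 2" using c[of i] by linarith
    finally show "\<bar>(x - x') $ i\<bar> \<le> r / 2" using r by simp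
  qed
  moreover have "CARD('n) * (r / 2) < e"
  proof -
    have "CARD('n) * (r / 2) \<le> CARD('n) * (e / (2 * real CARD('n)) / 2)" using r by (intro mult_left_mono) auto
    also have "\<dots> = e / 4" by simp
    finally have "CARD('n) * (r / 2) \<le> e / 4" .
    then show ?thesis using assms(2) by linarith
  qed
  ultimately show ?thesis using that by (meson le_less_trans)
qed

text \<open>Directions are chosen pairwise non-parallel, so that two of the segments meet in at most
  one point; this is what allows crossings to be cut out cheaply.\<close>

lemma generic_segments:
  fixes F :: "((real ^ 'n) \<times> (real ^ 'n)) set"
  assumes d: "CARD('n) \<ge> 2" and F: "finite F" "F \<subseteq> unit_cube \<times> unit_cube" and e: "0 < e"
  shows "\<exists>x z s. (\<forall>q\<in>F. z q \<in> Zd \<and> z q \<noteq> 0 \<and> 0 < s q \<and> x q \<in> open_cube \<and> x q + s q *\<^sub>R z q \<in> open_cube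
      \<and> l1norm (fst q - x q) < e \<and> l1norm (snd q - (x q + s q *\<^sub>R z q)) < e)
    \<and> (\<forall>q\<in>F. \<forall>q'\<in>F. q \<noteq> q' \<longrightarrow> (\<forall>c. z q \<noteq> c *\<^sub>R z q'))"
  using F
proof (induction F)
  case empty
  then show ?case by auto
next
  case (insert q F)
  have "F \<subseteq> unit_cube \<times> unit_cube" using insert.prems by blast
  from insert.IH[OF this] obtain x z s where
    IH1: "\<forall>q\<in>F. z q \<in> Zd \<and> z q \<noteq> 0 \<and> 0 < s q \<and> x q \<in> open_cube \<and> x q + s q *\<^sub>R z q \<in> open_cube
      \<and> l1norm (fst q - x q) < e \<and> l1norm (snd q - (x q + s q *\<^sub>R z q)) < e"
    and IH2: "\<forall>q\<in>F. \<forall>q'\<in>F. q \<noteq> q' \<longrightarrow> (\<forall>c. z q \<noteq> c *\<^sub>R z q')" by (elim exE conjE)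
  obtain x' where x': "x' \<in> open_cube" "l1norm (fst q - x') < e"
    using open_cube_approx[of "fst q" e] insert.prems e by (metis insert_subset mem_Times_iff)
  obtain y' where y': "y' \<in> open_cube" "l1norm (snd q - y') < e"
    using open_cube_approx[of "snd q" e] insert.prems e by (metis insert_subset mem_Times_iff)
  \<comment> \<open>Displacements from \<open>x'\<close> that end in the open cube and close to the
    second point of \<open>q\<close>.\<close>
  let ?O = "{v. x' + v \<in> open_cube} \<inter> {v. l1norm (snd q - (x' + v)) < e}"
  have "open {v. x' + v \<in> open_cube}"
  proof -
    have "{v. x' + v \<in> open_cube} = (+) (- x') ` open_cube"
    proof (intro equalityI subsetI)
      fix v assume "v \<in> {v. x' + v \<in> open_cube}"
      then show "v \<in> (+) (- x') ` open_cube" by (intro image_eqI[of _ _ "x' + v"]) auto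
    qed auto
    then show ?thesis using open_translation[OF open_open_cube, of "- x'"] by simp
  qed
  moreover have "open {v. l1norm (snd q - (x' + v)) < e}"
    by (intro open_Collect_less continuous_intros)
  ultimately have O: "open ?O" by (rule open_Int)
  have "y' - x' \<in> ?O" using y' by simp
  then have ne: "?O \<noteq> {}" by blast
  \<comment> \<open>Avoiding the lines spanned by the earlier directions makes the new one
    non-parallel to them; the additional vector 0 forces it to be nonzero.\<close>
  have "finite (insert 0 (z ` F))" using insert by simp
  from open_avoid_lines[OF d O ne this]
  obtain z' s' where z': "z' \<in> Zd" "0 < s'" "s' *\<^sub>R z' \<in> ?O - (\<Union>d\<in>insert 0 (z ` F). span {d})"
    using rational_multiple_in_open by metis
  have nz: "z' \<noteq> 0" using z' by auto
  have np: "z' \<noteq> c *\<^sub>R z q'" if "q' \<in> F" for c q'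
  proof
    assume "z' = c *\<^sub>R z q'"
    moreover have "(s' * c) *\<^sub>R z q' \<in> span {z q'}" by (intro span_scale span_base) simp
    ultimately have "s' *\<^sub>R z' \<in> span {z q'}" by simp
    then show False using z' that by auto
  qed
  have np': "z q' \<noteq> c *\<^sub>R z'" if q': "q' \<in> F" for c q'
  proof
    assume h: "z q' = c *\<^sub>R z'"
    then have "c \<noteq> 0" using bspec[OF IH1 q'] by auto
    moreover have "(1 / c) *\<^sub>R z q' = (1 / c) *\<^sub>R (c *\<^sub>R z')" by (simp only: h)
    ultimately have "z' = (1 / c) *\<^sub>R z q'" by simp
    then show False using np[OF q'] by blast
  qed
  show ?case
  proof (rule exI[of _ "x(q := x')"], rule exI[of _ "z(q := z')"], rule exI[of _ "s(q := s')"], intro conjI ballI impI allI)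
    fix q1 assume "q1 \<in> insert q F"
    then show "(z(q := z')) q1 \<in> Zd" "(z(q := z')) q1 \<noteq> 0" "0 < (s(q := s')) q1"
      "(x(q := x')) q1 \<in> open_cube" "(x(q := x')) q1 + (s(q := s')) q1 *\<^sub>R (z(q := z')) q1 \<in> open_cube"
      "l1norm (fst q1 - (x(q := x')) q1) < e"
      "l1norm (snd q1 - ((x(q := x')) q1 + (s(q := s')) q1 *\<^sub>R (z(q := z')) q1)) < e"
      using bspec[OF IH1, of q1] z' nz x' by auto
  next
    fix q1 q2 c assume "q1 \<in> insert q F" "q2 \<in> insert q F" "q1 \<noteq> q2"
    then show "(z(q := z')) q1 \<noteq> c *\<^sub>R (z(q := z')) q2"
      using IH2[rule_format, of q1 q2 c] np[of q2 c] np'[of q1 c] insert.hyps by auto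
  qed
qed

lemma unit_cube_net:
  assumes "0 < e"
  obtains F :: "((real ^ 'n) \<times> (real ^ 'n)) set" where "finite F" "F \<subseteq> unit_cube \<times> unit_cube"
    "\<And>x y. x \<in> unit_cube \<Longrightarrow> y \<in> unit_cube \<Longrightarrow> \<exists>q\<in>F. l1norm (x - fst q) < e \<and> l1norm (y - snd q) < e"
proof -
  let ?S = "(unit_cube :: (real ^ 'n) set) \<times> (unit_cube :: (real ^ 'n) set)"
  define r where "r = e / real CARD('n)"
  have r: "0 < r" using assms by (simp add: r_def)
  have "compact ?S" unfolding unit_cube_cbox by (intro compact_Times compact_cbox)
  then have "seq_compact ?S" by (simp add: compact_eq_seq_compact_metric)
  from seq_compact_imp_totally_bounded[OF this, rule_format, OF r]
  obtain F where F: "finite F" "F \<subseteq> ?S" "?S \<subseteq> (\<Union>q\<in>F. ball q r)" by (elim exE conjE)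
  show ?thesis
  proof (rule that[OF F(1,2)])
    fix x y :: "real ^ 'n" assume "x \<in> unit_cube" "y \<in> unit_cube"
    then have "(x, y) \<in> (\<Union>q\<in>F. ball q r)" using F(3) by blast
    then obtain q where q: "q \<in> F" "dist q (x, y) < r" by auto
    have *: "l1norm (v - w) < e" if "dist w v < r" for v w :: "real ^ 'n"
    proof -
      have "l1norm (v - w) \<le> CARD('n) * norm (v - w)" by (rule l1norm_le_norm)
      also have "\<dots> < CARD('n) * r" using that by (simp add: dist_norm norm_minus_commute)
      finally show ?thesis by (simp add: r_def)
    qed
    have "dist (fst q) x < r" "dist (snd q) y < r"
      using dist_fst_le[of q "(x, y)"] dist_snd_le[of q "(x, y)"] q by auto
    then show "\<exists>q\<in>F. l1norm (x - fst q) < e \<and> l1norm (y - snd q) < e" using * q by blast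
  qed
qed

lemma add_chain: "A \<le> B + (C + D) \<Longrightarrow> B \<le> X \<Longrightarrow> D \<le> X \<Longrightarrow> C \<le> Y \<Longrightarrow> Z = X + X \<Longrightarrow> A \<le> Y + Z"
  for A :: real by linarith

text \<open>Each pair of a finite net is joined by a segment in general position, which is cut into
  \<open>Nn\<close> equal pieces. A piece is trimmed at both ends, to separate it from its
  neighbours, and dropped if another segment meets the rest. Another segment does so for at most one
  piece, so at most \<open>card F\<close> pieces per segment are lost; trimmed ends and lost pieces
  are travelled at cost \<open>b\<close> per unit length. The conclusion is stated for an arbitrary
  \<open>T\<close> so that it can be applied to rescaled passage times.\<close>

lemma skeleton:
  fixes g :: "real ^ 'n \<Rightarrow> real"
  assumes d: "CARD('n) \<ge> 2" and g: "g \<in> norms a b" and b: "0 < b" and \<epsilon>: "0 < \<epsilon>"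
  obtains I :: "(((real ^ 'n) \<times> (real ^ 'n)) \<times> nat) set" and p z s \<eta> where
    "finite I" "0 < \<eta>" "\<And>k. k \<in> I \<Longrightarrow> z k \<in> Zd \<and> z k \<noteq> 0 \<and> 0 < s k"
    "\<And>k r. k \<in> I \<Longrightarrow> 0 \<le> r \<Longrightarrow> r \<le> s k \<Longrightarrow> p k + r *\<^sub>R z k \<in> open_cube"
    "\<And>k k' r r'. k \<in> I \<Longrightarrow> k' \<in> I \<Longrightarrow> k \<noteq> k' \<Longrightarrow> 0 \<le> r \<Longrightarrow> r \<le> s k \<Longrightarrow> 0 \<le> r' \<Longrightarrow> r' \<le> s k' \<Longrightarrow>
        p k + r *\<^sub>R z k \<noteq> p k' + r' *\<^sub>R z k'"
    "\<And>T x y. (\<And>x y z. x \<in> unit_cube \<Longrightarrow> y \<in> unit_cube \<Longrightarrow> z \<in> unit_cube \<Longrightarrow> T x z \<le> T x y + T y z) \<Longrightarrow>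
       (\<And>x y. x \<in> unit_cube \<Longrightarrow> y \<in> unit_cube \<Longrightarrow> T x y \<le> b * l1norm (x - y)) \<Longrightarrow>
       (\<And>k. k \<in> I \<Longrightarrow> T (p k) (p k + s k *\<^sub>R z k) \<le> g (s k *\<^sub>R z k) + \<eta>) \<Longrightarrow>
       x \<in> unit_cube \<Longrightarrow> y \<in> unit_cube \<Longrightarrow> T x y \<le> g (x - y) + \<epsilon>"
proof -
  note N = normsD[OF g]
  \<comment> \<open>The budget: both ends of a path cost \<open>2 * b * e\<close>, that is
    \<epsilon> / 8 each, and comparing \<open>g\<close> at the net points with
    \<open>g (x0 - y0)\<close> costs the same again. Trimming, lost pieces and the allowances \<eta>
    add \<epsilon> / 8 each through the choice of \<kappa>, \<open>Nn\<close> and \<eta>.\<close>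
  define e where "e = \<epsilon> / (16 * b)"
  have e: "0 < e" using \<epsilon> b by (simp add: e_def)
  obtain F :: "((real ^ 'n) \<times> (real ^ 'n)) set" where F: "finite F" "F \<subseteq> unit_cube \<times> unit_cube"
    "\<And>x y. x \<in> unit_cube \<Longrightarrow> y \<in> unit_cube \<Longrightarrow> \<exists>q\<in>F. l1norm (x - fst q) < e \<and> l1norm (y - snd q) < e"
    using unit_cube_net[OF e] by blast
  from generic_segments[OF d F(1,2) e] obtain x z s where
    S0: "\<forall>q\<in>F. z q \<in> Zd \<and> z q \<noteq> 0 \<and> 0 < s q \<and> x q \<in> open_cube \<and> x q + s q *\<^sub>R z q \<in> open_cube
      \<and> l1norm (fst q - x q) < e \<and> l1norm (snd q - (x q + s q *\<^sub>R z q)) < e"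
    and np0: "\<forall>q\<in>F. \<forall>q'\<in>F. q \<noteq> q' \<longrightarrow> (\<forall>c. z q \<noteq> c *\<^sub>R z q')" by (elim exE conjE)
  have S: "\<And>q. q \<in> F \<Longrightarrow> z q \<in> Zd" "\<And>q. q \<in> F \<Longrightarrow> z q \<noteq> 0" "\<And>q. q \<in> F \<Longrightarrow> 0 < s q"
      "\<And>q. q \<in> F \<Longrightarrow> x q \<in> open_cube" "\<And>q. q \<in> F \<Longrightarrow> x q + s q *\<^sub>R z q \<in> open_cube"
      "\<And>q. q \<in> F \<Longrightarrow> l1norm (fst q - x q) < e" "\<And>q. q \<in> F \<Longrightarrow> l1norm (snd q - (x q + s q *\<^sub>R z q)) < e"
    by (drule bspec[OF S0], elim conjE, assumption)+
  have np: "\<And>q q' c. q \<in> F \<Longrightarrow> q' \<in> F \<Longrightarrow> q \<noteq> q' \<Longrightarrow> z q \<noteq> c *\<^sub>R z q'"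
    using np0 by blast
  define v where "v q = s q *\<^sub>R z q" for q
  have cube: "x q + r *\<^sub>R v q \<in> open_cube" if "q \<in> F" "0 \<le> r" "r \<le> 1" for q r
    using open_cube_convex[of "x q" "v q" r] S(4,5)[OF that(1)] that by (simp add: v_def)
  have v0: "v q \<noteq> 0" if "q \<in> F" for q using S(2,3)[OF that] by (simp add: v_def)
  have vnp: "c *\<^sub>R v q \<noteq> c' *\<^sub>R v q'" if q: "q \<in> F" "q' \<in> F" "q \<noteq> q'" and c: "c \<noteq> 0" for c c' q q'
  proof
    assume "c *\<^sub>R v q = c' *\<^sub>R v q'"
    then have "(c * s q) *\<^sub>R z q = (c' * s q') *\<^sub>R z q'" by (simp add: v_def)
    then have "(1 / (c * s q)) *\<^sub>R ((c * s q) *\<^sub>R z q) = (1 / (c * s q)) *\<^sub>R ((c' * s q') *\<^sub>R z q')" by simp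
    then have "z q = (1 / (c * s q) * (c' * s q')) *\<^sub>R z q'" using c S(3)[OF q(1)] by simp
    then show False using np[OF q] by blast
  qed
  define D where "D = b * real CARD('n)"
  have D: "0 < D" using b by (simp add: D_def)
  have vD: "b * l1norm (v q) \<le> D" if "q \<in> F" for q
  proof -
    have "l1norm ((x q + v q) - x q) \<le> CARD('n)"
      using S(4,5)[OF that] by (intro l1norm_unit_cube open_cube_subset) (auto simp: v_def)
    then show ?thesis using b by (simp add: D_def)
  qed
  define \<kappa> where "\<kappa> = min (1 / 4) (\<epsilon> / (16 * D))"
  have \<kappa>: "0 < \<kappa>" "\<kappa> \<le> 1 / 4" "\<kappa> \<le> \<epsilon> / (16 * D)" using \<epsilon> D by (auto simp: \<kappa>_def)
  obtain Nn :: nat where Nn: "8 * (real (card F) + 1) * D / \<epsilon> < real Nn"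
    using reals_Archimedean2 by blast
  have "0 < 8 * (real (card F) + 1) * D / \<epsilon>" using D \<epsilon> by simp
  then have N0: "0 < real Nn" using Nn by linarith
  define \<eta> where "\<eta> = \<epsilon> / (8 * real Nn)"
  have \<eta>: "0 < \<eta>" using \<epsilon> N0 by (simp add: \<eta>_def)
  define P where "P q j = {r. (real j + \<kappa>) / real Nn \<le> r \<and> r \<le> (real j + 1 - \<kappa>) / real Nn}"
    for q :: "(real ^ 'n) \<times> (real ^ 'n)" and j :: nat
  have P01: "0 \<le> r \<and> r \<le> 1" if "r \<in> P q j" "j < Nn" for q j r
  proof -
    have 1: "(real j + \<kappa>) / real Nn \<le> r" "r \<le> (real j + 1 - \<kappa>) / real Nn" using that by (auto simp: P_def)
    have "0 \<le> (real j + \<kappa>) / real Nn" using \<kappa> by simp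
    moreover have "(real j + 1 - \<kappa>) / real Nn \<le> 1" using that(2) \<kappa> N0 by (simp add: field_simps)
    ultimately show ?thesis using 1 by linarith
  qed
  have Pdisj: "j = j'" if "r \<in> P q j" "r \<in> P q' j'" for q q' j j' r
  proof -
    have "(real j + \<kappa>) / real Nn \<le> (real j' + 1 - \<kappa>) / real Nn" "(real j' + \<kappa>) / real Nn \<le> (real j + 1 - \<kappa>) / real Nn"
      using that by (auto simp: P_def)
    then have "real j + \<kappa> \<le> real j' + 1 - \<kappa>" "real j' + \<kappa> \<le> real j + 1 - \<kappa>"
      using N0 by (simp_all add: divide_le_cancel)
    then show ?thesis using \<kappa> by linarith
  qed
  \<comment> \<open>A piece is tested against the whole of the other segment and not only against
    its surviving pieces, so survivors are disjoint irrespective of any order of the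
    segments.\<close>
  define hit where "hit q j q' \<longleftrightarrow> (\<exists>r\<in>P q j. \<exists>r'. 0 \<le> r' \<and> r' \<le> 1 \<and> x q + r *\<^sub>R v q = x q' + r' *\<^sub>R v q')" for q j q'
  define I where "I = {(q, j). q \<in> F \<and> j < Nn \<and> (\<forall>q'\<in>F. q' \<noteq> q \<longrightarrow> \<not> hit q j q')}"
  define lo where "lo j = (real j + \<kappa>) / real Nn" for j :: nat
  define p where "p = (\<lambda>(q, j). x q + lo j *\<^sub>R v q)"
  define zz where "zz = (\<lambda>(q, j :: nat). z q)"
  define ss where "ss = (\<lambda>(q, j :: nat). s q * ((1 - 2 * \<kappa>) / real Nn))"
  have I_fin: "finite I"
    by (rule finite_subset[of _ "F \<times> {..<Nn}"]) (use F in \<open>auto simp: I_def\<close>)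
  have param: "\<exists>t\<in>P q j. p (q, j) + r *\<^sub>R zz (q, j) = x q + t *\<^sub>R v q"
    if "(q, j) \<in> I" "0 \<le> r" "r \<le> ss (q, j)" for q j r
  proof -
    have q: "q \<in> F" using that by (simp add: I_def)
    let ?t = "lo j + r / s q"
    have "r / s q \<le> (1 - 2 * \<kappa>) / real Nn" using that(3) S(3)[OF q] by (simp add: ss_def field_simps)
    moreover have "lo j + (1 - 2 * \<kappa>) / real Nn = (real j + 1 - \<kappa>) / real Nn"
      by (simp add: lo_def add_divide_distrib[symmetric])
    ultimately have "?t \<in> P q j" using that(2) S(3)[OF q] by (auto simp: P_def lo_def[symmetric])
    moreover have "p (q, j) + r *\<^sub>R zz (q, j) = x q + ?t *\<^sub>R v q"
      using S(3)[OF q] by (simp add: p_def zz_def v_def algebra_simps)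
    ultimately show ?thesis by blast
  qed
  have few: "card {j. j < Nn \<and> (q, j) \<notin> I} \<le> card F" if q: "q \<in> F" for q
  proof -
    have "\<forall>j\<in>{j. j < Nn \<and> (q, j) \<notin> I}. \<exists>q'. q' \<in> F \<and> q' \<noteq> q \<and> hit q j q'" using q by (auto simp: I_def)
    from bchoice[OF this] obtain f where f: "\<And>j. j < Nn \<Longrightarrow> (q, j) \<notin> I \<Longrightarrow> f j \<in> F \<and> f j \<noteq> q \<and> hit q j (f j)" by auto
    \<comment> \<open>Two pieces of one segment hit by the same other segment would make these two
      segments parallel.\<close>
    have "inj_on f {j. j < Nn \<and> (q, j) \<notin> I}"
    proof (rule inj_onI, clarify)
      fix j j' assume j: "j < Nn" "(q, j) \<notin> I" "j' < Nn" "(q, j') \<notin> I" and eq: "f j = f j'"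
      define q' where "q' = f j"
      have q': "q' \<in> F" "q' \<noteq> q" "hit q j q'" "hit q j' q'"
        using f[OF j(1,2)] f[OF j(3,4)] eq by (auto simp: q'_def)
      from q'(3) obtain r1 t1 where 1: "r1 \<in> P q j" "x q + r1 *\<^sub>R v q = x q' + t1 *\<^sub>R v q'"
        unfolding hit_def by blast
      from q'(4) obtain r2 t2 where 2: "r2 \<in> P q j'" "x q + r2 *\<^sub>R v q = x q' + t2 *\<^sub>R v q'"
        unfolding hit_def by blast
      have "(r1 - r2) *\<^sub>R v q = (x q + r1 *\<^sub>R v q) - (x q + r2 *\<^sub>R v q)" by (simp add: algebra_simps)
      also have "\<dots> = (t1 - t2) *\<^sub>R v q'" unfolding 1 2 by (simp add: algebra_simps)
      finally have "r1 - r2 = 0" using vnp[OF q q'(1)] q'(2) by blast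
      then show "j = j'" using Pdisj[OF 1(1)] 2(1) by simp
    qed
    then show ?thesis by (rule card_inj_on_le) (use f F in auto)
  qed
  show ?thesis
  proof (rule that[of I \<eta> zz ss p])
    show "zz k \<in> Zd \<and> zz k \<noteq> 0 \<and> 0 < ss k" if "k \<in> I" for k
      using that S N0 \<kappa> by (auto simp: I_def zz_def ss_def)
    show "p k + r *\<^sub>R zz k \<in> open_cube" if k: "k \<in> I" "0 \<le> r" "r \<le> ss k" for k r
    proof -
      obtain q j where qj: "k = (q, j)" by (cases k)
      obtain t where t: "t \<in> P q j" "p (q, j) + r *\<^sub>R zz (q, j) = x q + t *\<^sub>R v q"
        using param[of q j r] k qj by blast
      have "q \<in> F" "j < Nn" using k qj by (auto simp: I_def)
      then show ?thesis unfolding qj t(2) using P01[OF t(1)] by (intro cube) auto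
    qed
    show "p k + r *\<^sub>R zz k \<noteq> p k' + r' *\<^sub>R zz k'"
      if k: "k \<in> I" "k' \<in> I" "k \<noteq> k'" "0 \<le> r" "r \<le> ss k" "0 \<le> r'" "r' \<le> ss k'" for k k' r r'
    proof
      assume eq: "p k + r *\<^sub>R zz k = p k' + r' *\<^sub>R zz k'"
      obtain q j q' j' where qj: "k = (q, j)" "k' = (q', j')" by (cases k, cases k')
      obtain t where t: "t \<in> P q j" "p (q, j) + r *\<^sub>R zz (q, j) = x q + t *\<^sub>R v q"
        using param[of q j r] k qj by blast
      obtain t' where t': "t' \<in> P q' j'" "p (q', j') + r' *\<^sub>R zz (q', j') = x q' + t' *\<^sub>R v q'"
        using param[of q' j' r'] k qj by blast
      have eq2: "x q + t *\<^sub>R v q = x q' + t' *\<^sub>R v q'" using eq qj t t' by simp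
      show False
      proof (cases "q = q'")
        case True
        have "q \<in> F" using k qj by (simp add: I_def)
        then have "t = t'" using eq2 v0 True by simp
        then have "j = j'" using Pdisj t(1) t'(1) by blast
        then show False using k qj True by simp
      next
        case False
        have "q' \<in> F" "j' < Nn" "\<not> hit q j q'" using k qj False by (auto simp: I_def)
        then show False using eq2 t(1) P01[OF t'(1)] unfolding hit_def by blast
      qed
    qed
    show "T x0 y0 \<le> g (x0 - y0) + \<epsilon>"
      if tri: "\<And>x y z. x \<in> unit_cube \<Longrightarrow> y \<in> unit_cube \<Longrightarrow> z \<in> unit_cube \<Longrightarrow> T x z \<le> T x y + T y z"
        and Tb: "\<And>x y. x \<in> unit_cube \<Longrightarrow> y \<in> unit_cube \<Longrightarrow> T x y \<le> b * l1norm (x - y)"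
        and TI: "\<And>k. k \<in> I \<Longrightarrow> T (p k) (p k + ss k *\<^sub>R zz k) \<le> g (ss k *\<^sub>R zz k) + \<eta>"
        and xy: "x0 \<in> unit_cube" "y0 \<in> unit_cube" for T x0 y0
    proof -
      obtain q where q: "q \<in> F" "l1norm (x0 - fst q) < e" "l1norm (y0 - snd q) < e" using F(3)[OF xy] by blast
      define u where "u j = x q + (real j / real Nn) *\<^sub>R v q" for j :: nat
      have uin: "u j \<in> unit_cube" if "j \<le> Nn" for j
        unfolding u_def using that N0 by (intro open_cube_subset cube[OF q(1)]) (auto simp: field_simps)
      have L: "b * l1norm (v q) / real Nn \<le> D / real Nn" using vD[OF q(1)] by (intro divide_right_mono) auto
      have gap: "l1norm ((x q + c *\<^sub>R v q) - (x q + c' *\<^sub>R v q)) = \<bar>c - c'\<bar> * l1norm (v q)" for c c'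
        by (simp add: scaleR_diff_left[symmetric])
      have step: "T (u j) (u (Suc j)) \<le> g (v q) / real Nn + \<eta> + 2 * \<kappa> * D / real Nn + (if (q, j) \<in> I then 0 else D / real Nn)"
        if j: "j < Nn" for j
      proof (cases "(q, j) \<in> I")
        case True
        define X where "X = \<kappa> * D / real Nn"
        let ?p = "p (q, j)" and ?p' = "p (q, j) + ss (q, j) *\<^sub>R zz (q, j)"
        have p': "?p' = x q + ((real j + 1 - \<kappa>) / real Nn) *\<^sub>R v q"
        proof -
          have "lo j + (1 - 2 * \<kappa>) / real Nn = (real j + 1 - \<kappa>) / real Nn"
            by (simp add: lo_def add_divide_distrib[symmetric])
          moreover have "?p' = x q + (lo j + (1 - 2 * \<kappa>) / real Nn) *\<^sub>R v q"
            unfolding scaleR_add_left p_def prod.case by (simp add: ss_def zz_def v_def mult.commute)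
          ultimately show ?thesis by simp
        qed
        have pin: "?p \<in> unit_cube" "?p' \<in> unit_cube"
          unfolding p' using j N0 \<kappa> q(1)
          by (auto simp: p_def lo_def field_simps intro!: open_cube_subset cube)
        have ui: "u j \<in> unit_cube" "u (Suc j) \<in> unit_cube" using uin j by auto
        have c1: "T (u j) (u (Suc j)) \<le> T (u j) ?p + (T ?p ?p' + T ?p' (u (Suc j)))"
          using tri[OF ui(1) pin(1) ui(2)] tri[OF pin ui(2)] by linarith
        have c2: "T (u j) ?p \<le> X"
        proof -
          have "T (u j) ?p \<le> b * l1norm (u j - ?p)" by (rule Tb[OF ui(1) pin(1)])
          also have "l1norm (u j - ?p) = \<bar>real j / real Nn - lo j\<bar> * l1norm (v q)"
            unfolding u_def p_def prod.case gap ..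
          also have "\<bar>real j / real Nn - lo j\<bar> = \<kappa> / real Nn"
            using \<kappa> N0 by (simp add: lo_def diff_divide_distrib[symmetric])
          also have "b * (\<kappa> / real Nn * l1norm (v q)) = \<kappa> * (b * l1norm (v q) / real Nn)" by simp
          also have "\<dots> \<le> \<kappa> * (D / real Nn)" using L \<kappa> by (intro mult_left_mono) auto
          finally show ?thesis by (simp add: X_def)
        qed
        have c3: "T ?p' (u (Suc j)) \<le> X"
        proof -
          have "T ?p' (u (Suc j)) \<le> b * l1norm (?p' - u (Suc j))" by (rule Tb[OF pin(2) ui(2)])
          also have "l1norm (?p' - u (Suc j)) = \<bar>(real j + 1 - \<kappa>) / real Nn - real (Suc j) / real Nn\<bar> * l1norm (v q)"
            unfolding u_def p' gap ..
          also have "\<bar>(real j + 1 - \<kappa>) / real Nn - real (Suc j) / real Nn\<bar> = \<kappa> / real Nn"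
            using \<kappa> N0 by (simp add: diff_divide_distrib[symmetric])
          also have "b * (\<kappa> / real Nn * l1norm (v q)) = \<kappa> * (b * l1norm (v q) / real Nn)" by simp
          also have "\<dots> \<le> \<kappa> * (D / real Nn)" using L \<kappa> by (intro mult_left_mono) auto
          finally show ?thesis by (simp add: X_def)
        qed
        have c4: "T ?p ?p' \<le> g (v q) / real Nn + \<eta>"
        proof -
          have "ss (q, j) *\<^sub>R zz (q, j) = ((1 - 2 * \<kappa>) / real Nn) *\<^sub>R v q"
            by (simp add: ss_def zz_def v_def)
          then have "g (ss (q, j) *\<^sub>R zz (q, j)) = (1 - 2 * \<kappa>) / real Nn * g (v q)"
            using N(3)[of "(1 - 2 * \<kappa>) / real Nn" "v q"] \<kappa> N0 by simp
          also have "\<dots> \<le> 1 / real Nn * g (v q)"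
            using \<kappa> N0 N(1)[of "v q"] by (intro mult_right_mono divide_right_mono) auto
          finally show ?thesis using TI[OF True] by simp
        qed
        have c5: "2 * \<kappa> * D / real Nn = X + X" by (simp add: X_def)
        have "T (u j) (u (Suc j)) \<le> (g (v q) / real Nn + \<eta>) + 2 * \<kappa> * D / real Nn"
          by (rule add_chain[OF c1 c2 c3 c4 c5])
        then show ?thesis using True by simp
      next
        case False
        have "T (u j) (u (Suc j)) \<le> b * l1norm (u j - u (Suc j))" using uin j by (intro Tb) auto
        also have "l1norm (u j - u (Suc j)) = \<bar>real j / real Nn - real (Suc j) / real Nn\<bar> * l1norm (v q)"
          unfolding u_def gap ..
        also have "\<bar>real j / real Nn - real (Suc j) / real Nn\<bar> = 1 / real Nn"
          using N0 by (simp add: diff_divide_distrib[symmetric])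
        also have "b * (1 / real Nn * l1norm (v q)) = b * l1norm (v q) / real Nn" by simp
        also have "\<dots> \<le> D / real Nn" by (rule L)
        finally show ?thesis using False N(1)[of "v q"] \<eta> \<kappa> D N0
          by (smt (verit) divide_nonneg_pos mult_nonneg_nonneg)
      qed
      have chain: "T (u 0) (u k) \<le> (\<Sum>j<k. T (u j) (u (Suc j)))" if "0 < k" "k \<le> Nn" for k
        using that
      proof (induction k)
        case (Suc k)
        show ?case
        proof (cases "k = 0")
          case False
          have "T (u 0) (u (Suc k)) \<le> T (u 0) (u k) + T (u k) (u (Suc k))"
            using uin Suc.prems by (intro tri) auto
          then show ?thesis using Suc False by simp
        qed simp
      qed simp
      have "T (u 0) (u Nn) \<le> (\<Sum>j<Nn. T (u j) (u (Suc j)))" using N0 by (intro chain) auto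
      also have "\<dots> \<le> (\<Sum>j<Nn. g (v q) / real Nn + \<eta> + 2 * \<kappa> * D / real Nn + (if (q, j) \<in> I then 0 else D / real Nn))"
        by (rule sum_mono) (use step in auto)
      also have "\<dots> = real Nn * (g (v q) / real Nn + \<eta> + 2 * \<kappa> * D / real Nn) + (\<Sum>j<Nn. if (q, j) \<in> I then 0 else D / real Nn)"
        by (simp add: sum.distrib)
      also have "(\<Sum>j<Nn. if (q, j) \<in> I then 0 else D / real Nn) = real (card {j. j < Nn \<and> (q, j) \<notin> I}) * (D / real Nn)"
        by (simp add: sum.If_cases Int_def)
      also have "\<dots> \<le> real (card F) * (D / real Nn)"
        using few[OF q(1)] D N0 by (intro mult_right_mono) auto
      also have "real Nn * (g (v q) / real Nn + \<eta> + 2 * \<kappa> * D / real Nn) = g (v q) + real Nn * \<eta> + 2 * \<kappa> * D"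
        using N0 by (simp add: field_simps)
      also have "real Nn * \<eta> = \<epsilon> / 8" using N0 by (simp add: \<eta>_def)
      finally have T1: "T (u 0) (u Nn) \<le> g (v q) + \<epsilon> / 8 + 2 * \<kappa> * D + real (card F) * (D / real Nn)" by simp
      have k1: "2 * \<kappa> * D \<le> \<epsilon> / 8" using \<kappa>(3) D by (simp add: field_simps)
      have k2: "real (card F) * (D / real Nn) \<le> \<epsilon> / 8"
      proof -
        have "8 * (real (card F) + 1) * D < real Nn * \<epsilon>" using Nn \<epsilon> by (simp add: field_simps)
        then have "8 * real (card F) * D \<le> real Nn * \<epsilon>" using D by (simp add: algebra_simps)
        then show ?thesis using N0 by (simp add: field_simps)
      qed
      have u0: "u 0 = x q" "u Nn = x q + v q" using N0 by (simp_all add: u_def)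
      have uc: "u 0 \<in> unit_cube" "u Nn \<in> unit_cube" using uin by auto
      have dx: "l1norm (x0 - u 0) \<le> 2 * e"
        using l1norm_triangle_diff[of x0 "u 0" "fst q"] q(2) S(6)[OF q(1)] u0 by simp
      have dy: "l1norm (u Nn - y0) \<le> 2 * e"
        using l1norm_triangle_diff[of "u Nn" y0 "snd q"] q(3) S(7)[OF q(1)] u0
        by (simp add: v_def l1norm_minus_commute)
      have be: "b * l1norm (x0 - u 0) \<le> \<epsilon> / 8" "b * l1norm (u Nn - y0) \<le> \<epsilon> / 8"
        using mult_left_mono[OF dx, of b] mult_left_mono[OF dy, of b] b by (auto simp: e_def)
      have "T x0 y0 \<le> T x0 (u 0) + (T (u 0) (u Nn) + T (u Nn) y0)"
        using tri[OF xy(1) uc(1) xy(2)] tri[OF uc xy(2)] by linarith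
      moreover have "T x0 (u 0) \<le> \<epsilon> / 8" using Tb[OF xy(1) uc(1)] be by linarith
      moreover have "T (u Nn) y0 \<le> \<epsilon> / 8" using Tb[OF uc(2) xy(2)] be by linarith
      moreover have "g (v q) \<le> g (x0 - y0) + \<epsilon> / 4"
      proof -
        have "g (u 0 - u Nn) \<le> g (u 0 - x0) + (g (x0 - y0) + g (y0 - u Nn))"
          using norms_diff(1)[OF g, of "u 0" "u Nn" x0] norms_diff(1)[OF g, of x0 "u Nn" y0] by linarith
        moreover have "g (u 0 - x0) \<le> \<epsilon> / 8" "g (y0 - u Nn) \<le> \<epsilon> / 8"
          using N(6)[of "u 0 - x0"] N(6)[of "y0 - u Nn"] be by (auto simp: l1norm_minus_commute)
        moreover have "g (u 0 - u Nn) = g (v q)" using N(7)[of "v q"] u0 by simp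
        ultimately show ?thesis by linarith
      qed
      ultimately show ?thesis using T1 k1 k2 \<epsilon> by linarith
    qed
  qed (use I_fin \<eta> in auto)
qed

section \<open>Highways\<close>

text \<open>The lower bound on passage times is by duality: any function that varies by at most the
  travel time along each step bounds passage times from below. The function used here is the
  smaller of \<open>\<psi>\<close> and of the inf-convolution of \<open>C\<close> (prescribed on the highways \<open>\<Gamma>\<close>) with
  \<open>\<beta>\<close> times the distance; away from the highways it coincides with \<open>\<psi>\<close>.\<close>

lemma potential_lower:
  fixes Y \<Gamma> :: "(real ^ 'n) set" and \<psi> C :: "real ^ 'n \<Rightarrow> real"
  assumes \<beta>: "\<beta>' \<le> \<beta>" "\<beta> \<le> b" and \<Gamma>: "\<Gamma> \<subseteq> Y"
    and Clip: "\<And>u v. u \<in> \<Gamma> \<Longrightarrow> v \<in> \<Gamma> \<Longrightarrow> C u - C v \<le> \<beta> * l1norm (u - v)"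
    and H\<Gamma>: "\<And>e z. e \<in> H \<Longrightarrow> z \<in> convex hull e \<Longrightarrow> z \<in> \<Gamma>"
    and H: "\<And>e z z'. e \<in> H \<Longrightarrow> z \<in> convex hull e \<Longrightarrow> z' \<in> convex hull e \<Longrightarrow> C z' - C z \<le> t e * l1norm (z - z')"
    and C\<psi>: "\<And>u. u \<in> \<Gamma> \<Longrightarrow> \<psi> u - E \<le> C u \<and> C u \<le> \<psi> u"
    and off: "\<And>e z z'. e \<in> edges \<Longrightarrow> e \<notin> H \<Longrightarrow> z \<noteq> z' \<Longrightarrow> z \<in> Y \<inter> convex hull e \<Longrightarrow> z' \<in> Y \<inter> convex hull e \<Longrightarrow>
        \<beta> \<le> t e \<or> (\<forall>u\<in>\<Gamma>. E \<le> (\<beta> - \<beta>') * l1norm (z - u)) \<and> \<psi> z' - \<psi> z \<le> t e * l1norm (z - z')"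
    and \<psi>lip: "\<And>z z'. z \<in> Y \<Longrightarrow> z' \<in> Y \<Longrightarrow> \<psi> z' - \<psi> z \<le> \<beta>' * l1norm (z - z')"
    and E: "0 \<le> E" and xy: "x \<in> Y" "y \<in> Y"
  shows "\<psi> y - \<psi> x - E \<le> passage_time b t Y x y"
proof -
  define F where "F y = insert (\<psi> y) ((\<lambda>u. C u + \<beta> * l1norm (y - u)) ` \<Gamma>)" for y
  define f where "f y = Inf (F y)" for y
  have low: "\<psi> y - E \<le> v" if "y \<in> Y" "v \<in> F y" for y v
  proof -
    have "\<psi> y - E \<le> C u + \<beta> * l1norm (y - u)" if u: "u \<in> \<Gamma>" for u
    proof -
      have "\<psi> y \<le> \<psi> u + \<beta>' * l1norm (u - y)" using \<psi>lip[of u y] u \<Gamma> \<open>y \<in> Y\<close> by force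
      also have "\<beta>' * l1norm (u - y) \<le> \<beta> * l1norm (y - u)"
        using \<beta> by (simp add: l1norm_minus_commute mult_right_mono)
      finally show ?thesis using C\<psi>[OF u] by linarith
    qed
    then show ?thesis using that E by (auto simp: F_def)
  qed
  have bdd: "bdd_below (F y)" if "y \<in> Y" for y
    by (rule bdd_belowI[of _ "\<psi> y - E"]) (rule low[OF that])
  have f_le: "f y \<le> v" if "y \<in> Y" "v \<in> F y" for y v
    unfolding f_def using that bdd by (intro cInf_lower)
  have f_ge: "c \<le> f y" if "c \<le> \<psi> y" "\<And>u. u \<in> \<Gamma> \<Longrightarrow> c \<le> C u + \<beta> * l1norm (y - u)" for y c
    unfolding f_def by (rule cInf_greatest) (use that in \<open>auto simp: F_def\<close>)
  have f\<psi>: "f y \<le> \<psi> y" if "y \<in> Y" for y by (rule f_le[OF that]) (simp add: F_def)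
  have fC: "f z = C z" if z: "z \<in> \<Gamma>" for z
  proof (rule antisym)
    have "C z + \<beta> * l1norm (z - z) \<in> F z"
      unfolding F_def by (intro insertI2 image_eqI[OF refl] z)
    then show "f z \<le> C z" using f_le[of z "C z + \<beta> * l1norm (z - z)"] z \<Gamma> by auto
    show "C z \<le> f z"
    proof (rule f_ge)
      show "C z \<le> \<psi> z" using C\<psi>[OF z] by simp
      show "C z \<le> C u + \<beta> * l1norm (z - u)" if "u \<in> \<Gamma>" for u using Clip[OF z that] by simp
    qed
  qed
  have lip: "f z' - f z \<le> \<beta> * l1norm (z - z')" if Y: "z \<in> Y" "z' \<in> Y" for z z'
  proof -
    have "f z' - \<beta> * l1norm (z - z') \<le> f z"
    proof (rule f_ge)
      have "f z' \<le> \<psi> z + \<beta>' * l1norm (z - z')" using f\<psi>[OF Y(2)] \<psi>lip[OF Y] by linarith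
      also have "\<beta>' * l1norm (z - z') \<le> \<beta> * l1norm (z - z')" using \<beta> by (simp add: mult_right_mono)
      finally show "f z' - \<beta> * l1norm (z - z') \<le> \<psi> z" by simp
      fix u assume u: "u \<in> \<Gamma>"
      \<comment> \<open>If the two points differ, the Lipschitz bound of \<psi> in both directions
        forces \<beta>', and hence \<beta>, to be nonnegative.\<close>
      have b0: "0 \<le> \<beta> \<or> l1norm (z - z') = 0"
      proof (rule disjCI)
        assume "l1norm (z - z') \<noteq> 0"
        then have pos: "0 < l1norm (z - z')" by (simp add: order_less_le)
        have "\<psi> z' - \<psi> z \<le> \<beta>' * l1norm (z - z')" "\<psi> z - \<psi> z' \<le> \<beta>' * l1norm (z - z')"
          using \<psi>lip[OF Y] \<psi>lip[OF Y(2,1)] by (auto simp: l1norm_minus_commute)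
        then have "0 \<le> \<beta>' * l1norm (z - z')" by linarith
        then have "0 \<le> \<beta>'" using pos by (simp add: zero_le_mult_iff)
        then show "0 \<le> \<beta>" using \<beta> by simp
      qed
      have "f z' \<le> C u + \<beta> * l1norm (z' - u)" by (rule f_le[OF Y(2)]) (use u in \<open>simp add: F_def\<close>)
      also have "\<beta> * l1norm (z' - u) \<le> \<beta> * l1norm (z - u) + \<beta> * l1norm (z - z')"
      proof -
        have "l1norm (z' - u) \<le> l1norm (z - u) + l1norm (z - z')"
          using l1norm_triangle_diff[of z' u z] by (simp add: l1norm_minus_commute)
        then show ?thesis using b0 by (auto simp: distrib_left[symmetric] mult_left_mono)
      qed
      finally show "f z' - \<beta> * l1norm (z - z') \<le> C u + \<beta> * l1norm (z - u)" by simp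
    qed
    then show ?thesis by simp
  qed
  have "f y - f x \<le> passage_time b t Y x y"
  proof (rule passage_potential)
    fix z z' assume Y: "z \<in> Y" "z' \<in> Y"
    show "f z' - f z \<le> step_time b t z z'"
    proof (cases "z = z'")
      case True then show ?thesis by (simp add: step_time_def)
    next
      case False
      show ?thesis
      proof (cases rule: step_time_cases[of z z'])
        case off
        have "\<beta> * l1norm (z - z') \<le> b * l1norm (z - z')" using \<beta> by (intro mult_right_mono) auto
        then show ?thesis unfolding off using lip[OF Y] by linarith
      next
        case (edge e)
        show ?thesis
        proof (cases "e \<in> H")
          case True
          then show ?thesis using H[OF True edge(2,3)] H\<Gamma>[OF True edge(2)] H\<Gamma>[OF True edge(3)]
            by (simp add: fC edge(4))
        next
          case notH: False
          from off[OF edge(1) notH False, OF IntI[OF Y(1) edge(2)] IntI[OF Y(2) edge(3)]] show ?thesis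
          proof
            assume "\<beta> \<le> t e"
            then have "\<beta> * l1norm (z - z') \<le> t e * l1norm (z - z')" by (intro mult_right_mono) auto
            then show ?thesis unfolding edge(4) using lip[OF Y] by linarith
          next
            assume far: "(\<forall>u\<in>\<Gamma>. E \<le> (\<beta> - \<beta>') * l1norm (z - u)) \<and> \<psi> z' - \<psi> z \<le> t e * l1norm (z - z')"
            \<comment> \<open>Far from \<Gamma> the surplus
              \<open>(\<beta> - \<beta>') * l1norm (z - u)\<close> outweighs the depth
              \<open>E\<close> by which \<open>C\<close> may lie below \<psi>, so the minimum at
              \<open>z\<close> is \<psi>; at \<open>z'\<close> the trivial bound \<open>f\<close>
              \<le> \<psi> is enough.\<close>
            have "\<psi> z \<le> f z"
            proof (rule f_ge)
              fix u assume u: "u \<in> \<Gamma>"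
              have "\<psi> z \<le> \<psi> u + \<beta>' * l1norm (z - u)"
                using \<psi>lip[of u z] u \<Gamma> Y by (force simp: l1norm_minus_commute)
              also have "\<dots> \<le> C u + E + \<beta>' * l1norm (z - u)" using C\<psi>[OF u] by simp
              also have "\<dots> \<le> C u + \<beta> * l1norm (z - u)" using far u by (auto simp: algebra_simps)
              finally show "\<psi> z \<le> C u + \<beta> * l1norm (z - u)" .
            qed simp
            then show ?thesis unfolding edge(4) using f\<psi>[OF Y(2)] far by linarith
          qed
        qed
      qed
    qed
  qed (use xy in auto)
  moreover have "\<psi> y - E \<le> f y"
    unfolding f_def by (rule cInf_greatest) (use low[OF xy(2)] in \<open>auto simp: F_def\<close>)
  ultimately show ?thesis using f\<psi>[OF xy(1)] by linarith
qed

section \<open>Interpolated lattice paths with two-valued weights\<close>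

definition clampi :: "real \<Rightarrow> real" where "clampi x = min 1 (max 0 x)"

text \<open>The piecewise linear interpolation of the partial sums of \<open>d\<close>, written
  without case distinction. Applied to steps it parametrises a lattice path by length, applied to
  weights it is the travel time along the path.\<close>

definition interp :: "(nat \<Rightarrow> 'a :: real_vector) \<Rightarrow> nat \<Rightarrow> real \<Rightarrow> 'a" where
  "interp d L s = (\<Sum>j<L. clampi (s - real j) *\<^sub>R d j)"

lemma clampi_mono: "x \<le> y \<Longrightarrow> clampi x \<le> clampi y"
  by (auto simp: clampi_def)

lemma sum_clampi: "(\<Sum>j<L. clampi (s - real j)) = min (real L) (max 0 s)"
proof (induction L)
  case (Suc L)
  then show ?case by (auto simp: clampi_def min_def max_def)
qed simp

lemma interp_segment:
  assumes "i < L" "real i \<le> s" "s \<le> real i + 1"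
  shows "interp d L s = (\<Sum>j<i. d j) + (s - real i) *\<^sub>R d i"
proof -
  have "interp d L s = (\<Sum>j<L. (if j < i then d j else 0) + (if j = i then (s - real i) *\<^sub>R d i else 0))"
    unfolding interp_def
  proof (rule sum.cong[OF refl])
    fix j
    consider "j < i" | "j = i" | "i < j" by linarith
    then show "clampi (s - real j) *\<^sub>R d j = (if j < i then d j else 0) + (if j = i then (s - real i) *\<^sub>R d i else 0)"
    proof cases
      case 1
      then have "real j + 1 \<le> real i" by linarith
      then have "clampi (s - real j) = 1" using assms by (simp add: clampi_def)
      then show ?thesis using 1 by simp
    next
      case 2
      then show ?thesis using assms by (simp add: clampi_def)
    next
      case 3
      then have "real i + 1 \<le> real j" by linarith
      then have "clampi (s - real j) = 0" using assms by (simp add: clampi_def)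
      then show ?thesis using 3 by simp
    qed
  qed
  also have "\<dots> = (\<Sum>j\<in>{..<L} \<inter> {j. j < i}. d j) + (s - real i) *\<^sub>R d i"
    using assms(1) by (simp add: sum.distrib sum.If_cases)
  also have "{..<L} \<inter> {j. j < i} = {..<i}" using assms(1) by auto
  finally show ?thesis .
qed

lemma interp_nat: "i \<le> L \<Longrightarrow> interp d L (real i) = (\<Sum>j<i. d j)"
proof (cases "i < L")
  case True
  then show ?thesis using interp_segment[of i L "real i" d] by simp
next
  case False
  assume "i \<le> L"
  then have "i = L" using False by simp
  have "clampi (real L - real j) = 1" if "j < L" for j
  proof -
    have "real j + 1 \<le> real L" using that by linarith
    then show ?thesis by (simp add: clampi_def)
  qed
  then show ?thesis unfolding \<open>i = L\<close> interp_def by simp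
qed

lemma sum_clampi_diff:
  assumes "0 \<le> s'" "s' \<le> s" "s \<le> real L"
  shows "(\<Sum>j<L. clampi (s - real j) - clampi (s' - real j)) = s - s'"
  unfolding sum_subtractf sum_clampi using assms by simp

lemma l1norm_sum: "l1norm (\<Sum>j\<in>A. f j) \<le> (\<Sum>j\<in>A. l1norm (f j))"
proof (induction A rule: infinite_finite_induct)
  case (insert x A)
  then show ?case using l1norm_triangle[of "f x" "sum f A"] by simp
qed auto

lemma interp_l1_lipschitz:
  fixes d :: "nat \<Rightarrow> real ^ 'n"
  assumes d: "\<And>j. j < L \<Longrightarrow> l1norm (d j) \<le> 1" and s: "0 \<le> s'" "s' \<le> s" "s \<le> real L"
  shows "l1norm (interp d L s - interp d L s') \<le> s - s'"
proof -
  let ?c = "\<lambda>j. clampi (s - real j) - clampi (s' - real j)"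
  have c0: "0 \<le> ?c j" for j using clampi_mono[of "s' - real j" "s - real j"] s by simp
  have "interp d L s - interp d L s' = (\<Sum>j<L. ?c j *\<^sub>R d j)"
    by (simp add: interp_def sum_subtractf[symmetric] scaleR_diff_left)
  also have "l1norm \<dots> \<le> (\<Sum>j<L. l1norm (?c j *\<^sub>R d j))" by (rule l1norm_sum)
  also have "\<dots> \<le> (\<Sum>j<L. ?c j)"
    by (rule sum_mono) (use d c0 in \<open>auto simp: mult_left_le\<close>)
  finally show ?thesis unfolding sum_clampi_diff[OF s] .
qed

lemma interp_real_mono:
  fixes d :: "nat \<Rightarrow> real"
  assumes d: "\<And>j. j < L \<Longrightarrow> 0 \<le> d j \<and> d j \<le> K" and s: "0 \<le> s'" "s' \<le> s" "s \<le> real L"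
  shows "0 \<le> interp d L s - interp d L s'" "interp d L s - interp d L s' \<le> K * (s - s')"
proof -
  let ?c = "\<lambda>j. clampi (s - real j) - clampi (s' - real j)"
  have c0: "0 \<le> ?c j" for j using clampi_mono[of "s' - real j" "s - real j"] s by simp
  have eq: "interp d L s - interp d L s' = (\<Sum>j<L. ?c j * d j)"
    by (simp add: interp_def sum_subtractf[symmetric] left_diff_distrib)
  show "0 \<le> interp d L s - interp d L s'" unfolding eq using d c0 by (intro sum_nonneg mult_nonneg_nonneg) auto
  have "(\<Sum>j<L. ?c j * d j) \<le> (\<Sum>j<L. ?c j * K)" using d c0 by (intro sum_mono mult_left_mono) auto
  also have "\<dots> = (s - s') * K" unfolding sum_distrib_right[symmetric] sum_clampi_diff[OF s] ..
  finally show "interp d L s - interp d L s' \<le> K * (s - s')" unfolding eq by (simp add: mult.commute)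
qed

text \<open>A unit step towards 0 in a nonzero coordinate lowers the norm by 1. The path found has
  exactly \<open>l1norm z\<close> steps and is therefore a shortest one.\<close>

lemma staircase_word:
  fixes z :: "real ^ 'n"
  assumes "z \<in> Zd" "l1norm z = real N"
  shows "\<exists>w :: nat \<Rightarrow> real ^ 'n. w 0 = 0 \<and> w N = z \<and> (\<forall>j\<le>N. w j \<in> Zd) \<and> (\<forall>j<N. l1norm (w (Suc j) - w j) = 1)"
  using assms
proof (induction N arbitrary: z)
  case 0
  then show ?case by (intro exI[of _ "\<lambda>_. 0"]) auto
next
  case (Suc N)
  then have "z \<noteq> 0" by auto
  then obtain i where i: "z $ i \<noteq> 0" by (auto simp: vec_eq_iff)
  have zi: "z $ i \<in> \<int>" using Suc.prems by (simp add: Zd_def)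
  then have ge1: "1 \<le> \<bar>z $ i\<bar>" using i by (rule Ints_nonzero_abs_ge1)
  define z' where "z' = z - axis i (sgn (z $ i))"
  have sg: "sgn (z $ i) \<in> \<int>" by (auto simp: sgn_if)
  have "z' \<in> Zd" using Suc.prems(1) sg by (auto simp: z'_def Zd_def axis_def)
  moreover have "l1norm z' = real N"
  proof -
    have "l1norm z = \<bar>z $ i\<bar> + (\<Sum>j\<in>UNIV - {i}. \<bar>z $ j\<bar>)"
      unfolding l1norm_def by (subst sum.remove[of _ i]) auto
    moreover have "l1norm z' = \<bar>z' $ i\<bar> + (\<Sum>j\<in>UNIV - {i}. \<bar>z' $ j\<bar>)"
      unfolding l1norm_def by (subst sum.remove[of _ i]) auto
    moreover have "(\<Sum>j\<in>UNIV - {i}. \<bar>z' $ j\<bar>) = (\<Sum>j\<in>UNIV - {i}. \<bar>z $ j\<bar>)"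
      by (rule sum.cong) (auto simp: z'_def axis_def)
    moreover have "\<bar>z' $ i\<bar> = \<bar>z $ i\<bar> - 1" using ge1 by (auto simp: z'_def sgn_if split: if_splits)
    ultimately show ?thesis using Suc.prems(2) by simp
  qed
  ultimately obtain w where w: "w 0 = 0" "w N = z'" "\<forall>j\<le>N. w j \<in> Zd" "\<forall>j<N. l1norm (w (Suc j) - w j) = 1"
    using Suc.IH by blast
  have last: "l1norm (z - z') = 1" using i by (simp add: z'_def sgn_if)
  show ?case
    by (rule exI[of _ "\<lambda>j. if j \<le> N then w j else z"]) (use w last Suc.prems in \<open>auto simp: less_Suc_eq le_Suc_eq\<close>)
qed

lemma l1norm_Zd_nat:
  assumes "z \<in> Zd"
  obtains N where "l1norm z = real N"
proof -
  have "l1norm z \<in> \<int>" unfolding l1norm_def by (rule Ints_sum) (use assms in \<open>auto simp: Zd_def\<close>)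
  then obtain k where "l1norm z = of_int k" by (elim Ints_cases)
  moreover have "0 \<le> k" using l1norm_nonneg[of z] calculation by simp
  ultimately show ?thesis using that[of "nat k"] by simp
qed

text \<open>The balanced (Sturmian) pattern: the value \<open>c\<close> is used exactly where the
  floor of the multiples of \<rho> jumps, so every initial sum differs from its ideal value by less
  than one jump.\<close>

lemma floor_pattern:
  fixes a c \<rho> :: real
  assumes "0 \<le> \<rho>" "\<rho> \<le> 1"
  shows "(\<Sum>j<i. if \<lfloor>real j * \<rho>\<rfloor> < \<lfloor>real (Suc j) * \<rho>\<rfloor> then c else a) = a * real i + (c - a) * real_of_int \<lfloor>real i * \<rho>\<rfloor>"
proof (induction i)
  case (Suc i)
  have st: "real (Suc i) * \<rho> = real i * \<rho> + \<rho>" by (simp add: algebra_simps)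
  have "\<lfloor>real (Suc i) * \<rho>\<rfloor> = \<lfloor>real i * \<rho>\<rfloor> \<or> \<lfloor>real (Suc i) * \<rho>\<rfloor> = \<lfloor>real i * \<rho>\<rfloor> + 1"
    unfolding st using assms by linarith
  then show ?case unfolding sum.lessThan_Suc Suc.IH
    by (elim disjE) (simp_all only: less_irrefl if_False if_True, simp_all add: algebra_simps)
qed simp

text \<open>A highway in direction \<open>z\<close>: a periodic monotone lattice path whose edges carry the two values
  \<open>a\<close> and \<open>c\<close> in proportions that make the average cost per unit length \<open>min c (g z / \<parallel>z\<parallel>)\<close>.
  \<open>C\<close> is the largest function below \<open>(1 - \<kappa>) g(\<cdot> - x)\<close> compatible with these values.\<close>

definition is_highway ::
  "(real ^ 'n \<Rightarrow> real) \<Rightarrow> real \<Rightarrow> real \<Rightarrow> real \<Rightarrow> real ^ 'n \<Rightarrow> nat \<Rightarrow> real \<Rightarrow> real ^ 'n \<Rightarrow> nat \<Rightarrow>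
    (nat \<Rightarrow> real ^ 'n) \<Rightarrow> (nat \<Rightarrow> real) \<Rightarrow> bool" where
  "is_highway g a c \<kappa> z N K v J u w \<longleftrightarrow> u 0 = v \<and> u (J * N) = v + real J *\<^sub>R z \<and>
       (\<forall>j. u j \<in> Zd) \<and> (\<forall>j. l1norm (u (Suc j) - u j) = 1) \<and> (\<forall>j. w j = a \<or> w j = c) \<and>
       (\<forall>j. l1norm (u j - (v + (real j / real N) *\<^sub>R z)) \<le> K) \<and>
       (\<Sum>j<J * N. w j) \<le> real J * g z \<and>
       (\<forall>i\<le>J * N. \<forall>j\<le>J * N. l1norm (u i - u j) = \<bar>real i - real j\<bar>) \<and>
       (\<forall>x. \<exists>C. (\<forall>p\<in>(\<Union>j<J * N. convex hull {u j, u (Suc j)}).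
                   (1 - \<kappa>) * g (p - x) - K \<le> C p \<and> C p \<le> (1 - \<kappa>) * g (p - x) \<and>
                   (\<forall>q\<in>(\<Union>j<J * N. convex hull {u j, u (Suc j)}). C p - C q \<le> c * l1norm (p - q))) \<and>
                (\<forall>j<J * N. \<forall>p\<in>convex hull {u j, u (Suc j)}. \<forall>q\<in>convex hull {u j, u (Suc j)}.
                   C p - C q \<le> w j * l1norm (p - q)))"

text \<open>The repeated staircase is a shortest path between its ends, hence parametrised
  isometrically by \<gamma>. Its travel time \<Phi> grows at rate \<open>r\<close> up to a bounded
  error, since the two values are distributed in a balanced way. Along the path
  \<open>(1 - \<kappa>) * g\<close> increases at rate at most \<open>r\<close> up to a bounded
  error; therefore the potential built from \<Phi> stays within a constant of it, uniformly in
  \<open>v\<close>, \<open>J\<close> and the reference point.\<close>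

lemma highway:
  fixes g :: "real ^ 'n \<Rightarrow> real"
  assumes g: "g \<in> norms a b" and a: "0 < a" "a < c" "c \<le> b" and z: "z \<in> Zd" "z \<noteq> 0"
    and \<kappa>: "0 \<le> \<kappa>" "\<kappa> \<le> 1" "(1 - \<kappa>) * g z \<le> c * l1norm z"
  obtains N :: nat and K where "0 < N" "real N = l1norm z" "0 \<le> K"
    "\<And>v J. v \<in> Zd \<Longrightarrow> \<exists>u w. is_highway g a c \<kappa> z N K v J u w"
proof -
  note G = normsD[OF g]
  obtain N where N: "l1norm z = real N" using l1norm_Zd_nat[OF z(1)] .
  have N0: "0 < N" using z(2) N by (cases N) auto
  obtain wd where wd: "wd 0 = 0" "wd N = z" "\<And>j. j \<le> N \<Longrightarrow> wd j \<in> Zd" "\<And>j. j < N \<Longrightarrow> l1norm (wd (Suc j) - wd j) = 1"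
    using staircase_word[OF z(1) N] by blast
  \<comment> \<open>The average weight. If the cap \<open>c\<close> is effective, it is still at
    least \<open>1 - \<kappa>\<close> times \<open>g z / N\<close> by hypothesis, so
    \<open>r\<close> dominates the smaller norm in either case.\<close>
  define r where "r = min c (g z / real N)"
  have ra: "a \<le> r" "r \<le> c" "r * real N \<le> g z" "(1 - \<kappa>) * g z \<le> r * real N"
  proof -
    have "a * real N \<le> g z" using G(5)[of z] N by simp
    then show "a \<le> r" using a N0 by (simp add: r_def field_simps)
    show "r \<le> c" by (simp add: r_def)
    have "r \<le> g z / real N" by (simp add: r_def)
    then show "r * real N \<le> g z" using N0 by (simp add: field_simps)
    have "(1 - \<kappa>) * g z \<le> g z" using \<kappa> G(1)[of z] by (simp add: mult_left_le_one_le)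
    then show "(1 - \<kappa>) * g z \<le> r * real N" using \<kappa>(3) N N0 by (auto simp: r_def min_def)
  qed
  define \<rho> where "\<rho> = (r - a) / (c - a)"
  have \<rho>: "0 \<le> \<rho>" "\<rho> \<le> 1" "(c - a) * \<rho> = r - a" using ra a by (auto simp: \<rho>_def field_simps)
  define w where "w j = (if \<lfloor>real j * \<rho>\<rfloor> < \<lfloor>real (Suc j) * \<rho>\<rfloor> then c else a)" for j
  have w: "w j = a \<or> w j = c" for j by (simp add: w_def)
  have w0: "0 \<le> w j \<and> w j \<le> c" for j using w[of j] a by auto
  have sumw: "r * real i - c \<le> (\<Sum>j<i. w j)" "(\<Sum>j<i. w j) \<le> r * real i" for i
  proof -
    have eq: "(\<Sum>j<i. w j) = a * real i + (c - a) * real_of_int \<lfloor>real i * \<rho>\<rfloor>"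
      unfolding w_def by (rule floor_pattern[OF \<rho>(1,2)])
    have e2: "(c - a) * (real i * \<rho>) = (r - a) * real i" using \<rho>(3) by (simp add: mult.left_commute mult.commute)
    have "(c - a) * real_of_int \<lfloor>real i * \<rho>\<rfloor> \<le> (c - a) * (real i * \<rho>)" using a by (intro mult_left_mono) auto
    then show "(\<Sum>j<i. w j) \<le> r * real i" unfolding eq e2 by (simp add: algebra_simps)
    have "(c - a) * (real i * \<rho> - 1) \<le> (c - a) * real_of_int \<lfloor>real i * \<rho>\<rfloor>" using a by (intro mult_left_mono) linarith+
    then show "r * real i - c \<le> (\<Sum>j<i. w j)" unfolding eq right_diff_distrib e2 using a by (simp add: algebra_simps)
  qed
  \<comment> \<open>A vertex is within \<open>2 * N\<close> of the ideal line; one unit is added for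
    a point inside an edge and one for the change of parameter on the line. \<open>K\<close>
    collects two such deviations, charged at \<open>b\<close>, and three roundings of \<Phi> of size
    at most \<open>b\<close>.\<close>
  define dv where "dv = 2 * real N + 2"
  define K where "K = 2 * b * dv + 3 * b"
  have b: "0 < b" using a by simp
  have K: "0 \<le> K" using b by (auto simp: K_def dv_def)
  show ?thesis
  proof (rule that[of N "K + dv"])
    show "0 < N" by (rule N0)
    show "real N = l1norm z" using N by simp
    show "0 \<le> K + dv" using K by (simp add: dv_def)
    fix v :: "real ^ 'n" and J :: nat assume v: "v \<in> Zd"
    define L where "L = J * N"
    define u where "u j = v + real (j div N) *\<^sub>R z + wd (j mod N)" for j
    have u0: "u 0 = v" by (simp add: u_def wd)
    have uL: "u L = v + real J *\<^sub>R z" using N0 by (simp add: u_def wd L_def)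
    have uZ: "u j \<in> Zd" for j
    proof -
      have "j mod N \<le> N" using N0 by (simp add: less_imp_le)
      then show ?thesis unfolding u_def using v z(1) wd(3) by (intro Zd_add Zd_scale) auto
    qed
    have ustep: "l1norm (u (Suc j) - u j) = 1" for j
    proof (cases "Suc (j mod N) = N")
      case True
      then have "Suc j mod N = 0" "Suc j div N = Suc (j div N)" by (auto simp: mod_Suc div_Suc)
      then have "u (Suc j) - u j = wd N - wd (j mod N)" by (simp add: u_def wd algebra_simps)
      then show ?thesis using wd(4)[of "j mod N"] True by simp
    next
      case False
      then have "Suc j mod N = Suc (j mod N)" "Suc j div N = j div N" by (auto simp: mod_Suc div_Suc)
      then have "u (Suc j) - u j = wd (Suc (j mod N)) - wd (j mod N)" by (simp add: u_def)
      then show ?thesis using wd(4)[of "j mod N"] N0 by simp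
    qed
    have wdle: "l1norm (wd j) \<le> real j" if "j \<le> N" for j
      using that
    proof (induction j)
      case 0 then show ?case by (simp add: wd)
    next
      case (Suc j)
      have "l1norm (wd (Suc j)) \<le> l1norm (wd (Suc j) - wd j) + l1norm (wd j)"
        using l1norm_triangle[of "wd (Suc j) - wd j" "wd j"] by simp
      then show ?case using Suc wd(4)[of j] by simp
    qed
    have dev: "l1norm (u j - (v + (real j / real N) *\<^sub>R z)) \<le> 2 * real N" for j
    proof -
      have "real j = real (j div N) * real N + real (j mod N)"
        by (metis div_mult_mod_eq of_nat_add of_nat_mult)
      then have "real j / real N = real (j div N) + real (j mod N) / real N" using N0 by (simp add: field_simps)
      then have "u j - (v + (real j / real N) *\<^sub>R z) = wd (j mod N) - (real (j mod N) / real N) *\<^sub>R z"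
        by (simp add: u_def algebra_simps)
      also have "l1norm \<dots> \<le> l1norm (wd (j mod N)) + l1norm ((real (j mod N) / real N) *\<^sub>R z)"
        using l1norm_triangle[of "wd (j mod N)" "- ((real (j mod N) / real N) *\<^sub>R z)"] by simp
      also have "\<dots> \<le> real (j mod N) + real (j mod N)"
        using wdle[of "j mod N"] N N0 by (simp add: less_imp_le)
      also have "\<dots> \<le> 2 * real N" using N0 by (simp add: less_imp_le)
      finally show ?thesis .
    qed
    define d where "d j = u (Suc j) - u j" for j
    define \<gamma> where "\<gamma> s = v + interp d L s" for s
    define \<Phi> where "\<Phi> = interp w L"
    have sumd: "(\<Sum>j<i. d j) = u i - v" for i unfolding d_def sum_lessThan_telescope u0 ..
    have \<gamma>nat: "\<gamma> (real i) = u i" if "i \<le> L" for i using interp_nat[OF that, of d] by (simp add: \<gamma>_def sumd)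
    have \<gamma>seg: "\<gamma> s = u i + (s - real i) *\<^sub>R (u (Suc i) - u i)" if "i < L" "real i \<le> s" "s \<le> real i + 1" for i s
    proof -
      have "interp d L s = (u i - v) + (s - real i) *\<^sub>R d i" using interp_segment[OF that, of d] sumd by simp
      then show ?thesis by (simp add: \<gamma>_def d_def)
    qed
    have \<Phi>seg: "\<Phi> s = (\<Sum>j<i. w j) + (s - real i) * w i" if "i < L" "real i \<le> s" "s \<le> real i + 1" for i s
      using interp_segment[OF that, of w] by (simp add: \<Phi>_def)
    have \<gamma>le: "l1norm (\<gamma> s - \<gamma> s') \<le> s - s'" if "0 \<le> s'" "s' \<le> s" "s \<le> real L" for s s'
      unfolding \<gamma>_def using interp_l1_lipschitz[of L d s' s] that ustep by (simp add: d_def)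
    have \<gamma>iso1: "l1norm (\<gamma> s - \<gamma> s') = s - s'" if s: "0 \<le> s'" "s' \<le> s" "s \<le> real L" for s s'
    proof (rule antisym)
      show "l1norm (\<gamma> s - \<gamma> s') \<le> s - s'" by (rule \<gamma>le[OF s])
      \<comment> \<open>The length of the whole path equals the distance of its ends, so the
        triangle inequality leaves no slack on any part of it.\<close>
      have "real L = l1norm (\<gamma> (real L) - \<gamma> 0)"
        using \<gamma>nat[of L] \<gamma>nat[of 0] u0 uL N by (simp add: L_def)
      also have "\<dots> \<le> l1norm (\<gamma> (real L) - \<gamma> s) + (l1norm (\<gamma> s - \<gamma> s') + l1norm (\<gamma> s' - \<gamma> 0))"
        using l1norm_triangle_diff[of "\<gamma> (real L)" "\<gamma> 0" "\<gamma> s"] l1norm_triangle_diff[of "\<gamma> s" "\<gamma> 0" "\<gamma> s'"] by linarith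
      also have "\<dots> \<le> (real L - s) + (l1norm (\<gamma> s - \<gamma> s') + (s' - 0))"
        using \<gamma>le[of s "real L"] \<gamma>le[of 0 s'] s by (intro add_mono) auto
      finally show "s - s' \<le> l1norm (\<gamma> s - \<gamma> s')" by simp
    qed
    have \<gamma>iso: "l1norm (\<gamma> s - \<gamma> s') = \<bar>s - s'\<bar>" if s: "0 \<le> s'" "s' \<le> real L" "0 \<le> s" "s \<le> real L" for s s'
    proof (cases "s' \<le> s")
      case True then show ?thesis using \<gamma>iso1[of s' s] s by simp
    next
      case False then show ?thesis using \<gamma>iso1[of s s'] s by (simp add: l1norm_minus_commute)
    qed
    have \<Phi>mono: "0 \<le> \<Phi> s - \<Phi> s'" "\<Phi> s - \<Phi> s' \<le> c * (s - s')" if "0 \<le> s'" "s' \<le> s" "s \<le> real L" for s s'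
      unfolding \<Phi>_def using interp_real_mono[of L w c s' s] w0 that by blast+
    have \<Phi>lip: "\<bar>\<Phi> s - \<Phi> s'\<bar> \<le> c * \<bar>s - s'\<bar>" if s: "0 \<le> s'" "s' \<le> real L" "0 \<le> s" "s \<le> real L" for s s'
    proof (cases "s' \<le> s")
      case True then show ?thesis using \<Phi>mono[of s' s] s by simp
    next
      case False then show ?thesis using \<Phi>mono[of s s'] s by simp
    qed
    have \<Phi>near: "r * s - 2 * c \<le> \<Phi> s" "\<Phi> s \<le> r * s + c" if s: "0 \<le> s" "s \<le> real L" for s
    proof -
      define i where "i = nat \<lfloor>s\<rfloor>"
      have i: "real i \<le> s" "s < real i + 1" using s unfolding i_def by linarith+
      have iL: "i \<le> L" using i(1) s by (metis of_nat_le_iff order_trans)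
      have \<Phi>i: "\<Phi> (real i) = (\<Sum>j<i. w j)" unfolding \<Phi>_def by (rule interp_nat[OF iL])
      have 1: "0 \<le> \<Phi> s - \<Phi> (real i)" "\<Phi> s - \<Phi> (real i) \<le> c * (s - real i)"
        using \<Phi>mono[of "real i" s] i s by auto
      have 2: "c * (s - real i) \<le> c * 1" using a i by (intro mult_left_mono) auto
      have 3: "r * (s - real i) \<le> c * 1" using a i ra by (intro mult_mono) auto
      have 4: "r * real i \<le> r * s" using i a ra by (intro mult_left_mono) auto
      show "r * s - 2 * c \<le> \<Phi> s" using 1 3 sumw(1)[of i] \<Phi>i by (simp add: algebra_simps)
      show "\<Phi> s \<le> r * s + c" using 1 2 4 sumw(2)[of i] \<Phi>i by simp
    qed
    have \<gamma>dev: "l1norm (\<gamma> s - (v + (s / real N) *\<^sub>R z)) \<le> dv" if s: "0 \<le> s" "s \<le> real L" for s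
    proof -
      define i where "i = nat \<lfloor>s\<rfloor>"
      have i: "real i \<le> s" "s < real i + 1" using s unfolding i_def by linarith+
      have iL: "i \<le> L" using i(1) s by (metis of_nat_le_iff order_trans)
      have "l1norm (\<gamma> s - (v + (s / real N) *\<^sub>R z))
          \<le> l1norm (\<gamma> s - u i) + (l1norm (u i - (v + (real i / real N) *\<^sub>R z)) + l1norm ((v + (real i / real N) *\<^sub>R z) - (v + (s / real N) *\<^sub>R z)))"
        using l1norm_triangle_diff[of "\<gamma> s" "v + (s / real N) *\<^sub>R z" "u i"]
          l1norm_triangle_diff[of "u i" "v + (s / real N) *\<^sub>R z" "v + (real i / real N) *\<^sub>R z"] by linarith
      also have "l1norm (\<gamma> s - u i) \<le> 1" using \<gamma>le[of "real i" s] \<gamma>nat[OF iL] i s by simp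
      also have "l1norm (u i - (v + (real i / real N) *\<^sub>R z)) \<le> 2 * real N" by (rule dev)
      also have "l1norm ((v + (real i / real N) *\<^sub>R z) - (v + (s / real N) *\<^sub>R z)) \<le> 1"
      proof -
        have "(v + (real i / real N) *\<^sub>R z) - (v + (s / real N) *\<^sub>R z) = ((real i - s) / real N) *\<^sub>R z"
          by (simp add: diff_divide_distrib algebra_simps)
        then show ?thesis using i N N0 by simp
      qed
      finally show ?thesis by (simp add: dv_def)
    qed
    let ?\<Gamma> = "\<Union>j<L. convex hull {u j, u (Suc j)}"
    have hullp: "\<exists>s. real j \<le> s \<and> s \<le> real j + 1 \<and> p = \<gamma> s" if j: "j < L" and p: "p \<in> convex hull {u j, u (Suc j)}" for j p
    proof -
      obtain t where t: "0 \<le> t" "t \<le> 1" "p = u j + t *\<^sub>R (u (Suc j) - u j)"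
        using p unfolding hull_pair by blast
      have "\<gamma> (real j + t) = p" using \<gamma>seg[OF j, of "real j + t"] t by simp
      then show ?thesis using t by (intro exI[of _ "real j + t"]) auto
    qed
    have \<Gamma>p: "\<exists>s. 0 \<le> s \<and> s \<le> real L \<and> p = \<gamma> s" if p: "p \<in> ?\<Gamma>" for p
    proof -
      obtain j where j: "j < L" "p \<in> convex hull {u j, u (Suc j)}" using p by blast
      obtain s where "real j \<le> s" "s \<le> real j + 1" "p = \<gamma> s" using hullp[OF j] by blast
      moreover have "real j + 1 \<le> real L" using j(1) by linarith
      ultimately show ?thesis by (intro exI[of _ s]) auto
    qed
    have ex_C: "\<exists>C. (\<forall>p\<in>?\<Gamma>. (1 - \<kappa>) * g (p - x) - (K + dv) \<le> C p \<and> C p \<le> (1 - \<kappa>) * g (p - x) \<and>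
                   (\<forall>q\<in>?\<Gamma>. C p - C q \<le> c * l1norm (p - q))) \<and>
                (\<forall>j<L. \<forall>p\<in>convex hull {u j, u (Suc j)}. \<forall>q\<in>convex hull {u j, u (Suc j)}.
                   C p - C q \<le> w j * l1norm (p - q))" for x
    proof -
      define h where "h p = (1 - \<kappa>) * g (p - x)" for p
      \<comment> \<open>The increment of the smaller norm along the path exceeds that of \<Phi> by
        at most \<open>K\<close>; this keeps the infimum defining \<open>cc\<close> from dropping
        further below \<open>h\<close>.\<close>
      have hK: "h (\<gamma> s) - h (\<gamma> s') \<le> \<bar>\<Phi> s - \<Phi> s'\<bar> + K" if s: "0 \<le> s" "s \<le> real L" "0 \<le> s'" "s' \<le> real L" for s s'
      proof -
        let ?e = "\<gamma> s - (v + (s / real N) *\<^sub>R z)" and ?e' = "\<gamma> s' - (v + (s' / real N) *\<^sub>R z)"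
        have "h (\<gamma> s) - h (\<gamma> s') = (1 - \<kappa>) * (g (\<gamma> s - x) - g (\<gamma> s' - x))" by (simp add: h_def algebra_simps)
        also have "\<dots> \<le> (1 - \<kappa>) * g (\<gamma> s - \<gamma> s')"
          using norms_diff(2)[OF g, of "\<gamma> s - x" "\<gamma> s' - x"] \<kappa> by (intro mult_left_mono) auto
        also have "\<gamma> s - \<gamma> s' = ((s - s') / real N) *\<^sub>R z + (?e - ?e')"
          by (simp add: diff_divide_distrib algebra_simps)
        also have "(1 - \<kappa>) * g (((s - s') / real N) *\<^sub>R z + (?e - ?e')) \<le> (1 - \<kappa>) * (\<bar>s - s'\<bar> / real N * g z + 2 * b * dv)"
        proof (rule mult_left_mono)
          have "g (((s - s') / real N) *\<^sub>R z + (?e - ?e')) \<le> g (((s - s') / real N) *\<^sub>R z) + g (?e - ?e')" by (rule G)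
          also have "g (((s - s') / real N) *\<^sub>R z) = \<bar>s - s'\<bar> / real N * g z" unfolding G(3) by simp
          also have "g (?e - ?e') \<le> b * l1norm (?e - ?e')" by (rule G)
          also have "\<dots> \<le> b * (dv + dv)"
            using l1norm_triangle[of ?e "- ?e'"] \<gamma>dev[OF s(1,2)] \<gamma>dev[OF s(3,4)] b
            by (intro mult_left_mono) (simp_all only: l1norm_uminus diff_conv_add_uminus)
          finally show "g (((s - s') / real N) *\<^sub>R z + (?e - ?e')) \<le> \<bar>s - s'\<bar> / real N * g z + 2 * b * dv" by simp
        qed (use \<kappa> in simp)
        also have "\<dots> = \<bar>s - s'\<bar> / real N * ((1 - \<kappa>) * g z) + (1 - \<kappa>) * (2 * b * dv)" by (simp add: algebra_simps)
        also have "\<dots> \<le> \<bar>s - s'\<bar> / real N * (r * real N) + 1 * (2 * b * dv)"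
          using ra(4) \<kappa> b by (intro add_mono mult_left_mono mult_right_mono) (auto simp: dv_def)
        also have "\<bar>s - s'\<bar> / real N * (r * real N) = r * \<bar>s - s'\<bar>" using N0 by simp
        also have "r * \<bar>s - s'\<bar> \<le> \<bar>\<Phi> s - \<Phi> s'\<bar> + 3 * c"
        proof (cases "s' \<le> s")
          case True
          then have "r * \<bar>s - s'\<bar> = r * s - r * s'" by (simp add: algebra_simps)
          then show ?thesis using \<Phi>near(1)[OF s(1,2)] \<Phi>near(2)[OF s(3,4)] by linarith
        next
          case False
          then have "r * \<bar>s - s'\<bar> = r * s' - r * s" by (simp add: algebra_simps)
          then show ?thesis using \<Phi>near(2)[OF s(1,2)] \<Phi>near(1)[OF s(3,4)] by linarith
        qed
        finally show ?thesis using a by (simp add: K_def)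
      qed
      \<comment> \<open>The inf-convolution of \<open>h\<close> with the travel time along the
        path.\<close>
      define A where "A s = (\<lambda>s'. h (\<gamma> s') + \<bar>\<Phi> s - \<Phi> s'\<bar>) ` {0..real L}" for s
      define cc where "cc s = Inf (A s)" for s
      have Alow: "h (\<gamma> s) - K \<le> y" if "0 \<le> s" "s \<le> real L" "y \<in> A s" for s y
        using hK[of s] that by (force simp: A_def)
      have Ane: "A s \<noteq> {}" for s by (auto simp: A_def)
      have bd: "bdd_below (A s)" if "0 \<le> s" "s \<le> real L" for s
        by (rule bdd_belowI[of _ "h (\<gamma> s) - K"]) (rule Alow[OF that])
      have cc1: "h (\<gamma> s) - K \<le> cc s" if "0 \<le> s" "s \<le> real L" for s
        unfolding cc_def by (rule cInf_greatest[OF Ane]) (rule Alow[OF that])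
      have cc2: "cc s \<le> h (\<gamma> s)" if "0 \<le> s" "s \<le> real L" for s
      proof -
        have "h (\<gamma> s) + \<bar>\<Phi> s - \<Phi> s\<bar> \<in> A s" unfolding A_def using that by (intro imageI) auto
        then show ?thesis unfolding cc_def using cInf_lower[OF _ bd[OF that]] by simp
      qed
      have cc3: "cc s - cc t \<le> \<bar>\<Phi> s - \<Phi> t\<bar>" if "0 \<le> s" "s \<le> real L" for s t
      proof -
        have "cc s - \<bar>\<Phi> s - \<Phi> t\<bar> \<le> cc t"
          unfolding cc_def[of t]
        proof (rule cInf_greatest[OF Ane])
          fix y assume "y \<in> A t"
          then obtain s' where s': "s' \<in> {0..real L}" "y = h (\<gamma> s') + \<bar>\<Phi> t - \<Phi> s'\<bar>" by (auto simp: A_def)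
          have "h (\<gamma> s') + \<bar>\<Phi> s - \<Phi> s'\<bar> \<in> A s" unfolding A_def using s' by (intro imageI)
          then have "cc s \<le> h (\<gamma> s') + \<bar>\<Phi> s - \<Phi> s'\<bar>" unfolding cc_def by (rule cInf_lower[OF _ bd[OF that]])
          then show "cc s - \<bar>\<Phi> s - \<Phi> t\<bar> \<le> y" using s'(2) by linarith
        qed
        then show ?thesis by simp
      qed
      \<comment> \<open>By isometry the parameter of a point of the path is its distance from the
        start \<open>v\<close>, which makes \<open>C\<close> a function of the point.\<close>
      define C where "C p = cc (l1norm (p - v))" for p
      have C\<gamma>: "C (\<gamma> s) = cc s" if "0 \<le> s" "s \<le> real L" for s
        using \<gamma>iso[of 0 s] that \<gamma>nat[of 0] u0 by (simp add: C_def)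
      show ?thesis
      proof (intro exI[of _ C] conjI ballI allI impI)
        fix p assume p: "p \<in> ?\<Gamma>"
        obtain s where s: "0 \<le> s" "s \<le> real L" "p = \<gamma> s" using \<Gamma>p[OF p] by blast
        have C: "C p = cc s" unfolding s(3) by (rule C\<gamma>[OF s(1,2)])
        show "(1 - \<kappa>) * g (p - x) - (K + dv) \<le> C p" "C p \<le> (1 - \<kappa>) * g (p - x)"
          using cc1[OF s(1,2)] cc2[OF s(1,2)] unfolding C unfolding s(3) h_def by (auto simp: dv_def)
        fix q assume q: "q \<in> ?\<Gamma>"
        obtain s' where s': "0 \<le> s'" "s' \<le> real L" "q = \<gamma> s'" using \<Gamma>p[OF q] by blast
        have "C p - C q \<le> \<bar>\<Phi> s - \<Phi> s'\<bar>" unfolding C s'(3) C\<gamma>[OF s'(1,2)] by (rule cc3[OF s(1,2)])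
        also have "\<dots> \<le> c * \<bar>s - s'\<bar>" by (rule \<Phi>lip) (use s s' in auto)
        also have "\<bar>s - s'\<bar> = l1norm (p - q)" unfolding s(3) s'(3) by (rule \<gamma>iso[symmetric]) (use s s' in auto)
        finally show "C p - C q \<le> c * l1norm (p - q)" .
      next
        fix j p q assume j: "j < L" and p: "p \<in> convex hull {u j, u (Suc j)}" and q: "q \<in> convex hull {u j, u (Suc j)}"
        have jL: "real j + 1 \<le> real L" using j by linarith
        obtain s where s: "real j \<le> s" "s \<le> real j + 1" "p = \<gamma> s" using hullp[OF j p] by blast
        obtain s' where s': "real j \<le> s'" "s' \<le> real j + 1" "q = \<gamma> s'" using hullp[OF j q] by blast
        have r0: "0 \<le> s" "s \<le> real L" "0 \<le> s'" "s' \<le> real L" using s s' jL by auto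
        have "C p - C q \<le> \<bar>\<Phi> s - \<Phi> s'\<bar>"
          unfolding s(3) s'(3) C\<gamma>[OF r0(1,2)] C\<gamma>[OF r0(3,4)] by (rule cc3[OF r0(1,2)])
        also have "\<Phi> s - \<Phi> s' = w j * (s - s')"
          unfolding \<Phi>seg[OF j s(1,2)] \<Phi>seg[OF j s'(1,2)] by (simp add: algebra_simps)
        also have "\<bar>w j * (s - s')\<bar> = w j * \<bar>s - s'\<bar>" using w0[of j] by (simp add: abs_mult)
        also have "\<bar>s - s'\<bar> = l1norm (p - q)" unfolding s(3) s'(3) by (rule \<gamma>iso[symmetric]) (use r0 in auto)
        finally show "C p - C q \<le> w j * l1norm (p - q)" .
      qed
    qed
    have wsum: "(\<Sum>j<L. w j) \<le> real J * g z"
    proof -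
      have "(\<Sum>j<L. w j) \<le> r * real L" by (rule sumw)
      also have "\<dots> = real J * (r * real N)" by (simp add: L_def)
      also have "\<dots> \<le> real J * g z" using ra by (intro mult_left_mono) auto
      finally show ?thesis .
    qed
    have dev': "l1norm (u j - (v + (real j / real N) *\<^sub>R z)) \<le> K + dv" for j
      using dev[of j] K by (simp add: dv_def)
    have iso: "l1norm (u i - u j) = \<bar>real i - real j\<bar>" if "i \<le> L" "j \<le> L" for i j
      using \<gamma>iso[of "real j" "real i"] \<gamma>nat that by simp
    show "\<exists>u w. is_highway g a c \<kappa> z N (K + dv) v J u w"
      unfolding is_highway_def L_def[symmetric]
      by (rule exI[of _ u], rule exI[of _ w], intro conjI)
        (use u0 uL uZ ustep w dev' wsum iso ex_C in blast)+
  qed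
qed

section \<open>Assembling the highways\<close>

text \<open>The potentials of the single highways are lowered by \<open>D\<close>, so as to lie
  below \<psi>, and glued. Between two highways the Lipschitz bound comes from that of \<psi> and
  the surplus \<theta> per unit of distance, which \<open>far\<close> makes at least as large as the
  error \<open>K + D\<close>. This error and another \<open>D\<close>, from comparing \<psi> with
  \<open>h\<close>, make up the loss.\<close>

lemma assemble_lower:
  fixes Y :: "(real ^ 'n) set" and \<Gamma> :: "'k \<Rightarrow> (real ^ 'n) set" and C :: "'k \<Rightarrow> real ^ 'n \<Rightarrow> real"
  assumes par: "\<beta>' + \<theta> \<le> c" "0 < \<theta>" "c \<le> b" and KD: "0 \<le> K" "0 < K + D" "0 \<le> D"
    and \<psi>lip: "\<And>z z'. z \<in> Y \<Longrightarrow> z' \<in> Y \<Longrightarrow> \<psi> z' - \<psi> z \<le> \<beta>' * l1norm (z - z')"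
    and \<psi>h: "\<And>y. y \<in> Y \<Longrightarrow> h y - D \<le> \<psi> y \<and> \<psi> y \<le> h y"
    and \<Gamma>: "\<And>k. k \<in> I \<Longrightarrow> \<Gamma> k \<subseteq> Y"
    and C: "\<And>k p. k \<in> I \<Longrightarrow> p \<in> \<Gamma> k \<Longrightarrow> h p - K \<le> C k p \<and> C k p \<le> h p"
    and Clip: "\<And>k p q. k \<in> I \<Longrightarrow> p \<in> \<Gamma> k \<Longrightarrow> q \<in> \<Gamma> k \<Longrightarrow> C k p - C k q \<le> c * l1norm (p - q)"
    and H\<Gamma>: "\<And>k e p. k \<in> I \<Longrightarrow> e \<in> H k \<Longrightarrow> p \<in> convex hull e \<Longrightarrow> p \<in> \<Gamma> k"
    and H: "\<And>k e p q. k \<in> I \<Longrightarrow> e \<in> H k \<Longrightarrow> p \<in> convex hull e \<Longrightarrow> q \<in> convex hull e \<Longrightarrow>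
        C k p - C k q \<le> t e * l1norm (p - q)"
    and far: "\<And>k k' p q. k \<in> I \<Longrightarrow> k' \<in> I \<Longrightarrow> k \<noteq> k' \<Longrightarrow> p \<in> \<Gamma> k \<Longrightarrow> q \<in> \<Gamma> k' \<Longrightarrow> K + D \<le> \<theta> * l1norm (p - q)"
    and off: "\<And>e z z'. e \<in> edges \<Longrightarrow> e \<notin> (\<Union>k\<in>I. H k) \<Longrightarrow> z \<noteq> z' \<Longrightarrow> z \<in> Y \<inter> convex hull e \<Longrightarrow> z' \<in> Y \<inter> convex hull e \<Longrightarrow>
        c \<le> t e \<or> (\<forall>u\<in>(\<Union>k\<in>I. \<Gamma> k). K + D \<le> \<theta> * l1norm (z - u)) \<and> \<psi> z' - \<psi> z \<le> t e * l1norm (z - z')"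
    and xy: "x \<in> Y" "y \<in> Y"
  shows "h y - h x - 2 * D - K \<le> passage_time b t Y x y"
proof -
  \<comment> \<open>By \<open>far\<close> and positivity of \<open>K + D\<close> the highways are
    disjoint, so a point on them has a unique index.\<close>
  define ix where "ix p = (SOME k. k \<in> I \<and> p \<in> \<Gamma> k)" for p
  have ix: "ix p = k" if "k \<in> I" "p \<in> \<Gamma> k" for p k
    unfolding ix_def
  proof (rule some_equality)
    show "k \<in> I \<and> p \<in> \<Gamma> k" using that by simp
    fix k' assume k': "k' \<in> I \<and> p \<in> \<Gamma> k'"
    show "k' = k"
    proof (rule ccontr)
      assume "k' \<noteq> k"
      then have "K + D \<le> \<theta> * l1norm (p - p)" using far[of k' k p p] k' that by blast
      then show False using KD by simp
    qed
  qed
  define CC where "CC p = C (ix p) p - D" for p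
  have CC: "CC p = C k p - D" if "k \<in> I" "p \<in> \<Gamma> k" for p k using ix[OF that] by (simp add: CC_def)
  have le: "\<theta> * l1norm p \<le> (c - \<beta>') * l1norm p" for p :: "real ^ 'n"
    using par by (intro mult_right_mono) auto
  have CC\<psi>: "\<psi> u - (K + D) \<le> CC u \<and> CC u \<le> \<psi> u" if k: "k \<in> I" "u \<in> \<Gamma> k" for k u
    using C[OF k] \<psi>h[of u] \<Gamma>[OF k(1)] k(2) CC[OF k] by (auto simp: subset_iff)
  have "\<psi> y - \<psi> x - (K + D) \<le> passage_time b t Y x y"
  proof (rule potential_lower[where \<Gamma> = "\<Union>k\<in>I. \<Gamma> k" and H = "\<Union>k\<in>I. H k" and \<beta> = c and \<beta>' = \<beta>' and C = CC])
    fix u v assume "u \<in> (\<Union>k\<in>I. \<Gamma> k)" "v \<in> (\<Union>k\<in>I. \<Gamma> k)"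
    then obtain k k' where k: "k \<in> I" "u \<in> \<Gamma> k" "k' \<in> I" "v \<in> \<Gamma> k'" by blast
    show "CC u - CC v \<le> c * l1norm (u - v)"
    proof (cases "k = k'")
      case True
      then show ?thesis using Clip[OF k(1,2)] CC[OF k(1,2)] CC[OF k(3,4)] k by simp
    next
      case False
      have uv: "u \<in> Y" "v \<in> Y" using \<Gamma> k by blast+
      have "CC u - CC v \<le> \<psi> u - \<psi> v + (K + D)" using CC\<psi>[OF k(1,2)] CC\<psi>[OF k(3,4)] by linarith
      also have "\<dots> \<le> \<beta>' * l1norm (u - v) + \<theta> * l1norm (u - v)"
        using \<psi>lip[OF uv(2,1)] far[OF k(1,3) False k(2,4)] by (simp add: l1norm_minus_commute)
      also have "\<dots> \<le> c * l1norm (u - v)"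
        using par unfolding distrib_right[symmetric] by (intro mult_right_mono) auto
      finally show ?thesis .
    qed
  next
    fix e z assume "e \<in> (\<Union>k\<in>I. H k)" "z \<in> convex hull e"
    then show "z \<in> (\<Union>k\<in>I. \<Gamma> k)" using H\<Gamma> by blast
  next
    fix e z z' assume e: "e \<in> (\<Union>k\<in>I. H k)" and z: "z \<in> convex hull e" and z': "z' \<in> convex hull e"
    then obtain k where k: "k \<in> I" "e \<in> H k" by blast
    show "CC z' - CC z \<le> t e * l1norm (z - z')"
      using H[OF k z' z] CC[OF k(1) H\<Gamma>[OF k z]] CC[OF k(1) H\<Gamma>[OF k z']] by (simp add: l1norm_minus_commute)
  next
    fix u assume "u \<in> (\<Union>k\<in>I. \<Gamma> k)"
    then show "\<psi> u - (K + D) \<le> CC u \<and> CC u \<le> \<psi> u" using CC\<psi> by blast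
  next
    fix e z z' assume *: "e \<in> edges" "e \<notin> (\<Union>k\<in>I. H k)" "z \<noteq> z'" "z \<in> Y \<inter> convex hull e" "z' \<in> Y \<inter> convex hull e"
    show "c \<le> t e \<or> (\<forall>u\<in>(\<Union>k\<in>I. \<Gamma> k). K + D \<le> (c - \<beta>') * l1norm (z - u)) \<and> \<psi> z' - \<psi> z \<le> t e * l1norm (z - z')"
      using off[OF *] le order_trans by blast
  next
    show "(\<Union>k\<in>I. \<Gamma> k) \<subseteq> Y" using \<Gamma> by blast
  qed (use par KD \<psi>lip xy in auto)
  then show ?thesis using \<psi>h[OF xy(1)] \<psi>h[OF xy(2)] by linarith
qed

text \<open>\<psi> is the largest function below \<open>g (y - x)\<close> whose increments are
  bounded by passage times; it stays within \<open>D\<close> of this norm because passage times are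
  at least \<open>g\<close> minus \<open>D\<close>. It replaces the norm itself, which need not
  respect the single edges of a typical environment.\<close>

lemma inf_convolution:
  fixes g :: "real ^ 'n \<Rightarrow> real"
  assumes g: "g \<in> norms a b" and b: "0 \<le> b" and t: "\<And>e. e \<in> edges \<Longrightarrow> 0 \<le> t e"
    and low: "\<And>v y. v \<in> Y \<Longrightarrow> y \<in> Y \<Longrightarrow> g (v - y) - D \<le> passage_time b t Y v y" and x: "x \<in> Y"
  obtains \<psi> where "\<And>y. y \<in> Y \<Longrightarrow> g (y - x) - D \<le> \<psi> y \<and> \<psi> y \<le> g (y - x)"
    "\<And>z z'. z \<in> Y \<Longrightarrow> z' \<in> Y \<Longrightarrow> \<psi> z' - \<psi> z \<le> passage_time b t Y z z'"
proof -
  let ?T = "passage_time b t Y"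
  define A where "A y = (\<lambda>v. g (v - x) + ?T v y) ` Y" for y
  define \<psi> where "\<psi> y = Inf (A y)" for y
  have Ane: "A y \<noteq> {}" for y using x by (auto simp: A_def)
  have low': "g (y - x) - D \<le> s" if y: "y \<in> Y" and s: "s \<in> A y" for y s
  proof -
    obtain v where v: "v \<in> Y" "s = g (v - x) + ?T v y" using s by (auto simp: A_def)
    have "g (y - x) \<le> g (y - v) + g (v - x)" by (rule norms_diff[OF g])
    then show ?thesis using low[OF v(1) y] v(2) norms_diff(3)[OF g, of y v] by linarith
  qed
  have bd: "bdd_below (A y)" if "y \<in> Y" for y
    by (rule bdd_belowI[of _ "g (y - x) - D"]) (rule low'[OF that])
  have le: "\<psi> y \<le> g (v - x) + ?T v y" if "y \<in> Y" "v \<in> Y" for y v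
    unfolding \<psi>_def by (rule cInf_lower[OF _ bd[OF that(1)]]) (use that in \<open>auto simp: A_def\<close>)
  show ?thesis
  proof (rule that[of \<psi>])
    fix y assume y: "y \<in> Y"
    have "?T y y = 0" by (rule passage_refl) (use t b y in auto)
    then have "\<psi> y \<le> g (y - x)" using le[OF y y] by simp
    moreover have "g (y - x) - D \<le> \<psi> y" unfolding \<psi>_def by (rule cInf_greatest[OF Ane low'[OF y]])
    ultimately show "g (y - x) - D \<le> \<psi> y \<and> \<psi> y \<le> g (y - x)" by simp
  next
    fix z z' assume z: "z \<in> Y" "z' \<in> Y"
    have "\<psi> z' - ?T z z' \<le> \<psi> z"
      unfolding \<psi>_def[of z]
    proof (rule cInf_greatest[OF Ane])
      fix s assume "s \<in> A z"
      then obtain v where v: "v \<in> Y" "s = g (v - x) + ?T v z" by (auto simp: A_def)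
      have "?T v z' \<le> ?T v z + ?T z z'" by (rule passage_triangle) (use t b v z in auto)
      then show "\<psi> z' - ?T z z' \<le> s" using le[OF z(2) v(1)] v(2) by linarith
    qed
    then show "\<psi> z' - \<psi> z \<le> ?T z z'" by simp
  qed
qed

text \<open>A tube of radius about \<open>M\<close> around a path of length at most \<open>A\<close>
  is covered by cubes around every \<open>M\<close>-th vertex: about \<open>A / M\<close> cubes with
  a number of lattice points of order \<open>M ^ CARD('n)\<close> each. The gain of one power of
  \<open>M\<close> over cubes around all vertices is what makes thin tubes cheap.\<close>

lemma tube_card:
  fixes u :: "'k \<Rightarrow> nat \<Rightarrow> real ^ 'n"
  assumes I: "finite I" and M: "1 \<le> M" "real M \<le> A" and L: "\<And>k. k \<in> I \<Longrightarrow> real (L k) \<le> A"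
    and u: "\<And>k i j. k \<in> I \<Longrightarrow> i \<le> L k \<Longrightarrow> j \<le> L k \<Longrightarrow> l1norm (u k i - u k j) \<le> \<bar>real i - real j\<bar>"
  shows "finite {e \<in> edges. \<exists>v\<in>e. \<exists>k\<in>I. \<exists>j\<le>L k. l1norm (v - u k j) \<le> real M + 2}"
    and "real (card {e \<in> edges. \<exists>v\<in>e. \<exists>k\<in>I. \<exists>j\<le>L k. l1norm (v - u k j) \<le> real M + 2})
      \<le> 2 * CARD('n) * (real (card I) * (2 * A / real M * (9 * real M) ^ CARD('n)))"
proof -
  let ?E = "{e \<in> edges. \<exists>v\<in>e. \<exists>k\<in>I. \<exists>j\<le>L k. l1norm (v - u k j) \<le> real M + 2}"
  \<comment> \<open>Half-width \<open>4 * M\<close>: \<open>M + 2\<close> for the distance to the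
    path and \<open>M\<close> for the way back to the preceding marked vertex, where
    \<open>M\<close> is at least 1.\<close>
  define B where "B k i = {v \<in> Zd. \<forall>l. \<bar>v $ l - u k (M * i) $ l\<bar> \<le> 4 * real M}" for k i
  define V where "V = (\<Union>k\<in>I. \<Union>i\<in>{..L k div M}. B k i)"
  have fB: "finite (B k i)" for k i unfolding B_def by (rule lattice_ball_card) simp
  have cB: "real (card (B k i)) \<le> (9 * real M) ^ CARD('n)" for k i
  proof -
    have "real (card (B k i)) \<le> (2 * (4 * real M) + 1) ^ CARD('n)" unfolding B_def by (rule lattice_ball_card) simp
    also have "\<dots> \<le> (9 * real M) ^ CARD('n)" using M by (intro power_mono) auto
    finally show ?thesis .
  qed
  have fV: "finite V" unfolding V_def using I fB by auto
  have "real (card V) \<le> (\<Sum>k\<in>I. \<Sum>i\<in>{..L k div M}. real (card (B k i)))"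
  proof -
    have "card V \<le> (\<Sum>k\<in>I. card (\<Union>i\<in>{..L k div M}. B k i))" unfolding V_def by (rule card_UN_le[OF I])
    also have "\<dots> \<le> (\<Sum>k\<in>I. \<Sum>i\<in>{..L k div M}. card (B k i))" by (intro sum_mono card_UN_le) simp
    finally have "real (card V) \<le> real (\<Sum>k\<in>I. \<Sum>i\<in>{..L k div M}. card (B k i))" by (rule of_nat_mono)
    then show ?thesis by simp
  qed
  also have "\<dots> \<le> (\<Sum>k\<in>I. \<Sum>i\<in>{..L k div M}. (9 * real M) ^ CARD('n))" by (intro sum_mono cB)
  also have "\<dots> \<le> (\<Sum>k\<in>I. 2 * A / real M * (9 * real M) ^ CARD('n))"
  proof (rule sum_mono)
    fix k assume k: "k \<in> I"
    have "real (L k div M) + 1 \<le> 2 * A / real M"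
    proof -
      have "real (L k div M) \<le> real (L k) / real M" by (rule of_nat_div_le_of_nat)
      also have "\<dots> \<le> A / real M" using L[OF k] by (intro divide_right_mono) auto
      finally have "real (L k div M) \<le> A / real M" .
      moreover have "1 \<le> A / real M" using M by (simp add: field_simps)
      moreover have "2 * A / real M = A / real M + A / real M" by simp
      ultimately show ?thesis by linarith
    qed
    then have "(real (L k div M) + 1) * (9 * real M) ^ CARD('n) \<le> 2 * A / real M * (9 * real M) ^ CARD('n)"
      by (rule mult_right_mono) simp
    then show "(\<Sum>i\<in>{..L k div M}. (9 * real M) ^ CARD('n)) \<le> 2 * A / real M * (9 * real M) ^ CARD('n)"
      by (simp add: add.commute)
  qed
  finally have cV: "real (card V) \<le> real (card I) * (2 * A / real M * (9 * real M) ^ CARD('n))" by simp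
  have VZ: "V \<subseteq> Zd" by (auto simp: V_def B_def)
  have sub: "?E \<subseteq> {e \<in> edges. e \<inter> V \<noteq> {}}"
  proof
    fix e assume "e \<in> ?E"
    then obtain v k j where e: "e \<in> edges" "v \<in> e" "k \<in> I" "j \<le> L k" "l1norm (v - u k j) \<le> real M + 2" by auto
    let ?i = "j div M"
    have "M * ?i \<le> j" by simp
    moreover have "j < M * ?i + M" using M by (metis add.commute dividend_less_times_div less_le_trans zero_less_one)
    ultimately have d: "\<bar>real j - real (M * ?i)\<bar> \<le> real M" by linarith
    have "l1norm (v - u k (M * ?i)) \<le> l1norm (v - u k j) + l1norm (u k j - u k (M * ?i))" by (rule l1norm_triangle_diff)
    also have "\<dots> \<le> (real M + 2) + real M" using e(5) u[OF e(3,4), of "M * ?i"] d e(4) \<open>M * ?i \<le> j\<close> by linarith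
    also have "\<dots> \<le> 4 * real M" using M by simp
    finally have "\<bar>(v - u k (M * ?i)) $ l\<bar> \<le> 4 * real M" for l using component_le_l1norm order_trans by blast
    then have "v \<in> B k ?i" using edge_subset_Zd[OF e(1)] e(2) by (auto simp: B_def)
    moreover have "?i \<le> L k div M" using e(4) by (rule div_le_mono)
    ultimately have "v \<in> V" using e(3) by (auto simp: V_def)
    then show "e \<in> {e \<in> edges. e \<inter> V \<noteq> {}}" using e by auto
  qed
  show "finite ?E" by (rule finite_subset[OF sub card_edges_touching(1)[OF fV VZ]])
  have "card ?E \<le> card {e \<in> edges. e \<inter> V \<noteq> {}}" by (rule card_mono[OF card_edges_touching(1)[OF fV VZ] sub])
  also have "\<dots> \<le> 2 * CARD('n) * card V" by (rule card_edges_touching(2)[OF fV VZ])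
  finally have "real (card ?E) \<le> real (2 * CARD('n) * card V)" by (rule of_nat_mono)
  also have "\<dots> = 2 * CARD('n) * real (card V)" by simp
  also have "\<dots> \<le> 2 * CARD('n) * (real (card I) * (2 * A / real M * (9 * real M) ^ CARD('n)))"
    using cV by (intro mult_left_mono) auto
  finally show "real (card ?E) \<le> 2 * CARD('n) * (real (card I) * (2 * A / real M * (9 * real M) ^ CARD('n)))" .
qed

text \<open>Finitely many disjoint compact segments in an open set keep a positive distance from
  each other and from the complement, which becomes room of order \<open>n\<close> after
  scaling.\<close>

lemma segments_margin:
  fixes p z :: "'k \<Rightarrow> real ^ 'n" and s :: "'k \<Rightarrow> real"
  assumes I: "finite I"
    and inside: "\<And>k r. k \<in> I \<Longrightarrow> 0 \<le> r \<Longrightarrow> r \<le> s k \<Longrightarrow> p k + r *\<^sub>R z k \<in> open_cube"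
    and disj: "\<And>k k' r r'. k \<in> I \<Longrightarrow> k' \<in> I \<Longrightarrow> k \<noteq> k' \<Longrightarrow> 0 \<le> r \<Longrightarrow> r \<le> s k \<Longrightarrow> 0 \<le> r' \<Longrightarrow> r' \<le> s k' \<Longrightarrow>
        p k + r *\<^sub>R z k \<noteq> p k' + r' *\<^sub>R z k'"
  obtains \<rho> where "0 < \<rho>"
    "\<And>k r y. k \<in> I \<Longrightarrow> 0 \<le> r \<Longrightarrow> r \<le> s k \<Longrightarrow> l1norm (y - (p k + r *\<^sub>R z k)) < \<rho> \<Longrightarrow> y \<in> open_cube"
    "\<And>k k' r r'. k \<in> I \<Longrightarrow> k' \<in> I \<Longrightarrow> k \<noteq> k' \<Longrightarrow> 0 \<le> r \<Longrightarrow> r \<le> s k \<Longrightarrow> 0 \<le> r' \<Longrightarrow> r' \<le> s k' \<Longrightarrow>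
        \<rho> \<le> l1norm ((p k + r *\<^sub>R z k) - (p k' + r' *\<^sub>R z k'))"
proof -
  define S where "S k = (\<lambda>r. p k + r *\<^sub>R z k) ` {0..s k}" for k
  have cS: "compact (S k)" for k unfolding S_def
    by (intro compact_continuous_image continuous_intros compact_Icc)
  have "\<exists>\<rho>>0. \<forall>x\<in>S k. \<forall>y\<in>- open_cube. \<rho> \<le> dist x y" if k: "k \<in> I" for k
  proof (rule separate_compact_closed[OF cS])
    show "closed (- (open_cube :: (real ^ 'n) set))" using open_open_cube by (simp add: closed_def)
    show "S k \<inter> - open_cube = {}" using inside[OF k] by (auto simp: S_def)
  qed
  then obtain r1 where r1: "\<And>k. k \<in> I \<Longrightarrow> 0 < r1 k" "\<And>k x y. k \<in> I \<Longrightarrow> x \<in> S k \<Longrightarrow> y \<notin> open_cube \<Longrightarrow> r1 k \<le> dist x y"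
    by (metis ComplI)
  have "\<exists>\<rho>>0. \<forall>x\<in>S k. \<forall>y\<in>S k'. \<rho> \<le> dist x y" if k: "k \<in> I" "k' \<in> I" "k \<noteq> k'" for k k'
  proof (rule separate_compact_closed[OF cS compact_imp_closed[OF cS]])
    show "S k \<inter> S k' = {}" using disj[OF k] by (auto simp: S_def)
  qed
  then obtain r2 where r2: "\<And>k k'. k \<in> I \<Longrightarrow> k' \<in> I \<Longrightarrow> k \<noteq> k' \<Longrightarrow> 0 < r2 k k'"
    "\<And>k k' x y. k \<in> I \<Longrightarrow> k' \<in> I \<Longrightarrow> k \<noteq> k' \<Longrightarrow> x \<in> S k \<Longrightarrow> y \<in> S k' \<Longrightarrow> r2 k k' \<le> dist x y" by metis
  \<comment> \<open>The element 1 keeps \<open>R\<close> nonempty even if \<open>I\<close> is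
    empty.\<close>
  define R where "R = insert 1 (r1 ` I \<union> (\<lambda>(k, k'). r2 k k') ` {q \<in> I \<times> I. fst q \<noteq> snd q})"
  have fR: "finite R" using I by (auto simp: R_def)
  have mR: "Min R \<le> x" if "x \<in> R" for x using that fR by simp
  have dl: "dist x y \<le> l1norm (x - y)" for x y :: "real ^ 'n" by (simp add: dist_norm norm_le_l1norm)
  show ?thesis
  proof (rule that[of "Min R"])
    show "0 < Min R" using fR r1(1) r2(1) by (subst Min_gr_iff) (auto simp: R_def)
    fix k r y assume k: "k \<in> I" "0 \<le> r" "r \<le> s k" and y: "l1norm (y - (p k + r *\<^sub>R z k)) < Min R"
    have S: "p k + r *\<^sub>R z k \<in> S k" using k by (auto simp: S_def)
    have "Min R \<le> r1 k" by (rule mR) (use k in \<open>simp add: R_def\<close>)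
    then show "y \<in> open_cube"
      using r1(2)[OF k(1) S, of y] y dl[of "p k + r *\<^sub>R z k" y] by (force simp: l1norm_minus_commute)
  next
    fix k k' r r' assume k: "k \<in> I" "k' \<in> I" "k \<noteq> k'" "0 \<le> r" "r \<le> s k" "0 \<le> r'" "r' \<le> s k'"
    have "p k + r *\<^sub>R z k \<in> S k" "p k' + r' *\<^sub>R z k' \<in> S k'" using k by (auto simp: S_def)
    then have "r2 k k' \<le> dist (p k + r *\<^sub>R z k) (p k' + r' *\<^sub>R z k')" by (rule r2(2)[OF k(1-3)])
    moreover have "Min R \<le> r2 k k'" by (rule mR) (use k in \<open>auto simp: R_def image_iff intro!: bexI[of _ "(k, k')"]\<close>)
    ultimately show "Min R \<le> l1norm ((p k + r *\<^sub>R z k) - (p k' + r' *\<^sub>R z k'))"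
      using dl[of "p k + r *\<^sub>R z k" "p k' + r' *\<^sub>R z k'"] by linarith
  qed
qed

lemma is_highwayD:
  assumes "is_highway g a c \<kappa> z N K v J u w"
  shows "u 0 = v" "u (J * N) = v + real J *\<^sub>R z" "\<And>j. u j \<in> Zd" "\<And>j. l1norm (u (Suc j) - u j) = 1"
    "\<And>j. w j = a \<or> w j = c" "\<And>j. l1norm (u j - (v + (real j / real N) *\<^sub>R z)) \<le> K"
    "(\<Sum>j<J * N. w j) \<le> real J * g z"
    "\<And>i j. i \<le> J * N \<Longrightarrow> j \<le> J * N \<Longrightarrow> l1norm (u i - u j) = \<bar>real i - real j\<bar>"
    "\<exists>C. (\<forall>p\<in>(\<Union>j<J * N. convex hull {u j, u (Suc j)}).
             (1 - \<kappa>) * g (p - x) - K \<le> C p \<and> C p \<le> (1 - \<kappa>) * g (p - x) \<and>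
             (\<forall>q\<in>(\<Union>j<J * N. convex hull {u j, u (Suc j)}). C p - C q \<le> c * l1norm (p - q))) \<and>
          (\<forall>j<J * N. \<forall>p\<in>convex hull {u j, u (Suc j)}. \<forall>q\<in>convex hull {u j, u (Suc j)}.
             C p - C q \<le> w j * l1norm (p - q))"
proof -
  note * = assms[unfolded is_highway_def]
  show "u 0 = v" "u (J * N) = v + real J *\<^sub>R z" "\<And>j. u j \<in> Zd" "\<And>j. l1norm (u (Suc j) - u j) = 1"
    "\<And>j. w j = a \<or> w j = c" "\<And>j. l1norm (u j - (v + (real j / real N) *\<^sub>R z)) \<le> K"
    "(\<Sum>j<J * N. w j) \<le> real J * g z"
    "\<And>i j. i \<le> J * N \<Longrightarrow> j \<le> J * N \<Longrightarrow> l1norm (u i - u j) = \<bar>real i - real j\<bar>"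
    using * by (elim conjE; simp)+
  show "\<exists>C. (\<forall>p\<in>(\<Union>j<J * N. convex hull {u j, u (Suc j)}).
             (1 - \<kappa>) * g (p - x) - K \<le> C p \<and> C p \<le> (1 - \<kappa>) * g (p - x) \<and>
             (\<forall>q\<in>(\<Union>j<J * N. convex hull {u j, u (Suc j)}). C p - C q \<le> c * l1norm (p - q))) \<and>
          (\<forall>j<J * N. \<forall>p\<in>convex hull {u j, u (Suc j)}. \<forall>q\<in>convex hull {u j, u (Suc j)}.
             C p - C q \<le> w j * l1norm (p - q))"
    using * by (elim conjE) (erule spec)
qed

lemma hull_step_near:
  assumes "p \<in> convex hull {x, y}"
  shows "l1norm (p - x) \<le> l1norm (y - x)"
proof -
  obtain t where t: "0 \<le> t" "t \<le> 1" "p = x + t *\<^sub>R (y - x)" using assms unfolding hull_pair by blast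
  then have "l1norm (p - x) = t * l1norm (y - x)" by simp
  also have "\<dots> \<le> l1norm (y - x)" using t by (simp add: mult_left_le_one_le)
  finally show ?thesis .
qed

lemma edge_unit_step:
  assumes "x \<in> Zd" "y \<in> Zd" "l1norm (y - x) = 1" shows "{x, y} \<in> edges"
  unfolding edges_def using assms l1norm_minus_commute[of x y] by auto

text \<open>An isometric path repeats no vertex, so no edge is used twice and weights can be
  prescribed edge by edge.\<close>

lemma isometric_edges_inj:
  assumes iso: "\<And>i j. i \<le> L \<Longrightarrow> j \<le> L \<Longrightarrow> l1norm (u i - u j) = \<bar>real i - real j\<bar>"
    and ij: "i < L" "j < L" and eq: "{u i, u (Suc i)} = {u j, u (Suc j)}"
  shows "i = j"
proof -
  have "u i \<in> {u j, u (Suc j)}" "u j \<in> {u i, u (Suc i)}" using eq by auto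
  then have "l1norm (u i - u j) = 0 \<or> l1norm (u i - u (Suc j)) = 0"
    "l1norm (u j - u i) = 0 \<or> l1norm (u j - u (Suc i)) = 0" by auto
  then have "(real i = real j \<or> real i = real (Suc j)) \<and> (real j = real i \<or> real j = real (Suc i))"
    using iso[of i j] iso[of i "Suc j"] iso[of j i] iso[of j "Suc i"] ij by auto
  then show ?thesis by auto
qed

lemma eventually_real_ge: "\<forall>\<^sub>F n in sequentially. K \<le> real n"
  using filterlim_real_sequentially by (simp add: filterlim_at_top)

definition cube_edges :: "nat \<Rightarrow> (real ^ 'n) set set" where
  "cube_edges n = {e \<in> edges. e \<subseteq> ncube n}"

text \<open>\<open>H\<close> are the highway edges, with prescribed values \<open>W\<close> up to \<open>2 \<theta>\<close>, and \<open>Tb\<close> the edges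
  around them. The two alternatives in the last clause are used when all edges are modified (so
  that the cost is of order \<open>n ^ d\<close>), respectively when the environment away from the highways
  is a typical one.\<close>

definition good_modification ::
  "(real ^ 'n \<Rightarrow> real) \<Rightarrow> real \<Rightarrow> real \<Rightarrow> real \<Rightarrow> real \<Rightarrow> real \<Rightarrow> real \<Rightarrow> nat \<Rightarrow>
    (real ^ 'n) set set \<Rightarrow> (real ^ 'n) set set \<Rightarrow> ((real ^ 'n) set \<Rightarrow> real) \<Rightarrow> bool" where
  "good_modification g a b \<beta> \<theta> D \<epsilon> n H Tb W \<longleftrightarrow>
     H \<subseteq> cube_edges n \<and> Tb \<subseteq> cube_edges n - H \<and> (\<forall>e\<in>H. W e = a \<or> W e = \<beta> - \<theta>) \<and>
     (\<forall>t. (\<forall>e\<in>edges. 0 \<le> t e \<and> t e \<le> b) \<longrightarrow> (\<forall>e\<in>H. W e \<le> t e \<and> t e \<le> W e + 2 * \<theta>) \<longrightarrow>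
       ((\<forall>e\<in>cube_edges n - H. \<beta> - \<theta> \<le> t e) \<or>
        (\<beta> = b \<and> (\<forall>e\<in>Tb. \<beta> - \<theta> \<le> t e) \<and>
          (\<exists>t'. (\<forall>e\<in>edges. 0 \<le> t' e \<and> t' e \<le> b) \<and> (\<forall>e\<in>cube_edges n - H - Tb. t' e \<le> t e) \<and>
            (\<forall>v\<in>ncube n. \<forall>y\<in>ncube n. g (v - y) - D * real n \<le> passage_time b t' (ncube n) v y)))) \<longrightarrow>
       (\<forall>x\<in>ncube n. \<forall>y\<in>ncube n. \<bar>g (x - y) - passage_time b t (ncube n) x y\<bar> \<le> \<epsilon> * real n))"

text \<open>The order of the quantifiers matters: \<theta>, and with it the probability of a
  prescribed window, is fixed before \<delta>. The fraction \<delta> of tube edges can thus be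
  chosen small against the logarithm of that probability, and the accuracy \<open>D\<close> demanded
  of the environment is adapted to it.\<close>

lemma construction:
  fixes g :: "real ^ 'n \<Rightarrow> real"
  assumes dim: "CARD('n) \<ge> 2" and g: "g \<in> norms a b" and ab: "0 < a" "a < \<beta>" "\<beta> \<le> b"
    and g\<beta>: "\<And>x. g x \<le> \<beta> * l1norm x" and \<epsilon>: "0 < \<epsilon>"
  shows "\<exists>\<theta>>0. \<theta> < \<beta> - a \<and> (\<forall>\<delta>>0. \<exists>D>0. \<exists>A. \<forall>\<^sub>F n in sequentially. \<exists>H Tb W.
      good_modification g a b \<beta> \<theta> D \<epsilon> n H Tb W \<and>
      real (card H) \<le> A * real n \<and> real (card Tb) \<le> \<delta> * real n ^ CARD('n))"
proof -
  note G = normsD[OF g]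
  have b: "0 < b" using ab by simp
  define d where "d = real CARD('n)"
  have d: "2 \<le> d" using dim by (simp add: d_def)
  show ?thesis
  proof (rule skeleton[OF dim g b \<epsilon>])
  fix I :: "(((real ^ 'n) \<times> (real ^ 'n)) \<times> nat) set" and p z s \<eta>
  assume I: "finite I" and \<eta>: "0 < \<eta>" and zs: "\<And>k. k \<in> I \<Longrightarrow> z k \<in> Zd \<and> z k \<noteq> 0 \<and> 0 < s k"
    and inside: "\<And>k r. k \<in> I \<Longrightarrow> 0 \<le> r \<Longrightarrow> r \<le> s k \<Longrightarrow> p k + r *\<^sub>R z k \<in> open_cube"
    and disj: "\<And>k k' r r'. k \<in> I \<Longrightarrow> k' \<in> I \<Longrightarrow> k \<noteq> k' \<Longrightarrow> 0 \<le> r \<Longrightarrow> r \<le> s k \<Longrightarrow> 0 \<le> r' \<Longrightarrow> r' \<le> s k' \<Longrightarrow>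
        p k + r *\<^sub>R z k \<noteq> p k' + r' *\<^sub>R z k'"
    and skel: "\<And>T x y. (\<And>x y z. x \<in> unit_cube \<Longrightarrow> y \<in> unit_cube \<Longrightarrow> z \<in> unit_cube \<Longrightarrow> T x z \<le> T x y + T y z) \<Longrightarrow>
       (\<And>x y. x \<in> unit_cube \<Longrightarrow> y \<in> unit_cube \<Longrightarrow> T x y \<le> b * l1norm (x - y)) \<Longrightarrow>
       (\<And>k. k \<in> I \<Longrightarrow> T (p k) (p k + s k *\<^sub>R z k) \<le> g (s k *\<^sub>R z k) + \<eta>) \<Longrightarrow>
       x \<in> unit_cube \<Longrightarrow> y \<in> unit_cube \<Longrightarrow> T x y \<le> g (x - y) + \<epsilon>"
  show ?thesis
  proof (rule segments_margin[where p = p and z = z and s = s, OF I inside disj])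
  fix \<rho> :: real assume \<rho>: "0 < \<rho>"
    and \<rho>in: "\<And>k r y. k \<in> I \<Longrightarrow> 0 \<le> r \<Longrightarrow> r \<le> s k \<Longrightarrow> l1norm (y - (p k + r *\<^sub>R z k)) < \<rho> \<Longrightarrow> y \<in> open_cube"
    and \<rho>far: "\<And>k k' r r'. k \<in> I \<Longrightarrow> k' \<in> I \<Longrightarrow> k \<noteq> k' \<Longrightarrow> 0 \<le> r \<Longrightarrow> r \<le> s k \<Longrightarrow> 0 \<le> r' \<Longrightarrow> r' \<le> s k' \<Longrightarrow>
        \<rho> \<le> l1norm ((p k + r *\<^sub>R z k) - (p k' + r' *\<^sub>R z k'))"
  \<comment> \<open>The entries give, in this order: \<open>a < c\<close>; \<kappa> at most 1; a
    total overshoot of at most \<open>\<eta> / 2 * n\<close> from \<open>2 * \<theta>\<close> on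
    each of at most \<open>n * d\<close> edges of a highway; a loss
    \<open>\<kappa> * b * d * n\<close> of at most \<open>\<epsilon> / 8 * n\<close>.\<close>
  define \<theta> where "\<theta> = Min {(\<beta> - a) / 2, a / 4, \<eta> / (8 * d), \<epsilon> * a / (16 * b * d)}"
  have \<theta>0: "0 < \<theta>" using ab \<eta> \<epsilon> b d by (simp add: \<theta>_def)
  have \<theta>: "\<theta> \<le> (\<beta> - a) / 2" "\<theta> \<le> a / 4" "\<theta> \<le> \<eta> / (8 * d)" "\<theta> \<le> \<epsilon> * a / (16 * b * d)"
    unfolding \<theta>_def by (rule Min_le; simp)+
  define c where "c = \<beta> - \<theta>"
  \<comment> \<open>The factor \<open>1 - \<kappa>\<close> lowers the Lipschitz constant \<beta> by
    at least \<open>\<kappa> * a\<close>, which is \<open>2 * \<theta>\<close>: one \<theta> to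
    reach \<open>c\<close> and one as surplus.\<close>
  define \<kappa> where "\<kappa> = 2 * \<theta> / a"
  have c: "a < c" "c \<le> b" using \<theta> \<theta>0 ab by (auto simp: c_def)
  have \<kappa>: "0 \<le> \<kappa>" "\<kappa> \<le> 1" using \<theta>(2) \<theta>0 ab by (auto simp: \<kappa>_def field_simps)
  have \<kappa>\<beta>: "(1 - \<kappa>) * \<beta> + \<theta> \<le> c"
  proof -
    have "2 * \<theta> = \<kappa> * a" using ab by (simp add: \<kappa>_def)
    also have "\<dots> \<le> \<kappa> * \<beta>" using \<kappa> ab by (intro mult_left_mono) auto
    finally show ?thesis by (simp add: c_def algebra_simps)
  qed
  have \<kappa>b: "\<kappa> * (b * d) \<le> \<epsilon> / 8"
  proof -
    have "\<kappa> * (b * d) = 2 * \<theta> * (b * d) / a" by (simp add: \<kappa>_def)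
    also have "\<dots> \<le> 2 * (\<epsilon> * a / (16 * b * d)) * (b * d) / a"
      using \<theta>(4) ab b d by (intro divide_right_mono mult_right_mono mult_left_mono) auto
    also have "\<dots> = \<epsilon> / 8" using ab b d by (simp add: field_simps)
    finally show ?thesis .
  qed
  have hw: "\<forall>k\<in>I. \<exists>N K. 0 < N \<and> real N = l1norm (z k) \<and> 0 \<le> K \<and>
      (\<forall>v J. v \<in> Zd \<longrightarrow> (\<exists>u w. is_highway g a c \<kappa> (z k) N K v J u w))"
  proof
    fix k assume k: "k \<in> I"
    have "(1 - \<kappa>) * g (z k) \<le> (1 - \<kappa>) * (\<beta> * l1norm (z k))" using g\<beta> \<kappa> by (intro mult_left_mono) auto
    also have "\<dots> = ((1 - \<kappa>) * \<beta>) * l1norm (z k)" by simp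
    also have "\<dots> \<le> c * l1norm (z k)" using \<kappa>\<beta> \<theta>0 by (intro mult_right_mono) auto
    finally have *: "(1 - \<kappa>) * g (z k) \<le> c * l1norm (z k)" .
    have zk: "z k \<in> Zd" "z k \<noteq> 0" using zs[OF k] by auto
    show "\<exists>N K. 0 < N \<and> real N = l1norm (z k) \<and> 0 \<le> K \<and>
      (\<forall>v J. v \<in> Zd \<longrightarrow> (\<exists>u w. is_highway g a c \<kappa> (z k) N K v J u w))"
      by (rule highway[OF g ab(1) c zk \<kappa> *]) blast
  qed
  from bchoice[OF this] obtain N where "\<forall>k\<in>I. \<exists>K. 0 < N k \<and> real (N k) = l1norm (z k) \<and> 0 \<le> K \<and>
      (\<forall>v J. v \<in> Zd \<longrightarrow> (\<exists>u w. is_highway g a c \<kappa> (z k) (N k) K v J u w))" by (elim exE)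
  from bchoice[OF this] obtain K where NK: "\<forall>k\<in>I. 0 < N k \<and> real (N k) = l1norm (z k) \<and> 0 \<le> K k \<and>
      (\<forall>v J. v \<in> Zd \<longrightarrow> (\<exists>u w. is_highway g a c \<kappa> (z k) (N k) (K k) v J u w))" by (elim exE)
  have N: "0 < N k" "real (N k) = l1norm (z k)" "0 \<le> K k" if "k \<in> I" for k using bspec[OF NK that] by auto
  have HW: "\<exists>u w. is_highway g a c \<kappa> (z k) (N k) (K k) v J u w" if "k \<in> I" "v \<in> Zd" for k v J
    using bspec[OF NK that(1)] that(2) by blast
  define Ks where "Ks = (\<Sum>k\<in>I. K k)"
  define Ns where "Ns = (\<Sum>k\<in>I. real (N k))"
  have Ks: "0 \<le> Ks" "\<And>k. k \<in> I \<Longrightarrow> K k \<le> Ks"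
    unfolding Ks_def using N I by (auto intro!: sum_nonneg member_le_sum)
  have Ns: "\<And>k. k \<in> I \<Longrightarrow> real (N k) \<le> Ns" "0 \<le> Ns"
    unfolding Ns_def using I by (auto intro!: sum_nonneg member_le_sum)
  have sN: "s k * real (N k) \<le> d" if k: "k \<in> I" for k
  proof -
    have "p k + 0 *\<^sub>R z k \<in> open_cube" "p k + s k *\<^sub>R z k \<in> open_cube"
      using zs[OF k] by (auto intro!: inside[OF k] simp del: scaleR_zero_left)
    then have "l1norm ((p k + s k *\<^sub>R z k) - (p k + 0 *\<^sub>R z k)) \<le> real CARD('n)"
      by (intro l1norm_unit_cube open_cube_subset)
    then show ?thesis using zs[OF k] N(2)[OF k] by (simp add: d_def)
  qed
  define Kc where "Kc = Ks + d + 1"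
  show ?thesis
  proof (rule exI[of _ \<theta>], intro conjI allI impI)
    show "0 < \<theta>" by (rule \<theta>0)
    show "\<theta> < \<beta> - a" using \<theta>(1) ab by simp
    fix \<delta> :: real assume \<delta>: "0 < \<delta>"
    define Q where "Q = 8 * d * d * real (card I) * 9 ^ CARD('n) + 1"
    have Q: "0 < Q" using d by (auto simp: Q_def intro!: add_nonneg_pos mult_nonneg_nonneg)
    \<comment> \<open>The tube radius relative to \<open>n\<close>. The bound 1/2 serves to reduce
      powers of \<open>2 * q\<close> to the first power, \<open>\<delta> / Q\<close> makes the tubes
      small, \<open>\<rho> / 4\<close> keeps highways farther apart than the tube radius, and the
      last entry makes \<open>D\<close> at most \<epsilon> / 16.\<close>
    define q where "q = Min {1 / 2, \<delta> / Q, \<rho> / 4, \<epsilon> / (16 * \<theta>)}"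
    have q0: "0 < q" using \<delta> Q \<rho> \<epsilon> \<theta>0 by (simp add: q_def)
    have q: "q \<le> 1 / 2" "q \<le> \<delta> / Q" "q \<le> \<rho> / 4" "q \<le> \<epsilon> / (16 * \<theta>)"
      unfolding q_def by (rule Min_le; simp)+
    \<comment> \<open>The environment may err by as much as the surplus \<theta> recovers over the
      distance \<open>q * n\<close>.\<close>
    define D where "D = q * \<theta>"
    have D: "0 < D" "D \<le> \<epsilon> / 16" using q0 \<theta>0 q(4) by (auto simp: D_def field_simps)
    define A where "A = real (card I) * d"
    have ev: "\<forall>\<^sub>F n in sequentially. 1 \<le> real n \<and> (Ks / \<theta> + 2) / q \<le> real n \<and> 2 * Kc / \<rho> \<le> real n
        \<and> (4 * Kc + 2 * Ks / \<theta>) / \<rho> \<le> real n \<and> 2 * (b * (2 * d + Ns)) / \<eta> \<le> real n \<and> 2 * Ks / \<epsilon> \<le> real n"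
      by (intro eventually_conj eventually_real_ge)
    show "\<exists>D>0. \<exists>A. \<forall>\<^sub>F n in sequentially. \<exists>H Tb W. good_modification g a b \<beta> \<theta> D \<epsilon> n H Tb W \<and>
      real (card H) \<le> A * real n \<and> real (card Tb) \<le> \<delta> * real n ^ CARD('n)"
    proof (rule exI[of _ D], intro conjI, rule D(1), rule exI[of _ A], rule eventually_mono[OF ev])
      fix n :: nat
      assume "1 \<le> real n \<and> (Ks / \<theta> + 2) / q \<le> real n \<and> 2 * Kc / \<rho> \<le> real n
        \<and> (4 * Kc + 2 * Ks / \<theta>) / \<rho> \<le> real n \<and> 2 * (b * (2 * d + Ns)) / \<eta> \<le> real n \<and> 2 * Ks / \<epsilon> \<le> real n"
      then have n1: "1 \<le> real n" and n2: "Ks / \<theta> + 2 \<le> q * real n" and n3: "2 * Kc \<le> \<rho> * real n"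
        and n4: "4 * Kc + 2 * Ks / \<theta> \<le> \<rho> * real n" and n5: "2 * (b * (2 * d + Ns)) \<le> \<eta> * real n" and n6: "2 * Ks \<le> \<epsilon> * real n"
        using q0 \<rho> \<eta> \<epsilon> by (simp_all add: pos_divide_le_eq mult.commute)
      have n: "0 < n" using n1 by simp
      \<comment> \<open>The highway starts at a lattice point next to the scaled segment and makes
        as many full periods as fit; the missing ends have bounded length and are travelled at cost
        \<open>b\<close>.\<close>
      define v where "v k = vfloor (real n *\<^sub>R p k)" for k
      have vP': "l1norm (real n *\<^sub>R p k - v k) \<le> d" for k unfolding v_def d_def by (rule l1norm_vfloor)
      have vP: "l1norm (v k - real n *\<^sub>R p k) \<le> d" for k by (subst l1norm_minus_commute) (rule vP')
      define J where "J k = nat \<lfloor>real n * s k\<rfloor>" for k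
      have J: "real (J k) \<le> real n * s k" "real n * s k \<le> real (J k) + 1" if "k \<in> I" for k
      proof -
        have "0 \<le> real n * s k" using zs[OF that] by simp
        then show "real (J k) \<le> real n * s k" "real n * s k \<le> real (J k) + 1" unfolding J_def by linarith+
      qed
      define L where "L k = J k * N k" for k
      have "\<forall>k\<in>I. \<exists>u w. is_highway g a c \<kappa> (z k) (N k) (K k) (v k) (J k) u w"
        by (intro ballI HW) (simp_all add: v_def)
      from bchoice[OF this] obtain u where "\<forall>k\<in>I. \<exists>w. is_highway g a c \<kappa> (z k) (N k) (K k) (v k) (J k) (u k) w"
        by (elim exE)
      from bchoice[OF this] obtain w where UW: "\<forall>k\<in>I. is_highway g a c \<kappa> (z k) (N k) (K k) (v k) (J k) (u k) (w k)"
        by (elim exE)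
      note U = is_highwayD[OF bspec[OF UW], folded L_def]
      have Ln: "real (L k) \<le> real n * d" if k: "k \<in> I" for k
      proof -
        have "real (L k) = real (J k) * real (N k)" by (simp add: L_def)
        also have "\<dots> \<le> (real n * s k) * real (N k)" using J[OF k] by (intro mult_right_mono) auto
        also have "\<dots> = real n * (s k * real (N k))" by simp
        also have "\<dots> \<le> real n * d" using sN[OF k] by (intro mult_left_mono) auto
        finally show ?thesis .
      qed
      define \<Gamma> where "\<Gamma> k = (\<Union>j<L k. convex hull {u k j, u k (Suc j)})" for k
      define ed where "ed = (\<lambda>(k, j). {u k j, u k (Suc j)})"
      define Hk where "Hk k = (\<lambda>j. ed (k, j)) ` {..<L k}" for k
      define H where "H = (\<Union>k\<in>I. Hk k)"
      \<comment> \<open>The three parts of \<open>Kc\<close>: \<open>Ks\<close> for the staircase,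
        \<open>d\<close> for rounding the start, and 1 for a point inside an edge.\<close>
      have near: "\<exists>r j. 0 \<le> r \<and> r \<le> s k \<and> l1norm (y - real n *\<^sub>R (p k + r *\<^sub>R z k)) \<le> Kc \<and> j \<le> L k \<and> l1norm (y - u k j) \<le> 1"
        if k: "k \<in> I" and y: "y \<in> \<Gamma> k" for k y
      proof -
        obtain j where j: "j < L k" "y \<in> convex hull {u k j, u k (Suc j)}" using y by (auto simp: \<Gamma>_def)
        define r where "r = real j / (real (N k) * real n)"
        have "real j \<le> real (J k) * real (N k)" using j(1) by (simp add: L_def flip: of_nat_mult)
        also have "\<dots> \<le> (real n * s k) * real (N k)" using J[OF k] by (intro mult_right_mono) auto
        finally have "r \<le> s k" using N(1)[OF k] n by (simp add: r_def field_simps)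
        have y1: "l1norm (y - u k j) \<le> 1" using hull_step_near[OF j(2)] U(4)[OF k] by simp
        have e: "(v k + (real j / real (N k)) *\<^sub>R z k) - real n *\<^sub>R (p k + r *\<^sub>R z k) = v k - real n *\<^sub>R p k"
          using n by (simp add: r_def algebra_simps)
        have "l1norm (y - real n *\<^sub>R (p k + r *\<^sub>R z k))
            \<le> l1norm (y - u k j) + (l1norm (u k j - (v k + (real j / real (N k)) *\<^sub>R z k))
               + l1norm ((v k + (real j / real (N k)) *\<^sub>R z k) - real n *\<^sub>R (p k + r *\<^sub>R z k)))"
          using l1norm_triangle_diff[of y "real n *\<^sub>R (p k + r *\<^sub>R z k)" "u k j"]
            l1norm_triangle_diff[of "u k j" "real n *\<^sub>R (p k + r *\<^sub>R z k)" "v k + (real j / real (N k)) *\<^sub>R z k"] by linarith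
        also have "\<dots> \<le> 1 + (Ks + d)"
        proof (intro add_mono y1)
          show "l1norm (u k j - (v k + (real j / real (N k)) *\<^sub>R z k)) \<le> Ks" using U(6)[OF k, of j] Ks(2)[OF k] by linarith
          show "l1norm ((v k + (real j / real (N k)) *\<^sub>R z k) - real n *\<^sub>R (p k + r *\<^sub>R z k)) \<le> d"
            unfolding e by (rule vP)
        qed
        finally have "l1norm (y - real n *\<^sub>R (p k + r *\<^sub>R z k)) \<le> Kc" by (simp add: Kc_def)
        moreover have "0 \<le> r" by (simp add: r_def)
        ultimately show ?thesis using \<open>r \<le> s k\<close> y1 j(1) by (intro exI[of _ r] exI[of _ j]) simp
      qed
      have \<Gamma>in: "\<Gamma> k \<subseteq> ncube n" if k: "k \<in> I" for k
      proof
        fix y assume "y \<in> \<Gamma> k"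
        from near[OF k this] obtain r where r: "0 \<le> r" "r \<le> s k" "l1norm (y - real n *\<^sub>R (p k + r *\<^sub>R z k)) \<le> Kc" by blast
        have "(1 / real n) *\<^sub>R y - (p k + r *\<^sub>R z k) = (1 / real n) *\<^sub>R (y - real n *\<^sub>R (p k + r *\<^sub>R z k))"
          using n by (simp add: algebra_simps)
        then have "l1norm ((1 / real n) *\<^sub>R y - (p k + r *\<^sub>R z k)) \<le> Kc / real n"
          using r(3) n by (simp add: divide_right_mono)
        also have "\<dots> < \<rho>"
        proof -
          have "0 < Kc" using Ks(1) d by (simp add: Kc_def)
          then have "Kc < \<rho> * real n" using n3 by linarith
          then show ?thesis using n by (simp add: pos_divide_less_eq)
        qed
        finally have "(1 / real n) *\<^sub>R y \<in> open_cube" by (rule \<rho>in[OF k r(1,2)])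
        then have "real n *\<^sub>R ((1 / real n) *\<^sub>R y) \<in> ncube n" by (intro scale_in_ncube open_cube_subset)
        then show "y \<in> ncube n" using n by simp
      qed
      \<comment> \<open>Scaled segments are \<open>\<rho> * n\<close> apart; after subtracting
        \<open>Kc\<close> twice, the bounds on \<open>q\<close> and \<open>n\<close> leave at least
        \<open>Ks / \<theta> + q * n\<close>.\<close>
      have far: "Ks + D * real n \<le> \<theta> * l1norm (y - y')"
        if k: "k \<in> I" "k' \<in> I" "k \<noteq> k'" and y: "y \<in> \<Gamma> k" "y' \<in> \<Gamma> k'" for k k' y y'
      proof -
        obtain r where r: "0 \<le> r" "r \<le> s k" "l1norm (y - real n *\<^sub>R (p k + r *\<^sub>R z k)) \<le> Kc" using near[OF k(1) y(1)] by blast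
        obtain r' where r': "0 \<le> r'" "r' \<le> s k'" "l1norm (y' - real n *\<^sub>R (p k' + r' *\<^sub>R z k')) \<le> Kc" using near[OF k(2) y(2)] by blast
        let ?x = "p k + r *\<^sub>R z k" and ?x' = "p k' + r' *\<^sub>R z k'"
        have "\<rho> * real n \<le> l1norm (?x - ?x') * real n" using \<rho>far[OF k r(1,2) r'(1,2)] by (intro mult_right_mono) auto
        also have "\<dots> = l1norm (real n *\<^sub>R ?x - real n *\<^sub>R ?x')" unfolding scaleR_diff_right[symmetric] by simp
        also have "\<dots> \<le> l1norm (real n *\<^sub>R ?x - y) + (l1norm (y - y') + l1norm (y' - real n *\<^sub>R ?x'))"
          using l1norm_triangle_diff[of "real n *\<^sub>R ?x" "real n *\<^sub>R ?x'" y] l1norm_triangle_diff[of y "real n *\<^sub>R ?x'" y'] by linarith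
        finally have 1: "\<rho> * real n \<le> 2 * Kc + l1norm (y - y')" using r(3) r'(3) by (simp add: l1norm_minus_commute)
        have "q * real n \<le> \<rho> / 4 * real n" using q(3) by (intro mult_right_mono) auto
        then have 2: "q * real n \<le> (\<rho> * real n) / 4" by simp
        define P where "P = \<rho> * real n"
        have "0 \<le> Ks / \<theta>" using Ks \<theta>0 by simp
        have "0 \<le> Kc" using Ks(1) d by (simp add: Kc_def)
        moreover have "2 * Ks / \<theta> = Ks / \<theta> + Ks / \<theta>" by simp
        ultimately have "Ks / \<theta> + q * real n \<le> l1norm (y - y')"
          using 1 2 n4 \<open>0 \<le> Ks / \<theta>\<close> unfolding P_def[symmetric] by linarith
        then have "\<theta> * (Ks / \<theta> + q * real n) \<le> \<theta> * l1norm (y - y')" using \<theta>0 by (intro mult_left_mono) auto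
        then show ?thesis using \<theta>0 by (simp add: D_def algebra_simps)
      qed
      have KD: "0 < Ks + D * real n" using Ks D n by (intro add_nonneg_pos) auto
      have \<Gamma>disj: "k = k'" if "k \<in> I" "k' \<in> I" "y \<in> \<Gamma> k" "y \<in> \<Gamma> k'" for k k' y
        using far[of k k' y y] that KD by fastforce
      have hullin: "convex hull (ed (k, j)) \<subseteq> \<Gamma> k" if "j < L k" for k j using that by (auto simp: \<Gamma>_def ed_def)
      have edE: "ed (k, j) \<in> cube_edges n" if k: "k \<in> I" and j: "j < L k" for k j
      proof -
        have "ed (k, j) \<in> edges" using U(3,4)[OF k] by (auto simp: ed_def intro!: edge_unit_step)
        moreover have "ed (k, j) \<subseteq> \<Gamma> k" using hullin[OF j] hull_subset[of "ed (k, j)" convex] by blast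
        ultimately show ?thesis using \<Gamma>in[OF k] by (auto simp: cube_edges_def)
      qed
      have inj: "inj_on ed (SIGMA k:I. {..<L k})"
      proof (rule inj_onI, clarify)
        fix k j k' j' assume k: "k \<in> I" "k' \<in> I" and j: "j < L k" "j' < L k'" and eq: "ed (k, j) = ed (k', j')"
        have "u k j \<in> convex hull (ed (k, j))" by (rule hull_inc) (simp add: ed_def)
        then have "u k j \<in> \<Gamma> k" "u k j \<in> \<Gamma> k'" using hullin[OF j(1)] hullin[OF j(2)] eq by auto
        then have kk: "k = k'" using \<Gamma>disj[OF k] by blast
        have "j = j'"
          by (rule isometric_edges_inj[of "L k" "u k"]) (use U(8)[OF k(1)] j eq kk in \<open>auto simp: ed_def\<close>)
        then show "k = k' \<and> j = j'" using kk by simp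
      qed
      have Hed: "H = ed ` (SIGMA k:I. {..<L k})" by (auto simp: H_def Hk_def)
      \<comment> \<open>Weights are prescribed on edges and not on pairs of indices, hence the
        inverse of the injective enumeration \<open>ed\<close>.\<close>
      define W where "W e = (case inv_into (SIGMA k:I. {..<L k}) ed e of (k, j) \<Rightarrow> w k j)" for e
      have W: "W (ed (k, j)) = w k j" if "k \<in> I" "j < L k" for k j
        using inv_into_f_f[OF inj, of "(k, j)"] that by (simp add: W_def)
      have cH: "real (card H) \<le> A * real n"
      proof -
        have "card H \<le> card (SIGMA k:I. {..<L k})" unfolding Hed using I by (intro card_image_le finite_SigmaI) auto
        also have "\<dots> = (\<Sum>k\<in>I. L k)" using I by simp
        finally have "real (card H) \<le> real (\<Sum>k\<in>I. L k)" by (rule of_nat_mono)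
        also have "\<dots> = (\<Sum>k\<in>I. real (L k))" by simp
        also have "\<dots> \<le> (\<Sum>k\<in>I. real n * d)" by (intro sum_mono Ln)
        finally show ?thesis by (simp add: A_def algebra_simps)
      qed
      \<comment> \<open>The tube has to contain every edge with a point where \<theta> times the
        distance to a highway is below \<open>Ks + D * n\<close>. The 2 added to \<open>M\<close> in
        \<open>Tb\<close> covers the way from a point of the edge to its end and from a point of the
        highway to a vertex.\<close>
      define M where "M = nat \<lceil>(Ks + D * real n) / \<theta>\<rceil> + 1"
      have eqKD: "(Ks + D * real n) / \<theta> = Ks / \<theta> + q * real n" using \<theta>0 by (simp add: D_def add_divide_distrib)
      have "0 \<le> (Ks + D * real n) / \<theta>" using KD \<theta>0 by simp
      then have M: "(Ks + D * real n) / \<theta> \<le> real M" "real M \<le> (Ks + D * real n) / \<theta> + 2" "1 \<le> M"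
        unfolding M_def by linarith+
      have M2: "real M \<le> 2 * (q * real n)" using M(2) n2 unfolding eqKD by linarith
      define Tb where "Tb = {e \<in> cube_edges n - H. \<exists>x\<in>e. \<exists>k\<in>I. \<exists>j\<le>L k. l1norm (x - u k j) \<le> real M + 2}"
      have cT: "real (card Tb) \<le> \<delta> * real n ^ CARD('n)"
      proof -
        let ?E = "{e \<in> edges. \<exists>x\<in>e. \<exists>k\<in>I. \<exists>j\<le>L k. l1norm (x - u k j) \<le> real M + 2}"
        have "q * real n \<le> 1 / 2 * real n" using q(1) by (intro mult_right_mono) auto
        then have MA: "real M \<le> real n * d"
          using M2 d n1 mult_left_mono[of 1 d "real n"] by linarith
        have fE: "finite ?E" and cE: "real (card ?E) \<le> 2 * CARD('n) * (real (card I) * (2 * (real n * d) / real M * (9 * real M) ^ CARD('n)))"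
          by (rule tube_card[OF I M(3) MA Ln]; use U(8) in simp)+
        have "card Tb \<le> card ?E" by (rule card_mono[OF fE]) (auto simp: Tb_def cube_edges_def)
        then have "real (card Tb) \<le> 2 * d * (real (card I) * (2 * (real n * d) / real M * (9 * real M) ^ CARD('n)))"
          using cE unfolding d_def by linarith
        \<comment> \<open>One factor \<open>M\<close> cancels. The remaining exponent is at least 1
          in dimension at least 2, so that one factor \<open>2 * q\<close> can be kept
          below.\<close>
        also have "2 * (real n * d) / real M * (9 * real M) ^ CARD('n) = 2 * (real n * d) * 9 ^ CARD('n) * real M ^ (CARD('n) - 1)"
        proof -
          have "real M ^ CARD('n) = real M * real M ^ (CARD('n) - 1)"
            by (simp add: power_eq_if)
          then show ?thesis using M(3) by (simp add: power_mult_distrib)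
        qed
        also have "2 * d * (real (card I) * (2 * (real n * d) * 9 ^ CARD('n) * real M ^ (CARD('n) - 1)))
            \<le> 2 * d * (real (card I) * (2 * (real n * d) * 9 ^ CARD('n) * (2 * q * real n ^ (CARD('n) - 1))))"
        proof (intro mult_left_mono)
          have "real M ^ (CARD('n) - 1) \<le> (2 * (q * real n)) ^ (CARD('n) - 1)" using M2 by (intro power_mono) auto
          also have "\<dots> = (2 * q) ^ (CARD('n) - 1) * real n ^ (CARD('n) - 1)" by (simp add: power_mult_distrib)
          also have "\<dots> \<le> (2 * q) ^ 1 * real n ^ (CARD('n) - 1)"
            using q(1) q0 dim by (intro mult_right_mono power_decreasing) auto
          finally show "real M ^ (CARD('n) - 1) \<le> 2 * q * real n ^ (CARD('n) - 1)" by simp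
        qed (use d in auto)
        also have "\<dots> = (8 * d * d * real (card I) * 9 ^ CARD('n)) * q * (real n * real n ^ (CARD('n) - 1))"
          by (simp add: algebra_simps)
        also have "real n * real n ^ (CARD('n) - 1) = real n ^ CARD('n)" by (simp add: power_eq_if)
        also have "(8 * d * d * real (card I) * 9 ^ CARD('n)) * q * real n ^ CARD('n) \<le> Q * q * real n ^ CARD('n)"
          using q0 by (intro mult_right_mono) (auto simp: Q_def)
        also have "\<dots> \<le> \<delta> * real n ^ CARD('n)"
          using q(2) Q by (intro mult_right_mono) (auto simp: field_simps)
        finally show ?thesis .
      qed
      have "good_modification g a b \<beta> \<theta> D \<epsilon> n H Tb W"
        unfolding good_modification_def
      proof (intro conjI allI impI ballI)
        show "H \<subseteq> cube_edges n" unfolding Hed using edE by auto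
        show "Tb \<subseteq> cube_edges n - H" by (auto simp: Tb_def)
        fix e assume "e \<in> H"
        then obtain k j where k: "k \<in> I" "j < L k" "e = ed (k, j)" unfolding Hed by blast
        then show "W e = a \<or> W e = \<beta> - \<theta>" using U(5)[OF k(1), of j] W[OF k(1,2)] by (simp add: c_def)
      next
        fix t :: "(real ^ 'n) set \<Rightarrow> real" and x y :: "real ^ 'n"
        assume t: "\<forall>e\<in>edges. 0 \<le> t e \<and> t e \<le> b" and tH: "\<forall>e\<in>H. W e \<le> t e \<and> t e \<le> W e + 2 * \<theta>"
          and cond: "(\<forall>e\<in>cube_edges n - H. \<beta> - \<theta> \<le> t e) \<or>
            (\<beta> = b \<and> (\<forall>e\<in>Tb. \<beta> - \<theta> \<le> t e) \<and>
            (\<exists>t'. (\<forall>e\<in>edges. 0 \<le> t' e \<and> t' e \<le> b) \<and> (\<forall>e\<in>cube_edges n - H - Tb. t' e \<le> t e) \<and>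
            (\<forall>v\<in>ncube n. \<forall>y\<in>ncube n. g (v - y) - D * real n \<le> passage_time b t' (ncube n) v y)))"
          and x: "x \<in> ncube n" and y: "y \<in> ncube n"
        have t0: "0 \<le> t e" "t e \<le> b" if "e \<in> edges" for e using t that by auto
        have b0: "0 \<le> b" using b by simp
        let ?T = "passage_time b t (ncube n)"
        have Ttri: "?T x z \<le> ?T x y + ?T y z" if "x \<in> ncube n" "y \<in> ncube n" "z \<in> ncube n" for x y z
          using passage_triangle[of t b x "ncube n" y z] t0 b0 that by blast
        have Tb': "?T x y \<le> b * l1norm (x - y)" if "x \<in> ncube n" "y \<in> ncube n" for x y
          using passage_le[of t b x "ncube n" y] t0 b0 that by blast
        have wt: "w k j \<le> t (ed (k, j))" "t (ed (k, j)) \<le> w k j + 2 * \<theta>" if "k \<in> I" "j < L k" for k j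
        proof -
          have "ed (k, j) \<in> H" unfolding Hed using that by auto
          then show "w k j \<le> t (ed (k, j))" "t (ed (k, j)) \<le> w k j + 2 * \<theta>" using tH W[OF that] by auto
        qed
        have upper: "?T x y \<le> g (x - y) + \<epsilon> * real n"
        proof -
          define T where "T x y = ?T (real n *\<^sub>R x) (real n *\<^sub>R y) / real n" for x y
          have "T ((1 / real n) *\<^sub>R x) ((1 / real n) *\<^sub>R y) \<le> g ((1 / real n) *\<^sub>R x - (1 / real n) *\<^sub>R y) + \<epsilon>"
          proof (rule skel[of T])
            fix x y z :: "real ^ 'n" assume "x \<in> unit_cube" "y \<in> unit_cube" "z \<in> unit_cube"
            then have "?T (real n *\<^sub>R x) (real n *\<^sub>R z) \<le> ?T (real n *\<^sub>R x) (real n *\<^sub>R y) + ?T (real n *\<^sub>R y) (real n *\<^sub>R z)"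
              by (intro Ttri scale_in_ncube)
            then show "T x z \<le> T x y + T y z"
              unfolding T_def add_divide_distrib[symmetric] by (rule divide_right_mono) simp
          next
            fix x y :: "real ^ 'n" assume "x \<in> unit_cube" "y \<in> unit_cube"
            then have "?T (real n *\<^sub>R x) (real n *\<^sub>R y) \<le> b * l1norm (real n *\<^sub>R x - real n *\<^sub>R y)"
              by (intro Tb' scale_in_ncube)
            also have "\<dots> = real n * (b * l1norm (x - y))" unfolding scaleR_diff_right[symmetric] by simp
            finally show "T x y \<le> b * l1norm (x - y)" unfolding T_def using n by (simp add: pos_divide_le_eq mult.commute)
          next
            fix k assume k: "k \<in> I"
            let ?P = "real n *\<^sub>R p k" and ?R = "real n *\<^sub>R (p k + s k *\<^sub>R z k)"
            have sk: "0 < s k" using zs[OF k] by simp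
            have "p k + 0 *\<^sub>R z k \<in> open_cube" "p k + s k *\<^sub>R z k \<in> open_cube"
              using sk by (auto intro!: inside[OF k] simp del: scaleR_zero_left)
            then have PR: "?P \<in> ncube n" "?R \<in> ncube n" by (auto intro!: scale_in_ncube open_cube_subset)
            show "T (p k) (p k + s k *\<^sub>R z k) \<le> g (s k *\<^sub>R z k) + \<eta>"
            proof (cases "L k = 0")
              case True
              \<comment> \<open>Not even one period fits, so the scaled segment is shorter than one
                period and the direct step is cheap enough.\<close>
              then have J0: "J k = 0" using N(1)[OF k] by (simp add: L_def)
              have "?T ?P ?R \<le> b * l1norm (?P - ?R)" by (rule Tb'[OF PR])
              also have "l1norm (?P - ?R) = (real n * s k) * real (N k)"
                using sk N(2)[OF k] by (simp add: scaleR_diff_right[symmetric])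
              also have "\<dots> \<le> 1 * real (N k)" using J(2)[OF k] J0 by (intro mult_right_mono) auto
              also have "\<dots> \<le> 2 * d + Ns" using Ns(1)[OF k] d by simp
              finally have "?T ?P ?R \<le> b * (2 * d + Ns)" using b by simp
              then have "?T ?P ?R \<le> \<eta> * real n" using n5 \<eta> n
                by (smt (verit) b d Ns(2) mult_nonneg_nonneg)
              then have "T (p k) (p k + s k *\<^sub>R z k) \<le> \<eta>" unfolding T_def using n by (simp add: pos_divide_le_eq)
              then show ?thesis using G(1)[of "s k *\<^sub>R z k"] by linarith
            next
              case False
              have uin: "u k j \<in> ncube n" if "j \<le> L k" for j
              proof -
                have "\<exists>i<L k. u k j \<in> {u k i, u k (Suc i)}"
                proof (cases "j < L k")
                  case True then show ?thesis by blast
                next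
                  case notless: False
                  then have "j = L k" using that by simp
                  then show ?thesis using False by (intro exI[of _ "j - 1"]) auto
                qed
                then obtain i where "i < L k" "u k j \<in> {u k i, u k (Suc i)}" by blast
                then have "u k j \<in> \<Gamma> k" unfolding \<Gamma>_def by (auto intro!: bexI[of _ i] hull_inc)
                then show ?thesis using \<Gamma>in[OF k] by blast
              qed
              have u0L: "u k 0 \<in> ncube n" "u k (L k) \<in> ncube n" using uin by auto
              have "?T (u k 0) (u k (L k)) \<le> (\<Sum>j<L k. ?T (u k j) (u k (Suc j)))"
                by (rule passage_chain) (use t0 b0 uin in auto)
              also have "\<dots> \<le> (\<Sum>j<L k. w k j + 2 * \<theta>)"
              proof (rule sum_mono)
                fix j assume "j \<in> {..<L k}"
                then have j: "j < L k" by simp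
                have "?T (u k j) (u k (Suc j)) \<le> step_time b t (u k j) (u k (Suc j))"
                  by (rule passage_le_step) (use t0 b0 uin j in auto)
                also have "\<dots> = t (ed (k, j)) * l1norm (u k j - u k (Suc j))"
                  by (rule step_time_edge) (use edE[OF k j] in \<open>auto simp: cube_edges_def ed_def intro!: hull_inc\<close>)
                also have "\<dots> = t (ed (k, j))" using U(4)[OF k, of j] by (simp add: l1norm_minus_commute)
                also have "\<dots> \<le> w k j + 2 * \<theta>" by (rule wt(2)[OF k j])
                finally show "?T (u k j) (u k (Suc j)) \<le> w k j + 2 * \<theta>" .
              qed
              also have "\<dots> = (\<Sum>j<L k. w k j) + real (L k) * (2 * \<theta>)" by (simp add: sum.distrib)
              also have "(\<Sum>j<L k. w k j) \<le> real (J k) * g (z k)" by (rule U(7)[OF k])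
              also have "real (J k) * g (z k) \<le> (real n * s k) * g (z k)" using J(1)[OF k] G(1)[of "z k"] by (rule mult_right_mono)
              also have "real (L k) * (2 * \<theta>) \<le> (real n * d) * (2 * \<theta>)" using Ln[OF k] \<theta>0 by (intro mult_right_mono) auto
              also have "(real n * d) * (2 * \<theta>) \<le> \<eta> / 2 * real n"
              proof -
                have "d * \<theta> \<le> \<eta> / 8" using \<theta>(3) d by (simp add: field_simps)
                then have "real n * (2 * (d * \<theta>)) \<le> real n * (\<eta> / 2)" using \<eta> by (intro mult_left_mono) linarith+
                then show ?thesis by (simp add: mult_ac)
              qed
              finally have mid: "?T (u k 0) (u k (L k)) \<le> (real n * s k) * g (z k) + \<eta> / 2 * real n" by simp
              have e1: "?T ?P (u k 0) \<le> b * d"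
              proof -
                have "?T ?P (u k 0) \<le> b * l1norm (?P - u k 0)" by (rule Tb'[OF PR(1) u0L(1)])
                also have "\<dots> \<le> b * d" unfolding U(1)[OF k] using vP'[of k] b by (intro mult_left_mono) auto
                finally show ?thesis .
              qed
              have e2: "?T (u k (L k)) ?R \<le> b * (d + Ns)"
              proof -
                have "u k (L k) - ?R = (v k - ?P) + (real (J k) - real n * s k) *\<^sub>R z k"
                  unfolding U(2)[OF k] by (simp add: algebra_simps)
                then have "l1norm (u k (L k) - ?R) \<le> l1norm (v k - ?P) + l1norm ((real (J k) - real n * s k) *\<^sub>R z k)"
                  using l1norm_triangle[of "v k - ?P" "(real (J k) - real n * s k) *\<^sub>R z k"] by simp
                also have "l1norm ((real (J k) - real n * s k) *\<^sub>R z k) = \<bar>real (J k) - real n * s k\<bar> * real (N k)"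
                  using N(2)[OF k] by simp
                also have "\<dots> \<le> 1 * real (N k)" using J[OF k] by (intro mult_right_mono) auto
                also have "l1norm (v k - ?P) \<le> d" by (rule vP)
                finally have "l1norm (u k (L k) - ?R) \<le> d + Ns" using Ns(1)[OF k] by simp
                then have "b * l1norm (u k (L k) - ?R) \<le> b * (d + Ns)" using b by (intro mult_left_mono) auto
                then show ?thesis using Tb'[OF u0L(2) PR(2)] by linarith
              qed
              have "?T ?P ?R \<le> ?T ?P (u k 0) + (?T (u k 0) (u k (L k)) + ?T (u k (L k)) ?R)"
                using Ttri[OF PR(1) u0L(1) PR(2)] Ttri[OF u0L PR(2)] by linarith
              also have "\<dots> \<le> b * d + (((real n * s k) * g (z k) + \<eta> / 2 * real n) + b * (d + Ns))"
                by (intro add_mono e1 e2 mid)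
              also have "\<dots> = b * (2 * d + Ns) + (real n * s k) * g (z k) + \<eta> / 2 * real n" by (simp add: algebra_simps)
              also have "\<dots> \<le> \<eta> / 2 * real n + (real n * s k) * g (z k) + \<eta> / 2 * real n"
                using n5 by simp
              also have "\<dots> = real n * (s k * g (z k) + \<eta>)" by (simp add: algebra_simps)
              also have "s k * g (z k) = g (s k *\<^sub>R z k)" using sk by (simp add: G(3))
              finally show ?thesis unfolding T_def using n by (simp add: pos_divide_le_eq mult.commute)
            qed
          qed (use x y n in \<open>auto simp: mem_ncube unit_cube_def pos_divide_le_eq\<close>)
          then have "?T x y / real n \<le> g ((1 / real n) *\<^sub>R (x - y)) + \<epsilon>"
            using n by (simp add: T_def scaleR_diff_right)
          also have "g ((1 / real n) *\<^sub>R (x - y)) = g (x - y) / real n" using n by (simp add: G(3))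
          finally have "?T x y / real n \<le> (g (x - y) + \<epsilon> * real n) / real n" using n by (simp add: add_divide_distrib)
          then show ?thesis using n by (simp add: divide_le_cancel)
        qed
        define h where "h y = (1 - \<kappa>) * g (y - x)" for y
        \<comment> \<open>Off the highways a potential near \<open>h\<close> is needed. If all other
          edges are expensive, \<open>h\<close> itself serves. In a typical environment it is
          \<open>1 - \<kappa>\<close> times the inf-convolution of the norm with passage times of
          \<open>t'\<close>, whose increments outside the tube are controlled by \<open>t' e\<close>
          \<le> \<open>t e\<close>.\<close>
        have ex\<psi>: "\<exists>\<psi>. (\<forall>z\<in>ncube n. \<forall>z'\<in>ncube n. \<psi> z' - \<psi> z \<le> ((1 - \<kappa>) * \<beta>) * l1norm (z - z')) \<and>
            (\<forall>y\<in>ncube n. h y - D * real n \<le> \<psi> y \<and> \<psi> y \<le> h y) \<and>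
            (\<forall>e z z'. e \<in> cube_edges n - H \<longrightarrow> z \<in> ncube n \<inter> convex hull e \<longrightarrow> z' \<in> ncube n \<inter> convex hull e \<longrightarrow>
               c \<le> t e \<or> (e \<notin> Tb \<and> \<psi> z' - \<psi> z \<le> t e * l1norm (z - z')))"
          using cond
        proof
          assume all: "\<forall>e\<in>cube_edges n - H. \<beta> - \<theta> \<le> t e"
          show ?thesis
          proof (intro exI[of _ h] conjI ballI allI impI)
            fix z z' :: "real ^ 'n"
            have "h z' - h z = (1 - \<kappa>) * (g (z' - x) - g (z - x))" by (simp add: h_def algebra_simps)
            also have "\<dots> \<le> (1 - \<kappa>) * (\<beta> * l1norm (z' - z))"
              using norms_diff(2)[OF g, of "z' - x" "z - x"] g\<beta>[of "z' - z"] \<kappa> by (intro mult_left_mono) auto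
            finally show "h z' - h z \<le> ((1 - \<kappa>) * \<beta>) * l1norm (z - z')" by (simp add: l1norm_minus_commute)
          next
            fix y show "h y - D * real n \<le> h y" using D by simp
          qed (use all in \<open>auto simp: c_def\<close>)
        next
          assume "\<beta> = b \<and> (\<forall>e\<in>Tb. \<beta> - \<theta> \<le> t e) \<and>
            (\<exists>t'. (\<forall>e\<in>edges. 0 \<le> t' e \<and> t' e \<le> b) \<and> (\<forall>e\<in>cube_edges n - H - Tb. t' e \<le> t e) \<and>
            (\<forall>v\<in>ncube n. \<forall>y\<in>ncube n. g (v - y) - D * real n \<le> passage_time b t' (ncube n) v y))"
          then obtain t' where bb: "\<beta> = b" and tT: "\<And>e. e \<in> Tb \<Longrightarrow> \<beta> - \<theta> \<le> t e"
            and t': "\<And>e. e \<in> edges \<Longrightarrow> 0 \<le> t' e" "\<And>e. e \<in> edges \<Longrightarrow> t' e \<le> b"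
            and t't: "\<And>e. e \<in> cube_edges n - H - Tb \<Longrightarrow> t' e \<le> t e"
            and low: "\<And>v y. v \<in> ncube n \<Longrightarrow> y \<in> ncube n \<Longrightarrow> g (v - y) - D * real n \<le> passage_time b t' (ncube n) v y"
            by blast
          obtain \<psi> where \<psi>: "\<And>y. y \<in> ncube n \<Longrightarrow> g (y - x) - D * real n \<le> \<psi> y \<and> \<psi> y \<le> g (y - x)"
              "\<And>z z'. z \<in> ncube n \<Longrightarrow> z' \<in> ncube n \<Longrightarrow> \<psi> z' - \<psi> z \<le> passage_time b t' (ncube n) z z'"
            using inf_convolution[where t = t', OF g b0 t'(1) low x] by blast
          show ?thesis
          proof (intro exI[of _ "\<lambda>y. (1 - \<kappa>) * \<psi> y"] conjI ballI allI impI)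
            fix z z' :: "real ^ 'n" assume z: "z \<in> ncube n" "z' \<in> ncube n"
            have "(1 - \<kappa>) * \<psi> z' - (1 - \<kappa>) * \<psi> z = (1 - \<kappa>) * (\<psi> z' - \<psi> z)" by (simp add: algebra_simps)
            also have "\<dots> \<le> (1 - \<kappa>) * (b * l1norm (z - z'))"
              using \<psi>(2)[OF z] passage_le[of t' b z "ncube n" z'] t' b0 z \<kappa> by (intro mult_left_mono) force+
            finally show "(1 - \<kappa>) * \<psi> z' - (1 - \<kappa>) * \<psi> z \<le> ((1 - \<kappa>) * \<beta>) * l1norm (z - z')" by (simp add: bb)
          next
            fix y :: "real ^ 'n" assume y: "y \<in> ncube n"
            have "(1 - \<kappa>) * (g (y - x) - D * real n) \<le> (1 - \<kappa>) * \<psi> y" using \<psi>(1)[OF y] \<kappa> by (intro mult_left_mono) auto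
            moreover have "(1 - \<kappa>) * (D * real n) \<le> D * real n" using \<kappa> D by (simp add: mult_left_le_one_le)
            ultimately show "h y - D * real n \<le> (1 - \<kappa>) * \<psi> y" by (simp add: h_def algebra_simps)
            show "(1 - \<kappa>) * \<psi> y \<le> h y" unfolding h_def using \<psi>(1)[OF y] \<kappa> by (intro mult_left_mono) auto
          next
            fix e and z z' :: "real ^ 'n" assume e: "e \<in> cube_edges n - H"
              and z: "z \<in> ncube n \<inter> convex hull e" and z': "z' \<in> ncube n \<inter> convex hull e"
            show "c \<le> t e \<or> (e \<notin> Tb \<and> (1 - \<kappa>) * \<psi> z' - (1 - \<kappa>) * \<psi> z \<le> t e * l1norm (z - z'))"
            proof (cases "e \<in> Tb")
              case True then show ?thesis using tT by (simp add: c_def)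
            next
              case False
              have ee: "e \<in> edges" using e by (simp add: cube_edges_def)
              let ?P = "passage_time b t' (ncube n) z z'"
              have "?P \<le> step_time b t' z z'" by (rule passage_le_step) (use t' b0 z z' in auto)
              also have "\<dots> = t' e * l1norm (z - z')" by (rule step_time_edge) (use ee z z' in auto)
              also have "\<dots> \<le> t e * l1norm (z - z')" using t't[of e] e False by (intro mult_right_mono) auto
              finally have P: "?P \<le> t e * l1norm (z - z')" .
              have "0 \<le> ?P" by (rule passage_ge) (use z z' t' b0 in \<open>auto intro!: path_time_nonneg\<close>)
              have "(1 - \<kappa>) * \<psi> z' - (1 - \<kappa>) * \<psi> z = (1 - \<kappa>) * (\<psi> z' - \<psi> z)" by (simp add: algebra_simps)
              also have "\<dots> \<le> (1 - \<kappa>) * ?P" using \<psi>(2)[of z z'] z z' \<kappa> by (intro mult_left_mono) auto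
              also have "\<dots> \<le> ?P" using \<open>0 \<le> ?P\<close> \<kappa> by (simp add: mult_left_le_one_le)
              finally show ?thesis using P False by simp
            qed
          qed
        qed
        then obtain \<psi> where \<psi>lip: "\<And>z z'. z \<in> ncube n \<Longrightarrow> z' \<in> ncube n \<Longrightarrow> \<psi> z' - \<psi> z \<le> ((1 - \<kappa>) * \<beta>) * l1norm (z - z')"
          and \<psi>h: "\<And>y. y \<in> ncube n \<Longrightarrow> h y - D * real n \<le> \<psi> y \<and> \<psi> y \<le> h y"
          and \<psi>off: "\<And>e z z'. e \<in> cube_edges n - H \<Longrightarrow> z \<in> ncube n \<inter> convex hull e \<Longrightarrow> z' \<in> ncube n \<inter> convex hull e \<Longrightarrow>
               c \<le> t e \<or> (e \<notin> Tb \<and> \<psi> z' - \<psi> z \<le> t e * l1norm (z - z'))"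
          by (elim exE conjE) blast
        have "\<forall>k\<in>I. \<exists>C. (\<forall>p\<in>\<Gamma> k. (1 - \<kappa>) * g (p - x) - K k \<le> C p \<and> C p \<le> (1 - \<kappa>) * g (p - x) \<and>
             (\<forall>q\<in>\<Gamma> k. C p - C q \<le> c * l1norm (p - q))) \<and>
          (\<forall>j<L k. \<forall>p\<in>convex hull {u k j, u k (Suc j)}. \<forall>q\<in>convex hull {u k j, u k (Suc j)}.
             C p - C q \<le> w k j * l1norm (p - q))"
          unfolding \<Gamma>_def by (rule ballI) (rule U(9))
        from bchoice[OF this] obtain C where C: "\<forall>k\<in>I. (\<forall>p\<in>\<Gamma> k. (1 - \<kappa>) * g (p - x) - K k \<le> C k p \<and> C k p \<le> (1 - \<kappa>) * g (p - x) \<and>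
             (\<forall>q\<in>\<Gamma> k. C k p - C k q \<le> c * l1norm (p - q))) \<and>
          (\<forall>j<L k. \<forall>p\<in>convex hull {u k j, u k (Suc j)}. \<forall>q\<in>convex hull {u k j, u k (Suc j)}.
             C k p - C k q \<le> w k j * l1norm (p - q))" by (elim exE)
        have "h y - h x - 2 * (D * real n) - Ks \<le> ?T x y"
        proof (rule assemble_lower[where \<beta>' = "(1 - \<kappa>) * \<beta>" and \<theta> = \<theta> and c = c and \<psi> = \<psi> and \<Gamma> = \<Gamma> and C = C and H = Hk and I = I])
          fix k p assume k: "k \<in> I" and p: "p \<in> \<Gamma> k"
          have "(1 - \<kappa>) * g (p - x) - K k \<le> C k p \<and> C k p \<le> (1 - \<kappa>) * g (p - x)" using bspec[OF C k] p by blast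
          then show "h p - Ks \<le> C k p \<and> C k p \<le> h p" using Ks(2)[OF k] unfolding h_def by linarith
          fix q assume "q \<in> \<Gamma> k"
          then show "C k p - C k q \<le> c * l1norm (p - q)" using bspec[OF C k] p by blast
        next
          fix k e p assume "k \<in> I" "e \<in> Hk k" "p \<in> convex hull e"
          then obtain j where "j < L k" "e = ed (k, j)" by (auto simp: Hk_def)
          then show "p \<in> \<Gamma> k" using hullin[of j k] \<open>p \<in> convex hull e\<close> by blast
        next
          fix k e p q assume k: "k \<in> I" and e: "e \<in> Hk k" and pq: "p \<in> convex hull e" "q \<in> convex hull e"
          obtain j where j: "j < L k" "e = ed (k, j)" using e by (auto simp: Hk_def)
          have "p \<in> convex hull {u k j, u k (Suc j)}" "q \<in> convex hull {u k j, u k (Suc j)}"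
            using pq unfolding j(2) ed_def by simp_all
          then have "C k p - C k q \<le> w k j * l1norm (p - q)" using bspec[OF C k] j(1) by blast
          also have "\<dots> \<le> t e * l1norm (p - q)" unfolding j(2) using wt(1)[OF k j(1)] by (intro mult_right_mono) auto
          finally show "C k p - C k q \<le> t e * l1norm (p - q)" .
        next
          fix e and z z' :: "real ^ 'n" assume e: "e \<in> edges" "e \<notin> (\<Union>k\<in>I. Hk k)" and ne: "z \<noteq> z'"
            and z: "z \<in> ncube n \<inter> convex hull e" and z': "z' \<in> ncube n \<inter> convex hull e"
          have eH: "e \<notin> H" using e(2) by (simp add: H_def)
          have "e \<subseteq> ncube n" unfolding ncube_def
            by (rule edge_in_box[OF _ _ e(1) ne]) (use z z' in \<open>auto simp: ncube_def\<close>)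
          then have ec: "e \<in> cube_edges n - H" using e(1) eH by (simp add: cube_edges_def)
          show "c \<le> t e \<or> (\<forall>u\<in>(\<Union>k\<in>I. \<Gamma> k). Ks + D * real n \<le> \<theta> * l1norm (z - u)) \<and> \<psi> z' - \<psi> z \<le> t e * l1norm (z - z')"
            using \<psi>off[OF ec z z']
          proof
            assume off: "e \<notin> Tb \<and> \<psi> z' - \<psi> z \<le> t e * l1norm (z - z')"
            \<comment> \<open>A point violating this would put its edge into the tube.\<close>
            have "Ks + D * real n \<le> \<theta> * l1norm (z - y)" if ky: "k \<in> I" "y \<in> \<Gamma> k" for k y
            proof (rule ccontr)
              assume "\<not> Ks + D * real n \<le> \<theta> * l1norm (z - y)"
              then have "l1norm (z - y) < (Ks + D * real n) / \<theta>" using \<theta>0 by (simp add: pos_less_divide_eq mult.commute)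
              then have zy: "l1norm (z - y) \<le> real M" using M(1) by linarith
              obtain j where j: "j \<le> L k" "l1norm (y - u k j) \<le> 1" using near[OF ky] by blast
              obtain v0 i where v0: "v0 \<in> Zd" "e = {v0, v0 + axis i 1}" using e(1) by (rule edge_cases)
              have zv: "l1norm (z - v0) \<le> 1" using hull_step_near[of z v0 "v0 + axis i 1"] z v0 by simp
              have "l1norm (v0 - u k j) \<le> l1norm (v0 - z) + (l1norm (z - y) + l1norm (y - u k j))"
                using l1norm_triangle_diff[of v0 "u k j" z] l1norm_triangle_diff[of z "u k j" y] by linarith
              also have "\<dots> \<le> real M + 2" using zv zy j by (simp add: l1norm_minus_commute)
              finally have "e \<in> Tb" using ec v0(2) j(1) ky(1) eH unfolding Tb_def by blast
              then show False using off by simp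
            qed
            then show ?thesis using off by blast
          qed simp
        qed (use \<kappa>\<beta> \<theta>0 c Ks KD D \<psi>lip \<psi>h \<Gamma>in far x y in auto)
        moreover have "h x = 0" using G(2) by (simp add: h_def)
        moreover have "h y \<ge> g (x - y) - \<epsilon> / 8 * real n"
        proof -
          have "l1norm (y - x) \<le> d * real n"
          proof -
            have "\<bar>(y - x) $ i\<bar> \<le> real n" for i
            proof -
              have "0 \<le> x $ i" "x $ i \<le> real n" "0 \<le> y $ i" "y $ i \<le> real n" using x y by (auto simp: mem_ncube)
              then show ?thesis by simp
            qed
            then show ?thesis using l1norm_bound[of "y - x" "real n"] by (simp add: d_def)
          qed
          then have "\<kappa> * g (y - x) \<le> \<kappa> * (b * (d * real n))"
            using G(6)[of "y - x"] b \<kappa> by (intro mult_left_mono order_trans[OF G(6)]) auto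
          also have "\<dots> = \<kappa> * (b * d) * real n" by simp
          also have "\<dots> \<le> \<epsilon> / 8 * real n" using \<kappa>b by (intro mult_right_mono) auto
          finally show ?thesis using norms_diff(3)[OF g, of x y] by (simp add: h_def algebra_simps)
        qed
        moreover have "2 * (D * real n) \<le> \<epsilon> / 8 * real n" using D(2) mult_right_mono[of "2 * D" "\<epsilon> / 8" "real n"] by simp
        moreover have "Ks \<le> \<epsilon> / 2 * real n" using n6 by simp
        moreover have "\<epsilon> / 8 * real n + \<epsilon> / 8 * real n + \<epsilon> / 2 * real n \<le> \<epsilon> * real n"
          using \<epsilon> by (simp add: algebra_simps)
        ultimately have "g (x - y) - \<epsilon> * real n \<le> ?T x y" by linarith
        then show "\<bar>g (x - y) - ?T x y\<bar> \<le> \<epsilon> * real n" using upper by linarith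
      qed
      then show "\<exists>H Tb W. good_modification g a b \<beta> \<theta> D \<epsilon> n H Tb W \<and>
        real (card H) \<le> A * real n \<and> real (card Tb) \<le> \<delta> * real n ^ CARD('n)"
        using cH cT by blast
    qed
  qed
  qed
  qed
qed

section \<open>Lower bounds on the probability\<close>

text \<open>The grid has a fixed number of points per side and a mesh \<open>m\<close> growing with
  \<open>n\<close>, so that finitely many pairs of grid points control the whole cube at scale
  \<open>n\<close>.\<close>

lemma exists_lattice_approx:
  fixes v :: "real ^ 'n"
  assumes N: "0 < N" and m: "m = n div N" "N \<le> m" and v: "v \<in> ncube n"
  obtains P where "P \<in> Zd" "\<And>i. 0 \<le> P $ i \<and> P $ i \<le> real N" "l1norm (v - real m *\<^sub>R P) \<le> CARD('n) * real m"
proof -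
  have m0: "0 < m" using assms by simp
  define P where "P = vfloor ((1 / real m) *\<^sub>R v)"
  have "n < (m + 1) * N" using N m(1)
    by (metis Suc_eq_plus1 dividend_less_div_times mult.commute add.commute mult_Suc)
  then have "real n < real ((m + 1) * N)" by (rule of_nat_less_iff[THEN iffD2])
  also have "\<dots> = real m * real N + real N" by (simp add: algebra_simps)
  \<comment> \<open>The remainder of \<open>n\<close> modulo \<open>N\<close> is less than one mesh;
    hence rounding down never gives an index above \<open>N\<close>.\<close>
  also have "\<dots> \<le> real m * real N + real m" using m(2) by simp
  finally have n: "real n < real m * (real N + 1)" by (simp add: algebra_simps)
  have "0 \<le> P $ i \<and> P $ i \<le> real N" for i
  proof -
    have vi: "0 \<le> v $ i" "v $ i \<le> real n" using v by (auto simp: mem_ncube)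
    have "v $ i < real m * (real N + 1)" using vi n by linarith
    then have "v $ i / real m < real N + 1" using m0 by (simp add: pos_divide_less_eq mult.commute)
    moreover have "0 \<le> v $ i / real m" using vi by simp
    ultimately have "0 \<le> \<lfloor>v $ i / real m\<rfloor>" "\<lfloor>v $ i / real m\<rfloor> \<le> int N" by linarith+
    moreover have "P $ i = real_of_int \<lfloor>v $ i / real m\<rfloor>" by (simp add: P_def vfloor_def)
    ultimately show ?thesis by linarith
  qed
  moreover have "l1norm (v - real m *\<^sub>R P) \<le> CARD('n) * real m"
  proof -
    have "v - real m *\<^sub>R P = real m *\<^sub>R ((1 / real m) *\<^sub>R v - P)" using m0 by (simp add: scaleR_diff_right)
    then have "l1norm (v - real m *\<^sub>R P) = real m * l1norm ((1 / real m) *\<^sub>R v - P)" by simp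
    also have "\<dots> \<le> real m * CARD('n)" unfolding P_def by (intro mult_left_mono l1norm_vfloor) auto
    finally show ?thesis by (simp add: mult.commute)
  qed
  moreover have "P \<in> Zd" by (simp add: P_def)
  ultimately show ?thesis using that by blast
qed

lemma prod_ge_power:
  fixes f :: "'a \<Rightarrow> real"
  assumes "finite A" "\<And>x. x \<in> A \<Longrightarrow> \<alpha> \<le> f x" "0 \<le> \<alpha>"
  shows "\<alpha> ^ card A \<le> (\<Prod>x\<in>A. f x)"
  using prod_mono[of A "\<lambda>_. \<alpha>" f] assms by simp

lemma power_ge_exp:
  assumes "0 < \<alpha>" "\<alpha> \<le> 1" "real k \<le> K"
  shows "exp (- (K * ln (1 / \<alpha>))) \<le> \<alpha> ^ k"
proof -
  have l: "0 \<le> ln (1 / \<alpha>)" using assms by simp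
  have "\<alpha> ^ k = exp (real k * ln \<alpha>)" using assms(1) by (simp add: exp_of_nat_mult)
  also have "real k * ln \<alpha> = - (real k * ln (1 / \<alpha>))" using assms(1) by (simp add: ln_div)
  finally have "\<alpha> ^ k = exp (- (real k * ln (1 / \<alpha>)))" .
  moreover have "real k * ln (1 / \<alpha>) \<le> K * ln (1 / \<alpha>)" using assms(3) l by (rule mult_right_mono)
  ultimately show ?thesis by simp
qed

text \<open>In dimension at least 2 a cost linear in \<open>n\<close>, such as that of the highways,
  is negligible against the volume.\<close>

lemma linear_le_power:
  fixes B :: real
  assumes "2 \<le> d" "B \<le> c * real n" "1 \<le> real n" "0 \<le> c"
  shows "B * real n \<le> c * real n ^ d"
proof -
  have "B * real n \<le> (c * real n) * real n" using assms(2) by (intro mult_right_mono) auto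
  also have "\<dots> = c * real n ^ 2" by (simp add: power2_eq_square)
  also have "\<dots> \<le> c * real n ^ d" using assms by (intro mult_left_mono power_increasing) auto
  finally show ?thesis .
qed

lemma finite_cube_edges: "finite (cube_edges n :: (real ^ 'n) set set)"
  unfolding cube_edges_def ncube_def by (rule finite_box_edges)

context fpp begin

lemma good_modification_LD:
  fixes g :: "real ^ 'n \<Rightarrow> real"
  assumes g: "g \<in> norms a b" and n: "0 < n" and sp: "\<omega> \<in> space M"
    and close: "\<And>x y. x \<in> ncube n \<Longrightarrow> y \<in> ncube n \<Longrightarrow>
        \<bar>g (x - y) - passage_time b (\<lambda>e. \<tau> e \<omega>) (ncube n) x y\<bar> \<le> \<epsilon> * real n"
  shows "\<omega> \<in> LD M \<tau> b n g \<epsilon>"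
proof -
  have "\<bar>g (x - y) - rescaled_time b (\<lambda>e. \<tau> e \<omega>) n unit_cube x y\<bar> \<le> \<epsilon>"
    if "x \<in> unit_cube" "y \<in> unit_cube" for x y
  proof -
    let ?T = "passage_time b (\<lambda>e. \<tau> e \<omega>) (ncube n) (real n *\<^sub>R x) (real n *\<^sub>R y)"
    have "g (real n *\<^sub>R x - real n *\<^sub>R y) = real n * g (x - y)"
      unfolding scaleR_diff_right[symmetric] normsD(3)[OF g] by simp
    then have "g (x - y) - ?T / real n = (g (real n *\<^sub>R x - real n *\<^sub>R y) - ?T) / real n"
      using n by (simp add: diff_divide_distrib)
    moreover have "\<bar>g (real n *\<^sub>R x - real n *\<^sub>R y) - ?T\<bar> \<le> \<epsilon> * real n"
      by (rule close) (use that scale_in_ncube in auto)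
    ultimately show ?thesis using n by (simp add: rescaled_time_ncube abs_divide pos_divide_le_eq)
  qed
  then show ?thesis using LD_iff[OF g, of \<tau> \<omega> n M \<epsilon>] tau_nonneg b_pos sp n by auto
qed

lemma window_pos:
  assumes "x \<in> top_support \<nu>" "0 < \<theta>"
  shows "0 < measure \<nu> ({x - \<theta>..x + \<theta>} \<inter> {0..})"
proof -
  interpret N: prob_space \<nu> by (rule nu_prob)
  have "0 < measure \<nu> ({x - \<theta><..<x + \<theta>} \<inter> {0..})" by (rule support_nbhd) (use assms in auto)
  also have "\<dots> \<le> measure \<nu> ({x - \<theta>..x + \<theta>} \<inter> {0..})"
    by (rule N.finite_measure_mono[OF _ nu_sets_Int]) auto
  finally show ?thesis .
qed

lemma nu_mono: "A \<subseteq> B \<Longrightarrow> B \<in> sets borel \<Longrightarrow> measure \<nu> (A \<inter> {0..}) \<le> measure \<nu> (B \<inter> {0..})"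
proof -
  assume "A \<subseteq> B" "B \<in> sets borel"
  interpret N: prob_space \<nu> by (rule nu_prob)
  show "measure \<nu> (A \<inter> {0..}) \<le> measure \<nu> (B \<inter> {0..})"
    by (rule N.finite_measure_mono[OF _ nu_sets_Int]) (use \<open>A \<subseteq> B\<close> \<open>B \<in> sets borel\<close> in auto)
qed

lemma nu_le_1: "measure \<nu> A \<le> 1"
  using prob_space.prob_le_1[OF nu_prob] .

text \<open>A window starts at the prescribed value, as weights must not fall below it. At
  \<open>a\<close> nothing is lost, since the left half of a symmetric window has no mass; the
  window starting at \<beta> - \<theta> is centred at the support point \<beta>.\<close>

lemma windows:
  assumes \<beta>: "\<beta> \<in> top_support \<nu>" and \<theta>: "0 < \<theta>"
  obtains \<alpha> where "0 < \<alpha>" "\<alpha> \<le> 1"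
    "\<And>w. w = a \<or> w = \<beta> - \<theta> \<Longrightarrow> \<alpha> \<le> measure \<nu> ({w..w + 2 * \<theta>} \<inter> {0..})"
proof -
  define \<alpha> where "\<alpha> = min (measure \<nu> ({a..a + 2 * \<theta>} \<inter> {0..})) (measure \<nu> ({\<beta> - \<theta>..\<beta> + \<theta>} \<inter> {0..}))"
  have "0 < measure \<nu> ({a..a + 2 * \<theta>} \<inter> {0..})"
  proof -
    interpret N: prob_space \<nu> by (rule nu_prob)
    have "0 < measure \<nu> ({a - \<theta>..a + \<theta>} \<inter> {0..})" by (rule window_pos[OF a_in_support \<theta>])
    also have "\<dots> \<le> measure \<nu> (({..<a} \<union> {a..a + 2 * \<theta>}) \<inter> {0..})" by (rule nu_mono) (use \<theta> in auto)
    also have "\<dots> = measure \<nu> (({..<a} \<inter> {0..}) \<union> ({a..a + 2 * \<theta>} \<inter> {0..}))" by (simp add: Int_Un_distrib2)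
    also have "\<dots> \<le> measure \<nu> ({..<a} \<inter> {0..}) + measure \<nu> ({a..a + 2 * \<theta>} \<inter> {0..})"
      by (rule measure_Un_le) (rule nu_sets_Int, simp)+
    also have "measure \<nu> ({..<a} \<inter> {0..}) = 0"
      by (rule null_outside_support) (use support_bounds in force)+
    finally show ?thesis by simp
  qed
  then have "0 < \<alpha>" using window_pos[OF \<beta> \<theta>] by (simp add: \<alpha>_def)
  moreover have "\<alpha> \<le> 1" unfolding \<alpha>_def using nu_le_1 by (rule min.coboundedI1)
  moreover have "\<alpha> \<le> measure \<nu> ({w..w + 2 * \<theta>} \<inter> {0..})" if "w = a \<or> w = \<beta> - \<theta>" for w
    using that
  proof
    assume "w = \<beta> - \<theta>"
    then have eq: "{w..w + 2 * \<theta>} = {\<beta> - \<theta>..\<beta> + \<theta>}" by auto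
    show ?thesis unfolding eq \<alpha>_def by (rule min.cobounded2)
  qed (simp add: \<alpha>_def)
  ultimately show ?thesis by (rule that)
qed

lemma tau_weights:
  assumes "\<forall>e\<in>edges. a \<le> \<tau> e \<omega> \<and> \<tau> e \<omega> \<le> b"
  shows "\<forall>e\<in>edges. 0 \<le> \<tau> e \<omega> \<and> \<tau> e \<omega> \<le> b"
  using assms ab by force

text \<open>All edges of the cube off the highways are required to be at least \<beta> - \<theta>,
  which has probability at least \<open>q\<close> per edge with \<open>q\<close> independent of
  \<epsilon>. The highways depend on \<epsilon> but cost only order \<open>n\<close>, so one
  constant \<open>C\<close> bounds the cost for every \<epsilon>.\<close>

lemma rate_finite:
  fixes g :: "real ^ 'n \<Rightarrow> real"
  assumes dim: "CARD('n) \<ge> 2" and g: "g \<in> norms a b"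
    and \<beta>: "\<beta> \<in> top_support \<nu>" "a < \<beta>" "\<And>x. g x \<le> \<beta> * l1norm x" and pos: "0 < measure \<nu> ({\<beta>..} \<inter> {0..})"
  shows "rate_upper M \<tau> b g < \<infinity>"
proof -
  have \<beta>b: "\<beta> \<le> b" using support_bounds[OF \<beta>(1)] by simp
  \<comment> \<open>Defined with the level \<beta> and not with \<beta> - \<theta>, because \<theta>
    depends on \<epsilon>.\<close>
  define q where "q = measure \<nu> ({\<beta>..} \<inter> {0..})"
  have q: "0 < q" "q \<le> 1" using pos nu_le_1 by (auto simp: q_def)
  have lq: "0 \<le> ln (1 / q)" using q by simp
  \<comment> \<open>The bound on the number of edges of the cube per unit of volume, times the cost
    of one edge, plus 1 for the highways.\<close>
  define C where "C = 1 + 2 * CARD('n) * 2 ^ CARD('n) * ln (1 / q)"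
  have main: "limsup (LD_cost M \<tau> b g \<epsilon>) \<le> ereal C" if \<epsilon>: "0 < \<epsilon>" for \<epsilon>
  proof -
    obtain \<theta> D A where \<theta>: "0 < \<theta>" "\<theta> < \<beta> - a" and ev: "\<forall>\<^sub>F n in sequentially. \<exists>H Tb W.
        good_modification g a b \<beta> \<theta> D \<epsilon> n H Tb W \<and>
        real (card H) \<le> A * real n \<and> real (card Tb) \<le> 1 * real n ^ CARD('n)"
      using construction[OF dim g ab(1) \<beta>(2) \<beta>b \<beta>(3) \<epsilon>] zero_less_one by blast
    obtain \<alpha> where \<alpha>: "0 < \<alpha>" "\<alpha> \<le> 1"
      "\<And>w. w = a \<or> w = \<beta> - \<theta> \<Longrightarrow> \<alpha> \<le> measure \<nu> ({w..w + 2 * \<theta>} \<inter> {0..})"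
      using windows[OF \<beta>(1) \<theta>(1)] by blast
    have "\<forall>\<^sub>F n in sequentially. LD_cost M \<tau> b g \<epsilon> n \<le> ereal C"
      using ev eventually_real_ge[of "max 1 (A * ln (1 / \<alpha>))"]
    proof eventually_elim
      case (elim n)
      then have n: "0 < n" "1 \<le> real n" "A * ln (1 / \<alpha>) \<le> 1 * real n" by auto
      from elim(1) obtain H Tb W where gm: "good_modification g a b \<beta> \<theta> D \<epsilon> n H Tb W"
        and cH: "real (card H) \<le> A * real n" by blast
      note gm' = gm[unfolded good_modification_def]
      have H: "H \<subseteq> cube_edges n" and W: "\<And>e. e \<in> H \<Longrightarrow> W e = a \<or> W e = \<beta> - \<theta>" using gm' by blast+
      let ?E = "cube_edges n :: (real ^ 'n) set set"
      have fE: "finite ?E" by (rule finite_cube_edges)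
      have fH: "finite H" using H fE by (rule finite_subset)
      have EE: "?E \<subseteq> edges" by (auto simp: cube_edges_def)
      define Wn where "Wn e = (if e \<in> H then {W e..W e + 2 * \<theta>} else {\<beta> - \<theta>..})" for e
      let ?Ev = "{\<omega> \<in> space M. \<forall>e\<in>?E. \<tau> e \<omega> \<in> Wn e}"
      have Evp: "prob ?Ev = (\<Prod>e\<in>?E. measure \<nu> (Wn e \<inter> {0..}))"
        by (rule prob_edges[OF fE EE]) (simp add: Wn_def)
      have "?E = H \<union> (?E - H)" using H by blast
      then have "(\<Prod>e\<in>?E. measure \<nu> (Wn e \<inter> {0..})) = (\<Prod>e\<in>H. measure \<nu> (Wn e \<inter> {0..})) * (\<Prod>e\<in>?E - H. measure \<nu> (Wn e \<inter> {0..}))"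
        using prod.subset_diff[OF H fE] by (simp add: mult.commute)
      also have "\<dots> \<ge> \<alpha> ^ card H * q ^ card (?E - H)"
      proof (rule mult_mono)
        show "\<alpha> ^ card H \<le> (\<Prod>e\<in>H. measure \<nu> (Wn e \<inter> {0..}))"
          by (rule prod_ge_power[OF fH]) (use \<alpha> W in \<open>auto simp: Wn_def\<close>)
        show "q ^ card (?E - H) \<le> (\<Prod>e\<in>?E - H. measure \<nu> (Wn e \<inter> {0..}))"
        proof (rule prod_ge_power)
          fix e assume "e \<in> ?E - H"
          then have "Wn e = {\<beta> - \<theta>..}" by (simp add: Wn_def)
          then show "q \<le> measure \<nu> (Wn e \<inter> {0..})" unfolding q_def using \<theta> by (simp only:) (rule nu_mono, auto)
        qed (use fE q in auto)
      qed (use q in \<open>auto intro!: prod_nonneg\<close>)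
      finally have pEv: "\<alpha> ^ card H * q ^ card (?E - H) \<le> prob ?Ev" unfolding Evp .
      have "prob ?Ev \<le> prob (LD M \<tau> b n g \<epsilon>)"
      proof (rule finite_measure_mono_AE[OF _ LD_events[OF g n(1)]])
        show "AE \<omega> in M. \<omega> \<in> ?Ev \<longrightarrow> \<omega> \<in> LD M \<tau> b n g \<epsilon>"
          using AE_bounds AE_space
        proof eventually_elim
          fix \<omega> assume bd: "\<forall>e\<in>edges. a \<le> \<tau> e \<omega> \<and> \<tau> e \<omega> \<le> b" and sp: "\<omega> \<in> space M"
          show "\<omega> \<in> ?Ev \<longrightarrow> \<omega> \<in> LD M \<tau> b n g \<epsilon>"
          proof
            assume "\<omega> \<in> ?Ev"
            then have in_W: "\<And>e. e \<in> ?E \<Longrightarrow> \<tau> e \<omega> \<in> Wn e" by simp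
            have 1: "\<forall>e\<in>H. W e \<le> \<tau> e \<omega> \<and> \<tau> e \<omega> \<le> W e + 2 * \<theta>"
            proof
              fix e assume e: "e \<in> H"
              then show "W e \<le> \<tau> e \<omega> \<and> \<tau> e \<omega> \<le> W e + 2 * \<theta>" using in_W[of e] H by (auto simp: Wn_def)
            qed
            have 2: "\<forall>e\<in>?E - H. \<beta> - \<theta> \<le> \<tau> e \<omega>"
            proof
              fix e assume e: "e \<in> ?E - H"
              then show "\<beta> - \<theta> \<le> \<tau> e \<omega>" using in_W[of e] by (auto simp: Wn_def)
            qed
            have "\<forall>x\<in>ncube n. \<forall>y\<in>ncube n. \<bar>g (x - y) - passage_time b (\<lambda>e. \<tau> e \<omega>) (ncube n) x y\<bar> \<le> \<epsilon> * real n"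
              using gm'[THEN conjunct2, THEN conjunct2, THEN conjunct2, THEN spec, THEN mp, THEN mp, THEN mp, OF tau_weights[OF bd] 1 disjI1[OF 2]] .
            then show "\<omega> \<in> LD M \<tau> b n g \<epsilon>" by (intro good_modification_LD[OF g n(1) sp]) blast
          qed
        qed
      qed
      then have p: "\<alpha> ^ card H * q ^ card (?E - H) \<le> prob (LD M \<tau> b n g \<epsilon>)" using pEv by linarith
      have cE: "real (card (?E - H)) \<le> 2 * CARD('n) * (real n + 1) ^ CARD('n)"
      proof -
        have "real (card (?E - H)) \<le> real (card ?E)" using fE by (intro of_nat_mono card_mono) auto
        then show ?thesis using card_ncube_edges[of n, where 'n = 'n] unfolding cube_edges_def by linarith
      qed
      have "(real n + 1) ^ CARD('n) \<le> (2 * real n) ^ CARD('n)" using n by (intro power_mono) auto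
      then have "(real n + 1) ^ CARD('n) \<le> 2 ^ CARD('n) * real n ^ CARD('n)" by (simp add: power_mult_distrib)
      then have "2 * CARD('n) * (real n + 1) ^ CARD('n) \<le> 2 * CARD('n) * (2 ^ CARD('n) * real n ^ CARD('n))"
        by (intro mult_left_mono) auto
      then have cE2: "real (card (?E - H)) \<le> 2 * CARD('n) * (2 ^ CARD('n) * real n ^ CARD('n))" using cE by linarith
      show ?case
      proof (rule LD_cost_le[OF n(1)])
        have "A * ln (1 / \<alpha>) * real n \<le> 1 * real n ^ CARD('n)"
          by (rule linear_le_power[OF dim n(3,2)]) simp
        then have "exp (- C * real n ^ CARD('n))
            \<le> exp (- (A * real n * ln (1 / \<alpha>))) * exp (- (2 * CARD('n) * (2 ^ CARD('n) * real n ^ CARD('n)) * ln (1 / q)))"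
          unfolding exp_add[symmetric] by (simp add: C_def algebra_simps)
        also have "\<dots> \<le> \<alpha> ^ card H * q ^ card (?E - H)"
          by (intro mult_mono power_ge_exp) (use \<alpha> q cH cE2 in auto)
        finally show "exp (- C * real n ^ CARD('n)) \<le> prob (LD M \<tau> b n g \<epsilon>)" using p by linarith
      qed
    qed
    then show ?thesis by (rule Limsup_bounded)
  qed
  have "rate_upper M \<tau> b g \<le> ereal C"
    unfolding rates_eq_SUP(2)[OF g] by (rule SUP_least) (use main in auto)
  then show ?thesis by (rule order.strict_trans1) simp
qed

text \<open>Convergence to the time constant controls the finitely many grid pairs at once.
  Full-space passage times bound those in a cube from below, so one \<open>m\<close> serves all
  cubes that contain the scaled grid. The slack 1 per mesh is harmless, because the mesh will be a
  small fraction of \<open>n\<close>.\<close>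

lemma typical_lower_bound:
  fixes g :: "real ^ 'n \<Rightarrow> real"
  assumes tc: "is_time_constant M \<tau> b \<mu>" and g\<mu>: "\<And>x. g x \<le> \<mu> x"
  shows "\<forall>\<^sub>F m in sequentially. \<forall>n\<ge>N * m. 1 / 2 \<le> prob {\<omega> \<in> space M.
      \<forall>P\<in>{P \<in> Zd. \<forall>i. 0 \<le> P $ i \<and> P $ i \<le> real N}. \<forall>Q\<in>{P \<in> Zd. \<forall>i. 0 \<le> P $ i \<and> P $ i \<le> real N}.
        real m * (g (Q - P) - 1) \<le> passage_time b (\<lambda>e. \<tau> e \<omega>) (ncube n) (real m *\<^sub>R P) (real m *\<^sub>R Q)}"
proof -
  define V where "V = {P :: real ^ 'n \<in> Zd. \<forall>i. 0 \<le> P $ i \<and> P $ i \<le> real N}"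
  have fV: "finite V"
    unfolding V_def using card_Zd_interval(1)[of 0 "int N", where 'n = 'n] by simp
  have "(0 :: real ^ 'n) \<in> V" by (simp add: V_def)
  then have cV: "0 < card V" using fV card_gt_0_iff by blast
  define bad where "bad m z = {\<omega> \<in> space M. 1 * real m < \<bar>passage_time b (\<lambda>e. \<tau> e \<omega>)
      (cbox (- corner (reach z * m)) (corner (reach z * m))) 0 (real m *\<^sub>R z) - real m * \<mu> z\<bar>}" for m z
  \<comment> \<open>The union bound over ordered pairs of grid points then loses at most
    1/2.\<close>
  let ?\<eta> = "1 / (2 * (real (card V) * real (card V)))"
  have "\<forall>\<^sub>F m in sequentially. \<forall>q\<in>V \<times> V. prob (bad m (snd q - fst q)) < ?\<eta>"
  proof (rule eventually_ball_finite)
    show "finite (V \<times> V)" using fV by simp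
    show "\<forall>q\<in>V \<times> V. \<forall>\<^sub>F m in sequentially. prob (bad m (snd q - fst q)) < ?\<eta>"
    proof
      fix q assume q: "q \<in> V \<times> V"
      then have "snd q - fst q \<in> Zd" by (auto simp: V_def)
      then have "(\<lambda>m. prob (bad m (snd q - fst q))) \<longlonglongrightarrow> 0"
        unfolding bad_def by (rule time_constant_prob[OF tc]) simp
      then show "\<forall>\<^sub>F m in sequentially. prob (bad m (snd q - fst q)) < ?\<eta>"
        by (rule order_tendstoD) (use cV in simp)
    qed
  qed
  then show ?thesis
    using eventually_gt_at_top[of 0]
  proof eventually_elim
    case (elim m)
    show ?case
    proof (intro allI impI)
      fix n assume n: "N * m \<le> n"
      define T where "T P Q \<omega> = passage_time b (\<lambda>e. \<tau> e \<omega>) (ncube n) (real m *\<^sub>R P) (real m *\<^sub>R Q)" for P Q \<omega>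
      have Vin: "real m *\<^sub>R P \<in> ncube n" if P: "P \<in> V" for P
      proof -
        have "0 \<le> real m * P $ i \<and> real m * P $ i \<le> real n" for i
        proof -
          have "0 \<le> P $ i" "P $ i \<le> real N" using P by (auto simp: V_def)
          then have "real m * P $ i \<le> real m * real N" by (intro mult_left_mono) auto
          also have "\<dots> = real (N * m)" by simp
          also have "\<dots> \<le> real n" using n by (rule of_nat_mono)
          finally show ?thesis using \<open>0 \<le> P $ i\<close> by simp
        qed
        then show ?thesis by (simp add: mem_ncube)
      qed
      have Tm: "T P Q \<in> borel_measurable M" if "P \<in> V" "Q \<in> V" for P Q
        unfolding T_def[abs_def] by (rule box_passage_measurable) (use that Vin in auto)
      let ?B = "\<lambda>P Q. {\<omega> \<in> space M. T P Q \<omega> < real m * (g (Q - P) - 1)}"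
      have Bev: "?B P Q \<in> events" if "P \<in> V" "Q \<in> V" for P Q using Tm[OF that] by measurable
      have pB: "prob (?B P Q) \<le> ?\<eta>" if PQ: "P \<in> V" "Q \<in> V" for P Q
      proof -
        define z where "z = Q - P"
        have z: "z \<in> Zd" and PZ: "P \<in> Zd" using PQ by (auto simp: V_def z_def)
        let ?l = "- corner (reach z * m)" and ?u = "corner (reach z * m) :: real ^ 'n"
        let ?v = "real m *\<^sub>R P"
        let ?S = "{..<real m * (g z - 1)}"
        have mQ: "real m *\<^sub>R Q = ?v + real m *\<^sub>R z" by (simp add: z_def algebra_simps)
        have z0: "0 \<in> cbox ?l ?u" by (rule reach_box) (use b_pos in auto)
        have zin: "real m *\<^sub>R z \<in> cbox ?l ?u" by (rule reach_box) (use ab in \<open>auto intro!: mult_right_mono\<close>)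
        have vin: "?v + 0 \<in> cbox (?v + ?l) (?v + ?u)" "?v + real m *\<^sub>R z \<in> cbox (?v + ?l) (?v + ?u)"
          unfolding cbox_translation using z0 zin by blast+
        have bm: "(\<lambda>\<omega>. passage_time b (\<lambda>e. \<tau> e \<omega>) (cbox (?v + ?l) (?v + ?u)) (?v + 0) (?v + real m *\<^sub>R z)) \<in> borel_measurable M"
          by (rule box_passage_measurable[OF vin])
        have "prob (?B P Q) \<le> prob {\<omega> \<in> space M. passage_time b (\<lambda>e. \<tau> e \<omega>) (cbox (?v + ?l) (?v + ?u)) (?v + 0) (?v + real m *\<^sub>R z) \<in> ?S}"
        proof (rule finite_measure_mono_AE)
          show "AE \<omega> in M. \<omega> \<in> ?B P Q \<longrightarrow> \<omega> \<in> {\<omega> \<in> space M. passage_time b (\<lambda>e. \<tau> e \<omega>) (cbox (?v + ?l) (?v + ?u)) (?v + 0) (?v + real m *\<^sub>R z) \<in> ?S}"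
            using AE_bounds
          proof eventually_elim
            fix \<omega> assume bd: "\<forall>e\<in>edges. a \<le> \<tau> e \<omega> \<and> \<tau> e \<omega> \<le> b"
            have t0: "\<And>e. e \<in> edges \<Longrightarrow> 0 \<le> \<tau> e \<omega>" using tau_weights[OF bd] by blast
            \<comment> \<open>The box and the cube are compared through the full space, since
              neither has to contain the other.\<close>
            have "passage_time b (\<lambda>e. \<tau> e \<omega>) UNIV ?v (?v + real m *\<^sub>R z)
                = passage_time b (\<lambda>e. \<tau> e \<omega>) (cbox (?v + ?l) (?v + ?u)) ?v (?v + real m *\<^sub>R z)"
            proof (rule passage_UNIV_eq[of a])
              fix w assume "a * l1norm (w - ?v) \<le> b * l1norm (?v - (?v + real m *\<^sub>R z))"
              then have "w - ?v \<in> cbox ?l ?u" by (intro reach_box) simp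
              then show "w \<in> cbox (?v + ?l) (?v + ?u)" unfolding cbox_translation
                by (intro image_eqI[of _ _ "w - ?v"]) auto
            qed (use bd ab vin in auto)
            moreover have "passage_time b (\<lambda>e. \<tau> e \<omega>) UNIV ?v (?v + real m *\<^sub>R z) \<le> T P Q \<omega>"
              unfolding T_def mQ[symmetric]
              by (rule passage_mono_set) (use t0 b_pos Vin PQ in auto)
            ultimately show "\<omega> \<in> ?B P Q \<longrightarrow> \<omega> \<in> {\<omega> \<in> space M. passage_time b (\<lambda>e. \<tau> e \<omega>) (cbox (?v + ?l) (?v + ?u)) (?v + 0) (?v + real m *\<^sub>R z) \<in> ?S}"
              by (auto simp: z_def[symmetric])
          qed
          show "{\<omega> \<in> space M. passage_time b (\<lambda>e. \<tau> e \<omega>) (cbox (?v + ?l) (?v + ?u)) (?v + 0) (?v + real m *\<^sub>R z) \<in> ?S} \<in> events"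
            using bm by measurable
        qed
        also have "\<dots> = prob {\<omega> \<in> space M. passage_time b (\<lambda>e. \<tau> e \<omega>) (cbox ?l ?u) 0 (real m *\<^sub>R z) \<in> ?S}"
          by (rule prob_translate) (use z0 zin PZ in auto)
        also have "\<dots> \<le> prob (bad m z)"
        proof (rule finite_measure_mono)
          have "real m * g z \<le> real m * \<mu> z" using g\<mu> by (intro mult_left_mono) auto
          then show "{\<omega> \<in> space M. passage_time b (\<lambda>e. \<tau> e \<omega>) (cbox ?l ?u) 0 (real m *\<^sub>R z) \<in> ?S} \<subseteq> bad m z"
            by (auto simp: bad_def algebra_simps)
          show "bad m z \<in> events" unfolding bad_def using box_passage_measurable[OF z0 zin] by measurable
        qed
        also have "\<dots> \<le> ?\<eta>" using elim(1) PQ by (force simp: z_def less_imp_le)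
        finally show ?thesis .
      qed
      let ?U = "\<Union>q\<in>V \<times> V. ?B (fst q) (snd q)"
      have Uev: "?U \<in> events" by (rule sets.finite_UN) (use fV Bev in auto)
      have "prob ?U \<le> (\<Sum>q\<in>V \<times> V. prob (?B (fst q) (snd q)))"
        by (rule finite_measure_subadditive_finite) (use fV Bev in auto)
      also have "\<dots> \<le> (\<Sum>q\<in>V \<times> V. ?\<eta>)" by (rule sum_mono) (use pB in auto)
      also have "\<dots> = 1 / 2" using cV by (simp add: card_cartesian_product)
      finally have "1 / 2 \<le> prob (space M - ?U)" using prob_compl[OF Uev] by linarith
      also have "space M - ?U = {\<omega> \<in> space M. \<forall>P\<in>V. \<forall>Q\<in>V. real m * (g (Q - P) - 1) \<le> T P Q \<omega>}"
      proof (rule set_eqI)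
        fix \<omega>
        have "\<omega> \<in> ?U \<longleftrightarrow> (\<exists>P\<in>V. \<exists>Q\<in>V. \<omega> \<in> ?B P Q)" by (simp add: Bex_def)
        then show "\<omega> \<in> space M - ?U \<longleftrightarrow> \<omega> \<in> {\<omega> \<in> space M. \<forall>P\<in>V. \<forall>Q\<in>V. real m * (g (Q - P) - 1) \<le> T P Q \<omega>}"
          unfolding Diff_iff mem_Collect_eq not_less[symmetric] by blast
      qed
      finally show "1 / 2 \<le> prob {\<omega> \<in> space M.
        \<forall>P\<in>{P \<in> Zd. \<forall>i. 0 \<le> P $ i \<and> P $ i \<le> real N}. \<forall>Q\<in>{P \<in> Zd. \<forall>i. 0 \<le> P $ i \<and> P $ i \<le> real N}.
        real m * (g (Q - P) - 1) \<le> passage_time b (\<lambda>e. \<tau> e \<omega>) (ncube n) (real m *\<^sub>R P) (real m *\<^sub>R Q)}"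
        unfolding V_def T_def .
    qed
  qed
qed

text \<open>Typical behaviour is expressed through the edges off highways and tubes alone, so that
  it is independent of the prescribed weights; its probability of at least 1/2 costs nothing in the
  limit. The prescribed edges cost order \<open>n\<close> for the highways and an arbitrarily small
  fraction of the volume for the tubes.\<close>

lemma rate_zero:
  fixes g :: "real ^ 'n \<Rightarrow> real"
  assumes dim: "CARD('n) \<ge> 2" and g: "g \<in> norms a b"
    and tc: "is_time_constant M \<tau> b \<mu>" and g\<mu>: "\<And>x. g x \<le> \<mu> x"
  shows "rate_upper M \<tau> b g \<le> 0"
proof -
  note G = normsD[OF g]
  have main: "limsup (LD_cost M \<tau> b g \<epsilon>) \<le> ereal \<delta>" if \<epsilon>: "0 < \<epsilon>" and \<delta>: "0 < \<delta>" for \<epsilon> \<delta>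
  proof -
    obtain \<theta> where \<theta>: "0 < \<theta>" and con: "\<And>\<delta>. 0 < \<delta> \<Longrightarrow> \<exists>D>0. \<exists>A. \<forall>\<^sub>F n in sequentially. \<exists>H Tb W.
        good_modification g a b b \<theta> D \<epsilon> n H Tb W \<and>
        real (card H) \<le> A * real n \<and> real (card Tb) \<le> \<delta> * real n ^ CARD('n)"
      using construction[OF dim g ab order_refl G(6) \<epsilon>] by blast
    obtain \<alpha> where \<alpha>: "0 < \<alpha>" "\<alpha> \<le> 1"
      "\<And>w. w = a \<or> w = b - \<theta> \<Longrightarrow> \<alpha> \<le> measure \<nu> ({w..w + 2 * \<theta>} \<inter> {0..})"
      using windows[OF b_in_support \<theta>] by blast
    define l where "l = ln (1 / \<alpha>)"
    have l: "0 \<le> l" using \<alpha> by (simp add: l_def)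
    \<comment> \<open>Tube edges contribute at most \<open>\<delta>' * l\<close> per unit of volume;
      the shift by 1 covers the case \<open>l = 0\<close>.\<close>
    define \<delta>' where "\<delta>' = \<delta> / (4 * (l + 1))"
    have \<delta>': "0 < \<delta>'" "\<delta>' * l \<le> \<delta> / 4" using \<delta> l by (auto simp: \<delta>'_def field_simps)
    obtain D A where D: "0 < D" and ev: "\<forall>\<^sub>F n in sequentially. \<exists>H Tb W.
        good_modification g a b b \<theta> D \<epsilon> n H Tb W \<and>
        real (card H) \<le> A * real n \<and> real (card Tb) \<le> \<delta>' * real n ^ CARD('n)"
      using con[OF \<delta>'(1)] by blast
    define d where "d = real CARD('n)"
    have d: "0 < d" by (simp add: d_def)
    \<comment> \<open>Four roundings to the grid, two in the passage time and two in
      \<open>g\<close>, of at most \<open>b * d * m\<close> each, together with the slack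
      \<open>m\<close>, have to fit into \<open>D * n\<close>.\<close>
    obtain N :: nat where N: "(4 * b * d + 1) / D < real N" using reals_Archimedean2 by blast
    have "0 < (4 * b * d + 1) / D" using b_pos d D by (simp add: add_nonneg_pos)
    then have N0: "0 < N" using N by (metis of_nat_0 of_nat_0_less_iff less_trans)
    have ND: "4 * b * d + 1 \<le> D * real N" using N D by (simp add: field_simps)
    define V where "V = {P :: real ^ 'n \<in> Zd. \<forall>i. 0 \<le> P $ i \<and> P $ i \<le> real N}"
    have fV: "finite V"
      unfolding V_def using card_Zd_interval(1)[of 0 "int N", where 'n = 'n] by simp
    obtain m0 where m0: "\<And>m n. m0 \<le> m \<Longrightarrow> N * m \<le> n \<Longrightarrow> 1 / 2 \<le> prob {\<omega> \<in> space M. \<forall>P\<in>V. \<forall>Q\<in>V.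
        real m * (g (Q - P) - 1) \<le> passage_time b (\<lambda>e. \<tau> e \<omega>) (ncube n) (real m *\<^sub>R P) (real m *\<^sub>R Q)}"
      using typical_lower_bound[OF tc g\<mu>, of N] unfolding eventually_sequentially V_def by blast
    have "\<forall>\<^sub>F n in sequentially. LD_cost M \<tau> b g \<epsilon> n \<le> ereal \<delta>"
      using ev eventually_real_ge[of "max 1 (A * l / (\<delta> / 4))"] eventually_real_ge[of "ln 2 / (\<delta> / 4)"]
        eventually_ge_at_top[of "N * (max m0 N)"]
    proof eventually_elim
      case (elim n)
      have n: "0 < n" "1 \<le> real n" using elim(2) by auto
      have n3: "A * l \<le> \<delta> / 4 * real n" "ln 2 \<le> \<delta> / 4 * real n"
        using elim(2,3) \<delta> by (simp_all add: pos_divide_le_eq mult.commute)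
      define m where "m = n div N"
      have mN: "max m0 N \<le> m" unfolding m_def 
        using elim(4) less_eq_div_iff_mult_less_eq[OF N0, of "max m0 N" n] by (simp only: mult.commute)
      have Nm: "N * m \<le> n" by (simp add: m_def)
      from elim(1) obtain H Tb W where gm: "good_modification g a b b \<theta> D \<epsilon> n H Tb W"
        and cH: "real (card H) \<le> A * real n" and cT: "real (card Tb) \<le> \<delta>' * real n ^ CARD('n)" by blast
      note gm' = gm[unfolded good_modification_def]
      have H: "H \<subseteq> cube_edges n" and Tb: "Tb \<subseteq> cube_edges n - H"
        and W: "\<And>e. e \<in> H \<Longrightarrow> W e = a \<or> W e = b - \<theta>" using gm' by blast+
      let ?E = "cube_edges n - H - Tb :: (real ^ 'n) set set"
      have fE: "finite (cube_edges n :: (real ^ 'n) set set)" by (rule finite_cube_edges)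
      have fH: "finite H" "finite Tb" using H Tb fE by (meson finite_subset finite_Diff)+
      have EE: "cube_edges n \<subseteq> (edges :: (real ^ 'n) set set)" by (auto simp: cube_edges_def)
      define Wn where "Wn e = (if e \<in> H then {W e..W e + 2 * \<theta>} else {b - \<theta>..b - \<theta> + 2 * \<theta>})" for e
      \<comment> \<open>Edges outside \<open>?E\<close> get the maximal value \<open>b\<close>.
        Almost surely this only raises passage times, so the typical lower bounds survive and become
        an event of the weights on \<open>?E\<close>. The minimum with \<open>b\<close> makes the
        environment admissible for every realisation.\<close>
      define ext where "ext f = (\<lambda>e. if e \<in> ?E then min (f e) b else b)" for f :: "(real ^ 'n) set \<Rightarrow> real"
      let ?\<Pi> = "PiM ?E (\<lambda>_. \<nu>)"
      define G where "G = {f \<in> space ?\<Pi>. \<forall>P\<in>V. \<forall>Q\<in>V.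
          real m * (g (Q - P) - 1) \<le> passage_time b (ext f) (ncube n) (real m *\<^sub>R P) (real m *\<^sub>R Q)}"
      have Vin: "real m *\<^sub>R P \<in> ncube n" if P: "P \<in> V" for P
      proof -
        have "0 \<le> real m * P $ i \<and> real m * P $ i \<le> real n" for i
        proof -
          have "0 \<le> P $ i" "P $ i \<le> real N" using P by (auto simp: V_def)
          then have "real m * P $ i \<le> real m * real N" by (intro mult_left_mono) auto
          also have "\<dots> = real (N * m)" by simp
          also have "\<dots> \<le> real n" using Nm by (rule of_nat_mono)
          finally show ?thesis using \<open>0 \<le> P $ i\<close> by simp
        qed
        then show ?thesis by (simp add: mem_ncube)
      qed
      have Gs: "G \<in> sets ?\<Pi>"
      proof -
        have "(\<lambda>f. passage_time b (ext f) (ncube n) (real m *\<^sub>R P) (real m *\<^sub>R Q)) \<in> borel_measurable ?\<Pi>"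
          if "P \<in> V" "Q \<in> V" for P Q
          unfolding ext_def
        proof (rule passage_measurable)
          fix e :: "(real ^ 'n) set"
          show "(\<lambda>f. if e \<in> ?E then min (f e) b else b) \<in> borel_measurable ?\<Pi>"
          proof (cases "e \<in> ?E")
            case True
            then have "(\<lambda>f. f e) \<in> measurable ?\<Pi> \<nu>" by (rule measurable_component_singleton)
            then have "(\<lambda>f. f e) \<in> borel_measurable ?\<Pi>" by (rule nu_to_borel)
            then have "(\<lambda>f. min (f e) b) \<in> borel_measurable ?\<Pi>" by measurable
            then show ?thesis using True by simp
          next
            case False
            then show ?thesis unfolding if_not_P[OF False] by simp
          qed
          fix f assume "f \<in> space ?\<Pi>"
          then show "0 \<le> (if e \<in> ?E then min (f e) b else b)"
            using b_pos by (auto simp: space_PiM space_nu PiE_def Pi_def)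
        qed (use that Vin b_pos in auto)
        then have "{f \<in> space ?\<Pi>. real m * (g (Q - P) - 1) \<le> passage_time b (ext f) (ncube n) (real m *\<^sub>R P) (real m *\<^sub>R Q)} \<in> sets ?\<Pi>"
          if "P \<in> V" "Q \<in> V" for P Q using that by measurable
        then show ?thesis unfolding G_def
          by (intro sets.sets_Collect_finite_All' sets.sets_Collect_finite_All fV) auto
      qed
      have pG: "1 / 2 \<le> prob {\<omega> \<in> space M. (\<lambda>e\<in>?E. \<tau> e \<omega>) \<in> G}"
      proof -
        have rm: "(\<lambda>\<omega>. \<lambda>e\<in>?E. \<tau> e \<omega>) \<in> measurable M ?\<Pi>"
          using restrict_measurable[of "\<lambda>e. e" ?E] EE by auto
        have "1 / 2 \<le> prob {\<omega> \<in> space M. \<forall>P\<in>V. \<forall>Q\<in>V.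
          real m * (g (Q - P) - 1) \<le> passage_time b (\<lambda>e. \<tau> e \<omega>) (ncube n) (real m *\<^sub>R P) (real m *\<^sub>R Q)}"
          by (rule m0[OF _ Nm]) (use mN in simp)
        also have "\<dots> \<le> prob {\<omega> \<in> space M. (\<lambda>e\<in>?E. \<tau> e \<omega>) \<in> G}"
        proof (rule finite_measure_mono_AE)
          show "{\<omega> \<in> space M. (\<lambda>e\<in>?E. \<tau> e \<omega>) \<in> G} \<in> events" using measurable_sets[OF rm Gs]
            by (simp add: vimage_def Int_def conj_commute)
          show "AE \<omega> in M. \<omega> \<in> {\<omega> \<in> space M. \<forall>P\<in>V. \<forall>Q\<in>V.
              real m * (g (Q - P) - 1) \<le> passage_time b (\<lambda>e. \<tau> e \<omega>) (ncube n) (real m *\<^sub>R P) (real m *\<^sub>R Q)}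
              \<longrightarrow> \<omega> \<in> {\<omega> \<in> space M. (\<lambda>e\<in>?E. \<tau> e \<omega>) \<in> G}"
            using AE_bounds AE_space
          proof eventually_elim
            fix \<omega> assume bd: "\<forall>e\<in>edges. a \<le> \<tau> e \<omega> \<and> \<tau> e \<omega> \<le> b" and sp: "\<omega> \<in> space M"
            let ?f = "\<lambda>e\<in>?E. \<tau> e \<omega>"
            have mono: "passage_time b (\<lambda>e. \<tau> e \<omega>) (ncube n) (real m *\<^sub>R P) (real m *\<^sub>R Q)
                \<le> passage_time b (ext ?f) (ncube n) (real m *\<^sub>R P) (real m *\<^sub>R Q)" if PQ: "P \<in> V" "Q \<in> V" for P Q
            proof (rule passage_mono_weights)
              fix z z' :: "real ^ 'n"
              show "step_time b (\<lambda>e. \<tau> e \<omega>) z z' \<le> step_time b (ext ?f) z z'"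
                by (rule step_time_mono) (use bd in \<open>auto simp: ext_def\<close>)
            qed (use tau_weights[OF bd] b_pos Vin PQ in auto)
            have fsp: "?f \<in> space ?\<Pi>" by (rule measurable_space[OF rm sp])
            show "\<omega> \<in> {\<omega> \<in> space M. \<forall>P\<in>V. \<forall>Q\<in>V.
              real m * (g (Q - P) - 1) \<le> passage_time b (\<lambda>e. \<tau> e \<omega>) (ncube n) (real m *\<^sub>R P) (real m *\<^sub>R Q)}
              \<longrightarrow> \<omega> \<in> {\<omega> \<in> space M. (\<lambda>e\<in>?E. \<tau> e \<omega>) \<in> G}"
            proof
              assume h: "\<omega> \<in> {\<omega> \<in> space M. \<forall>P\<in>V. \<forall>Q\<in>V.
                real m * (g (Q - P) - 1) \<le> passage_time b (\<lambda>e. \<tau> e \<omega>) (ncube n) (real m *\<^sub>R P) (real m *\<^sub>R Q)}"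
              have "real m * (g (Q - P) - 1) \<le> passage_time b (ext ?f) (ncube n) (real m *\<^sub>R P) (real m *\<^sub>R Q)"
                if PQ: "P \<in> V" "Q \<in> V" for P Q
                by (rule order_trans[OF _ mono[OF PQ]]) (use h PQ in blast)
              then have "?f \<in> G" unfolding G_def using fsp by blast
              then show "\<omega> \<in> {\<omega> \<in> space M. (\<lambda>e\<in>?E. \<tau> e \<omega>) \<in> G}" using sp by blast
            qed
          qed
        qed
        finally show ?thesis .
      qed
      let ?Ev = "{\<omega> \<in> space M. (\<lambda>e\<in>?E. \<tau> e \<omega>) \<in> G \<and> (\<forall>e\<in>H \<union> Tb. \<tau> e \<omega> \<in> Wn e)}"
      have "prob ?Ev = prob {\<omega> \<in> space M. (\<lambda>e\<in>?E. \<tau> e \<omega>) \<in> G} * (\<Prod>e\<in>H \<union> Tb. measure \<nu> (Wn e \<inter> {0..}))"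
      proof (rule prob_block_edges)
        show "H \<union> Tb \<subseteq> edges" "?E \<subseteq> edges" using H Tb EE by blast+
        show "?E \<inter> (H \<union> Tb) = {}" by blast
      qed (use fH Gs in \<open>auto simp: Wn_def\<close>)
      also have "\<dots> \<ge> 1 / 2 * \<alpha> ^ card (H \<union> Tb)"
      proof (rule mult_mono[OF pG])
        show "\<alpha> ^ card (H \<union> Tb) \<le> (\<Prod>e\<in>H \<union> Tb. measure \<nu> (Wn e \<inter> {0..}))"
        proof (rule prod_ge_power)
          fix e
          show "\<alpha> \<le> measure \<nu> (Wn e \<inter> {0..})"
          proof (cases "e \<in> H")
            case True then show ?thesis using \<alpha>(3)[OF W[OF True]] by (simp add: Wn_def)
          next
            case False then show ?thesis using \<alpha>(3)[of "b - \<theta>"] by (simp add: Wn_def)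
          qed
        qed (use fH \<alpha> in auto)
      qed (use \<alpha> in auto)
      finally have pEv: "1 / 2 * \<alpha> ^ card (H \<union> Tb) \<le> prob ?Ev" .
      have "prob ?Ev \<le> prob (LD M \<tau> b n g \<epsilon>)"
      proof (rule finite_measure_mono_AE[OF _ LD_events[OF g n(1)]])
        show "AE \<omega> in M. \<omega> \<in> ?Ev \<longrightarrow> \<omega> \<in> LD M \<tau> b n g \<epsilon>"
          using AE_bounds AE_space
        proof eventually_elim
          fix \<omega> assume bd: "\<forall>e\<in>edges. a \<le> \<tau> e \<omega> \<and> \<tau> e \<omega> \<le> b" and sp: "\<omega> \<in> space M"
          show "\<omega> \<in> ?Ev \<longrightarrow> \<omega> \<in> LD M \<tau> b n g \<epsilon>"
          proof
            assume Ev: "\<omega> \<in> ?Ev"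
            then have in_W: "\<And>e. e \<in> H \<union> Tb \<Longrightarrow> \<tau> e \<omega> \<in> Wn e" and inG: "(\<lambda>e\<in>?E. \<tau> e \<omega>) \<in> G" by auto
            have 1: "\<forall>e\<in>H. W e \<le> \<tau> e \<omega> \<and> \<tau> e \<omega> \<le> W e + 2 * \<theta>"
            proof
              fix e assume e: "e \<in> H"
              then show "W e \<le> \<tau> e \<omega> \<and> \<tau> e \<omega> \<le> W e + 2 * \<theta>" using in_W[of e] by (simp add: Wn_def)
            qed
            have 2: "\<forall>e\<in>Tb. b - \<theta> \<le> \<tau> e \<omega>"
            proof
              fix e assume e: "e \<in> Tb"
              then have "e \<notin> H" using Tb by blast
              then show "b - \<theta> \<le> \<tau> e \<omega>" using in_W[of e] e by (simp add: Wn_def)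
            qed
            define t' where "t' = ext (\<lambda>e\<in>?E. \<tau> e \<omega>)"
            have t'b: "\<forall>e\<in>edges. 0 \<le> t' e \<and> t' e \<le> b"
              using tau_weights[OF bd] b_pos EE by (auto simp: t'_def ext_def)
            have t't: "\<forall>e\<in>?E. t' e \<le> \<tau> e \<omega>" by (auto simp: t'_def ext_def)
            have low: "\<forall>v\<in>ncube n. \<forall>y\<in>ncube n. g (v - y) - D * real n \<le> passage_time b t' (ncube n) v y"
            proof (intro ballI)
              fix v y :: "real ^ 'n" assume v: "v \<in> ncube n" and y: "y \<in> ncube n"
              let ?T = "passage_time b t' (ncube n)"
              have Nm': "N \<le> m" using mN by simp
              obtain P where P0: "P \<in> Zd" "\<And>i. 0 \<le> P $ i \<and> P $ i \<le> real N" "l1norm (v - real m *\<^sub>R P) \<le> CARD('n) * real m"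
                using exists_lattice_approx[OF N0 m_def Nm' v] by blast
              obtain Q where Q0: "Q \<in> Zd" "\<And>i. 0 \<le> Q $ i \<and> Q $ i \<le> real N" "l1norm (y - real m *\<^sub>R Q) \<le> CARD('n) * real m"
                using exists_lattice_approx[OF N0 m_def Nm' y] by blast
              have PV: "P \<in> V" and QV: "Q \<in> V" using P0 Q0 by (simp_all add: V_def)
              have t'0: "\<And>e. e \<in> edges \<Longrightarrow> 0 \<le> t' e" "\<And>e. e \<in> edges \<Longrightarrow> 0 \<le> t' e \<and> t' e \<le> b" using t'b by auto
              have b0: "0 \<le> b" using b_pos by simp
              have dv: "l1norm (v - real m *\<^sub>R P) \<le> d * real m" "l1norm (y - real m *\<^sub>R Q) \<le> d * real m"
                using P0(3) Q0(3) by (simp_all add: d_def)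
              have "?T (real m *\<^sub>R P) (real m *\<^sub>R Q) \<le> ?T (real m *\<^sub>R P) v + (?T v y + ?T y (real m *\<^sub>R Q))"
                using passage_triangle[of t' b "real m *\<^sub>R P" "ncube n" v "real m *\<^sub>R Q"]
                  passage_triangle[of t' b v "ncube n" y "real m *\<^sub>R Q"] t'0 b0 Vin[OF PV] Vin[OF QV] v y by force
              moreover have "?T (real m *\<^sub>R P) v \<le> b * (d * real m)"
              proof -
                have "?T (real m *\<^sub>R P) v \<le> b * l1norm (real m *\<^sub>R P - v)"
                  by (rule passage_le) (use t'0 b0 Vin[OF PV] v in auto)
                also have "\<dots> \<le> b * (d * real m)" using dv(1) b0 by (intro mult_left_mono) (simp_all add: l1norm_minus_commute)
                finally show ?thesis .
              qed
              moreover have "?T y (real m *\<^sub>R Q) \<le> b * (d * real m)"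
              proof -
                have "?T y (real m *\<^sub>R Q) \<le> b * l1norm (y - real m *\<^sub>R Q)"
                  by (rule passage_le) (use t'0 b0 Vin[OF QV] y in auto)
                also have "\<dots> \<le> b * (d * real m)" using dv(2) b0 by (intro mult_left_mono) simp_all
                finally show ?thesis .
              qed
              moreover have "real m * (g (Q - P) - 1) \<le> ?T (real m *\<^sub>R P) (real m *\<^sub>R Q)"
                using inG PV QV unfolding G_def t'_def by blast
              moreover have "g (v - y) \<le> real m * g (Q - P) + 2 * (b * (d * real m))"
              proof -
                have "g (v - y) \<le> g (v - real m *\<^sub>R P) + (g (real m *\<^sub>R P - real m *\<^sub>R Q) + g (real m *\<^sub>R Q - y))"
                  using norms_diff(1)[OF g, of v y "real m *\<^sub>R P"] norms_diff(1)[OF g, of "real m *\<^sub>R P" y "real m *\<^sub>R Q"] by linarith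
                moreover have "g (v - real m *\<^sub>R P) \<le> b * (d * real m)"
                  using G(6)[of "v - real m *\<^sub>R P"] mult_left_mono[OF dv(1) b0] by linarith
                moreover have "g (real m *\<^sub>R Q - y) \<le> b * (d * real m)"
                  using G(6)[of "y - real m *\<^sub>R Q"] mult_left_mono[OF dv(2) b0] norms_diff(3)[OF g, of y "real m *\<^sub>R Q"] by linarith
                moreover have "g (real m *\<^sub>R P - real m *\<^sub>R Q) = real m * g (Q - P)"
                proof -
                  have "g (real m *\<^sub>R P - real m *\<^sub>R Q) = real m * g (P - Q)"
                    unfolding scaleR_diff_right[symmetric] G(3) by simp
                  then show ?thesis using norms_diff(3)[OF g, of P Q] by simp
                qed
                ultimately show ?thesis by linarith
              qed
              moreover have "4 * (b * (d * real m)) + real m \<le> D * real n"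
              proof -
                have "(4 * b * d + 1) * real m \<le> (D * real N) * real m" using ND by (rule mult_right_mono) simp
                also have "\<dots> = D * real (N * m)" by simp
                also have "\<dots> \<le> D * real n" using Nm D by (intro mult_left_mono of_nat_mono) auto
                finally show ?thesis by (simp add: algebra_simps)
              qed
              ultimately show "g (v - y) - D * real n \<le> ?T v y" by (simp add: algebra_simps)
            qed
            have "\<exists>t'. (\<forall>e\<in>edges. 0 \<le> t' e \<and> t' e \<le> b) \<and> (\<forall>e\<in>?E. t' e \<le> \<tau> e \<omega>) \<and>
                (\<forall>v\<in>ncube n. \<forall>y\<in>ncube n. g (v - y) - D * real n \<le> passage_time b t' (ncube n) v y)"
              by (intro exI[of _ t'] conjI t'b t't low)
            then have "\<forall>x\<in>ncube n. \<forall>y\<in>ncube n. \<bar>g (x - y) - passage_time b (\<lambda>e. \<tau> e \<omega>) (ncube n) x y\<bar> \<le> \<epsilon> * real n"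
              using gm'[THEN conjunct2, THEN conjunct2, THEN conjunct2, THEN spec, THEN mp, THEN mp, THEN mp,
                OF tau_weights[OF bd] 1 disjI2[OF conjI[OF refl conjI[OF 2]]]] by blast
            then show "\<omega> \<in> LD M \<tau> b n g \<epsilon>" by (intro good_modification_LD[OF g n(1) sp]) blast
          qed
        qed
      qed
      then have p: "1 / 2 * \<alpha> ^ card (H \<union> Tb) \<le> prob (LD M \<tau> b n g \<epsilon>)" using pEv by linarith
      have cHT: "real (card (H \<union> Tb)) \<le> A * real n + \<delta>' * real n ^ CARD('n)"
        using cH cT card_Un_le[of H Tb] by linarith
      show ?case
      proof (rule LD_cost_le[OF n(1)])
        let ?nd = "real n ^ CARD('n)"
        have 1: "A * l * real n \<le> \<delta> / 4 * ?nd" by (rule linear_le_power[OF dim n3(1) n(2)]) (use \<delta> in simp)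
        have "ln 2 * real n \<le> \<delta> / 4 * ?nd" by (rule linear_le_power[OF dim n3(2) n(2)]) (use \<delta> in simp)
        moreover have "ln 2 * 1 \<le> ln 2 * real n" using n(2) by (intro mult_left_mono) auto
        ultimately have 2: "ln 2 \<le> \<delta> / 4 * ?nd" by linarith
        have 3: "\<delta>' * ?nd * l \<le> \<delta> / 4 * ?nd"
          using mult_right_mono[OF \<delta>'(2), of ?nd] by (simp add: mult_ac)
        have "(A * real n + \<delta>' * ?nd) * l = A * l * real n + \<delta>' * ?nd * l" by (simp add: algebra_simps)
        also have "\<dots> \<le> \<delta> / 4 * ?nd + \<delta> / 4 * ?nd" by (rule add_mono[OF 1 3])
        finally have "ln 2 + (A * real n + \<delta>' * ?nd) * l \<le> \<delta> / 4 * ?nd + (\<delta> / 4 * ?nd + \<delta> / 4 * ?nd)"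
          by (rule add_mono[OF 2])
        also have "\<dots> \<le> \<delta> * ?nd" using \<delta> by simp
        finally have "- \<delta> * ?nd \<le> - ln 2 + - ((A * real n + \<delta>' * ?nd) * l)" by simp
        then have "exp (- \<delta> * ?nd) \<le> exp (- ln 2 + - ((A * real n + \<delta>' * ?nd) * l))" by simp
        also have "\<dots> = 1 / 2 * exp (- ((A * real n + \<delta>' * ?nd) * l))"
          unfolding exp_add exp_minus[of "ln 2"] by simp
        also have "\<dots> \<le> 1 / 2 * \<alpha> ^ card (H \<union> Tb)"
          unfolding l_def by (intro mult_left_mono power_ge_exp \<alpha> cHT) auto
        finally show "exp (- \<delta> * ?nd) \<le> prob (LD M \<tau> b n g \<epsilon>)" using p by linarith
      qed
    qed
    then show ?thesis by (rule Limsup_bounded)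
  qed
  have "limsup (LD_cost M \<tau> b g \<epsilon>) \<le> 0" if "0 < \<epsilon>" for \<epsilon>
  proof (rule ereal_le_epsilon2)
    fix e :: real assume "0 < e"
    then show "limsup (LD_cost M \<tau> b g \<epsilon>) \<le> 0 + ereal e" using main[OF that] by simp
  qed
  then show ?thesis unfolding rates_eq_SUP(2)[OF g] by (intro SUP_least) auto
qed

section \<open>The level \<beta> and the conclusion\<close>

lemma finite_rate_level:
  fixes g :: "real ^ 'n \<Rightarrow> real"
  assumes g: "g \<in> norms a b" and h: "g \<in> norms_star a b \<or> measure \<nu> {b} \<noteq> 0"
  obtains \<beta> where "\<beta> \<in> top_support \<nu>" "a < \<beta>" "\<And>x. g x \<le> \<beta> * l1norm x" "0 < measure \<nu> ({\<beta>..} \<inter> {0..})"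
proof (cases "measure \<nu> {b} = 0")
  case False
  have "0 < measure \<nu> {b}" using False by (simp add: zero_less_measure_iff)
  also have "measure \<nu> {b} = measure \<nu> ({b} \<inter> {0..})" using b_pos by simp
  also have "\<dots> \<le> measure \<nu> ({b..} \<inter> {0..})" by (rule nu_mono) auto
  finally show ?thesis using that[OF b_in_support ab(2) normsD(6)[OF g]] by blast
next
  case True
  then have gs: "g \<in> norms_star a b" using h by simp
  note G = normsD[OF g]
  let ?S = "{x :: real ^ 'n. l1norm x = 1}"
  have "closed ?S" by (intro closed_Collect_eq continuous_intros)
  moreover have "bounded ?S"
  proof (rule boundedI[of _ 1])
    fix x :: "real ^ 'n" assume "x \<in> ?S"
    then show "norm x \<le> 1" using norm_le_l1norm[of x] by simp
  qed
  ultimately have "compact ?S" by (simp add: compact_eq_bounded_closed)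
  moreover have "?S \<noteq> {}" using l1norm_axis[of undefined 1] by (metis (mono_tags) abs_one empty_Collect_eq)
  moreover have "continuous_on ?S g"
  proof (rule lipschitz_on_continuous_on[of "b * CARD('n)"], rule lipschitz_onI)
    fix x y :: "real ^ 'n"
    have "dist (g x) (g y) \<le> g (x - y)" unfolding dist_real_def by (rule norms_diff(2)[OF g])
    also have "\<dots> \<le> b * l1norm (x - y)" by (rule G)
    also have "\<dots> \<le> b * (CARD('n) * norm (x - y))" using b_pos by (intro mult_left_mono l1norm_le_norm) auto
    finally show "dist (g x) (g y) \<le> b * CARD('n) * dist x y" by (simp add: dist_norm)
  qed (use b_pos in simp)
  ultimately have "\<exists>x\<in>?S. \<forall>y\<in>?S. g y \<le> g x" by (rule continuous_attains_sup)
  then obtain x0 where x0: "x0 \<in> ?S" "\<forall>x\<in>?S. g x \<le> g x0" by (elim bexE)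
  have "x0 \<noteq> 0" using x0(1) by auto
  then have "g x0 < b" using gs x0(1) by (auto simp: norms_star_def)
  \<comment> \<open>On the compact unit sphere \<open>g\<close> attains a maximum below
    \<open>b\<close>; taking the larger of it and the midpoint keeps the level above
    \<open>a\<close>.\<close>
  define \<beta>0 where "\<beta>0 = max (g x0) ((a + b) / 2)"
  have \<beta>0: "g x0 \<le> \<beta>0" "a < \<beta>0" "\<beta>0 < b" using \<open>g x0 < b\<close> ab by (auto simp: \<beta>0_def less_max_iff_disj)
  have g\<beta>0: "g x \<le> \<beta>0 * l1norm x" for x
  proof (cases "x = 0")
    case True then show ?thesis using G(2) by simp
  next
    case False
    then have pos: "0 < l1norm x" by (simp add: order_less_le)
    have "(1 / l1norm x) *\<^sub>R x \<in> ?S" using pos False by simp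
    then have "g ((1 / l1norm x) *\<^sub>R x) \<le> g x0" by (rule bspec[OF x0(2)])
    then have "g ((1 / l1norm x) *\<^sub>R x) \<le> \<beta>0" using \<beta>0(1) by linarith
    then have "g x / l1norm x \<le> \<beta>0" using pos by (simp add: G(3))
    then show ?thesis using pos by (simp add: pos_divide_le_eq)
  qed
  \<comment> \<open>Since \<open>b\<close> belongs to the support, there is mass above \<beta>0; as
    there is none at \<open>b\<close> or beyond, some of the support lies below
    \<open>b\<close>.\<close>
  have "\<exists>\<beta>\<in>top_support \<nu>. \<beta>0 \<le> \<beta> \<and> \<beta> < b"
  proof (rule ccontr)
    assume "\<not> ?thesis"
    then have "{\<beta>0..<b} \<inter> top_support \<nu> = {}" "{b<..} \<inter> top_support \<nu> = {}" using support_bounds by force+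
    then have z: "measure \<nu> ({\<beta>0..<b} \<inter> {0..}) = 0" "measure \<nu> ({b<..} \<inter> {0..}) = 0"
      by (auto intro!: null_outside_support)
    interpret N: prob_space \<nu> by (rule nu_prob)
    have "0 < measure \<nu> ({\<beta>0<..} \<inter> {0..})" by (rule support_nbhd[OF b_in_support]) (use \<beta>0 in auto)
    also have "\<dots> \<le> measure \<nu> ({\<beta>0..} \<inter> {0..})" by (rule nu_mono) auto
    also have "{\<beta>0..} \<inter> {0..} = ({\<beta>0..<b} \<inter> {0..}) \<union> (({b} \<inter> {0..}) \<union> ({b<..} \<inter> {0..}))" using \<beta>0 by auto
    also have "measure \<nu> \<dots> \<le> measure \<nu> ({\<beta>0..<b} \<inter> {0..}) + measure \<nu> (({b} \<inter> {0..}) \<union> ({b<..} \<inter> {0..}))"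
      by (rule measure_Un_le) (intro sets.Un nu_sets_Int; simp)+
    also have "measure \<nu> (({b} \<inter> {0..}) \<union> ({b<..} \<inter> {0..})) \<le> measure \<nu> ({b} \<inter> {0..}) + measure \<nu> ({b<..} \<inter> {0..})"
      by (rule measure_Un_le) (intro nu_sets_Int; simp)+
    finally show False using z True b_pos by simp
  qed
  then obtain \<beta> where \<beta>: "\<beta> \<in> top_support \<nu>" "\<beta>0 \<le> \<beta>" "\<beta> < b" by blast
  show ?thesis
  proof (rule that[OF \<beta>(1)])
    show "a < \<beta>" using \<beta> \<beta>0 by simp
    fix x :: "real ^ 'n"
    have "\<beta>0 * l1norm x \<le> \<beta> * l1norm x" using \<beta>(2) by (intro mult_right_mono) auto
    then show "g x \<le> \<beta> * l1norm x" using g\<beta>0[of x] by linarith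
  next
    have "0 < measure \<nu> ({\<beta><..} \<inter> {0..})" by (rule support_nbhd[OF b_in_support]) (use \<beta> in auto)
    also have "\<dots> \<le> measure \<nu> ({\<beta>..} \<inter> {0..})" by (rule nu_mono) auto
    finally show "0 < measure \<nu> ({\<beta>..} \<inter> {0..})" .
  qed
qed

end

theorem proposition1p10:
  fixes M :: "'w measure" and \<nu> :: "real measure"
    and \<tau> :: "(real ^ 'n) set \<Rightarrow> 'w \<Rightarrow> real"
    and a b :: real and g :: "real ^ 'n \<Rightarrow> real"
  assumes dim: "CARD('n) \<ge> 2"
    and nu_prob: "prob_space \<nu>"
    and nu_sets: "sets \<nu> = sets (restrict_space borel {0..})"
    and a_def: "ereal a = (INF x\<in>top_support \<nu>. ereal x)"
    and b_def: "ereal b = (SUP x\<in>top_support \<nu>. ereal x)"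
    and ab: "0 < a" "a < b"
    and M_prob: "prob_space M"
    and indep: "prob_space.indep_vars M (\<lambda>_. \<nu>) \<tau> edges"
    and ident: "\<And>e. e \<in> edges \<Longrightarrow> distr M \<nu> (\<tau> e) = \<nu>"
    and g: "g \<in> norms a b"
  shows "\<forall>I\<in>{rate_lower M \<tau> b g, rate_upper M \<tau> b g}.
           (I = \<infinity> \<longleftrightarrow> g \<in> norms a b - norms_star a b \<and> measure \<nu> {b} = 0) \<and>
           (\<forall>\<mu>. is_time_constant M \<tau> b \<mu> \<longrightarrow> (I = 0 \<longleftrightarrow> (\<forall>x. g x \<le> \<mu> x)))"
proof -
  interpret prob_space M by (rule M_prob)
  interpret fpp M \<nu> \<tau> a b
    by (intro fpp.intro fpp_axioms.intro M_prob nu_prob nu_sets a_def b_def ab indep ident)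
  have le: "rate_lower M \<tau> b g \<le> rate_upper M \<tau> b g" by (rule rates_le[OF g])
  have nonneg: "0 \<le> rate_lower M \<tau> b g" by (rule rate_lower_nonneg[OF g])
  have inf: "I = \<infinity> \<longleftrightarrow> g \<in> norms a b - norms_star a b \<and> measure \<nu> {b} = 0"
    if I: "I = rate_lower M \<tau> b g \<or> I = rate_upper M \<tau> b g" for I
  proof
    assume "I = \<infinity>"
    then have top: "rate_upper M \<tau> b g = \<infinity>" using I le by auto
    show "g \<in> norms a b - norms_star a b \<and> measure \<nu> {b} = 0"
    proof (rule ccontr)
      assume "\<not> ?thesis"
      then have "g \<in> norms_star a b \<or> measure \<nu> {b} \<noteq> 0" using g by blast
      then obtain \<beta> where "\<beta> \<in> top_support \<nu>" "a < \<beta>" "\<And>x. g x \<le> \<beta> * l1norm x" "0 < measure \<nu> ({\<beta>..} \<inter> {0..})"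
        using finite_rate_level[OF g] by blast
      then have "rate_upper M \<tau> b g < \<infinity>" by (rule rate_finite[OF dim g])
      then show False using top by simp
    qed
  next
    assume "g \<in> norms a b - norms_star a b \<and> measure \<nu> {b} = 0"
    then have "rate_lower M \<tau> b g = \<infinity>" by (intro rate_infinite) auto
    then show "I = \<infinity>" using I le by auto
  qed
  have zero: "I = 0 \<longleftrightarrow> (\<forall>x. g x \<le> \<mu> x)"
    if I: "I = rate_lower M \<tau> b g \<or> I = rate_upper M \<tau> b g" and tc: "is_time_constant M \<tau> b \<mu>" for I \<mu>
  proof
    assume "I = 0"
    then have "\<not> 0 < rate_lower M \<tau> b g" using I le by auto
    then show "\<forall>x. g x \<le> \<mu> x" using rate_pos[OF g tc] by (meson not_less)
  next
    assume "\<forall>x. g x \<le> \<mu> x"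
    then have "rate_upper M \<tau> b g \<le> 0" by (intro rate_zero[OF dim g tc]) simp
    then show "I = 0" using I le nonneg by auto
  qed
  show ?thesis using inf zero by blast
qed

end
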